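(* Both $\mathrm{SO}\text{-}\mathrm{EKROM}$ and $\Pi^1_2\text{-}\mathrm{EKROM}$ capture $\mathrm{co}\text{-}\mathrm{NP}$ on ordered finite structures.
   Context: A finite structure is ordered if its vocabulary contains a linear order $\le$, a successor relation SUCC and constants min, max, interpreted as a linear order of the domain, its successor relation, and its minimal and maximal elements. A logic $\mathcal{L}$ captures a complexity class $\mathcal{C}$ on a class $K$ of finite structures if (i) for every $\mathcal{L}$ sentence $\varphi$, the set of structures in $K$ satisfying $\varphi$ is decidable in $\mathcal{C}$, and (ii) every isomorphism-closed subclass of $K$ (over a fixed vocabulary) decidable in $\mathcal{C}$ is the class of models in $K$ of some $\mathcal{L}$ sentence. For a vocabulary $\tau$ (containing equality), an SO-EKROM$(\tau)$ formula is a second-order formula of the form $\forall X_1\exists Y_1\cdots\forall X_k\exists Y_k\forall\bar{x}(C_1\wedge\cdots\wedge C_n)$, where each clause $C_i$ is a disjunction $\alpha_1\vee\cdots\vee\alpha_l\vee H_1\vee H_2$ in which each $\alpha_s$ is $Q\bar{y}$ or $\neg Q\bar{y}$ with $Q\in\tau\cup\{X_1,\dots,X_k\}$, and each $H_t$ is $Y_i\bar{z}$ or $\neg Y_i\bar{z}$ for some $1\le i\le k$. $\Pi^1_2\text{-}\mathrm{EKROM}$ consists of SO-EKROM formulas with prefix $\forall\bar{X}\exists\bar{Y}$ (one universal block followed by one existential block). *)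

theory Defs
  imports Main
begin

text \<open>A vocabulary: relation symbols 0..length(rel_arity)-1 with the given rel_arity,
  and constant symbols 0..nconsts-1.  Equality is built into the logic.
  Convention for ordered vocabularies: relation 0 is the linear order, relation 1
  is SUCC, constant 0 is min and constant 1 is max.\<close>

record vocab =
  rel_arity :: "nat list"
  nconsts :: nat

text \<open>A finite structure with universe {0..<univ_size}.\<close>
record struc =
  univ_size :: nat
  rel :: "nat \<Rightarrow> nat list \<Rightarrow> bool"
  cst :: "nat \<Rightarrow> nat"

definition struc_wf :: "vocab \<Rightarrow> struc \<Rightarrow> bool" where
  "struc_wf \<sigma> A \<longleftrightarrow> univ_size A \<ge> 1
     \<and> (\<forall>c < nconsts \<sigma>. cst A c < univ_size A)
     \<and> (\<forall>r t. rel A r t \<longrightarrow> r < length (rel_arity \<sigma>) \<and> length t = rel_arity \<sigma> ! r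
                          \<and> (\<forall>x \<in> set t. x < univ_size A))"

definition ordered_vocab :: "vocab \<Rightarrow> bool" where
  "ordered_vocab \<sigma> \<longleftrightarrow> length (rel_arity \<sigma>) \<ge> 2 \<and> rel_arity \<sigma> ! 0 = 2 \<and> rel_arity \<sigma> ! 1 = 2
     \<and> nconsts \<sigma> \<ge> 2"

definition ordered_struc :: "vocab \<Rightarrow> struc \<Rightarrow> bool" where
  "ordered_struc \<sigma> A \<longleftrightarrow> struc_wf \<sigma> A \<and>
     (let n = univ_size A; le = (\<lambda>x y. rel A 0 [x, y]) in
       (\<forall>x<n. le x x)
     \<and> (\<forall>x<n. \<forall>y<n. le x y \<and> le y x \<longrightarrow> x = y)
     \<and> (\<forall>x<n. \<forall>y<n. \<forall>z<n. le x y \<and> le y z \<longrightarrow> le x z)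
     \<and> (\<forall>x<n. \<forall>y<n. le x y \<or> le y x)
     \<and> (\<forall>x<n. \<forall>y<n. rel A 1 [x, y] \<longleftrightarrow>
            (le x y \<and> x \<noteq> y \<and> (\<forall>z<n. le x z \<and> le z y \<longrightarrow> z = x \<or> z = y)))
     \<and> (\<forall>x<n. le (cst A 0) x)
     \<and> (\<forall>x<n. le x (cst A 1)))"

definition ordered_strucs :: "vocab \<Rightarrow> struc set" where
  "ordered_strucs \<sigma> = {A. ordered_struc \<sigma> A}"

definition struc_iso :: "vocab \<Rightarrow> struc \<Rightarrow> struc \<Rightarrow> bool" where
  "struc_iso \<sigma> A B \<longleftrightarrow> univ_size A = univ_size B \<and>
     (\<exists>\<pi>. bij_betw \<pi> {..<univ_size A} {..<univ_size B}
        \<and> (\<forall>r < length (rel_arity \<sigma>). \<forall>t. length t = rel_arity \<sigma> ! r \<and> (\<forall>x\<in>set t. x < univ_size A)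
               \<longrightarrow> (rel B r (map \<pi> t) \<longleftrightarrow> rel A r t))
        \<and> (\<forall>c < nconsts \<sigma>. cst B c = \<pi> (cst A c)))"

definition iso_closed_in :: "vocab \<Rightarrow> struc set \<Rightarrow> struc set \<Rightarrow> bool" where
  "iso_closed_in \<sigma> K S \<longleftrightarrow> (\<forall>A\<in>K. \<forall>B\<in>K. struc_iso \<sigma> A B \<longrightarrow> A \<in> S \<longrightarrow> B \<in> S)"

fun tuples :: "nat \<Rightarrow> nat \<Rightarrow> nat list list" where
  "tuples n 0 = [[]]"
| "tuples n (Suc k) = concat (map (\<lambda>i. map (Cons i) (tuples n k)) [0..<n])"

definition enc :: "vocab \<Rightarrow> struc \<Rightarrow> bool list" where
  "enc \<sigma> A = (let n = univ_size A in
      replicate n True @ [False]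
      @ concat (map (\<lambda>r. map (rel A r) (tuples n (rel_arity \<sigma> ! r))) [0..<length (rel_arity \<sigma>)])
      @ concat (map (\<lambda>c. map (\<lambda>i. cst A c = i) [0..<n]) [0..<nconsts \<sigma>]))"

text \<open>Single-tape NTM: states and tape symbols are naturals; start state 0;
  blank 0, input bits False/True written as 1/2. A transition
  (q, a, q', b, m) reads a in state q, writes b, moves by m \<in> {-1,0,1}, enters q'.\<close>
record ntm =
  delta :: "(nat \<times> nat \<times> nat \<times> nat \<times> int) set"
  acc_state :: nat

type_synonym conf = "nat \<times> (int \<Rightarrow> nat) \<times> int"

definition ntm_step :: "ntm \<Rightarrow> conf \<Rightarrow> conf \<Rightarrow> bool" where
  "ntm_step M c c' \<longleftrightarrow> (case c of (q, tp, h) \<Rightarrow> case c' of (q', tp', h') \<Rightarrow>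
     (\<exists>b m. (q, tp h, q', b, m) \<in> delta M \<and> m \<in> {-1, 0, 1} \<and> tp' = tp(h := b) \<and> h' = h + m))"

definition init_conf :: "bool list \<Rightarrow> conf" where
  "init_conf w = (0, (\<lambda>i. if 0 \<le> i \<and> i < int (length w) then (if w ! nat i then 2 else 1) else 0), 0)"

definition accepts_within :: "ntm \<Rightarrow> bool list \<Rightarrow> nat \<Rightarrow> bool" where
  "accepts_within M w t \<longleftrightarrow> (\<exists>k c. k \<le> t \<and> (ntm_step M ^^ k) (init_conf w) c \<and> fst c = acc_state M)"

definition NP :: "bool list set set" where
  "NP = {L. \<exists>M a d. finite (delta M) \<and>
            (\<forall>w. w \<in> L \<longleftrightarrow> accepts_within M w (a * (length w + 1) ^ d))}"

definition coNP :: "bool list set set" where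
  "coNP = {L. - L \<in> NP}"

definition coNP_on :: "vocab \<Rightarrow> struc set \<Rightarrow> struc set \<Rightarrow> bool" where
  "coNP_on \<sigma> K S \<longleftrightarrow> (\<exists>L \<in> coNP. \<forall>A\<in>K. A \<in> S \<longleftrightarrow> enc \<sigma> A \<in> L)"

datatype trm = V nat | C nat

text \<open>SV j: the second-order variable bound by the j-th quantifier of the prefix.\<close>
datatype atom = Rel nat "trm list" | Eq trm trm | SV nat "trm list"

type_synonym lit = "bool \<times> atom"   \<comment> \<open>True = positive literal\<close>

datatype qent = QAll nat | QEx nat   \<comment> \<open>quantified relation variable with its arity\<close>

text \<open>A clause: literals alpha_1..alpha_l and the two literals H_1, H_2.\<close>
type_synonym clause = "lit list \<times> lit \<times> lit"

datatype ekrom = Ekrom (prefix: "qent list") (nvars: nat) (clauses: "clause list")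

fun qarity :: "qent \<Rightarrow> nat" where
  "qarity (QAll a) = a" | "qarity (QEx a) = a"

fun is_QAll :: "qent \<Rightarrow> bool" where
  "is_QAll (QAll _) = True" | "is_QAll (QEx _) = False"

fun trm_ok :: "vocab \<Rightarrow> nat \<Rightarrow> trm \<Rightarrow> bool" where
  "trm_ok \<sigma> m (V i) = (i < m)" | "trm_ok \<sigma> m (C c) = (c < nconsts \<sigma>)"

fun alpha_ok :: "vocab \<Rightarrow> qent list \<Rightarrow> nat \<Rightarrow> atom \<Rightarrow> bool" where
  "alpha_ok \<sigma> qs m (Rel r ts) = (r < length (rel_arity \<sigma>) \<and> length ts = rel_arity \<sigma> ! r \<and> (\<forall>t\<in>set ts. trm_ok \<sigma> m t))"
| "alpha_ok \<sigma> qs m (Eq s t) = (trm_ok \<sigma> m s \<and> trm_ok \<sigma> m t)"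
| "alpha_ok \<sigma> qs m (SV j ts) = (j < length qs \<and> is_QAll (qs ! j) \<and> length ts = qarity (qs ! j) \<and> (\<forall>t\<in>set ts. trm_ok \<sigma> m t))"

fun h_ok :: "vocab \<Rightarrow> qent list \<Rightarrow> nat \<Rightarrow> atom \<Rightarrow> bool" where
  "h_ok \<sigma> qs m (SV j ts) = (j < length qs \<and> \<not> is_QAll (qs ! j) \<and> length ts = qarity (qs ! j) \<and> (\<forall>t\<in>set ts. trm_ok \<sigma> m t))"
| "h_ok \<sigma> qs m _ = False"

definition SO_EKROM :: "vocab \<Rightarrow> ekrom set" where
  "SO_EKROM \<sigma> = {\<phi>. \<forall>(al, h1, h2) \<in> set (clauses \<phi>).
      (\<forall>l\<in>set al. alpha_ok \<sigma> (prefix \<phi>) (nvars \<phi>) (snd l))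
      \<and> h_ok \<sigma> (prefix \<phi>) (nvars \<phi>) (snd h1) \<and> h_ok \<sigma> (prefix \<phi>) (nvars \<phi>) (snd h2)}"

definition Pi12_EKROM :: "vocab \<Rightarrow> ekrom set" where
  "Pi12_EKROM \<sigma> = {\<phi> \<in> SO_EKROM \<sigma>. \<exists>xs ys. prefix \<phi> = map QAll xs @ map QEx ys}"

fun tval :: "struc \<Rightarrow> (nat \<Rightarrow> nat) \<Rightarrow> trm \<Rightarrow> nat" where
  "tval A v (V i) = v i" | "tval A v (C c) = cst A c"

fun aval :: "struc \<Rightarrow> nat list set list \<Rightarrow> (nat \<Rightarrow> nat) \<Rightarrow> atom \<Rightarrow> bool" where
  "aval A Rs v (Rel r ts) = rel A r (map (tval A v) ts)"
| "aval A Rs v (Eq s t) = (tval A v s = tval A v t)"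
| "aval A Rs v (SV j ts) = (map (tval A v) ts \<in> Rs ! j)"

definition lval :: "struc \<Rightarrow> nat list set list \<Rightarrow> (nat \<Rightarrow> nat) \<Rightarrow> lit \<Rightarrow> bool" where
  "lval A Rs v l = (if fst l then aval A Rs v (snd l) else \<not> aval A Rs v (snd l))"

definition cval :: "struc \<Rightarrow> nat list set list \<Rightarrow> (nat \<Rightarrow> nat) \<Rightarrow> clause \<Rightarrow> bool" where
  "cval A Rs v cl = (case cl of (al, h1, h2) \<Rightarrow>
     (\<exists>l\<in>set al. lval A Rs v l) \<or> lval A Rs v h1 \<or> lval A Rs v h2)"

definition rels_over :: "struc \<Rightarrow> nat \<Rightarrow> nat list set set" where
  "rels_over A a = {R. \<forall>t\<in>R. length t = a \<and> (\<forall>x\<in>set t. x < univ_size A)}"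

fun qsat :: "struc \<Rightarrow> nat \<Rightarrow> clause list \<Rightarrow> qent list \<Rightarrow> nat list set list \<Rightarrow> bool" where
  "qsat A m cls [] Rs = (\<forall>v. (\<forall>i<m. v i < univ_size A) \<longrightarrow> (\<forall>cl\<in>set cls. cval A Rs v cl))"
| "qsat A m cls (QAll a # qs) Rs = (\<forall>R \<in> rels_over A a. qsat A m cls qs (Rs @ [R]))"
| "qsat A m cls (QEx a # qs) Rs = (\<exists>R \<in> rels_over A a. qsat A m cls qs (Rs @ [R]))"

definition models :: "struc \<Rightarrow> ekrom \<Rightarrow> bool" where
  "models A \<phi> = qsat A (nvars \<phi>) (clauses \<phi>) (prefix \<phi>) []"

definition captures_coNP_ordered :: "vocab \<Rightarrow> ekrom set \<Rightarrow> bool" where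
  "captures_coNP_ordered \<sigma> Lg \<longleftrightarrow>
     (\<forall>\<phi>\<in>Lg. coNP_on \<sigma> (ordered_strucs \<sigma>) {A. models A \<phi>})
   \<and> (\<forall>S. S \<subseteq> ordered_strucs \<sigma> \<longrightarrow> iso_closed_in \<sigma> (ordered_strucs \<sigma>) S
          \<longrightarrow> coNP_on \<sigma> (ordered_strucs \<sigma>) S
          \<longrightarrow> (\<exists>\<phi>\<in>Lg. \<forall>A\<in>ordered_strucs \<sigma>. A \<in> S \<longleftrightarrow> models A \<phi>))"

end

(* For a formula of SO-EKROM with the universal relations fixed, the admissible values of each existential relation
   are solutions of a conjunction of clauses with two literals, hence closed under majority. By Baker and Pixley such
   a family is determined by its projections to pairs of points, so if every value of an existential relation is
   refuted by some choice of the later universal ones, then polynomially many of these choices refute all values at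
   once. Hence all universal relations, as families with polynomially many indices, can be moved to the front. The
   sentence then fails iff for some values of these families a literal and its negation imply each other in a graph
   of polynomial size, and an NP machine can guess the families and check such a cycle.

   Conversely, let a machine decide the complement of a class within time T. Writing numbers as tuples in the order
   of the structure, the existence of an accepting run is expressed by a guess of relations subject to universal
   clauses. The negation of such a sentence has the form: for all relations some clause fails somewhere. It becomes
   an EKROM sentence by existential relations that scan all pairs of a tuple and a clause for a violation along the
   successor relation, which takes only clauses with two existential literals. *)
theory Submission
  imports Defs "HOL-Library.Nat_Bijection" "HOL-Library.Countable"
begin

section \<open>Regular programs over the positions of a word, and their flow graphs\<close>

section \<open>Programs on words\<close>

text \<open>No machine is programmed by hand. The guessed families become tracks on the tape, and
  the search for the cycle is a formula with existential quantifiers, reachability between pairs of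
  positions and no negation; it is compiled to a register program, and one generic machine runs
  every such program. Pairs are needed because a literal is stored as two numbers: sign and level in
  one, a point in the other. A refutation found by the machine is correct whatever tape length and
  index bound were guessed, so that lengths and bounds only matter for finding one. The number of
  choices that refute all values of an existential relation of arity a is at most 4 n^(2a): one for
  each clause with two literals over its n^a points.

  In the converse direction the encoding of a structure follows the names of its elements while a
  sentence sees only the given order; this is where closure under isomorphism enters.\<close>

type_synonym letter = "nat \<times> nat set"
type_synonym env = "nat \<Rightarrow> nat"

text \<open>\<open>Hav\<close> is a havoc: it assigns an arbitrary position, and it is the only
  action that changes a register. The actions starting with \<open>T\<close> are tests that block
  when they fail.\<close>

datatype act = Skip | Hav nat | TLet nat "letter set" | TEq nat nat | TSuc nat nat | TZero nat

fun act_step :: "letter list \<Rightarrow> act \<Rightarrow> env \<Rightarrow> env \<Rightarrow> bool" where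
  "act_step u Skip e e' = (e' = e)"
| "act_step u (Hav i) e e' = (\<exists>k<length u. e' = e(i := k))"
| "act_step u (TLet i L) e e' = (e' = e \<and> u ! e i \<in> L)"
| "act_step u (TEq i j) e e' = (e' = e \<and> e i = e j)"
| "act_step u (TSuc i j) e e' = (e' = e \<and> e j = Suc (e i))"
| "act_step u (TZero i) e e' = (e' = e \<and> e i = 0)"

fun act_regs :: "act \<Rightarrow> nat set" where
  "act_regs Skip = {}"
| "act_regs (Hav i) = {i}"
| "act_regs (TLet i L) = {i}"
| "act_regs (TEq i j) = {i, j}"
| "act_regs (TSuc i j) = {i, j}"
| "act_regs (TZero i) = {i}"

datatype prog = Act act | Seq prog prog | Choice prog prog | Star prog

primrec run :: "letter list \<Rightarrow> prog \<Rightarrow> env \<Rightarrow> env \<Rightarrow> bool" where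
  "run u (Act a) = act_step u a"
| "run u (Seq p q) = run u p OO run u q"
| "run u (Choice p q) = sup (run u p) (run u q)"
| "run u (Star p) = (run u p)\<^sup>*\<^sup>*"

primrec frag_end :: "prog \<Rightarrow> nat \<Rightarrow> nat" where
  "frag_end (Act a) s = Suc s"
| "frag_end (Seq p q) s = frag_end q (frag_end p s)"
| "frag_end (Choice p q) s = Suc (frag_end q (Suc (frag_end p (Suc s))))"
| "frag_end (Star p) s = Suc (frag_end p (Suc s))"

text \<open>Thompson's construction with consecutively numbered nodes: entry \<open>s\<close>, exit
  \<open>frag_end p s\<close>. In \<open>Seq\<close> the exit of one part is the entry of the next;
  \<open>Choice\<close> and \<open>Star\<close> are glued with \<open>Skip\<close> edges.\<close>

primrec frag :: "prog \<Rightarrow> nat \<Rightarrow> (nat \<times> act \<times> nat) set" where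
  "frag (Act a) s = {(s, a, Suc s)}"
| "frag (Seq p q) s = frag p s \<union> frag q (frag_end p s)"
| "frag (Choice p q) s = (let t1 = frag_end p (Suc s); t2 = frag_end q (Suc t1) in
     frag p (Suc s) \<union> frag q (Suc t1) \<union>
     {(s, Skip, Suc s), (s, Skip, Suc t1), (t1, Skip, Suc t2), (t2, Skip, Suc t2)})"
| "frag (Star p) s = (let t1 = frag_end p (Suc s) in
     frag p (Suc s) \<union> {(s, Skip, Suc s), (t1, Skip, s), (s, Skip, Suc t1)})"

definition gstep :: "letter list \<Rightarrow> (nat \<times> act \<times> nat) set \<Rightarrow> nat \<times> env \<Rightarrow> nat \<times> env \<Rightarrow> bool" where
  "gstep u E c c' \<longleftrightarrow> (\<exists>a. (fst c, a, fst c') \<in> E \<and> act_step u a (snd c) (snd c'))"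

lemma gstepI: "(q, a, q') \<in> E \<Longrightarrow> act_step u a e e' \<Longrightarrow> gstep u E (q, e) (q', e')"
  by (auto simp: gstep_def)

lemma frag_finite: "finite (frag p s)"
  by (induction p arbitrary: s) (auto simp: Let_def)

lemma frag_end_gt: "s < frag_end p s"
proof (induction p arbitrary: s)
  case (Seq p1 p2) then show ?case using less_trans by fastforce
next
  case (Choice p1 p2)
  have "s < frag_end p1 (Suc s)" using Choice(1)[of "Suc s"] by simp
  also have "\<dots> < frag_end p2 (Suc (frag_end p1 (Suc s)))" using Choice(2)[of "Suc (frag_end p1 (Suc s))"] by simp
  finally show ?case by simp
next
  case (Star p) show ?case using Star[of "Suc s"] by simp
qed simp

text \<open>The strict bound on the source says that no edge leaves the exit. In a sequential
  composition this prevents the two parts from sharing any edge source, so a path cannot slip back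
  into the first part.\<close>

lemma frag_nodes: "(q, a, q') \<in> frag p s \<Longrightarrow> s \<le> q \<and> q < frag_end p s \<and> s \<le> q' \<and> q' \<le> frag_end p s"
proof (induction p arbitrary: s q a q')
  case (Act x) then show ?case by auto
next
  case (Seq p1 p2)
  then show ?case using frag_end_gt[of s p1] frag_end_gt[of "frag_end p1 s" p2] by fastforce
next
  case (Choice p1 p2)
  note g = frag_end_gt[of "Suc s" p1] frag_end_gt[of "Suc (frag_end p1 (Suc s))" p2]
  from Choice.prems consider "(q,a,q') \<in> frag p1 (Suc s)" | "(q,a,q') \<in> frag p2 (Suc (frag_end p1 (Suc s)))"
    | "(q,a,q') \<in> {(s, Skip, Suc s), (s, Skip, Suc (frag_end p1 (Suc s))),
        (frag_end p1 (Suc s), Skip, Suc (frag_end p2 (Suc (frag_end p1 (Suc s))))),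
        (frag_end p2 (Suc (frag_end p1 (Suc s))), Skip, Suc (frag_end p2 (Suc (frag_end p1 (Suc s)))))}"
    by (auto simp: Let_def)
  then show ?case
  proof cases
    case 1 then show ?thesis using Choice.IH(1)[OF 1] g by simp
  next
    case 2 then show ?thesis using Choice.IH(2)[OF 2] g by simp
  next
    case 3 then show ?thesis using g by auto
  qed
next
  case (Star p)
  note g = frag_end_gt[of "Suc s" p]
  from Star.prems consider "(q,a,q') \<in> frag p (Suc s)"
    | "(q,a,q') \<in> {(s, Skip, Suc s), (frag_end p (Suc s), Skip, s), (s, Skip, Suc (frag_end p (Suc s)))}"
    by (auto simp: Let_def)
  then show ?case
  proof cases
    case 1 then show ?thesis using Star.IH[OF 1] g by simp
  next
    case 2 then show ?thesis using g by auto
  qed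
qed

text \<open>Stated for every graph that contains the fragment, so that the induction hypotheses
  apply inside the larger fragment.\<close>

lemma frag_complete:
  "run u p e e' \<Longrightarrow> frag p s \<subseteq> E \<Longrightarrow> (gstep u E)\<^sup>*\<^sup>* (s, e) (frag_end p s, e')"
proof (induction p arbitrary: s e e')
  case (Act x) then show ?case by (auto intro: gstepI)
next
  case (Seq p1 p2)
  then obtain e1 where "run u p1 e e1" "run u p2 e1 e'" by auto
  then show ?case using Seq.IH(1)[of e e1 s] Seq.IH(2)[of e1 e' "frag_end p1 s"] Seq.prems(2) by auto
next
  case (Choice p1 p2)
  let ?t1 = "frag_end p1 (Suc s)" let ?t2 = "frag_end p2 (Suc ?t1)"
  have E: "frag p1 (Suc s) \<subseteq> E" "frag p2 (Suc ?t1) \<subseteq> E" "(s, Skip, Suc s) \<in> E" "(s, Skip, Suc ?t1) \<in> E"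
    "(?t1, Skip, Suc ?t2) \<in> E" "(?t2, Skip, Suc ?t2) \<in> E"
    using Choice.prems(2) by (auto simp: Let_def)
  from Choice.prems(1) consider "run u p1 e e'" | "run u p2 e e'" by auto
  then show ?case
  proof cases
    case 1
    have "gstep u E (s,e) (Suc s,e)" "gstep u E (?t1,e') (Suc ?t2,e')" using E by (auto intro: gstepI)
    with Choice.IH(1)[OF 1 E(1)] show ?thesis by (simp add: converse_rtranclp_into_rtranclp rtranclp.rtrancl_into_rtrancl)
  next
    case 2
    have "gstep u E (s,e) (Suc ?t1,e)" "gstep u E (?t2,e') (Suc ?t2,e')" using E by (auto intro: gstepI)
    with Choice.IH(2)[OF 2 E(2)] show ?thesis by (simp add: converse_rtranclp_into_rtranclp rtranclp.rtrancl_into_rtrancl)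
  qed
next
  case (Star p)
  let ?t1 = "frag_end p (Suc s)"
  have E: "frag p (Suc s) \<subseteq> E" "(s, Skip, Suc s) \<in> E" "(?t1, Skip, s) \<in> E" "(s, Skip, Suc ?t1) \<in> E"
    using Star.prems(2) by (auto simp: Let_def)
  have "(run u p)\<^sup>*\<^sup>* e e'" using Star.prems(1) by simp
  then have "(gstep u E)\<^sup>*\<^sup>* (s, e) (s, e')"
  proof induction
    case (step e1 e2)
    have "gstep u E (s,e1) (Suc s,e1)" "gstep u E (?t1,e2) (s,e2)" using E by (auto intro: gstepI)
    with Star.IH[OF step.hyps(2) E(1)] have "(gstep u E)\<^sup>*\<^sup>* (s,e1) (s,e2)"
      by (simp add: converse_rtranclp_into_rtranclp rtranclp.rtrancl_into_rtrancl)
    with step.IH show ?case by simp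
  qed simp
  moreover have "gstep u E (s,e') (Suc ?t1,e')" using E by (auto intro: gstepI)
  ultimately show ?case by simp
qed

(* Floyd-style: every node of the fragment carries an invariant relating the entry environment to the current one. *)
lemma frag_invariant:
  "\<exists>I. (\<forall>e. I s e e) \<and>
     (\<forall>q a q' e0 e e'. (q, a, q') \<in> frag p s \<longrightarrow> I q e0 e \<longrightarrow> act_step u a e e' \<longrightarrow> I q' e0 e') \<and>
     (\<forall>e0 e. I (frag_end p s) e0 e \<longrightarrow> run u p e0 e)"
proof (induction p arbitrary: s)
  case (Act a)
  show ?case by (rule exI[of _ "\<lambda>q e0 e. if q = s then e = e0 else act_step u a e0 e"]) auto
next
  case (Seq p1 p2)
  let ?t = "frag_end p1 s"
  obtain I1 where I1: "\<And>e. I1 s e e" "\<And>q a q' e0 e e'. (q, a, q') \<in> frag p1 s \<Longrightarrow> I1 q e0 e \<Longrightarrow> act_step u a e e' \<Longrightarrow> I1 q' e0 e'"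
    "\<And>e0 e. I1 ?t e0 e \<Longrightarrow> run u p1 e0 e" using Seq.IH(1)[of s] by metis
  obtain I2 where I2: "\<And>e. I2 ?t e e" "\<And>q a q' e0 e e'. (q, a, q') \<in> frag p2 ?t \<Longrightarrow> I2 q e0 e \<Longrightarrow> act_step u a e e' \<Longrightarrow> I2 q' e0 e'"
    "\<And>e0 e. I2 (frag_end p2 ?t) e0 e \<Longrightarrow> run u p2 e0 e" using Seq.IH(2)[of ?t] by metis
  \<comment> \<open>The shared node \<open>?t\<close> already counts as the second part: arriving
    there completes a run of \<open>p1\<close>, whose final environment \<open>e1\<close> is
    remembered from then on.\<close>
  define I where "I q e0 e = (if q < ?t then I1 q e0 e else (\<exists>e1. run u p1 e0 e1 \<and> I2 q e1 e))" for q e0 e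
  have gt: "s < ?t" "?t < frag_end p2 ?t" by (rule frag_end_gt)+
  show ?case
  proof (intro exI[of _ I] conjI allI impI)
    fix q a q' e0 e e' assume A: "(q, a, q') \<in> frag (Seq p1 p2) s" "I q e0 e" "act_step u a e e'"
    from A(1) consider "(q,a,q') \<in> frag p1 s" | "(q,a,q') \<in> frag p2 ?t" by auto
    then show "I q' e0 e'"
    proof cases
      case 1
      note n = frag_nodes[OF 1]
      have "I1 q' e0 e'" using I1(2)[OF 1] A n by (auto simp: I_def)
      then show ?thesis using n I1(3) I2(1) by (cases "q' = ?t") (auto simp: I_def)
    next
      case 2
      note n = frag_nodes[OF 2]
      then show ?thesis using A I2(2)[OF 2] by (auto simp: I_def)
    qed
  qed (use gt I1(1) I2(3) in \<open>auto simp: I_def\<close>)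
next
  case (Choice p1 p2)
  let ?t1 = "frag_end p1 (Suc s)" let ?t2 = "frag_end p2 (Suc ?t1)"
  obtain I1 where I1: "\<And>e. I1 (Suc s) e e" "\<And>q a q' e0 e e'. (q, a, q') \<in> frag p1 (Suc s) \<Longrightarrow> I1 q e0 e \<Longrightarrow> act_step u a e e' \<Longrightarrow> I1 q' e0 e'"
    "\<And>e0 e. I1 ?t1 e0 e \<Longrightarrow> run u p1 e0 e" using Choice.IH(1)[of "Suc s"] by metis
  obtain I2 where I2: "\<And>e. I2 (Suc ?t1) e e" "\<And>q a q' e0 e e'. (q, a, q') \<in> frag p2 (Suc ?t1) \<Longrightarrow> I2 q e0 e \<Longrightarrow> act_step u a e e' \<Longrightarrow> I2 q' e0 e'"
    "\<And>e0 e. I2 ?t2 e0 e \<Longrightarrow> run u p2 e0 e" using Choice.IH(2)[of "Suc ?t1"] by metis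
  define I where "I q e0 e = (if q = s then e = e0 else if q \<le> ?t1 then I1 q e0 e else
     if q \<le> ?t2 then I2 q e0 e else run u (Choice p1 p2) e0 e)" for q e0 e
  have gt: "Suc s < ?t1" "Suc ?t1 < ?t2" by (rule frag_end_gt)+
  show ?case
  proof (intro exI[of _ I] conjI allI impI)
    fix q a q' e0 e e' assume A: "(q, a, q') \<in> frag (Choice p1 p2) s" "I q e0 e" "act_step u a e e'"
    from A(1) consider "(q,a,q') \<in> frag p1 (Suc s)" | "(q,a,q') \<in> frag p2 (Suc ?t1)" |
      "(q,a,q') \<in> {(s, Skip, Suc s), (s, Skip, Suc ?t1), (?t1, Skip, Suc ?t2), (?t2, Skip, Suc ?t2)}"
      by (auto simp: Let_def)
    then show "I q' e0 e'"
    proof cases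
      case 1
      then show ?thesis using frag_nodes[OF 1] A(2,3) I1(2)[OF 1] by (auto simp: I_def)
    next
      case 2
      then show ?thesis using frag_nodes[OF 2] A(2,3) I2(2)[OF 2] gt by (auto simp: I_def)
    next
      case 3
      then show ?thesis using A(2,3) gt I1(1,3) I2(1,3) by (auto simp: I_def)
    qed
  qed (use gt in \<open>auto simp: I_def\<close>)
next
  case (Star p)
  let ?t1 = "frag_end p (Suc s)"
  obtain I1 where I1: "\<And>e. I1 (Suc s) e e" "\<And>q a q' e0 e e'. (q, a, q') \<in> frag p (Suc s) \<Longrightarrow> I1 q e0 e \<Longrightarrow> act_step u a e e' \<Longrightarrow> I1 q' e0 e'"
    "\<And>e0 e. I1 ?t1 e0 e \<Longrightarrow> run u p e0 e" using Star.IH[of "Suc s"] by metis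
  \<comment> \<open>At the loop head and at the exit only whole iterations lie behind; inside the
    body, \<open>e1\<close> is the environment in which the current iteration began.\<close>
  define I where "I q e0 e = (if q = s \<or> q > ?t1 then (run u p)\<^sup>*\<^sup>* e0 e
     else (\<exists>e1. (run u p)\<^sup>*\<^sup>* e0 e1 \<and> I1 q e1 e))" for q e0 e
  have gt: "Suc s < ?t1" by (rule frag_end_gt)
  show ?case
  proof (intro exI[of _ I] conjI allI impI)
    fix q a q' e0 e e' assume A: "(q, a, q') \<in> frag (Star p) s" "I q e0 e" "act_step u a e e'"
    from A(1) consider "(q,a,q') \<in> frag p (Suc s)" |
      "(q,a,q') \<in> {(s, Skip, Suc s), (?t1, Skip, s), (s, Skip, Suc ?t1)}"
      by (auto simp: Let_def)
    then show "I q' e0 e'"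
    proof cases
      case 1
      then show ?thesis using frag_nodes[OF 1] A(2,3) I1(2)[OF 1] by (auto simp: I_def)
    next
      case 2
      then show ?thesis using A(2,3) gt I1(1,3)
        by (auto simp: I_def) (metis rtranclp.rtrancl_into_rtrancl)
    qed
  qed (use gt in \<open>auto simp: I_def\<close>)
qed

lemma frag_sound:
  assumes "(gstep u (frag p s))\<^sup>*\<^sup>* (s, e) (frag_end p s, e')"
  shows "run u p e e'"
proof -
  obtain I where I: "\<And>e. I s e e" "\<And>q a q' e0 e e'. (q, a, q') \<in> frag p s \<Longrightarrow> I q e0 e \<Longrightarrow> act_step u a e e' \<Longrightarrow> I q' e0 e'"
    "\<And>e0 e. I (frag_end p s) e0 e \<Longrightarrow> run u p e0 e" using frag_invariant[of s p u] by metis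
  have "I (fst c) e (snd c)" if "(gstep u (frag p s))\<^sup>*\<^sup>* (s, e) c" for c
    using that
  proof induction
    case base then show ?case using I(1) by simp
  next
    case (step c1 c2) then show ?case using I(2) unfolding gstep_def by blast
  qed
  from this[OF assms] I(3) show ?thesis by simp
qed

section \<open>One nondeterministic machine for each flow graph, and its soundness\<close>

section \<open>Programs as nondeterministic machines\<close>

(* A tape cell holds a flag for the first cell, the letter (a, S) of the word at this position, and the set of
   registers whose value is this position. *)
definition sym_code :: "bool \<Rightarrow> nat \<Rightarrow> nat set \<Rightarrow> nat set \<Rightarrow> nat" where
  "sym_code f a S M = 3 + prod_encode (of_bool f, prod_encode (a, prod_encode (set_encode S, set_encode M)))"

lemma sym_code_inject:
  assumes "finite S" "finite S'" "finite M" "finite M'"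
  shows "sym_code f a S M = sym_code f' a' S' M' \<longleftrightarrow> f = f' \<and> a = a' \<and> S = S' \<and> M = M'"
  using assms by (auto simp: sym_code_def set_encode_eq of_bool_def split: if_splits)

text \<open>The values 0, 1 and 2 stay free for the blank and the two input symbols, so that a cell
  not yet rewritten is recognizable.\<close>

lemma sym_code_ge: "sym_code f a S M \<ge> 3"
  by (simp add: sym_code_def)

datatype mstate = Start | Guess | At nat | Put nat nat | Next nat nat

instance mstate :: countable by countable_datatype

text \<open>The start state of an \<open>ntm\<close> is fixed as 0, hence the special case.\<close>

definition st_code :: "mstate \<Rightarrow> nat" where
  "st_code s = (if s = Start then 0 else Suc (to_nat s))"

lemma st_code_inject: "st_code s = st_code s' \<longleftrightarrow> s = s'"
  by (auto simp: st_code_def)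

definition bit_code :: "bool \<Rightarrow> nat" where
  "bit_code b = (if b then 2 else 1)"

text \<open>\<open>u\<close> is the input with a guess added: some number of blanks is appended, and
  every position carries a set of tracks below \<open>R\<close>. The tracks later store second-order
  relations.\<close>

definition ext :: "nat \<Rightarrow> bool list \<Rightarrow> letter list \<Rightarrow> bool" where
  "ext R w u \<longleftrightarrow> length w \<le> length u \<and>
     (\<forall>i<length u. fst (u ! i) = (if i < length w then bit_code (w ! i) else 0) \<and> snd (u ! i) \<subseteq> {..<R})"

locale graph_machine =
  fixes E :: "(nat \<times> act \<times> nat) set" and K R s0 t0 :: nat
  assumes finE: "finite E"
    and regs: "\<And>q a q'. (q, a, q') \<in> E \<Longrightarrow> act_regs a \<subseteq> {..<K}"
begin

definition nodes :: "nat set" where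
  "nodes = insert s0 (insert t0 (fst ` E \<union> (snd \<circ> snd) ` E))"

definition syms :: "nat set" where
  "syms = {0, 1, 2} \<union> {sym_code f a S M |f a S M. a < 3 \<and> S \<subseteq> {..<R} \<and> M \<subseteq> {..<K}}"

definition ok_sym :: "nat \<Rightarrow> nat set \<Rightarrow> nat set \<Rightarrow> bool" where
  "ok_sym a S M \<longleftrightarrow> a < 3 \<and> S \<subseteq> {..<R} \<and> M \<subseteq> {..<K}"

(* The head wanders freely over the tape; a transition of the graph fires wherever the marked cell permits it. *)
inductive tr :: "mstate \<Rightarrow> nat \<Rightarrow> mstate \<Rightarrow> nat \<Rightarrow> int \<Rightarrow> bool" where
  start: "a = 1 \<or> a = 2 \<Longrightarrow> S \<subseteq> {..<R} \<Longrightarrow> tr Start a Guess (sym_code True a S {..<K}) 1"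
| guess: "a = 0 \<or> a = 1 \<or> a = 2 \<Longrightarrow> S \<subseteq> {..<R} \<Longrightarrow> tr Guess a Guess (sym_code False a S {}) 1"
| stop: "tr Guess 0 (At s0) 0 0"
| wander_at: "x \<in> syms \<Longrightarrow> q \<in> nodes \<Longrightarrow> d = -1 \<or> d = 1 \<Longrightarrow> tr (At q) x (At q) x d"
| wander_put: "x \<in> syms \<Longrightarrow> q \<in> nodes \<Longrightarrow> i < K \<Longrightarrow> d = -1 \<or> d = 1 \<Longrightarrow> tr (Put q i) x (Put q i) x d"
| skip: "(q, Skip, q') \<in> E \<Longrightarrow> x \<in> syms \<Longrightarrow> tr (At q) x (At q') x 0"
| hav1: "(q, Hav i, q') \<in> E \<Longrightarrow> i \<in> M \<Longrightarrow> ok_sym a S M \<Longrightarrow>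
     tr (At q) (sym_code f a S M) (Put q' i) (sym_code f a S (M - {i})) 0"
| hav2: "q' \<in> nodes \<Longrightarrow> i < K \<Longrightarrow> ok_sym a S M \<Longrightarrow>
     tr (Put q' i) (sym_code f a S M) (At q') (sym_code f a S (insert i M)) 0"
| tlet: "(q, TLet i L, q') \<in> E \<Longrightarrow> i \<in> M \<Longrightarrow> (a, S) \<in> L \<Longrightarrow> ok_sym a S M \<Longrightarrow>
     tr (At q) (sym_code f a S M) (At q') (sym_code f a S M) 0"
| teq: "(q, TEq i j, q') \<in> E \<Longrightarrow> i \<in> M \<Longrightarrow> j \<in> M \<Longrightarrow> ok_sym a S M \<Longrightarrow>
     tr (At q) (sym_code f a S M) (At q') (sym_code f a S M) 0"
| tzero: "(q, TZero i, q') \<in> E \<Longrightarrow> i \<in> M \<Longrightarrow> ok_sym a S M \<Longrightarrow>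
     tr (At q) (sym_code True a S M) (At q') (sym_code True a S M) 0"
| tsuc1: "(q, TSuc i j, q') \<in> E \<Longrightarrow> i \<in> M \<Longrightarrow> ok_sym a S M \<Longrightarrow>
     tr (At q) (sym_code f a S M) (Next q' j) (sym_code f a S M) 1"
| tsuc2: "q' \<in> nodes \<Longrightarrow> j < K \<Longrightarrow> j \<in> M \<Longrightarrow> ok_sym a S M \<Longrightarrow>
     tr (Next q' j) (sym_code f a S M) (At q') (sym_code f a S M) 0"

definition machine :: ntm where
  "machine = \<lparr>delta = {(st_code q, x, st_code q', y, d) |q x q' y d. tr q x q' y d}, acc_state = st_code (At t0)\<rparr>"

lemma edge_nodes: "(q, a, q') \<in> E \<Longrightarrow> q \<in> nodes \<and> q' \<in> nodes"
  by (force simp: nodes_def image_iff)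

lemma finite_nodes: "finite nodes"
  using finE by (simp add: nodes_def)

lemma sym_in_syms: "ok_sym a S M \<Longrightarrow> sym_code f a S M \<in> syms"
  by (auto simp: syms_def ok_sym_def)

lemma finite_syms: "finite syms"
proof -
  have "syms \<subseteq> {0,1,2} \<union> (\<lambda>(f,a,S,M). sym_code f a S M) ` (UNIV \<times> {..<3} \<times> Pow {..<R} \<times> Pow {..<K})"
    by (force simp: syms_def)
  moreover have "finite ({0,1,2} \<union> (\<lambda>(f,a,S,M). sym_code f a S M) ` ((UNIV::bool set) \<times> {..<3} \<times> Pow {..<R} \<times> Pow {..<K}))"
    by auto
  ultimately show ?thesis by (rule finite_subset)
qed

lemma finite_delta: "finite (delta machine)"
proof -
  let ?Q = "{Start, Guess} \<union> At ` nodes \<union> (\<lambda>(q, i). Put q i) ` (nodes \<times> {..<K}) \<union> (\<lambda>(q, i). Next q i) ` (nodes \<times> {..<K})"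
  have s0: "s0 \<in> nodes" by (simp add: nodes_def)
  have "q \<in> ?Q \<and> x \<in> syms \<and> q' \<in> ?Q \<and> y \<in> syms \<and> d \<in> {-1, 0, 1}" if "tr q x q' y d" for q x q' y d
    using that
  proof cases
    case start then show ?thesis by (auto intro!: sym_in_syms simp: ok_sym_def) (auto simp: syms_def)
  next
    case guess then show ?thesis by (auto intro!: sym_in_syms simp: ok_sym_def) (auto simp: syms_def)
  next
    case stop then show ?thesis using s0 by (auto simp: syms_def)
  next
    case (skip)
    then show ?thesis using edge_nodes by auto
  next
    case (hav1 q i q' M a S f)
    have "ok_sym a S (M - {i})" using hav1 by (auto simp: ok_sym_def)
    then show ?thesis using hav1 edge_nodes[OF hav1(6)] regs[OF hav1(6)] by (auto intro!: sym_in_syms simp: image_iff)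
  next
    case (hav2 q' i a S M f)
    have "ok_sym a S (insert i M)" using hav2 by (auto simp: ok_sym_def)
    then show ?thesis using hav2 by (auto intro!: sym_in_syms simp: image_iff)
  next
    case tlet then show ?thesis using edge_nodes by (auto intro!: sym_in_syms)
  next
    case teq then show ?thesis using edge_nodes by (auto intro!: sym_in_syms)
  next
    case tzero then show ?thesis using edge_nodes by (auto intro!: sym_in_syms)
  next
    case (tsuc1 q i j q' M a S f) then show ?thesis using edge_nodes[OF tsuc1(6)] regs[OF tsuc1(6)] by (auto intro!: sym_in_syms simp: image_iff)
  next
    case tsuc2 then show ?thesis by (auto intro!: sym_in_syms)
  qed auto
  then have "delta machine \<subseteq> st_code ` ?Q \<times> syms \<times> st_code ` ?Q \<times> syms \<times> {-1, 0, 1}"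
    by (fastforce simp: machine_def)
  then show ?thesis
    by (rule finite_subset) (use finite_nodes finite_syms in auto)
qed

text \<open>\<open>X\<close> is the set of registers marked on the tape; one register is missing
  from it while \<open>Hav\<close> carries its mark to another cell.\<close>

definition tape :: "letter list \<Rightarrow> env \<Rightarrow> nat set \<Rightarrow> int \<Rightarrow> nat" where
  "tape u e X p = (if 0 \<le> p \<and> p < int (length u)
     then sym_code (p = 0) (fst (u ! nat p)) (snd (u ! nat p)) {r \<in> X. e r = nat p} else 0)"

abbreviation step :: "conf \<Rightarrow> conf \<Rightarrow> bool" where
  "step \<equiv> ntm_step machine"

lemma step_iff: "step (st_code q, tp, h) (k, tp', h') \<longleftrightarrow>
   (\<exists>q' y d. tr q (tp h) q' y d \<and> k = st_code q' \<and> tp' = tp(h := y) \<and> h' = h + d)"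
proof -
  have "d = -1 \<or> d = 0 \<or> d = 1" if "tr q x q' y d" for q x q' y d
    using that by cases auto
  then show ?thesis by (fastforce simp: ntm_step_def machine_def st_code_inject)
qed

lemma tape_eq_sym:
  assumes "tape u e X p = sym_code f a S M" "X \<subseteq> {..<K}" "ok_sym a S M" "\<And>i. i < length u \<Longrightarrow> snd (u ! i) \<subseteq> {..<R}"
  obtains "0 \<le> p" "p < int (length u)" "f = (p = 0)" "u ! nat p = (a, S)" "M = {r \<in> X. e r = nat p}"
proof -
  have r: "0 \<le> p" "p < int (length u)" using assms(1) sym_code_ge[of f a S M] by (auto simp: tape_def split: if_splits)
  then have "snd (u ! nat p) \<subseteq> {..<R}" using assms(4) by simp
  then have "finite (snd (u ! nat p))" "finite S" "finite M" "finite {r \<in> X. e r = nat p}"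
    using assms(2,3) by (auto simp: ok_sym_def intro: finite_subset)
  then show ?thesis using assms(1) r that by (auto simp: tape_def sym_code_inject prod_eq_iff)
qed

definition run_to :: "letter list \<Rightarrow> nat \<Rightarrow> env \<Rightarrow> bool" where
  "run_to u q e \<longleftrightarrow> (gstep u E)\<^sup>*\<^sup>* (s0, \<lambda>_. 0) (q, e) \<and> (\<forall>r<K. e r < length u)"

lemma run_to_step: "run_to u q e \<Longrightarrow> (q, a, q') \<in> E \<Longrightarrow> act_step u a e e' \<Longrightarrow> run_to u q' e'"
proof -
  assume A: "run_to u q e" "(q, a, q') \<in> E" "act_step u a e e'"
  have "gstep u E (q, e) (q', e')" using A by (auto intro: gstepI)
  moreover have "\<forall>r<K. e' r < length u" using A by (cases a) (auto simp: run_to_def)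
  ultimately show ?thesis using A(1) by (auto simp: run_to_def)
qed

text \<open>The head is unconstrained at \<open>At\<close> and \<open>Put\<close>, where it wanders
  freely. At \<open>Next\<close> it stands just right of the cell marked \<open>i\<close>; this
  state has no wandering moves, so the test for \<open>j\<close> really compares adjacent
  cells.\<close>

inductive inv :: "bool list \<Rightarrow> conf \<Rightarrow> bool" for w where
  inv_init: "inv w (init_conf w)"
| inv_guess: "length u \<ge> 1 \<Longrightarrow>
    (\<forall>i<length u. fst (u ! i) = (if i < length w then bit_code (w ! i) else 0) \<and> snd (u ! i) \<subseteq> {..<R}) \<Longrightarrow>
    h = int (length u) \<Longrightarrow>
    tp = (\<lambda>p. if 0 \<le> p \<and> p < int (length u) then tape u (\<lambda>_. 0) {..<K} p else fst (snd (init_conf w)) p) \<Longrightarrow>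
    inv w (st_code Guess, tp, h)"
| inv_at: "ext R w u \<Longrightarrow> run_to u q e \<Longrightarrow> inv w (st_code (At q), tape u e {..<K}, h)"
| inv_put: "ext R w u \<Longrightarrow> (q, Hav i, q') \<in> E \<Longrightarrow> run_to u q e \<Longrightarrow>
    inv w (st_code (Put q' i), tape u e ({..<K} - {i}), h)"
| inv_next: "ext R w u \<Longrightarrow> (q, TSuc i j, q') \<in> E \<Longrightarrow> run_to u q e \<Longrightarrow> h = int (e i) + 1 \<Longrightarrow>
    inv w (st_code (Next q' j), tape u e {..<K}, h)"

lemma ext_tracks: "ext R w u \<Longrightarrow> i < length u \<Longrightarrow> snd (u ! i) \<subseteq> {..<R}"
  by (simp add: ext_def)

lemma inv_step:
  assumes "w \<noteq> []" "inv w c" "step c c'"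
  shows "inv w c'"
  using assms(2)
proof cases
  case inv_init
  obtain k tp' h' where c': "c' = (k, tp', h')" by (cases c')
  have i: "init_conf w = (st_code Start, fst (snd (init_conf w)), 0)" by (simp add: init_conf_def st_code_def)
  obtain q' y d where t: "tr Start (fst (snd (init_conf w)) 0) q' y d" "k = st_code q'"
    "tp' = (fst (snd (init_conf w)))(0 := y)" "h' = 0 + d"
    using assms(3) unfolding inv_init c' by (subst (asm) (2) i, unfold step_iff) blast
  from t(1) show ?thesis
  proof cases
    case (start S)
    define u where "u = [(fst (snd (init_conf w)) 0, S)]"
    have w0: "fst (snd (init_conf w)) 0 = bit_code (w ! 0)" using assms(1) by (simp add: init_conf_def bit_code_def)
    have m: "{r. r < K} = {..<K}" by auto
    show ?thesis unfolding c' t(2) start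
    proof (rule inv.inv_guess[of u])
      show "\<forall>i<length u. fst (u ! i) = (if i < length w then bit_code (w ! i) else 0) \<and> snd (u ! i) \<subseteq> {..<R}"
        using assms(1) w0 start by (simp add: u_def)
      show "tp' = (\<lambda>p. if 0 \<le> p \<and> p < int (length u) then tape u (\<lambda>_. 0) {..<K} p else fst (snd (init_conf w)) p)"
      proof
        fix p :: int
        show "tp' p = (if 0 \<le> p \<and> p < int (length u) then tape u (\<lambda>_. 0) {..<K} p else fst (snd (init_conf w)) p)"
          using t(3) start m by (cases "p = 0") (auto simp: u_def tape_def)
      qed
    qed (use t start in \<open>auto simp: u_def\<close>)
  qed
next
  case (inv_guess u h tp)
  obtain k tp' h' where c': "c' = (k, tp', h')" by (cases c')
  obtain q' y d where t: "tr Guess (tp h) q' y d" "k = st_code q'" "tp' = tp(h := y)" "h' = h + d"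
    using assms(3) unfolding inv_guess(1) c' step_iff by blast
  have tph: "tp h = (if length u < length w then bit_code (w ! length u) else 0)"
    using inv_guess(4,5) by (simp add: init_conf_def bit_code_def)
  from t(1) show ?thesis
  proof cases
    case (guess S)
    have une: "u \<noteq> []" using inv_guess(2) by auto
    define u' where "u' = u @ [(tp h, S)]"
    show ?thesis unfolding c' t(2) guess
    proof (rule inv.inv_guess[of u'])
      show "1 \<le> length u'" by (simp add: u'_def)
      show "\<forall>i<length u'. fst (u' ! i) = (if i < length w then bit_code (w ! i) else 0) \<and> snd (u' ! i) \<subseteq> {..<R}"
        using inv_guess(3) guess tph by (auto simp: u'_def nth_append less_Suc_eq)
      show "h' = int (length u')" using t guess inv_guess by (simp add: u'_def)
      show "tp' = (\<lambda>p. if 0 \<le> p \<and> p < int (length u') then tape u' (\<lambda>_. 0) {..<K} p else fst (snd (init_conf w)) p)"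
      proof
        fix p
        have "nat p = length u \<longleftrightarrow> p = int (length u)" if "0 \<le> p" for p using that by auto
        then show "tp' p = (if 0 \<le> p \<and> p < int (length u') then tape u' (\<lambda>_. 0) {..<K} p else fst (snd (init_conf w)) p)"
          using t(3) guess inv_guess(4,5) une by (auto simp: u'_def tape_def nth_append)
      qed
    qed
  next
    case stop
    \<comment> \<open>Guessing stops only on a blank, hence never inside the input.\<close>
    have l: "length w \<le> length u" using stop tph by (auto simp: bit_code_def split: if_splits)
    have "ext R w u" using l inv_guess(3) by (simp add: ext_def)
    moreover have "run_to u s0 (\<lambda>_. 0)" using inv_guess(2) by (cases u) (auto simp: run_to_def)
    moreover have "tp' = tape u (\<lambda>_. 0) {..<K}"
      using t(3) stop inv_guess(4,5) l by (auto simp: tape_def init_conf_def fun_eq_iff)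
    ultimately show ?thesis unfolding c' t(2) stop by (simp add: inv_at)
  qed
next
  case (inv_at u q e h)
  let ?tp = "tape u e {..<K}"
  obtain k tp' h' where c': "c' = (k, tp', h')" by (cases c')
  obtain q' y d where t: "tr (At q) (?tp h) q' y d" "k = st_code q'" "tp' = ?tp(h := y)" "h' = h + d"
    using assms(3) unfolding inv_at(1) c' step_iff by blast
  note tes = tape_eq_sym[of u e "{..<K}" h, OF _ _ _ ext_tracks[OF inv_at(2)]]
  from t(1) show ?thesis
  proof cases
    case wander_at
    then show ?thesis unfolding c' t(2-4) using inv_at by (simp add: inv.inv_at)
  next
    case (skip q2)
    then show ?thesis unfolding c' t(2-4) using inv_at run_to_step[OF inv_at(3) skip(4), of e] by (simp add: inv.inv_at)
  next
    case (hav1 i q2 M a S f)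
    obtain h: "0 \<le> h" "h < int (length u)" "f = (h = 0)" "u ! nat h = (a, S)" "M = {r \<in> {..<K}. e r = nat h}"
      using tes[OF hav1(1)] hav1 by auto
    have "tp' = tape u e ({..<K} - {i})"
    proof
      fix p show "tp' p = tape u e ({..<K} - {i}) p"
      proof (cases "p = h")
        case True
        have "{r \<in> {..<K}. e r = nat h} - {i} = {r \<in> {..<K} - {i}. e r = nat h}" by auto
        then show ?thesis using True t(3) hav1(3) h by (simp add: tape_def)
      next
        case False
        have "{r \<in> {..<K}. e r = nat p} = {r \<in> {..<K} - {i}. e r = nat p}" if "0 \<le> p"
          using that h False hav1 by auto
        then show ?thesis using False t(3) by (simp add: tape_def)
      qed
    qed
    then show ?thesis unfolding c' t(2) hav1 using inv_at hav1 by (simp add: inv.inv_put)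
  next
    case (tlet i L q2 M a S f)
    obtain h: "0 \<le> h" "h < int (length u)" "u ! nat h = (a, S)" "M = {r \<in> {..<K}. e r = nat h}"
      using tes[OF tlet(1)] tlet by auto
    have "act_step u (TLet i L) e e" using h tlet by simp
    then show ?thesis unfolding c' t(2-4) tlet using inv_at(2) run_to_step[OF inv_at(3) tlet(5)] tlet(1) fun_upd_triv[of ?tp h]
      by (metis inv.inv_at)
  next
    case (teq i j q2 M a S f)
    obtain h: "0 \<le> h" "h < int (length u)" "u ! nat h = (a, S)" "M = {r \<in> {..<K}. e r = nat h}"
      using tes[OF teq(1)] teq by auto
    have "act_step u (TEq i j) e e" using h teq by simp
    then show ?thesis unfolding c' t(2-4) teq using inv_at(2) run_to_step[OF inv_at(3) teq(5)] teq(1) fun_upd_triv[of ?tp h]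
      by (metis inv.inv_at)
  next
    case (tzero i q2 M a S)
    obtain h: "h = 0" "M = {r \<in> {..<K}. e r = nat h}"
      using tes[OF tzero(1)] tzero by auto
    have "act_step u (TZero i) e e" using h tzero by simp
    then show ?thesis unfolding c' t(2-4) tzero using inv_at(2) run_to_step[OF inv_at(3) tzero(5)] tzero(1) fun_upd_triv[of ?tp h]
      by (metis inv.inv_at)
  next
    case (tsuc1 i j q2 M a S f)
    obtain h: "0 \<le> h" "M = {r \<in> {..<K}. e r = nat h}"
      using tes[OF tsuc1(1)] tsuc1 by auto
    have "h' = int (e i) + 1" using h tsuc1 t by auto
    then show ?thesis unfolding c' t(2) tsuc1 using inv.inv_next[OF inv_at(2) tsuc1(5) inv_at(3)] t(3) tsuc1(1,3) fun_upd_triv[of ?tp h]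
      by metis
  qed
next
  case (inv_put u q i q2 e h)
  let ?tp = "tape u e ({..<K} - {i})"
  obtain k tp' h' where c': "c' = (k, tp', h')" by (cases c')
  obtain q' y d where t: "tr (Put q2 i) (?tp h) q' y d" "k = st_code q'" "tp' = ?tp(h := y)" "h' = h + d"
    using assms(3) unfolding inv_put(1) c' step_iff by blast
  note tes = tape_eq_sym[of u e "{..<K} - {i}" h, OF _ _ _ ext_tracks[OF inv_put(2)]]
  have iK: "i < K" using regs[OF inv_put(3)] by simp
  from t(1) show ?thesis
  proof cases
    case wander_put
    then show ?thesis unfolding c' t(2-4) using inv_put by (simp add: inv.inv_put)
  next
    case (hav2 a S M f)
    obtain h: "0 \<le> h" "h < int (length u)" "f = (h = 0)" "u ! nat h = (a, S)" "M = {r \<in> {..<K} - {i}. e r = nat h}"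
      using tes[OF hav2(1)] hav2 by auto
    have "tp' = tape u (e(i := nat h)) {..<K}"
    proof
      fix p show "tp' p = tape u (e(i := nat h)) {..<K} p"
      proof (cases "p = h")
        case True
        have "insert i {r \<in> {..<K} - {i}. e r = nat h} = {r \<in> {..<K}. (e(i := nat h)) r = nat h}" using iK by auto
        then show ?thesis using True t(3) hav2(3) h by (simp add: tape_def)
      next
        case False
        have "{r \<in> {..<K} - {i}. e r = nat p} = {r \<in> {..<K}. (e(i := nat h)) r = nat p}" if "0 \<le> p"
          using that h False by auto
        then show ?thesis using False t(3) by (simp add: tape_def)
      qed
    qed
    moreover have "nat h < length u" using h by auto
    then have "act_step u (Hav i) e (e(i := nat h))" by auto
    ultimately show ?thesis unfolding c' t(2) hav2 using inv_put(2) run_to_step[OF inv_put(4,3)] by (simp add: inv_at)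
  qed
next
  case (inv_next u q i j q2 e h)
  let ?tp = "tape u e {..<K}"
  obtain k tp' h' where c': "c' = (k, tp', h')" by (cases c')
  obtain q' y d where t: "tr (Next q2 j) (?tp h) q' y d" "k = st_code q'" "tp' = ?tp(h := y)" "h' = h + d"
    using assms(3) unfolding inv_next(1) c' step_iff by blast
  note tes = tape_eq_sym[of u e "{..<K}" h, OF _ _ _ ext_tracks[OF inv_next(2)]]
  from t(1) show ?thesis
  proof cases
    case (tsuc2 M a S f)
    obtain h: "0 \<le> h" "M = {r \<in> {..<K}. e r = nat h}"
      using tes[OF tsuc2(1)] tsuc2 by auto
    have "act_step u (TSuc i j) e e" using h tsuc2 inv_next(5) by auto
    then show ?thesis unfolding c' t(2-4) tsuc2 using inv_next(2) run_to_step[OF inv_next(4,3)] tsuc2(1) fun_upd_triv[of ?tp h]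
      by (metis inv.inv_at)
  qed
qed

text \<open>Holds for every \<open>t\<close>: an accepting computation of any length exhibits a
  guessed word and a path through the graph.\<close>

lemma machine_sound:
  assumes "w \<noteq> []" "accepts_within machine w t"
  shows "\<exists>u e. ext R w u \<and> (gstep u E)\<^sup>*\<^sup>* (s0, \<lambda>_. 0) (t0, e)"
proof -
  obtain k c where kc: "(step ^^ k) (init_conf w) c" "fst c = st_code (At t0)"
    using assms(2) by (auto simp: accepts_within_def machine_def)
  have "inv w c" using kc(1)
  proof (induction k arbitrary: c)
    case 0 then show ?case by (auto intro: inv_init)
  next
    case (Suc k) then show ?case using inv_step[OF assms(1)] by (metis relpowp_Suc_E)
  qed
  then show ?thesis
  proof cases
    case inv_init then show ?thesis using kc(2) by (simp add: init_conf_def st_code_def)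
  qed (use kc(2) in \<open>auto simp: st_code_inject run_to_def\<close>)
qed

end

section \<open>Completeness of the machine within polynomial time\<close>

context graph_machine
begin

definition reach_in :: "nat \<Rightarrow> conf \<Rightarrow> conf \<Rightarrow> bool" where
  "reach_in k c c' \<longleftrightarrow> (\<exists>j\<le>k. (step ^^ j) c c')"

lemma reach_in_trans: "reach_in k c c' \<Longrightarrow> reach_in l c' c'' \<Longrightarrow> reach_in (k + l) c c''"
  unfolding reach_in_def by (meson add_mono relpowp_trans)

lemma reach_in_mono: "reach_in k c c' \<Longrightarrow> k \<le> l \<Longrightarrow> reach_in l c c'"
  unfolding reach_in_def using le_trans by blast

lemma reach_in_step: "step c c' \<Longrightarrow> reach_in 1 c c'"
  unfolding reach_in_def by (metis order_refl relpowp_1)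

lemma wander:
  assumes "\<And>p d. d = -1 \<or> d = 1 \<Longrightarrow> tr s (tp p) s (tp p) d"
  shows "reach_in (nat \<bar>h - h'\<bar>) (st_code s, tp, h) (st_code s, tp, h')"
proof (induction "nat \<bar>h - h'\<bar>" arbitrary: h)
  case 0 then show ?case by (auto simp: reach_in_def intro: exI[of _ 0])
next
  case (Suc n)
  define d :: int where "d = (if h < h' then 1 else -1)"
  have "n = nat \<bar>(h + d) - h'\<bar>" using Suc(2) by (auto simp: d_def)
  then have "reach_in n (st_code s, tp, h + d) (st_code s, tp, h')" using Suc(1)[of "h + d"] by simp
  moreover have "step (st_code s, tp, h) (st_code s, tp, h + d)"
    using assms[of d h] unfolding step_iff by (intro exI[of _ s] exI[of _ "tp h"] exI[of _ d]) (auto simp: d_def)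
  ultimately have "reach_in (1 + n) (st_code s, tp, h) (st_code s, tp, h')"
    using reach_in_trans reach_in_step by blast
  then show ?case using Suc(2) by simp
qed

lemma tape_ok:
  assumes "ext R w u" "X \<subseteq> {..<K}" "0 \<le> p" "p < int (length u)"
  shows "ok_sym (fst (u ! nat p)) (snd (u ! nat p)) {r \<in> X. e r = nat p}"
proof -
  have "nat p < length u" using assms by auto
  then show ?thesis using assms(1,2) by (auto simp: ok_sym_def ext_def bit_code_def)
qed

lemma tape_syms: "ext R w u \<Longrightarrow> X \<subseteq> {..<K} \<Longrightarrow> tape u e X p \<in> syms"
  using tape_ok[of w u X p e] sym_in_syms by (simp add: tape_def) (simp add: syms_def)

text \<open>The costliest action is \<open>Hav\<close>: one walk to the old mark, one to the new
  place, each of at most \<open>length u\<close> steps, and two rewriting steps. Every other action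
  takes one walk and at most two further steps.\<close>

lemma edge_complete:
  assumes "ext R w u" "(q, a, q') \<in> E" "act_step u a e e'" "\<forall>r<K. e r < length u" "0 \<le> h" "h \<le> int (length u)"
  shows "\<exists>h'. 0 \<le> h' \<and> h' \<le> int (length u) \<and>
    reach_in (2 * length u + 4) (st_code (At q), tape u e {..<K}, h) (st_code (At q'), tape u e' {..<K}, h')"
proof -
  let ?W = "length u" and ?T = "tape u e {..<K}"
  have qn: "q \<in> nodes" "q' \<in> nodes" using edge_nodes[OF assms(2)] by auto
  have ex: "\<exists>h'. 0 \<le> h' \<and> h' \<le> int ?W \<and> reach_in (2 * ?W + 4) (st_code (At q), ?T, h) (st_code (At q'), tape u e' {..<K}, h')"
    if "k \<le> 2 * ?W + 4" "0 \<le> h'" "h' \<le> int ?W" "reach_in k (st_code (At q), ?T, h) (st_code (At q'), tape u e' {..<K}, h')" for k h'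
    using that reach_in_mono by blast
  have go: "reach_in ?W (st_code (At q), ?T, h) (st_code (At q), ?T, h')" if "0 \<le> h'" "h' \<le> int ?W" for h'
  proof -
    have "reach_in (nat \<bar>h - h'\<bar>) (st_code (At q), ?T, h) (st_code (At q), ?T, h')"
      by (rule wander) (use qn tape_syms[OF assms(1)] in \<open>auto intro: tr.wander_at\<close>)
    then show ?thesis by (rule reach_in_mono) (use that assms(5,6) in auto)
  qed
  have one: "reach_in (?W + 1) (st_code (At q), ?T, h) (st_code q2, ?T, h' + d)"
    if "0 \<le> h'" "h' \<le> int ?W" "tr (At q) (?T h') q2 (?T h') d" for h' q2 d
  proof -
    have "step (st_code (At q), ?T, h') (st_code q2, ?T, h' + d)"
      unfolding step_iff using that(3) by (metis fun_upd_triv)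
    then show ?thesis using reach_in_trans[OF go[OF that(1,2)] reach_in_step] by blast
  qed
  have T: "?T (int i) = sym_code (i = 0) (fst (u ! i)) (snd (u ! i)) {r \<in> {..<K}. e r = i}" if "i < ?W" for i
    using that by (simp add: tape_def)
  have O: "ok_sym (fst (u ! i)) (snd (u ! i)) {r \<in> {..<K}. e r = i}" if "i < ?W" for i
    using tape_ok[OF assms(1), of "{..<K}" "int i" e] that by simp
  have single: ?thesis if "i < K" "e' = e" "tr (At q) (?T (int (e i))) (At q') (?T (int (e i))) 0" for i
    using ex[of "?W + 1" "int (e i)"] one[of "int (e i)" "At q'" 0] that assms(4) by (simp add: less_imp_le)
  note rg = regs[OF assms(2)]
  show ?thesis
  proof (cases a)
    case Skip
    have "tr (At q) (?T h) (At q') (?T h) 0" using assms(2) Skip tape_syms[OF assms(1)] by (auto intro: tr.skip)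
    then show ?thesis using ex[of "?W + 1" h] one[of h "At q'" 0] assms Skip by simp
  next
    case (Hav i)
    obtain k where k: "k < ?W" "e' = e(i := k)" using assms(3) Hav by auto
    have iK: "i < K" using rg Hav by simp
    let ?p = "e i"
    have pW: "?p < ?W" using assms(4) iK by simp
    let ?U = "tape u e ({..<K} - {i})"
    have upd1: "?U = ?T(int ?p := sym_code (?p = 0) (fst (u ! ?p)) (snd (u ! ?p)) ({r \<in> {..<K}. e r = ?p} - {i}))"
    proof
      fix x
      have a: "{r \<in> {..<K} - {i}. e r = ?p} = {r \<in> {..<K}. e r = ?p} - {i}" by auto
      have b: "{r \<in> {..<K} - {i}. e r = nat x} = {r \<in> {..<K}. e r = nat x}" if "x \<noteq> int ?p" "0 \<le> x" using that by auto
      show "?U x = (?T(int ?p := sym_code (?p = 0) (fst (u ! ?p)) (snd (u ! ?p)) ({r \<in> {..<K}. e r = ?p} - {i}))) x"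
        using a b pW by (cases "x = int ?p") (auto simp: tape_def)
    qed
    have "tr (At q) (?T (int ?p)) (Put q' i) (sym_code (?p = 0) (fst (u ! ?p)) (snd (u ! ?p)) ({r \<in> {..<K}. e r = ?p} - {i})) 0"
      unfolding T[OF pW] using assms(2) Hav O[OF pW] iK by (intro tr.hav1) auto
    then have "step (st_code (At q), ?T, int ?p) (st_code (Put q' i), ?U, int ?p)"
      unfolding step_iff upd1 by fastforce
    then have 1: "reach_in (?W + 1) (st_code (At q), ?T, h) (st_code (Put q' i), ?U, int ?p)"
      using reach_in_trans[OF go reach_in_step, of "int ?p"] pW by simp
    have "reach_in (nat \<bar>int ?p - int k\<bar>) (st_code (Put q' i), ?U, int ?p) (st_code (Put q' i), ?U, int k)"
      by (rule wander) (use qn iK tape_syms[OF assms(1), of "{..<K} - {i}"] in \<open>auto intro: tr.wander_put\<close>)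
    then have 2: "reach_in ?W (st_code (Put q' i), ?U, int ?p) (st_code (Put q' i), ?U, int k)"
      by (rule reach_in_mono) (use pW k in auto)
    let ?V = "tape u e' {..<K}"
    have Uk: "?U (int k) = sym_code (k = 0) (fst (u ! k)) (snd (u ! k)) {r \<in> {..<K} - {i}. e r = k}"
      using k by (simp add: tape_def)
    have upd2: "?V = ?U(int k := sym_code (k = 0) (fst (u ! k)) (snd (u ! k)) (insert i {r \<in> {..<K} - {i}. e r = k}))"
    proof
      fix x
      have a: "{r \<in> {..<K}. e' r = k} = insert i {r \<in> {..<K} - {i}. e r = k}" using k iK by auto
      have b: "{r \<in> {..<K}. e' r = nat x} = {r \<in> {..<K} - {i}. e r = nat x}" if "x \<noteq> int k" "0 \<le> x" using that k by auto
      show "?V x = (?U(int k := sym_code (k = 0) (fst (u ! k)) (snd (u ! k)) (insert i {r \<in> {..<K} - {i}. e r = k}))) x"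
        using a b k(1) by (cases "x = int k") (auto simp: tape_def)
    qed
    have "tr (Put q' i) (?U (int k)) (At q') (sym_code (k = 0) (fst (u ! k)) (snd (u ! k)) (insert i {r \<in> {..<K} - {i}. e r = k})) 0"
      unfolding Uk using qn iK tape_ok[OF assms(1), of "{..<K} - {i}" "int k" e] k by (intro tr.hav2) auto
    then have "step (st_code (Put q' i), ?U, int k) (st_code (At q'), ?V, int k)"
      unfolding step_iff upd2 by fastforce
    then have "reach_in (?W + 1 + ?W + 1) (st_code (At q), ?T, h) (st_code (At q'), ?V, int k)"
      using reach_in_trans[OF reach_in_trans[OF 1 2] reach_in_step] by simp
    then show ?thesis using ex[of "?W + 1 + ?W + 1" "int k"] k by simp
  next
    case (TLet i L)
    then have "i < K" "e i < ?W" "u ! e i \<in> L" "e' = e" using rg assms(3,4) by auto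
    then show ?thesis
      using single[of i] assms(2) O[of "e i"] TLet by (simp add: T tr.tlet)
  next
    case (TEq i j)
    then have "i < K" "j < K" "e i < ?W" "e j = e i" "e' = e" using rg assms(3,4) by auto
    then show ?thesis
      using single[of i] assms(2) O[of "e i"] TEq by (simp add: T tr.teq)
  next
    case (TZero i)
    then have *: "i < K" "e i = 0" "0 < ?W" "e' = e" using rg assms(3,4) by auto
    have "tr (At q) (?T (int (e i))) (At q') (?T (int (e i))) 0"
      unfolding *(2) T[OF *(3)] using assms(2) O[OF *(3)] TZero * by (simp add: tr.tzero)
    then show ?thesis using single[of i] * by simp
  next
    case (TSuc i j)
    then have *: "i < K" "j < K" "e i < ?W" "e j < ?W" "e j = Suc (e i)" "e' = e" using rg assms(3,4) by auto
    have "tr (At q) (?T (int (e i))) (Next q' j) (?T (int (e i))) 1"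
      unfolding T[OF *(3)] using assms(2) O[OF *(3)] TSuc * by (intro tr.tsuc1) auto
    then have 1: "reach_in (?W + 1) (st_code (At q), ?T, h) (st_code (Next q' j), ?T, int (e i) + 1)"
      using one[of "int (e i)" "Next q' j" 1] * by simp
    have "tr (Next q' j) (?T (int (e j))) (At q') (?T (int (e j))) 0"
      unfolding T[OF *(4)] using qn O[OF *(4)] * by (intro tr.tsuc2) auto
    then have "step (st_code (Next q' j), ?T, int (e j)) (st_code (At q'), ?T, int (e j))"
      unfolding step_iff by (metis fun_upd_triv add_0_right)
    moreover have "int (e i) + 1 = int (e j)" using * by simp
    ultimately have "reach_in (?W + 1 + 1) (st_code (At q), ?T, h) (st_code (At q'), ?T, int (e j))"
      using reach_in_trans[OF 1] reach_in_step by metis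
    then show ?thesis using ex[of "?W + 1 + 1" "int (e j)"] * by simp
  qed
qed

lemma guess_complete:
  assumes "w \<noteq> []" "ext R w u"
  shows "reach_in (length u + 1) (init_conf w) (st_code (At s0), tape u (\<lambda>_. 0) {..<K}, int (length u))"
proof -
  let ?i = "fst (snd (init_conf w))"
  define T where "T k = (\<lambda>p. if 0 \<le> p \<and> p < int k then tape u (\<lambda>_. 0) {..<K} p else ?i p)" for k
  have lw: "length w \<le> length u" "0 < length u" using assms by (auto simp: ext_def)
  have u: "snd (u ! k) \<subseteq> {..<R}" "fst (u ! k) = ?i (int k)" if "k < length u" for k
    using assms(2) that by (auto simp: ext_def init_conf_def bit_code_def)
  have fst3: "?i x = 0 \<or> ?i x = 1 \<or> ?i x = 2" for x by (simp add: init_conf_def)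
  have main: "k \<ge> 1 \<Longrightarrow> k \<le> length u \<Longrightarrow> reach_in k (init_conf w) (st_code Guess, T k, int k)" for k
  proof (induction k)
    case (Suc k)
    show ?case
    proof (cases "k = 0")
      case True
      have "?i 0 = 1 \<or> ?i 0 = 2" using assms(1) by (simp add: init_conf_def)
      then have "tr Start (?i 0) Guess (sym_code True (?i 0) (snd (u ! 0)) {..<K}) 1"
        using u[OF lw(2)] by (intro tr.start) auto
      moreover have "T (Suc 0) = ?i(0 := sym_code True (?i 0) (snd (u ! 0)) {..<K})"
      proof
        fix p :: int
        have "{r. r < K} = {..<K}" by auto
        then show "T (Suc 0) p = (?i(0 := sym_code True (?i 0) (snd (u ! 0)) {..<K})) p"
          using lw u[OF lw(2)] by (cases "p = 0") (auto simp: T_def tape_def)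
      qed
      moreover have "init_conf w = (st_code Start, ?i, 0)" by (simp add: init_conf_def st_code_def)
      ultimately have "step (init_conf w) (st_code Guess, T (Suc 0), 1)" by (metis step_iff add_0)
      then show ?thesis using True reach_in_step by simp
    next
      case False
      then have k: "k \<ge> 1" "k < length u" using Suc.prems by auto
      have Tk: "T k (int k) = ?i (int k)" by (simp add: T_def)
      have "tr Guess (T k (int k)) Guess (sym_code False (?i (int k)) (snd (u ! k)) {}) 1"
        unfolding Tk using fst3 u[OF k(2)] by (intro tr.guess) auto
      moreover have "T (Suc k) = (T k)(int k := sym_code False (?i (int k)) (snd (u ! k)) {})"
      proof
        fix p :: int
        show "T (Suc k) p = ((T k)(int k := sym_code False (?i (int k)) (snd (u ! k)) {})) p"
          using k u[OF k(2)] by (cases "p = int k") (auto simp: T_def tape_def)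
      qed
      ultimately have "step (st_code Guess, T k, int k) (st_code Guess, T (Suc k), int k + 1)"
        unfolding step_iff by fastforce
      moreover have "int k + 1 = int (Suc k)" by simp
      ultimately have "reach_in (k + 1) (init_conf w) (st_code Guess, T (Suc k), int (Suc k))"
        using Suc.IH k reach_in_trans reach_in_step by (metis less_imp_le)
      then show ?thesis by simp
    qed
  qed simp
  have e: "T (length u) = tape u (\<lambda>_. 0) {..<K}"
    using lw by (auto simp: T_def fun_eq_iff tape_def init_conf_def)
  have "tape u (\<lambda>_. 0) {..<K} (int (length u)) = 0" by (simp add: tape_def)
  then have "step (st_code Guess, T (length u), int (length u)) (st_code (At s0), tape u (\<lambda>_. 0) {..<K}, int (length u))"
    unfolding step_iff e using tr.stop by (metis fun_upd_triv add_0_right)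
  then show ?thesis using reach_in_trans[OF main reach_in_step] lw by (simp add: Suc_le_eq)
qed

lemma path_complete:
  assumes "ext R w u" "u \<noteq> []" "(gstep u E ^^ n) (s0, \<lambda>_. 0) (q, e)"
  shows "\<exists>h. 0 \<le> h \<and> h \<le> int (length u) \<and>
    reach_in (n * (2 * length u + 4)) (st_code (At s0), tape u (\<lambda>_. 0) {..<K}, int (length u)) (st_code (At q), tape u e {..<K}, h)
    \<and> (\<forall>r<K. e r < length u)"
  using assms(3)
proof (induction n arbitrary: q e)
  case 0
  have "reach_in 0 c c" for c by (auto simp: reach_in_def)
  then show ?case using 0 assms(2) by (intro exI[of _ "int (length u)"]) auto
next
  case (Suc n)
  obtain c1 where c1: "(gstep u E ^^ n) (s0, \<lambda>_. 0) c1" "gstep u E c1 (q, e)" using Suc.prems by (rule relpowp_Suc_E)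
  obtain q1 e1 where qe: "c1 = (q1, e1)" by (cases c1)
  obtain a where a: "(q1, a, q) \<in> E" "act_step u a e1 e" using c1(2) qe by (auto simp: gstep_def)
  obtain h where h: "0 \<le> h" "h \<le> int (length u)"
    "reach_in (n * (2 * length u + 4)) (st_code (At s0), tape u (\<lambda>_. 0) {..<K}, int (length u)) (st_code (At q1), tape u e1 {..<K}, h)"
    "\<forall>r<K. e1 r < length u" using Suc.IH[of q1 e1] c1(1) qe by blast
  obtain h' where h': "0 \<le> h'" "h' \<le> int (length u)"
    "reach_in (2 * length u + 4) (st_code (At q1), tape u e1 {..<K}, h) (st_code (At q), tape u e {..<K}, h')"
    using edge_complete[OF assms(1) a h(4,1,2)] by blast
  have "\<forall>r<K. e r < length u" using a(2) h(4) by (cases a) auto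
  then show ?case using reach_in_trans[OF h(3) h'(3)] h' by (auto simp: add.commute)
qed

text \<open>Registers from \<open>K\<close> on are never assigned and stay 0, so at most
  \<open>card nodes * length u ^ K\<close> states of the graph are reachable. The length of a
  shortest path is bounded by the number of edges between them, whence the square.\<close>

lemma short_path:
  assumes "u \<noteq> []" "(gstep u E)\<^sup>*\<^sup>* (s0, \<lambda>_. 0) c"
  shows "\<exists>n\<le>(card nodes * length u ^ K)\<^sup>2. (gstep u E ^^ n) (s0, \<lambda>_. 0) c"
proof -
  define Env where "Env = {e :: env. (\<forall>r<K. e r < length u) \<and> (\<forall>r\<ge>K. e r = 0)}"
  define C where "C = nodes \<times> Env"
  define S where "S = {(c, c'). c \<in> C \<and> c' \<in> C \<and> gstep u E c c'}"
  have inj: "inj_on (\<lambda>e. map e [0..<K]) Env"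
  proof (rule inj_onI)
    fix e e' assume A: "e \<in> Env" "e' \<in> Env" "map e [0..<K] = map e' [0..<K]"
    show "e = e'"
    proof
      fix r show "e r = e' r" using A by (cases "r < K") (auto simp: Env_def)
    qed
  qed
  have sub: "(\<lambda>e. map e [0..<K]) ` Env \<subseteq> {xs. set xs \<subseteq> {..<length u} \<and> length xs = K}"
    by (auto simp: Env_def)
  have fL: "finite {xs. set xs \<subseteq> {..<length u} \<and> length xs = K}" by (simp add: finite_lists_length_eq)
  have finEnv: "finite Env" using finite_imageD[OF finite_subset[OF sub fL] inj] .
  have cE: "card Env \<le> length u ^ K"
    using card_mono[OF fL sub] card_image[OF inj] card_lists_length_eq[of "{..<length u}" K] by simp
  have finC: "finite C" and cC: "card C \<le> card nodes * length u ^ K"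
    using finEnv finite_nodes cE by (auto simp: C_def card_cartesian_product)
  have "S \<subseteq> C \<times> C" by (auto simp: S_def)
  then have finS: "finite S" and "card S \<le> card C * card C"
    using finC card_mono[of "C \<times> C" S] by (auto intro: finite_subset simp: card_cartesian_product)
  then have cS: "card S \<le> (card nodes * length u ^ K)\<^sup>2"
    using mult_mono[OF cC cC] by (simp add: power2_eq_square)
  have "c \<in> C \<and> ((s0, \<lambda>_. 0), c) \<in> S\<^sup>*" using assms(2)
  proof induction
    case base then show ?case using assms(1) by (auto simp: C_def Env_def nodes_def)
  next
    case (step c1 c2)
    obtain a where a: "(fst c1, a, fst c2) \<in> E" "act_step u a (snd c1) (snd c2)" using step(2) by (auto simp: gstep_def)
    have "fst c2 \<in> nodes" using edge_nodes[OF a(1)] by simp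
    moreover have "snd c2 \<in> Env" using a(2) regs[OF a(1)] step.IH by (cases a) (auto simp: C_def Env_def)
    ultimately have "c2 \<in> C" by (simp add: C_def mem_Times_iff)
    then show ?case using step by (auto simp: S_def intro: rtrancl_into_rtrancl)
  qed
  then obtain n where n: "n \<le> card S" "((s0, \<lambda>_. 0), c) \<in> S ^^ n"
    using rtrancl_finite_eq_relpow[OF finS] by auto
  have "(gstep u E ^^ n) x y" if "(x, y) \<in> S ^^ n" for x y n using that
  proof (induction n arbitrary: y)
    case (Suc n) then show ?case by (auto simp: S_def)
  qed simp
  then show ?thesis using n cS le_trans by blast
qed

lemma machine_complete:
  assumes "w \<noteq> []" "ext R w u" "(gstep u E)\<^sup>*\<^sup>* (s0, \<lambda>_. 0) (t0, e)"
  shows "accepts_within machine w (length u + 1 + (card nodes * length u ^ K)\<^sup>2 * (2 * length u + 4))"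
proof -
  have u: "u \<noteq> []" using assms(1,2) by (auto simp: ext_def)
  obtain n where n: "n \<le> (card nodes * length u ^ K)\<^sup>2" "(gstep u E ^^ n) (s0, \<lambda>_. 0) (t0, e)"
    using short_path[OF u assms(3)] by blast
  obtain h where h: "reach_in (n * (2 * length u + 4)) (st_code (At s0), tape u (\<lambda>_. 0) {..<K}, int (length u)) (st_code (At t0), tape u e {..<K}, h)"
    using path_complete[OF assms(2) u n(2)] by blast
  have "reach_in (length u + 1 + (card nodes * length u ^ K)\<^sup>2 * (2 * length u + 4)) (init_conf w) (st_code (At t0), tape u e {..<K}, h)"
    using reach_in_mono[OF reach_in_trans[OF guess_complete[OF assms(1,2)] h]] n(1) by simp
  then show ?thesis by (auto simp: accepts_within_def reach_in_def machine_def)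
qed

end

text \<open>Acceptance is sound at any time, and a good guess \<open>u\<close> is accepted in time
  polynomial in the length of \<open>u\<close>, with \<open>c\<close> and \<open>d\<close>
  independent of \<open>w\<close> and \<open>u\<close>. \<open>K\<close> exceeds every register of
  the program.\<close>

lemma prog_ntm:
  "\<exists>M c d. finite (delta M) \<and>
    (\<forall>w t. w \<noteq> [] \<longrightarrow> accepts_within M w t \<longrightarrow> (\<exists>u e. ext R w u \<and> run u p (\<lambda>_. 0) e)) \<and>
    (\<forall>w u e. w \<noteq> [] \<longrightarrow> ext R w u \<longrightarrow> run u p (\<lambda>_. 0) e \<longrightarrow> accepts_within M w (c * (length u + 1) ^ d))"
proof -
  define K where "K = Suc (Max (insert 0 (\<Union>(q, a, q') \<in> frag p 0. act_regs a)))"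
  have fin: "finite (\<Union>(q, a, q') \<in> frag p 0. act_regs a)"
  proof -
    have "finite (act_regs a)" for a by (cases a) auto
    then show ?thesis using frag_finite[of p 0] by auto
  qed
  interpret graph_machine "frag p 0" K R 0 "frag_end p 0"
  proof
    show "finite (frag p 0)" by (rule frag_finite)
    fix q a q' assume A: "(q, a, q') \<in> frag p 0"
    show "act_regs a \<subseteq> {..<K}"
    proof
      fix i assume "i \<in> act_regs a"
      then have "i \<in> insert 0 (\<Union>(q, a, q') \<in> frag p 0. act_regs a)" using A by auto
      then have "i \<le> Max (insert 0 (\<Union>(q, a, q') \<in> frag p 0. act_regs a))" using fin by (intro Max_ge) auto
      then show "i \<in> {..<K}" by (simp add: K_def)
    qed
  qed
  let ?n = "card nodes"
  have bound: "W + 1 + (?n * W ^ K)\<^sup>2 * (2 * W + 4) \<le> (1 + 4 * ?n\<^sup>2) * (W + 1) ^ (2 * K + 1)" for W :: nat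
  proof -
    have "(?n * W ^ K)\<^sup>2 \<le> ?n\<^sup>2 * (W + 1) ^ (2 * K)"
    proof -
      have "(W ^ K)\<^sup>2 \<le> (W + 1) ^ (2 * K)" by (metis le_add1 power_even_eq power_mono zero_le power_mult mult.commute)
      then show ?thesis by (simp add: power_mult_distrib)
    qed
    then have "(?n * W ^ K)\<^sup>2 * (2 * W + 4) \<le> ?n\<^sup>2 * (W + 1) ^ (2 * K) * (4 * (W + 1))"
      by (rule mult_mono) auto
    moreover have "W + 1 \<le> (W + 1) ^ (2 * K + 1)" by (rule self_le_power) auto
    ultimately show ?thesis by (simp add: algebra_simps)
  qed
  show ?thesis
  proof (rule exI[of _ machine], rule exI[of _ "1 + 4 * ?n\<^sup>2"], rule exI[of _ "2 * K + 1"], intro conjI allI impI)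
    show "finite (delta machine)" by (rule finite_delta)
    fix w t assume "w \<noteq> []" "accepts_within machine w t"
    then show "\<exists>u e. ext R w u \<and> run u p (\<lambda>_. 0) e" using machine_sound frag_sound by blast
  next
    fix w u e assume A: "w \<noteq> []" "ext R w u" "run u p (\<lambda>_. 0) e"
    have "(gstep u (frag p 0))\<^sup>*\<^sup>* (0, \<lambda>_. 0) (frag_end p 0, e)" using frag_complete[OF A(3)] by blast
    from machine_complete[OF A(1,2) this] bound[of "length u"]
    show "accepts_within machine w ((1 + 4 * ?n\<^sup>2) * (length u + 1) ^ (2 * K + 1))"
      unfolding accepts_within_def by (meson le_trans)
  qed
qed

section \<open>A negation-free logic with reachability between pairs, compiled to programs\<close>

section \<open>First-order logic with reachability\<close>

text \<open>Negation is absent because a program certifies truth only by having a run. Negative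
  facts are expressed positively where they arise. Variables are registers.\<close>

datatype fm = FLet nat "letter set" | FEq nat nat | FSuc nat nat | FZero nat | FAnd fm fm | FOr fm fm
  | FEx nat fm | FReach nat nat nat nat fm

primrec sat :: "letter list \<Rightarrow> fm \<Rightarrow> env \<Rightarrow> bool" where
  "sat u (FLet x L) e = (u ! e x \<in> L)"
| "sat u (FEq x y) e = (e x = e y)"
| "sat u (FSuc x y) e = (e y = Suc (e x))"
| "sat u (FZero x) e = (e x = 0)"
| "sat u (FAnd f g) e = (sat u f e \<and> sat u g e)"
| "sat u (FOr f g) e = (sat u f e \<or> sat u g e)"
| "sat u (FEx x f) e = (\<exists>v<length u. sat u f (e(x := v)))"
| "sat u (FReach x1 x2 y1 y2 f) e =
     (\<lambda>c c'. fst c' < length u \<and> snd c' < length u \<and>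
        sat u f (e(x1 := fst c, x2 := snd c, y1 := fst c', y2 := snd c')))\<^sup>*\<^sup>* (e x1, e x2) (e y1, e y2)"

text \<open>All registers of the formula, bound ones included, lie below \<open>k\<close>, which
  leaves the registers from \<open>k\<close> on as scratch space. The four registers of
  \<open>FReach\<close> are distinct because its body reads the old and the new pair at
  once.\<close>

primrec fm_ok :: "nat \<Rightarrow> fm \<Rightarrow> bool" where
  "fm_ok k (FLet x L) = (x < k)"
| "fm_ok k (FEq x y) = (x < k \<and> y < k)"
| "fm_ok k (FSuc x y) = (x < k \<and> y < k)"
| "fm_ok k (FZero x) = (x < k)"
| "fm_ok k (FAnd f g) = (fm_ok k f \<and> fm_ok k g)"
| "fm_ok k (FOr f g) = (fm_ok k f \<and> fm_ok k g)"
| "fm_ok k (FEx x f) = (x < k \<and> fm_ok k f)"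
| "fm_ok k (FReach x1 x2 y1 y2 f) = (x1 < k \<and> x2 < k \<and> y1 < k \<and> y2 < k \<and> distinct [x1, x2, y1, y2] \<and> fm_ok k f)"

definition assign :: "nat \<Rightarrow> nat \<Rightarrow> prog" where
  "assign i j = Seq (Act (Hav i)) (Act (TEq i j))"

lemma run_assign: "i \<noteq> j \<Longrightarrow> e j < length u \<Longrightarrow> run u (assign i j) e e' \<longleftrightarrow> e' = e(i := e j)"
  by (auto simp: assign_def OO_def)

fun seqs :: "prog list \<Rightarrow> prog" where
  "seqs [] = Act Skip"
| "seqs (p # ps) = Seq p (seqs ps)"

fun runs :: "letter list \<Rightarrow> prog list \<Rightarrow> env \<Rightarrow> env \<Rightarrow> bool" where
  "runs u [] e e' = (e' = e)"
| "runs u (p # ps) e e' = (\<exists>e1. run u p e e1 \<and> runs u ps e1 e')"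

lemma run_seqs: "run u (seqs ps) e e' = runs u ps e e'"
  by (induction ps arbitrary: e) (auto simp: OO_def)

text \<open>A bound register may shadow a live one, so old values are saved from register
  \<open>k\<close> on and restored at the end. For \<open>FReach\<close> the current pair sits in
  \<open>x1\<close>, \<open>x2\<close>, the guessed next pair in \<open>y1\<close>,
  \<open>y2\<close>, and the target in \<open>k + 2\<close>, \<open>k + 3\<close>.\<close>

primrec compile :: "nat \<Rightarrow> fm \<Rightarrow> prog" where
  "compile k (FLet x L) = Act (TLet x L)"
| "compile k (FEq x y) = Act (TEq x y)"
| "compile k (FSuc x y) = Act (TSuc x y)"
| "compile k (FZero x) = Act (TZero x)"
| "compile k (FAnd f g) = Seq (compile k f) (compile k g)"
| "compile k (FOr f g) = Choice (compile k f) (compile k g)"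
| "compile k (FEx x f) = seqs [assign k x, Act (Hav x), compile (Suc k) f, assign x k]"
| "compile k (FReach x1 x2 y1 y2 f) = seqs [assign k x1, assign (k + 1) x2, assign (k + 2) y1, assign (k + 3) y2,
     Star (seqs [Act (Hav y1), Act (Hav y2), compile (k + 4) f, assign x1 y1, assign x2 y2]),
     Act (TEq x1 (k + 2)), Act (TEq x2 (k + 3)),
     assign x1 k, assign x2 (k + 1), assign y1 (k + 2), assign y2 (k + 3)]"

lemma fm_ok_mono: "fm_ok k f \<Longrightarrow> k \<le> l \<Longrightarrow> fm_ok l f"
  by (induction f) auto

lemma sat_cong: "fm_ok k f \<Longrightarrow> (\<And>r. r < k \<Longrightarrow> e r = e' r) \<Longrightarrow> sat u f e = sat u f e'"
proof (induction f arbitrary: e e')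
  case (FEx x f)
  have "sat u f (e(x := v)) = sat u f (e'(x := v))" for v by (rule FEx.IH) (use FEx.prems in auto)
  then show ?case by simp
next
  case (FReach x1 x2 y1 y2 f)
  have "sat u f (e(x1 := a, x2 := b, y1 := c, y2 := d)) = sat u f (e'(x1 := a, x2 := b, y1 := c, y2 := d))" for a b c d
    by (rule FReach.IH) (use FReach.prems in auto)
  moreover have "e x1 = e' x1" "e x2 = e' x2" "e y1 = e' y1" "e y2 = e' y2" using FReach.prems by auto
  ultimately show ?case by simp
next
  case (FAnd f g)
  have "sat u f e = sat u f e'" by (rule FAnd.IH(1)) (use FAnd.prems(1) in simp, rule FAnd.prems(2))
  moreover have "sat u g e = sat u g e'" by (rule FAnd.IH(2)) (use FAnd.prems(1) in simp, rule FAnd.prems(2))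
  ultimately show ?case by simp
next
  case (FOr f g)
  have "sat u f e = sat u f e'" by (rule FOr.IH(1)) (use FOr.prems(1) in simp, rule FOr.prems(2))
  moreover have "sat u g e = sat u g e'" by (rule FOr.IH(2)) (use FOr.prems(1) in simp, rule FOr.prems(2))
  ultimately show ?case by simp
qed auto

definition env_ok :: "letter list \<Rightarrow> env \<Rightarrow> bool" where
  "env_ok u e \<longleftrightarrow> (\<forall>r. e r < length u)"

lemma env_ok_upd: "env_ok u e \<Longrightarrow> v < length u \<Longrightarrow> env_ok u (e(x := v))"
  by (simp add: env_ok_def)

text \<open>Preservation of the registers below \<open>k\<close> belongs to the induction, since in
  a conjunction the second program starts in the environment that the first one leaves.\<close>

lemma compile_correct:
  assumes "fm_ok k f" "env_ok u e"
  shows "(\<forall>e'. run u (compile k f) e e' \<longrightarrow> sat u f e \<and> (\<forall>r<k. e' r = e r) \<and> env_ok u e') \<and>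
    (sat u f e \<longrightarrow> (\<exists>e'. run u (compile k f) e e'))"
  using assms
proof (induction f arbitrary: k e)
  case (FAnd f g)
  have fg: "fm_ok k f" "fm_ok k g" using FAnd.prems(1) by auto
  have F: "\<And>e'. run u (compile k f) e e' \<Longrightarrow> sat u f e \<and> (\<forall>r<k. e' r = e r) \<and> env_ok u e'"
    "sat u f e \<Longrightarrow> \<exists>e'. run u (compile k f) e e'" using FAnd.IH(1)[OF fg(1) FAnd.prems(2)] by blast+
  have G: "\<And>e1 e'. env_ok u e1 \<Longrightarrow> run u (compile k g) e1 e' \<Longrightarrow> sat u g e1 \<and> (\<forall>r<k. e' r = e1 r) \<and> env_ok u e'"
    "\<And>e1. env_ok u e1 \<Longrightarrow> sat u g e1 \<Longrightarrow> \<exists>e'. run u (compile k g) e1 e'" using FAnd.IH(2)[OF fg(2)] by blast+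
  have C: "(\<forall>r<k. e1 r = e r) \<Longrightarrow> sat u g e1 = sat u g e" for e1 by (rule sat_cong[of k]) (use FAnd.prems in auto)
  show ?case
  proof (intro conjI allI impI)
    fix e' assume "run u (compile k (FAnd f g)) e e'"
    then obtain e1 where "run u (compile k f) e e1" "run u (compile k g) e1 e'" by auto
    then show "sat u (FAnd f g) e" "env_ok u e'" "\<And>r. r < k \<Longrightarrow> e' r = e r" using F(1)[of e1] G(1)[of e1 e'] C[of e1] by auto
  next
    assume "sat u (FAnd f g) e"
    then obtain e1 where "run u (compile k f) e e1" "sat u g e" using F(2) by auto
    then show "\<exists>e'. run u (compile k (FAnd f g)) e e'" using F(1)[of e1] G(2)[of e1] C[of e1] by auto
  qed
next
  case (FOr f g)
  have *: "fm_ok k f" "fm_ok k g" using FOr.prems by auto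
  have "run u (compile k (FOr f g)) e e' \<longleftrightarrow> run u (compile k f) e e' \<or> run u (compile k g) e e'" for e'
    by simp
  then show ?case using FOr.IH(1)[OF *(1) FOr.prems(2)] FOr.IH(2)[OF *(2) FOr.prems(2)] unfolding sat.simps by blast
next
  case (FEx x f)
  let ?W = "length u"
  have x: "x < k" "fm_ok (Suc k) f" using FEx.prems(1) fm_ok_mono[of k f "Suc k"] by auto
  have IH: "\<And>e e'. env_ok u e \<Longrightarrow> run u (compile (Suc k) f) e e' \<Longrightarrow> sat u f e \<and> (\<forall>r<Suc k. e' r = e r) \<and> env_ok u e'"
    "\<And>e. env_ok u e \<Longrightarrow> sat u f e \<Longrightarrow> \<exists>e'. run u (compile (Suc k) f) e e'" using FEx.IH[OF x(2)] by blast+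
  have ok: "env_ok u (e(k := e x, x := v))" if "v < ?W" for v using that FEx.prems(2) by (simp add: env_ok_def)
  have C: "sat u f (e(k := e x, x := v)) = sat u f (e(x := v))" for v by (rule sat_cong[of k]) (use FEx.prems(1) in auto)
  have R: "run u (compile k (FEx x f)) e e' \<longleftrightarrow>
    (\<exists>v<?W. \<exists>e2. run u (compile (Suc k) f) (e(k := e x, x := v)) e2 \<and> run u (assign x k) e2 e')" for e'
  proof -
    have "e x < ?W" using FEx.prems(2) by (simp add: env_ok_def)
    then have "run u (assign k x) e e1 \<longleftrightarrow> e1 = e(k := e x)" for e1 using x by (intro run_assign) auto
    moreover have "(\<exists>e1. (\<exists>v<W. e1 = F v) \<and> Q e1) = (\<exists>v<W. Q (F v))" for W :: nat and F :: "nat \<Rightarrow> env" and Q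
      by blast
    ultimately show ?thesis unfolding compile.simps run_seqs runs.simps run.simps act_step.simps by simp
  qed
  show ?case
  proof (intro conjI allI impI)
    fix e' assume "run u (compile k (FEx x f)) e e'"
    then obtain v e2 where v: "v < ?W" "run u (compile (Suc k) f) (e(k := e x, x := v)) e2" "run u (assign x k) e2 e'" using R by blast
    note i = IH(1)[OF ok[OF v(1)] v(2)]
    have "e' = e2(x := e2 k)" using v(3) i x FEx.prems(2) by (subst (asm) run_assign) (auto simp: env_ok_def)
    moreover have "e2 k = e x" using i x by simp
    ultimately show "sat u (FEx x f) e" "env_ok u e'" "\<And>r. r < k \<Longrightarrow> e' r = e r"
      using i C v(1) x FEx.prems(2) by (auto simp: env_ok_def)
  next
    assume "sat u (FEx x f) e"
    then obtain v where v: "v < ?W" "sat u f (e(x := v))" by auto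
    then obtain e2 where e2: "run u (compile (Suc k) f) (e(k := e x, x := v)) e2" using IH(2)[OF ok] C by blast
    then have "run u (assign x k) e2 (e2(x := e2 k))" using IH(1)[OF ok[OF v(1)] e2] x FEx.prems(2) by (subst run_assign) (auto simp: env_ok_def)
    then show "\<exists>e'. run u (compile k (FEx x f)) e e'" using R v(1) e2 by blast
  qed
next
  case (FReach x1 x2 y1 y2 f)
  let ?W = "length u"
  have x: "x1 < k" "x2 < k" "y1 < k" "y2 < k" "fm_ok (k + 4) f" "fm_ok k f"
    and d: "x1 \<noteq> x2" "x1 \<noteq> y1" "x1 \<noteq> y2" "x2 \<noteq> y1" "x2 \<noteq> y2" "y1 \<noteq> y2"
    using FReach.prems(1) fm_ok_mono[of k f "k + 4"] by auto
  have IH: "\<And>e e'. env_ok u e \<Longrightarrow> run u (compile (k + 4) f) e e' \<Longrightarrow> sat u f e \<and> (\<forall>r<k + 4. e' r = e r) \<and> env_ok u e'"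
    "\<And>e. env_ok u e \<Longrightarrow> sat u f e \<Longrightarrow> \<exists>e'. run u (compile (k + 4) f) e e'" using FReach.IH[OF x(5)] by blast+
  define R where "R = (\<lambda>c c'. fst c' < ?W \<and> snd c' < ?W \<and> sat u f (e(x1 := fst c, x2 := snd c, y1 := fst c', y2 := snd c')))"
  define e0 where "e0 = e(k := e x1, k + 1 := e x2, k + 2 := e y1, k + 3 := e y2)"
  have ok0: "env_ok u e0" using FReach.prems(2) by (simp add: e0_def env_ok_def)
  define B where "B = run u (seqs [Act (Hav y1), Act (Hav y2), compile (k + 4) f, assign x1 y1, assign x2 y2])"
  \<comment> \<open>The loop invariant: below \<open>k + 4\<close>, everything except the four
    registers of the walk is as at the entry of the loop, so the body can be evaluated in the
    original environment \<open>e\<close>.\<close>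
  define agree where "agree e1 = (env_ok u e1 \<and> (\<forall>r<k + 4. r \<notin> {x1, x2, y1, y2} \<longrightarrow> e1 r = e0 r))" for e1
  have ag0: "agree e0" using ok0 by (simp add: agree_def)
  have C: "sat u f (e1(y1 := a, y2 := b)) = sat u f (e(x1 := e1 x1, x2 := e1 x2, y1 := a, y2 := b))" if "agree e1" for e1 a b
    by (rule sat_cong[OF x(6)]) (use that in \<open>auto simp: agree_def e0_def\<close>)
  have Bs: "agree e2 \<and> R (e1 x1, e1 x2) (e2 x1, e2 x2)" if ag: "agree e1" and B: "B e1 e2" for e1 e2
  proof -
    obtain a b e3 e4 where s: "a < ?W" "b < ?W" "run u (compile (k + 4) f) (e1(y1 := a, y2 := b)) e3"
      "run u (assign x1 y1) e3 e4" "run u (assign x2 y2) e4 e2"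
      using B by (auto simp: B_def run_seqs)
    have ok1: "env_ok u (e1(y1 := a, y2 := b))" using ag s(1,2) by (simp add: agree_def env_ok_def)
    note i = IH(1)[OF ok1 s(3)]
    have e4: "e4 = e3(x1 := e3 y1)" using s(4) d i by (subst (asm) run_assign) (auto simp: env_ok_def)
    then have ok4: "env_ok u e4" using i by (simp add: env_ok_def)
    have e2: "e2 = e4(x2 := e4 y2)" using s(5) d ok4 by (subst (asm) run_assign) (auto simp: env_ok_def)
    have y: "e3 y1 = a" "e3 y2 = b" using i x d by auto
    have "agree e2" using i ag ok4 unfolding e2 e4 agree_def env_ok_def by auto
    moreover have "e2 x1 = a" "e2 x2 = b" using y d by (auto simp: e2 e4)
    ultimately show ?thesis using i C[OF ag] s(1,2) by (simp add: R_def)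
  qed
  have Bc: "\<exists>e2. B e1 e2 \<and> e2 x1 = a \<and> e2 x2 = b" if ag: "agree e1" and r: "R (e1 x1, e1 x2) (a, b)" for e1 a b
  proof -
    have ab: "a < ?W" "b < ?W" "sat u f (e1(y1 := a, y2 := b))" using r C[OF ag] by (auto simp: R_def)
    have ok1: "env_ok u (e1(y1 := a, y2 := b))" using ag ab(1,2) by (simp add: agree_def env_ok_def)
    obtain e3 where e3: "run u (compile (k + 4) f) (e1(y1 := a, y2 := b)) e3" using IH(2)[OF ok1 ab(3)] by blast
    note i = IH(1)[OF ok1 e3]
    have y: "e3 y1 = a" "e3 y2 = b" using i x d by auto
    have 1: "run u (assign x1 y1) e3 (e3(x1 := a))" using y i d by (subst run_assign) (auto simp: env_ok_def)
    have 2: "run u (assign x2 y2) (e3(x1 := a)) (e3(x1 := a, x2 := b))" using y i d by (subst run_assign) (auto simp: env_ok_def)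
    have 3: "run u (Act (Hav y1)) e1 (e1(y1 := a))" "run u (Act (Hav y2)) (e1(y1 := a)) (e1(y1 := a, y2 := b))"
      using ab(1,2) by auto
    have "B e1 (e3(x1 := a, x2 := b))" unfolding B_def run_seqs runs.simps using 1 2 3 e3 by blast
    moreover have "(e3(x1 := a, x2 := b)) x1 = a" "(e3(x1 := a, x2 := b)) x2 = b" using d by auto
    ultimately show ?thesis by blast
  qed
  have Ss: "agree e2 \<and> R\<^sup>*\<^sup>* (e0 x1, e0 x2) (e2 x1, e2 x2)" if "B\<^sup>*\<^sup>* e0 e2" for e2
    using that
  proof induction
    case base then show ?case using ag0 by simp
  next
    case (step a b) then show ?case using Bs by (meson rtranclp.rtrancl_into_rtrancl)
  qed
  have Sc: "\<exists>e2. B\<^sup>*\<^sup>* e0 e2 \<and> e2 x1 = fst c \<and> e2 x2 = snd c" if "R\<^sup>*\<^sup>* (e0 x1, e0 x2) c" for c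
    using that
  proof induction
    case base then show ?case by auto
  next
    case (step c1 c2)
    then obtain e1 where e1: "B\<^sup>*\<^sup>* e0 e1" "e1 x1 = fst c1" "e1 x2 = snd c1" by auto
    have "R (e1 x1, e1 x2) (fst c2, snd c2)" using step(2) e1 by simp
    from Bc[OF _ this] Ss[OF e1(1)] obtain e2 where "B e1 e2" "e2 x1 = fst c2" "e2 x2 = snd c2" by auto
    then show ?case using e1(1) by (meson rtranclp.rtrancl_into_rtrancl)
  qed
  have W: "e x1 < ?W" "e x2 < ?W" "e y1 < ?W" "e y2 < ?W" using FReach.prems(2) by (auto simp: env_ok_def)
  have e0x: "e0 x1 = e x1" "e0 x2 = e x2" "e0 k = e x1" "e0 (k+1) = e x2" "e0 (k + 2) = e y1" "e0 (k + 3) = e y2"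
    using x by (auto simp: e0_def)
  have Rn: "run u (compile k (FReach x1 x2 y1 y2 f)) e e' \<longleftrightarrow>
    (\<exists>e2. B\<^sup>*\<^sup>* e0 e2 \<and> e2 x1 = e2 (k + 2) \<and> e2 x2 = e2 (k + 3) \<and>
      runs u [assign x1 k, assign x2 (k + 1), assign y1 (k + 2), assign y2 (k + 3)] e2 e')" for e'
  proof -
    have s1: "run u (assign k x1) e e1 \<longleftrightarrow> e1 = e(k := e x1)" for e1
      using x W by (intro run_assign) auto
    have s2: "run u (assign (k + 1) x2) (e(k := e x1)) e1 \<longleftrightarrow> e1 = e(k := e x1, k + 1 := e x2)" for e1
      using x W by (subst run_assign) auto
    have s3: "run u (assign (k + 2) y1) (e(k := e x1, k + 1 := e x2)) e1 \<longleftrightarrow> e1 = e(k := e x1, k + 1 := e x2, k + 2 := e y1)" for e1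
      using x W by (subst run_assign) auto
    have s4: "run u (assign (k + 3) y2) (e(k := e x1, k + 1 := e x2, k + 2 := e y1)) e1 \<longleftrightarrow> e1 = e0" for e1
      using x W by (subst run_assign) (auto simp: e0_def)
    have B: "run u (Star (seqs [Act (Hav y1), Act (Hav y2), compile (k + 4) f, assign x1 y1, assign x2 y2])) = B\<^sup>*\<^sup>*"
      by (simp only: run.simps B_def)
    show ?thesis unfolding compile.simps run_seqs
      by (subst runs.simps(2), unfold s1, simp only: ex_simps simp_thms,
          subst runs.simps(2), unfold s2, simp only: ex_simps simp_thms,
          subst runs.simps(2), unfold s3, simp only: ex_simps simp_thms,
          subst runs.simps(2), unfold s4, simp only: ex_simps simp_thms,
          subst runs.simps(2), unfold B,
          subst runs.simps(2), subst runs.simps(2)) (auto simp del: runs.simps)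
  qed
  have E: "runs u [assign x1 k, assign x2 (k + 1), assign y1 (k + 2), assign y2 (k + 3)] e2 e' \<longleftrightarrow>
    e' = e2(x1 := e x1, x2 := e x2, y1 := e y1, y2 := e y2)" if ag: "agree e2" for e2 e'
  proof -
    have v: "e2 k = e x1" "e2 (k + 1) = e x2" "e2 (k + 2) = e y1" "e2 (k + 3) = e y2"
      using ag x e0x by (auto simp: agree_def)
    have s1: "run u (assign x1 k) e2 e1 \<longleftrightarrow> e1 = e2(x1 := e x1)" for e1
      using x W v by (subst run_assign) auto
    have s2: "run u (assign x2 (k + 1)) (e2(x1 := e x1)) e1 \<longleftrightarrow> e1 = e2(x1 := e x1, x2 := e x2)" for e1
      using x W v by (subst run_assign) auto
    have s3: "run u (assign y1 (k + 2)) (e2(x1 := e x1, x2 := e x2)) e1 \<longleftrightarrow> e1 = e2(x1 := e x1, x2 := e x2, y1 := e y1)" for e1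
      using x W v by (subst run_assign) auto
    have s4: "run u (assign y2 (k + 3)) (e2(x1 := e x1, x2 := e x2, y1 := e y1)) e1 \<longleftrightarrow> e1 = e2(x1 := e x1, x2 := e x2, y1 := e y1, y2 := e y2)" for e1
      using x W v by (subst run_assign) auto
    show ?thesis by (simp add: s1 s2[simplified] s3[simplified] s4[simplified])
  qed
  have tgt: "e2 (k + 2) = e y1" "e2 (k + 3) = e y2" if "agree e2" for e2
    using that x e0x by (auto simp: agree_def)
  have S: "sat u (FReach x1 x2 y1 y2 f) e \<longleftrightarrow> R\<^sup>*\<^sup>* (e x1, e x2) (e y1, e y2)" by (simp add: R_def)
  show ?case
  proof (intro conjI allI impI)
    fix e' assume "run u (compile k (FReach x1 x2 y1 y2 f)) e e'"
    then obtain e2 where e2: "B\<^sup>*\<^sup>* e0 e2" "e2 x1 = e2 (k + 2)" "e2 x2 = e2 (k + 3)"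
      "runs u [assign x1 k, assign x2 (k + 1), assign y1 (k + 2), assign y2 (k + 3)] e2 e'" using Rn by blast
    note s = Ss[OF e2(1)]
    show "sat u (FReach x1 x2 y1 y2 f) e" unfolding S using s e2(2,3) tgt[of e2] e0x by simp
    have e': "e' = e2(x1 := e x1, x2 := e x2, y1 := e y1, y2 := e y2)" using e2(4) E s by blast
    show "env_ok u e'" using s FReach.prems(2) unfolding e' by (auto simp: agree_def env_ok_def)
    show "\<And>r. r < k \<Longrightarrow> e' r = e r" using s unfolding e' by (auto simp: agree_def e0_def)
  next
    assume "sat u (FReach x1 x2 y1 y2 f) e"
    then have "R\<^sup>*\<^sup>* (e0 x1, e0 x2) (e y1, e y2)" using S e0x by simp
    from Sc[OF this] obtain e2 where e2: "B\<^sup>*\<^sup>* e0 e2" "e2 x1 = e y1" "e2 x2 = e y2" by auto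
    have ag: "agree e2" using Ss[OF e2(1)] by simp
    show "\<exists>e'. run u (compile k (FReach x1 x2 y1 y2 f)) e e'"
      using Rn E[OF ag] e2 tgt[OF ag] by metis
  qed
qed auto

text \<open>The tracks of \<open>u\<close> act as unary relations under an existential second-order
  quantifier. Formulas of the logic under such a guess are thus decided in nondeterministic time
  polynomial in the length of the padded word.\<close>

theorem fm_ntm:
  assumes "fm_ok k f"
  shows "\<exists>M c d. finite (delta M) \<and>
    (\<forall>w t. w \<noteq> [] \<longrightarrow> accepts_within M w t \<longrightarrow> (\<exists>u. ext R w u \<and> sat u f (\<lambda>_. 0))) \<and>
    (\<forall>w u. w \<noteq> [] \<longrightarrow> ext R w u \<longrightarrow> sat u f (\<lambda>_. 0) \<longrightarrow> accepts_within M w (c * (length u + 1) ^ d))"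
proof -
  have ok: "env_ok u (\<lambda>_. 0)" if "w \<noteq> []" "ext R w u" for w u
    using that by (auto simp: env_ok_def ext_def)
  note cc = compile_correct[OF assms ok]
  obtain M c d where M: "finite (delta M)"
    "\<And>w t. w \<noteq> [] \<Longrightarrow> accepts_within M w t \<Longrightarrow> \<exists>u e. ext R w u \<and> run u (compile k f) (\<lambda>_. 0) e"
    "\<And>w u e. w \<noteq> [] \<Longrightarrow> ext R w u \<Longrightarrow> run u (compile k f) (\<lambda>_. 0) e \<Longrightarrow> accepts_within M w (c * (length u + 1) ^ d)"
    using prog_ntm[of R "compile k f"] by metis
  show ?thesis
  proof (rule exI[of _ M], rule exI[of _ c], rule exI[of _ d], intro conjI allI impI)
    show "finite (delta M)" by (rule M(1))
  next
    fix w t assume A: "w \<noteq> []" "accepts_within M w t"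
    then obtain u e where u: "ext R w u" "run u (compile k f) (\<lambda>_. 0) e" using M(2) by blast
    then show "\<exists>u. ext R w u \<and> sat u f (\<lambda>_. 0)" using cc[OF A(1) u(1)] by blast
  next
    fix w u assume A: "w \<noteq> []" "ext R w u" "sat u f (\<lambda>_. 0)"
    then obtain e where "run u (compile k f) (\<lambda>_. 0) e" using cc[OF A(1,2)] by blast
    then show "accepts_within M w (c * (length u + 1) ^ d)" using M(3) A by blast
  qed
qed

section \<open>Arithmetic on positions, and the layout of the encoding\<close>

section \<open>Arithmetic and the encoding of structures\<close>

text \<open>The part of \<open>fm_ok\<close> that does not depend on a register bound; some bound
  always exists, by \<open>fm_wf_ok\<close>.\<close>

primrec fm_wf :: "fm \<Rightarrow> bool" where
  "fm_wf (FLet x L) = True"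
| "fm_wf (FEq x y) = True"
| "fm_wf (FSuc x y) = True"
| "fm_wf (FZero x) = True"
| "fm_wf (FAnd f g) = (fm_wf f \<and> fm_wf g)"
| "fm_wf (FOr f g) = (fm_wf f \<and> fm_wf g)"
| "fm_wf (FEx x f) = fm_wf f"
| "fm_wf (FReach x1 x2 y1 y2 f) = (distinct [x1, x2, y1, y2] \<and> fm_wf f)"

lemma fm_wf_ok: "fm_wf f \<Longrightarrow> \<exists>k. fm_ok k f"
proof (induction f)
  case (FLet x L) then show ?case by auto
next
  case (FEq x y) then show ?case by (intro exI[of _ "Suc (max x y)"]) auto
next
  case (FSuc x y) then show ?case by (intro exI[of _ "Suc (max x y)"]) auto
next
  case (FZero x) then show ?case by auto
next
  case (FAnd f g)
  then obtain k l where "fm_ok k f" "fm_ok l g" by auto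
  then show ?case using fm_ok_mono[of k f "max k l"] fm_ok_mono[of l g "max k l"] by auto
next
  case (FOr f g)
  then obtain k l where "fm_ok k f" "fm_ok l g" by auto
  then show ?case using fm_ok_mono[of k f "max k l"] fm_ok_mono[of l g "max k l"] by auto
next
  case (FEx x f)
  then obtain k where "fm_ok k f" by auto
  then show ?case using fm_ok_mono[of k f "max k (Suc x)"] by (intro exI[of _ "max k (Suc x)"]) auto
next
  case (FReach x1 x2 y1 y2 f)
  then obtain k where k: "fm_ok k f" by auto
  let ?l = "k + x1 + x2 + y1 + y2 + 1"
  show ?case using fm_ok_mono[OF k, of ?l] FReach.prems by (intro exI[of _ ?l]) auto
qed

definition FTrue :: fm where "FTrue = FEq 0 0"
definition FFalse :: fm where "FFalse = FLet 0 {}"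

lemma sat_FTrue [simp]: "sat u FTrue e" by (simp add: FTrue_def)
lemma sat_FFalse [simp]: "\<not> sat u FFalse e" by (simp add: FFalse_def)

definition FAll :: "fm list \<Rightarrow> fm" where "FAll fs = foldr FAnd fs FTrue"
definition FAny :: "fm list \<Rightarrow> fm" where "FAny fs = foldr FOr fs FFalse"

lemma sat_FAll [simp]: "sat u (FAll fs) e \<longleftrightarrow> (\<forall>f\<in>set fs. sat u f e)"
  unfolding FAll_def by (induction fs) auto
lemma sat_FAny [simp]: "sat u (FAny fs) e \<longleftrightarrow> (\<exists>f\<in>set fs. sat u f e)"
  unfolding FAny_def by (induction fs) auto
lemma wf_FAll [simp]: "fm_wf (FAll fs) \<longleftrightarrow> (\<forall>f\<in>set fs. fm_wf f)"
  unfolding FAll_def by (induction fs) (auto simp: FTrue_def)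
lemma wf_FAny [simp]: "fm_wf (FAny fs) \<longleftrightarrow> (\<forall>f\<in>set fs. fm_wf f)"
  unfolding FAny_def by (induction fs) (auto simp: FFalse_def)

definition bnd :: "nat \<Rightarrow> nat \<times> nat \<Rightarrow> bool" where
  "bnd W c \<longleftrightarrow> fst c < W \<and> snd c < W"

(* In the definitions of formulas, k is the first register that is free for bound variables. *)
definition FR :: "nat \<Rightarrow> nat \<Rightarrow> nat \<Rightarrow> nat \<Rightarrow> nat \<Rightarrow> fm \<Rightarrow> fm" where
  "FR k a1 a2 b1 b2 f = FEx k (FEx (k + 1) (FEx (k + 2) (FEx (k + 3)
     (FAnd (FAnd (FEq k a1) (FEq (k + 1) a2)) (FAnd (FAnd (FEq (k + 2) b1) (FEq (k + 3) b2))
       (FReach k (k + 1) (k + 2) (k + 3) f))))))"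

lemma wf_FR [simp]: "fm_wf (FR k a1 a2 b1 b2 f) \<longleftrightarrow> fm_wf f"
  by (simp add: FR_def)

text \<open>\<open>FReach\<close> takes its endpoints from the very registers that its body rebinds;
  copying them into four fresh registers allows arbitrary, even equal, endpoints. Bounding the
  target of each step is enough because the starting pair is in range.\<close>

lemma sat_FR:
  assumes "env_ok u e" "a1 < k" "a2 < k" "b1 < k" "b2 < k"
    and Q: "\<And>p q p' q'. p < length u \<Longrightarrow> q < length u \<Longrightarrow> p' < length u \<Longrightarrow> q' < length u \<Longrightarrow>
      sat u f (e(k := p, k + 1 := q, k + 2 := p', k + 3 := q')) = Q (p, q) (p', q')"
  shows "sat u (FR k a1 a2 b1 b2 f) e \<longleftrightarrow>
    (\<lambda>c c'. bnd (length u) c' \<and> Q c c')\<^sup>*\<^sup>* (e a1, e a2) (e b1, e b2)"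
proof -
  let ?W = "length u"
  define R where "R = (\<lambda>c c'. fst c' < ?W \<and> snd c' < ?W \<and>
    sat u f (e(k := fst c, k + 1 := snd c, k + 2 := fst c', k + 3 := snd c')))"
  define R' where "R' = (\<lambda>c c'. bnd ?W c' \<and> Q c c')"
  have W: "e x < ?W" for x using assms(1) by (simp add: env_ok_def)
  have RR: "R c c' = R' c c'" if "bnd ?W c" for c c'
    using Q that by (cases c; cases c') (auto simp: R_def R'_def bnd_def)
  have "R\<^sup>*\<^sup>* c c' \<longleftrightarrow> R'\<^sup>*\<^sup>* c c'" if b: "bnd ?W c" for c c'
  proof
    assume "R\<^sup>*\<^sup>* c c'"
    then have "bnd ?W c' \<and> R'\<^sup>*\<^sup>* c c'"
    proof induction
      case (step c1 c2)
      then have "R' c1 c2" using RR by blast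
      then show ?case using step by (auto simp: R'_def intro: rtranclp.rtrancl_into_rtrancl)
    qed (use b in simp)
    then show "R'\<^sup>*\<^sup>* c c'" by simp
  next
    assume "R'\<^sup>*\<^sup>* c c'"
    then have "bnd ?W c' \<and> R\<^sup>*\<^sup>* c c'"
    proof induction
      case (step c1 c2)
      then have "R c1 c2" using RR by blast
      then show ?case using step by (auto simp: R'_def intro: rtranclp.rtrancl_into_rtrancl)
    qed (use b in simp)
    then show "R\<^sup>*\<^sup>* c c'" by simp
  qed
  moreover have "sat u (FR k a1 a2 b1 b2 f) e \<longleftrightarrow> R\<^sup>*\<^sup>* (e a1, e a2) (e b1, e b2)"
  proof -
    have upd: "e(k := a, k + 1 := b, k + 2 := c, k + 3 := d, k := a', k + 1 := b', k + 2 := c', k + 3 := d')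
      = e(k := a', k + 1 := b', k + 2 := c', k + 3 := d')" for a b c d a' b' c' d' by (auto simp: fun_eq_iff)
    have "sat u (FReach k (k + 1) (k + 2) (k + 3) f) (e(k := a, k + 1 := b, k + 2 := c, k + 3 := d)) \<longleftrightarrow> R\<^sup>*\<^sup>* (a, b) (c, d)" for a b c d
      unfolding sat.simps upd R_def by simp
    then have S: "sat u (FAnd (FAnd (FEq k a1) (FEq (k + 1) a2)) (FAnd (FAnd (FEq (k + 2) b1) (FEq (k + 3) b2))
       (FReach k (k + 1) (k + 2) (k + 3) f))) (e(k := a, k + 1 := b, k + 2 := c, k + 3 := d)) \<longleftrightarrow>
       a = e a1 \<and> b = e a2 \<and> c = e b1 \<and> d = e b2 \<and> R\<^sup>*\<^sup>* (a, b) (c, d)" for a b c d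
      using assms(2-5) by (simp del: sat.simps(8))
    show ?thesis unfolding FR_def sat.simps(7) S using W by auto
  qed
  ultimately show ?thesis using W by (simp add: R'_def bnd_def)
qed

text \<open>Recursion as reachability: the first component counts the rounds from 0 and the second
  accumulates. \<open>FMul\<close> follows the same pattern with \<open>FAdd\<close> as its
  step.\<close>

definition FAdd :: "nat \<Rightarrow> nat \<Rightarrow> nat \<Rightarrow> nat \<Rightarrow> fm" where
  "FAdd k x y z = FEx k (FAnd (FZero k) (FR (k + 1) k x y z (FAnd (FSuc (k + 1) (k + 3)) (FSuc (k + 2) (k + 4)))))"

lemma wf_FAdd [simp]: "fm_wf (FAdd k x y z)"
  by (simp add: FAdd_def)

lemma env_okD: "env_ok u e \<Longrightarrow> e x < length u"
  by (simp add: env_ok_def)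

lemma env_ok_0: "env_ok u e \<Longrightarrow> 0 < length u"
  by (rule le_less_trans[OF le0 env_okD])

lemma sat_FAdd:
  assumes "env_ok u e" "x < k" "y < k" "z < k"
  shows "sat u (FAdd k x y z) e \<longleftrightarrow> e x + e y = e z"
proof -
  let ?W = "length u"
  let ?e = "e(k := 0)"
  have ok: "env_ok u ?e" using assms(1) env_ok_0 by (simp add: env_ok_def)
  define R where "R = (\<lambda>c c'. bnd ?W c' \<and> fst c' = Suc (fst c) \<and> snd c' = Suc (snd c))"
  have "sat u (FR (k + 1) k x y z (FAnd (FSuc (k + 1) (k + 3)) (FSuc (k + 2) (k + 4)))) ?e
    \<longleftrightarrow> R\<^sup>*\<^sup>* (?e k, ?e x) (?e y, ?e z)"
    unfolding R_def by (rule sat_FR[OF ok]) (use assms in auto)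
  moreover have "R\<^sup>*\<^sup>* (0, a) (b, c) \<longleftrightarrow> a + b = c" if "b < ?W" "c < ?W" for a b c
  proof
    assume "R\<^sup>*\<^sup>* (0, a) (b, c)"
    moreover have "snd d = a + fst d" if "R\<^sup>*\<^sup>* (0, a) d" for d
      using that by induction (auto simp: R_def)
    ultimately show "a + b = c" by fastforce
  next
    assume "a + b = c"
    with that show "R\<^sup>*\<^sup>* (0, a) (b, c)"
    proof (induction b arbitrary: c)
      case (Suc b)
      then have "R\<^sup>*\<^sup>* (0, a) (b, a + b)" by simp
      moreover have "R (b, a + b) (Suc b, c)" using Suc.prems by (auto simp: R_def bnd_def)
      ultimately show ?case by (rule rtranclp.rtrancl_into_rtrancl)
    qed simp
  qed
  ultimately show ?thesis using assms env_okD[OF assms(1)] env_ok_0[OF assms(1)] by (auto simp: FAdd_def)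
qed

definition FMul :: "nat \<Rightarrow> nat \<Rightarrow> nat \<Rightarrow> nat \<Rightarrow> fm" where
  "FMul k x y z = FEx k (FAnd (FZero k) (FR (k + 1) k k x z (FAnd (FSuc (k + 1) (k + 3)) (FAdd (k + 5) (k + 2) y (k + 4)))))"

lemma wf_FMul [simp]: "fm_wf (FMul k x y z)"
  by (simp add: FMul_def)

lemma sat_FMul:
  assumes "env_ok u e" "x < k" "y < k" "z < k"
  shows "sat u (FMul k x y z) e \<longleftrightarrow> e x * e y = e z"
proof -
  let ?W = "length u"
  let ?e = "e(k := 0)"
  have ok: "env_ok u ?e" using assms(1) env_ok_0 by (simp add: env_ok_def)
  define R where "R = (\<lambda>c c'. bnd ?W c' \<and> fst c' = Suc (fst c) \<and> snd c + e y = snd c')"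
  have "sat u (FR (k + 1) k k x z (FAnd (FSuc (k + 1) (k + 3)) (FAdd (k + 5) (k + 2) y (k + 4)))) ?e
    \<longleftrightarrow> R\<^sup>*\<^sup>* (?e k, ?e k) (?e x, ?e z)"
    unfolding R_def
  proof (rule sat_FR[OF ok])
    fix p q p' q' assume "p < ?W" "q < ?W" "p' < ?W" "q' < ?W"
    then have "env_ok u (?e(k + 1 := p, k + 1 + 1 := q, k + 1 + 2 := p', k + 1 + 3 := q'))"
      using ok by (simp add: env_ok_def)
    from sat_FAdd[OF this, of "k + 2" "k + 5" y "k + 4"] assms
    show "sat u (FAnd (FSuc (k + 1) (k + 3)) (FAdd (k + 5) (k + 2) y (k + 4))) (?e(k + 1 := p, k + 1 + 1 := q, k + 1 + 2 := p', k + 1 + 3 := q'))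
      = (fst (p', q') = Suc (fst (p, q)) \<and> snd (p, q) + e y = snd (p', q'))" by auto
  qed (use assms in auto)
  moreover have "R\<^sup>*\<^sup>* (0, 0) (b, c) \<longleftrightarrow> b * e y = c" if "b < ?W" "c < ?W" for b c
  proof
    assume "R\<^sup>*\<^sup>* (0, 0) (b, c)"
    moreover have "fst d * e y = snd d" if "R\<^sup>*\<^sup>* (0, 0) d" for d
      using that by induction (auto simp: R_def)
    ultimately show "b * e y = c" by fastforce
  next
    assume "b * e y = c"
    with that show "R\<^sup>*\<^sup>* (0, 0) (b, c)"
    proof (induction b arbitrary: c)
      case (Suc b)
      then have "R\<^sup>*\<^sup>* (0, 0) (b, b * e y)" by simp
      moreover have "R (b, b * e y) (Suc b, c)" using Suc.prems by (auto simp: R_def bnd_def)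
      ultimately show ?case by (rule rtranclp.rtrancl_into_rtrancl)
    qed simp
  qed
  ultimately show ?thesis using assms env_okD[OF assms(1)] env_ok_0[OF assms(1)] by (auto simp: FMul_def)
qed

fun FConst :: "nat \<Rightarrow> nat \<Rightarrow> nat \<Rightarrow> fm" where
  "FConst k 0 x = FZero x"
| "FConst k (Suc c) x = FEx k (FAnd (FConst (k + 1) c k) (FSuc k x))"

lemma wf_FConst [simp]: "fm_wf (FConst k c x)"
  by (induction k c x rule: FConst.induct) auto

lemma sat_FConst:
  assumes "env_ok u e" "x < k"
  shows "sat u (FConst k c x) e \<longleftrightarrow> e x = c"
  using assms
proof (induction k c x arbitrary: e rule: FConst.induct)
  case (2 k c x)
  have IH: "env_ok u e' \<Longrightarrow> sat u (FConst (k + 1) c k) e' \<longleftrightarrow> e' k = c" for e' :: env using "2.IH"[of e'] by simp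
  have "sat u (FConst (k + 1) c k) (e(k := v)) \<longleftrightarrow> v = c" if "v < length u" for v
    using IH[OF env_ok_upd[OF "2.prems"(1) that, of k]] by simp
  then show ?case using "2.prems" env_okD[OF "2.prems"(1), of x] by auto
qed simp

definition FLess :: "nat \<Rightarrow> nat \<Rightarrow> nat \<Rightarrow> fm" where
  "FLess k x y = FEx k (FEx (k + 1) (FAnd (FSuc (k + 1) k) (FAdd (k + 2) x k y)))"

lemma wf_FLess [simp]: "fm_wf (FLess k x y)"
  by (simp add: FLess_def)

lemma sat_FLess:
  assumes "env_ok u e" "x < k" "y < k"
  shows "sat u (FLess k x y) e \<longleftrightarrow> e x < e y"
proof -
  have "sat u (FAdd (k + 2) x k y) (e(k := a, k + 1 := b)) \<longleftrightarrow> e x + a = e y" if "a < length u" "b < length u" for a b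
    using sat_FAdd[of u "e(k := a, k + 1 := b)" x "k + 2" k y] assms that by (simp add: env_ok_upd)
  then have "sat u (FLess k x y) e \<longleftrightarrow> (\<exists>a<length u. \<exists>b<length u. a = Suc b \<and> e x + a = e y)"
    by (auto simp: FLess_def)
  also have "\<dots> \<longleftrightarrow> e x < e y"
  proof
    assume "e x < e y"
    then have "e y - e x = Suc (e y - e x - 1)" "e x + (e y - e x) = e y" by auto
    moreover have "e y - e x < length u" "e y - e x - 1 < length u" using env_okD[OF assms(1), of y] by auto
    ultimately show "\<exists>a<length u. \<exists>b<length u. a = Suc b \<and> e x + a = e y" by blast
  qed auto
  finally show ?thesis .
qed

fun FPow :: "nat \<Rightarrow> nat \<Rightarrow> nat \<Rightarrow> nat \<Rightarrow> fm" where
  "FPow k b 0 z = FConst k 1 z"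
| "FPow k b (Suc n) z = FEx k (FAnd (FPow (k + 1) b n k) (FMul (k + 1) k b z))"

lemma wf_FPow [simp]: "fm_wf (FPow k b n z)"
  by (induction k b n z rule: FPow.induct) auto

lemma sat_FPow:
  assumes "env_ok u e" "b < k" "z < k" "0 < e b"
  shows "sat u (FPow k b n z) e \<longleftrightarrow> e z = e b ^ n"
  using assms
proof (induction k b n z arbitrary: e rule: FPow.induct)
  case (1 k b z) then show ?case using sat_FConst[of u e z k 1] by simp
next
  case (2 k b n z)
  have IH: "env_ok u e' \<Longrightarrow> 0 < e' b \<Longrightarrow> sat u (FPow (k + 1) b n k) e' \<longleftrightarrow> e' k = e' b ^ n" for e' :: env
    using "2.IH"[of e'] "2.prems"(2) by simp
  have "sat u (FPow (k + 1) b n k) (e(k := v)) \<longleftrightarrow> v = e b ^ n" "sat u (FMul (k + 1) k b z) (e(k := v)) \<longleftrightarrow> v * e b = e z"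
    if "v < length u" for v
    using IH[OF env_ok_upd[OF "2.prems"(1) that, of k]] sat_FMul[OF env_ok_upd[OF "2.prems"(1) that, of k], of k "k + 1" b z] "2.prems"
    by simp_all
  then have "sat u (FPow k b (Suc n) z) e \<longleftrightarrow> e b ^ n < length u \<and> e z = e b ^ Suc n" by (auto simp: mult.commute)
  \<comment> \<open>With a positive base the intermediate power does not exceed the value at
    \<open>z\<close>, so it is a position and the bounded quantifier finds it.\<close>
  moreover have "e b ^ n \<le> e b ^ Suc n" using "2.prems"(4) by simp
  ultimately show ?case using env_okD[OF "2.prems"(1), of z] le_less_trans by metis
qed

fun FSum :: "nat \<Rightarrow> nat \<Rightarrow> nat list \<Rightarrow> nat \<Rightarrow> fm" where
  "FSum k b [] z = FZero z"
| "FSum k b (n # ns) z = FEx k (FEx (k + 1) (FAnd (FPow (k + 2) b n k) (FAnd (FSum (k + 2) b ns (k + 1)) (FAdd (k + 2) k (k + 1) z))))"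

lemma wf_FSum [simp]: "fm_wf (FSum k b ns z)"
  by (induction k b ns z rule: FSum.induct) auto

lemma sat_FSum:
  assumes "env_ok u e" "b < k" "z < k" "0 < e b"
  shows "sat u (FSum k b ns z) e \<longleftrightarrow> e z = (\<Sum>n\<leftarrow>ns. e b ^ n)"
  using assms
proof (induction k b ns z arbitrary: e rule: FSum.induct)
  case (2 k b n ns z)
  have IH: "env_ok u e' \<Longrightarrow> 0 < e' b \<Longrightarrow> sat u (FSum (k + 2) b ns (k + 1)) e' \<longleftrightarrow> e' (k + 1) = (\<Sum>n\<leftarrow>ns. e' b ^ n)" for e' :: env
    using "2.IH"[of e'] "2.prems"(2) by simp
  have *: "sat u (FPow (k + 2) b n k) (e(k := v, k + 1 := w)) \<longleftrightarrow> v = e b ^ n"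
    "sat u (FSum (k + 2) b ns (k + 1)) (e(k := v, k + 1 := w)) \<longleftrightarrow> w = (\<Sum>n\<leftarrow>ns. e b ^ n)"
    "sat u (FAdd (k + 2) k (k + 1) z) (e(k := v, k + 1 := w)) \<longleftrightarrow> v + w = e z"
    if "v < length u" "w < length u" for v w
  proof -
    have ok: "env_ok u (e(k := v, k + 1 := w))" using that "2.prems" by (simp add: env_ok_upd)
    show "sat u (FPow (k + 2) b n k) (e(k := v, k + 1 := w)) \<longleftrightarrow> v = e b ^ n"
      using sat_FPow[OF ok, of b "k + 2" k n] "2.prems" by auto
    show "sat u (FSum (k + 2) b ns (k + 1)) (e(k := v, k + 1 := w)) \<longleftrightarrow> w = (\<Sum>n\<leftarrow>ns. e b ^ n)"
      using IH[OF ok] "2.prems" by auto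
    show "sat u (FAdd (k + 2) k (k + 1) z) (e(k := v, k + 1 := w)) \<longleftrightarrow> v + w = e z"
      using sat_FAdd[OF ok, of k "k + 2" "k + 1" z] "2.prems" by auto
  qed
  have "sat u (FSum k b (n # ns) z) e \<longleftrightarrow> (\<exists>v<length u. \<exists>w<length u. v = e b ^ n \<and> w = (\<Sum>n\<leftarrow>ns. e b ^ n) \<and> v + w = e z)"
    using * by (simp cong: conj_cong)
  then show ?case using env_okD[OF "2.prems"(1), of z] by auto
qed simp

fun FNumAcc :: "nat \<Rightarrow> nat \<Rightarrow> nat \<Rightarrow> nat list \<Rightarrow> nat \<Rightarrow> fm" where
  "FNumAcc k b a [] z = FEq a z"
| "FNumAcc k b a (x # xs) z = FEx k (FEx (k + 1) (FAnd (FMul (k + 2) a b k) (FAnd (FAdd (k + 2) k x (k + 1)) (FNumAcc (k + 2) b (k + 1) xs z))))"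

lemma wf_FNumAcc [simp]: "fm_wf (FNumAcc k b a xs z)"
  by (induction k b a xs z rule: FNumAcc.induct) auto

definition horner :: "nat \<Rightarrow> nat \<Rightarrow> nat list \<Rightarrow> nat" where
  "horner b a xs = foldl (\<lambda>a x. a * b + x) a xs"

lemma horner_simps [simp]: "horner b a [] = a" "horner b a (x # xs) = horner b (a * b + x) xs"
  by (simp_all add: horner_def)

text \<open>Each partial Horner value is at most the final one and hence a position whenever the
  result is; \<open>FNumAcc\<close> therefore never runs out of the word.\<close>

lemma horner_ge: "0 < b \<Longrightarrow> a \<le> horner b a xs"
proof (induction xs arbitrary: a)
  case (Cons x xs)
  have "a \<le> a * b + x" using Cons.prems by (simp add: trans_le_add1)
  also have "\<dots> \<le> horner b a (x # xs)" using Cons.IH[OF Cons.prems, of "a * b + x"] by simp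
  finally show ?case .
qed simp

lemma sat_FNumAcc:
  assumes "env_ok u e" "b < k" "a < k" "z < k" "\<forall>x\<in>set xs. x < k" "0 < e b"
  shows "sat u (FNumAcc k b a xs z) e \<longleftrightarrow> e z = horner (e b) (e a) (map e xs)"
  using assms
proof (induction k b a xs z arbitrary: e rule: FNumAcc.induct)
  case (2 k b a x xs z)
  have IH: "env_ok u e' \<Longrightarrow> 0 < e' b \<Longrightarrow> sat u (FNumAcc (k + 2) b (k + 1) xs z) e' \<longleftrightarrow> e' z = horner (e' b) (e' (k + 1)) (map e' xs)" for e' :: env
    using "2.IH"[of e'] "2.prems"(2-5) by (auto simp: less_SucI)
  have *: "sat u (FMul (k + 2) a b k) (e(k := v, k + 1 := w)) \<longleftrightarrow> e a * e b = v"
    "sat u (FAdd (k + 2) k x (k + 1)) (e(k := v, k + 1 := w)) \<longleftrightarrow> v + e x = w"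
    "sat u (FNumAcc (k + 2) b (k + 1) xs z) (e(k := v, k + 1 := w)) \<longleftrightarrow> e z = horner (e b) w (map e xs)"
    if "v < length u" "w < length u" for v w
  proof -
    have ok: "env_ok u (e(k := v, k + 1 := w))" using that "2.prems" by (simp add: env_ok_upd)
    show "sat u (FMul (k + 2) a b k) (e(k := v, k + 1 := w)) \<longleftrightarrow> e a * e b = v"
      using sat_FMul[OF ok, of a "k + 2" b k] "2.prems" by auto
    show "sat u (FAdd (k + 2) k x (k + 1)) (e(k := v, k + 1 := w)) \<longleftrightarrow> v + e x = w"
      using sat_FAdd[OF ok, of k "k + 2" x "k + 1"] "2.prems" by auto
    have "map (e(k := v, k + 1 := w)) xs = map e xs" using "2.prems"(5) by auto
    then show "sat u (FNumAcc (k + 2) b (k + 1) xs z) (e(k := v, k + 1 := w)) \<longleftrightarrow> e z = horner (e b) w (map e xs)"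
      using IH[OF ok] "2.prems" by (auto simp del: map_eq_conv)
  qed
  have "sat u (FNumAcc k b a (x # xs) z) e \<longleftrightarrow>
    (\<exists>v<length u. \<exists>w<length u. e a * e b = v \<and> v + e x = w \<and> e z = horner (e b) w (map e xs))"
    using * by (simp cong: conj_cong)
  also have "\<dots> \<longleftrightarrow> e a * e b + e x < length u \<and> e z = horner (e b) (e a * e b + e x) (map e xs)" by auto
  also have "\<dots> \<longleftrightarrow> e z = horner (e b) (e a) (map e (x # xs))"
    using horner_ge[OF "2.prems"(6), of "e a * e b + e x" "map e xs"] env_okD[OF "2.prems"(1), of z] by auto
  finally show ?case .
qed auto

text \<open>Most significant digit first, which agrees with the order in which \<open>tuples\<close>
  lists its entries.\<close>

definition num :: "nat \<Rightarrow> nat list \<Rightarrow> nat" where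
  "num b xs = horner b 0 xs"

definition FNum :: "nat \<Rightarrow> nat \<Rightarrow> nat list \<Rightarrow> nat \<Rightarrow> fm" where
  "FNum k b xs z = FEx k (FAnd (FZero k) (FNumAcc (k + 1) b k xs z))"

lemma wf_FNum [simp]: "fm_wf (FNum k b xs z)"
  by (simp add: FNum_def)

lemma sat_FNum:
  assumes "env_ok u e" "b < k" "z < k" "\<forall>x\<in>set xs. x < k" "0 < e b"
  shows "sat u (FNum k b xs z) e \<longleftrightarrow> e z = num (e b) (map e xs)"
proof -
  have "env_ok u (e(k := 0))" using assms(1) env_ok_0 by (simp add: env_ok_upd)
  moreover have "map (e(k := 0)) xs = map e xs" using assms(4) by auto
  ultimately have "sat u (FNumAcc (k + 1) b k xs z) (e(k := 0)) \<longleftrightarrow> e z = num (e b) (map e xs)"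
    using sat_FNumAcc[of u "e(k := 0)" b "k + 1" k z xs] assms by (simp add: num_def less_SucI del: map_eq_conv)
  then show ?thesis using env_ok_0[OF assms(1)] by (auto simp: FNum_def)
qed

text \<open>The encoding begins with \<open>n\<close> times True (letter 2) and one False (letter
  1), so the size is the position of the first letter 1. The walk stays on the diagonal because
  reachability concerns pairs.\<close>

definition FSize :: "nat \<Rightarrow> nat \<Rightarrow> fm" where
  "FSize k x = FAnd (FLet x {l. fst l = 1}) (FEx k (FAnd (FZero k)
     (FR (k + 1) k k x x (FAnd (FLet (k + 1) {l. fst l = 2}) (FAnd (FSuc (k + 1) (k + 3)) (FSuc (k + 2) (k + 4)))))))"

lemma wf_FSize [simp]: "fm_wf (FSize k x)"
  by (simp add: FSize_def)

lemma sat_FSize: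
  assumes "env_ok u e" "x < k"
  shows "sat u (FSize k x) e \<longleftrightarrow> fst (u ! e x) = 1 \<and> (\<forall>i<e x. fst (u ! i) = 2)"
proof -
  let ?W = "length u"
  let ?e = "e(k := 0)"
  have ok: "env_ok u ?e" using assms(1) env_ok_0 by (simp add: env_ok_def)
  define R where "R = (\<lambda>c c'. bnd ?W c' \<and> fst (u ! fst c) = 2 \<and> fst c' = Suc (fst c) \<and> snd c' = Suc (snd c))"
  have "sat u (FR (k + 1) k k x x (FAnd (FLet (k + 1) {l. fst l = 2}) (FAnd (FSuc (k + 1) (k + 3)) (FSuc (k + 2) (k + 4))))) ?e
    \<longleftrightarrow> R\<^sup>*\<^sup>* (?e k, ?e k) (?e x, ?e x)"
    unfolding R_def by (rule sat_FR[OF ok]) (use assms in auto)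
  moreover have "R\<^sup>*\<^sup>* (0, 0) (b, b) \<longleftrightarrow> (\<forall>i<b. fst (u ! i) = 2)" if "b < ?W" for b
  proof
    assume "R\<^sup>*\<^sup>* (0, 0) (b, b)"
    moreover have "\<forall>i<fst d. fst (u ! i) = 2" if "R\<^sup>*\<^sup>* (0, 0) d" for d
      using that by induction (auto simp: R_def less_Suc_eq)
    ultimately show "\<forall>i<b. fst (u ! i) = 2" by fastforce
  next
    assume "\<forall>i<b. fst (u ! i) = 2"
    with that show "R\<^sup>*\<^sup>* (0, 0) (b, b)"
    proof (induction b)
      case (Suc b)
      then have "R\<^sup>*\<^sup>* (0, 0) (b, b)" by simp
      moreover have "R (b, b) (Suc b, Suc b)" using Suc.prems by (auto simp: R_def bnd_def)
      ultimately show ?case by (rule rtranclp.rtrancl_into_rtrancl)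
    qed simp
  qed
  ultimately show ?thesis using assms env_okD[OF assms(1)] env_ok_0[OF assms(1)] by (auto simp: FSize_def)
qed

lemma horner_acc: "horner b a xs = a * b ^ length xs + horner b 0 xs"
proof (induction xs arbitrary: a)
  case (Cons x xs)
  show ?case using Cons[of "a * b + x"] Cons[of x] by (simp add: algebra_simps)
qed simp

lemma num_Nil [simp]: "num b [] = 0"
  by (simp add: num_def)

lemma num_Cons [simp]: "num b (x # xs) = x * b ^ length xs + num b xs"
  using horner_acc[of b x xs] by (simp add: num_def)

lemma num_append: "num b (xs @ ys) = num b xs * b ^ length ys + num b ys"
  by (induction xs) (auto simp: algebra_simps power_add)

lemma num_less: "\<forall>x\<in>set xs. x < b \<Longrightarrow> num b xs < b ^ length xs"
proof (induction xs)
  case (Cons x xs)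
  have "x * b ^ length xs + num b xs < (x + 1) * b ^ length xs" using Cons by simp
  also have "\<dots> \<le> b * b ^ length xs" by (rule mult_le_mono1) (use Cons.prems in auto)
  finally show ?case by simp
qed simp

lemma num_inj:
  "length xs = length ys \<Longrightarrow> \<forall>x\<in>set xs. x < b \<Longrightarrow> \<forall>y\<in>set ys. y < b \<Longrightarrow> num b xs = num b ys \<Longrightarrow> xs = ys"
proof (induction xs ys rule: list_induct2)
  case (Cons x xs y ys)
  let ?B = "b ^ length ys"
  have l: "num b xs < ?B" "num b ys < ?B" using num_less[of xs b] num_less[of ys b] Cons by auto
  have e: "x * ?B + num b xs = y * ?B + num b ys" using Cons by simp
  have "x = y"
  proof -
    have d: "(c * m + r) div m = c" if "r < m" for c m r :: nat using that by (cases "m = 0") auto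
    show ?thesis using d[OF l(1), of x] d[OF l(2), of y] e by simp
  qed
  then show ?case using Cons e by simp
qed simp

lemma length_tuples [simp]: "length (tuples n k) = n ^ k"
  by (induction k) (simp_all add: length_concat comp_def sum_list_triv)

lemma nth_concat_uniform:
  "(\<forall>xs\<in>set xss. length xs = m) \<Longrightarrow> i < length xss \<Longrightarrow> j < m \<Longrightarrow> concat xss ! (i * m + j) = xss ! i ! j"
proof (induction xss arbitrary: i)
  case (Cons xs xss)
  then show ?case by (cases i) (auto simp: nth_append algebra_simps)
qed simp

lemma nth_tuples: "\<forall>x\<in>set t. x < n \<Longrightarrow> tuples n (length t) ! num n t = t"
proof (induction t)
  case (Cons x t)
  have "num n t < n ^ length t" using num_less[of t n] Cons.prems by simp
  then have "tuples n (length (x # t)) ! num n (x # t) = map (\<lambda>i. map (Cons i) (tuples n (length t))) [0..<n] ! x ! num n t"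
    using nth_concat_uniform[of "map (\<lambda>i. map (Cons i) (tuples n (length t))) [0..<n]" "n ^ length t" x "num n t"] Cons.prems by simp
  also have "\<dots> = x # t" using Cons num_less[of t n] by simp
  finally show ?case .
qed simp

text \<open>A uniform view of the encoding: the unary size is a relation of arity 1 that always
  holds, the separator one of arity 0 that never holds, and a constant the unary relation of being
  its value. Every bit then has an address made of a block and a tuple.\<close>

datatype block = BTrue | BFalse | BRel nat | BCst nat

primrec block_arity :: "vocab \<Rightarrow> block \<Rightarrow> nat" where
  "block_arity \<sigma> BTrue = 1"
| "block_arity \<sigma> BFalse = 0"
| "block_arity \<sigma> (BRel r) = rel_arity \<sigma> ! r"
| "block_arity \<sigma> (BCst c) = 1"

primrec block_val :: "struc \<Rightarrow> block \<Rightarrow> nat list \<Rightarrow> bool" where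
  "block_val A BTrue t = True"
| "block_val A BFalse t = False"
| "block_val A (BRel r) t = rel A r t"
| "block_val A (BCst c) t = (cst A c = hd t)"

definition blocks :: "vocab \<Rightarrow> block list" where
  "blocks \<sigma> = [BTrue, BFalse] @ map BRel [0..<length (rel_arity \<sigma>)] @ map BCst [0..<nconsts \<sigma>]"

definition offset :: "vocab \<Rightarrow> nat \<Rightarrow> nat \<Rightarrow> nat" where
  "offset \<sigma> n i = (\<Sum>b\<leftarrow>take i (blocks \<sigma>). n ^ block_arity \<sigma> b)"

lemma enc_blocks:
  "enc \<sigma> A = concat (map (\<lambda>b. map (block_val A b) (tuples (univ_size A) (block_arity \<sigma> b))) (blocks \<sigma>))"
proof -
  have t1: "tuples n 1 = map (\<lambda>i. [i]) [0..<n]" for n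
  proof -
    have "concat (map (\<lambda>i. [[i]]) xs) = map (\<lambda>i. [i]) xs" for xs :: "nat list" by (induction xs) auto
    then show ?thesis by simp
  qed
  have "map (block_val A BTrue) (tuples (univ_size A) 1) = replicate (univ_size A) True"
    by (simp only: t1 map_map comp_def block_val.simps map_replicate_const) simp
  moreover have "map (block_val A (BCst c)) (tuples (univ_size A) 1) = map (\<lambda>i. cst A c = i) [0..<univ_size A]" for c
    by (simp only: t1 map_map comp_def block_val.simps list.sel)
  moreover have "block_val A (BRel r) = rel A r" for r by (rule ext) simp
  ultimately show ?thesis by (simp add: enc_def blocks_def Let_def comp_def del: One_nat_def tuples.simps(2))
qed

lemma nth_concat_offset:
  "i < length xss \<Longrightarrow> j < length (xss ! i) \<Longrightarrow>
   (\<Sum>xs\<leftarrow>take i xss. length xs) + j < length (concat xss) \<and> concat xss ! ((\<Sum>xs\<leftarrow>take i xss. length xs) + j) = xss ! i ! j"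
proof (induction xss arbitrary: i)
  case (Cons xs xss)
  then show ?case by (cases i) (auto simp: nth_append)
qed simp

lemma enc_nth:
  assumes "i < length (blocks \<sigma>)" "length t = block_arity \<sigma> (blocks \<sigma> ! i)" "\<forall>x\<in>set t. x < univ_size A"
  shows "offset \<sigma> (univ_size A) i + num (univ_size A) t < length (enc \<sigma> A)"
    and "enc \<sigma> A ! (offset \<sigma> (univ_size A) i + num (univ_size A) t) = block_val A (blocks \<sigma> ! i) t"
proof -
  let ?n = "univ_size A"
  let ?f = "\<lambda>b. map (block_val A b) (tuples ?n (block_arity \<sigma> b))"
  have "num ?n t < ?n ^ length t" using num_less[of t ?n] assms(3) by simp
  then have j: "num ?n t < length (map ?f (blocks \<sigma>) ! i)" using assms(1,2) by simp
  have o: "(\<Sum>xs\<leftarrow>take i (map ?f (blocks \<sigma>)). length xs) = offset \<sigma> ?n i"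
    by (simp add: offset_def take_map comp_def)
  note c = nth_concat_offset[of i "map ?f (blocks \<sigma>)" "num ?n t", unfolded o]
  show "offset \<sigma> ?n i + num ?n t < length (enc \<sigma> A)"
    using c j assms(1) unfolding enc_blocks by simp
  have "enc \<sigma> A ! (offset \<sigma> ?n i + num ?n t) = map ?f (blocks \<sigma>) ! i ! num ?n t"
    using c j assms(1) unfolding enc_blocks by simp
  also have "\<dots> = block_val A (blocks \<sigma> ! i) t"
    using assms(1,2) num_less[of t ?n] nth_tuples[of t ?n] assms(3) by simp
  finally show "enc \<sigma> A ! (offset \<sigma> ?n i + num ?n t) = block_val A (blocks \<sigma> ! i) t" .
qed

definition FBit :: "vocab \<Rightarrow> nat \<Rightarrow> nat \<Rightarrow> nat \<Rightarrow> nat list \<Rightarrow> bool \<Rightarrow> fm" where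
  "FBit \<sigma> k N i ts b = FEx k (FEx (k + 1) (FEx (k + 2)
     (FAnd (FSum (k + 3) N (map (block_arity \<sigma>) (take i (blocks \<sigma>))) k)
     (FAnd (FNum (k + 3) N ts (k + 1)) (FAnd (FAdd (k + 3) k (k + 1) (k + 2)) (FLet (k + 2) {l. fst l = bit_code b}))))))"

lemma wf_FBit [simp]: "fm_wf (FBit \<sigma> k N i ts b)"
  by (simp add: FBit_def)

text \<open>Offset, tuple number and their sum are positions of \<open>u\<close> because the
  addressed bit lies inside the encoding, so the bounded quantifiers find them.\<close>

lemma sat_FBit:
  assumes "env_ok u e" "N < k" "\<forall>x\<in>set ts. x < k" "ext R (enc \<sigma> A) u" "e N = univ_size A" "0 < univ_size A"
    "i < length (blocks \<sigma>)" "length ts = block_arity \<sigma> (blocks \<sigma> ! i)" "\<forall>x\<in>set ts. e x < univ_size A"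
  shows "sat u (FBit \<sigma> k N i ts b) e \<longleftrightarrow> block_val A (blocks \<sigma> ! i) (map e ts) = b"
proof -
  let ?n = "univ_size A"
  have *: "sat u (FSum (k + 3) N (map (block_arity \<sigma>) (take i (blocks \<sigma>))) k) (e(k := x, k + 1 := y, k + 2 := z)) \<longleftrightarrow> x = offset \<sigma> ?n i"
    "sat u (FNum (k + 3) N ts (k + 1)) (e(k := x, k + 1 := y, k + 2 := z)) \<longleftrightarrow> y = num ?n (map e ts)"
    "sat u (FAdd (k + 3) k (k + 1) (k + 2)) (e(k := x, k + 1 := y, k + 2 := z)) \<longleftrightarrow> x + y = z"
    if "x < length u" "y < length u" "z < length u" for x y z
  proof -
    have ok: "env_ok u (e(k := x, k + 1 := y, k + 2 := z))" using that assms by (simp add: env_ok_upd)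
    show "sat u (FSum (k + 3) N (map (block_arity \<sigma>) (take i (blocks \<sigma>))) k) (e(k := x, k + 1 := y, k + 2 := z)) \<longleftrightarrow> x = offset \<sigma> ?n i"
      using sat_FSum[OF ok, of N "k + 3" k] assms by (auto simp: offset_def comp_def)
    have "map (e(k := x, k + 1 := y, k + 2 := z)) ts = map e ts" "\<forall>x\<in>set ts. x < k + 3" using assms(3) by auto
    then show "sat u (FNum (k + 3) N ts (k + 1)) (e(k := x, k + 1 := y, k + 2 := z)) \<longleftrightarrow> y = num ?n (map e ts)"
      using sat_FNum[OF ok, of N "k + 3" "k + 1" ts] assms by (auto simp del: map_eq_conv)
    show "sat u (FAdd (k + 3) k (k + 1) (k + 2)) (e(k := x, k + 1 := y, k + 2 := z)) \<longleftrightarrow> x + y = z"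
      using sat_FAdd[OF ok, of k "k + 3" "k + 1" "k + 2"] by auto
  qed
  let ?p = "offset \<sigma> ?n i + num ?n (map e ts)"
  note en = enc_nth[of i \<sigma> "map e ts" A]
  have p: "?p < length (enc \<sigma> A)" "enc \<sigma> A ! ?p = block_val A (blocks \<sigma> ! i) (map e ts)" using en assms(7-9) by auto
  then have pu: "?p < length u" "fst (u ! ?p) = bit_code (block_val A (blocks \<sigma> ! i) (map e ts))"
    using assms(4) by (auto simp: ext_def)
  have "sat u (FBit \<sigma> k N i ts b) e \<longleftrightarrow> (\<exists>x<length u. \<exists>y<length u. \<exists>z<length u.
     x = offset \<sigma> ?n i \<and> y = num ?n (map e ts) \<and> x + y = z \<and> fst (u ! z) = bit_code b)"
    using * unfolding FBit_def by (simp cong: conj_cong)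
  also have "\<dots> \<longleftrightarrow> fst (u ! ?p) = bit_code b" using pu by auto
  also have "\<dots> \<longleftrightarrow> block_val A (blocks \<sigma> ! i) (map e ts) = b" unfolding pu(2) by (auto simp: bit_code_def)
  finally show ?thesis .
qed

section \<open>Satisfiability of two-literal clauses through the implication graph\<close>

section \<open>Two-literal clauses and the quantifier prefix\<close>

type_synonym 'v lit2 = "bool \<times> 'v"

definition val2 :: "'v set \<Rightarrow> 'v lit2 \<Rightarrow> bool" where
  "val2 G l \<longleftrightarrow> fst l = (snd l \<in> G)"

definition neg2 :: "'v lit2 \<Rightarrow> 'v lit2" where
  "neg2 l = (\<not> fst l, snd l)"

text \<open>The implication graph: every clause contributes its two contrapositive edges.\<close>

definition implies2 :: "('v lit2 \<times> 'v lit2) set \<Rightarrow> 'v lit2 \<Rightarrow> 'v lit2 \<Rightarrow> bool" where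
  "implies2 CL a b \<longleftrightarrow> (neg2 a, b) \<in> CL \<or> (b, neg2 a) \<in> CL"

definition contradictory2 :: "('v lit2 \<times> 'v lit2) set \<Rightarrow> bool" where
  "contradictory2 CL \<longleftrightarrow> (\<exists>v. (implies2 CL)\<^sup>*\<^sup>* (True, v) (False, v) \<and> (implies2 CL)\<^sup>*\<^sup>* (False, v) (True, v))"

lemma neg2_neg2 [simp]: "neg2 (neg2 l) = l"
  by (simp add: neg2_def)

lemma val2_neg2 [simp]: "val2 G (neg2 l) \<longleftrightarrow> \<not> val2 G l"
  by (auto simp: val2_def neg2_def)

lemma implies2_contra: "implies2 CL a b \<Longrightarrow> implies2 CL (neg2 b) (neg2 a)"
  by (auto simp: implies2_def)

lemma implies2_contra_rtrancl: "(implies2 CL)\<^sup>*\<^sup>* a b \<Longrightarrow> (implies2 CL)\<^sup>*\<^sup>* (neg2 b) (neg2 a)"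
  by (induction rule: rtranclp_induct) (auto intro: converse_rtranclp_into_rtranclp implies2_contra)

(* A maximal set of literals that is closed under implication and consistent decides every variable. *)
theorem two_sat: "(\<exists>G. \<forall>(c, d)\<in>CL. val2 G c \<or> val2 G d) \<longleftrightarrow> \<not> contradictory2 CL"
proof
  assume "\<exists>G. \<forall>(c, d)\<in>CL. val2 G c \<or> val2 G d"
  then obtain G where G: "\<forall>(c, d)\<in>CL. val2 G c \<or> val2 G d" by blast
  have step: "val2 G b" if "(implies2 CL)\<^sup>*\<^sup>* a b" "val2 G a" for a b
    using that
  proof induction
    case (step b c)
    then have "(neg2 b, c) \<in> CL \<or> (c, neg2 b) \<in> CL" "val2 G b" by (auto simp: implies2_def)
    then show ?case using G val2_neg2[of G b] by blast
  qed
  show "\<not> contradictory2 CL"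
    using step unfolding contradictory2_def by (metis val2_def fst_conv snd_conv)
next
  assume nc: "\<not> contradictory2 CL"
  let ?r = "implies2 CL"
  define \<A> where "\<A> = {S. (\<forall>a b. a \<in> S \<longrightarrow> ?r a b \<longrightarrow> b \<in> S) \<and> (\<forall>a\<in>S. neg2 a \<notin> S)}"
  have "\<exists>M\<in>\<A>. \<forall>X\<in>\<A>. M \<subseteq> X \<longrightarrow> X = M"
  proof (rule subset_Zorn')
    fix C assume "subset.chain \<A> C"
    then have C: "C \<subseteq> \<A>" "\<And>S T. S \<in> C \<Longrightarrow> T \<in> C \<Longrightarrow> S \<subseteq> T \<or> T \<subseteq> S"
      by (auto simp: subset_chain_def)
    show "\<Union>C \<in> \<A>" unfolding \<A>_def
    proof (intro CollectI conjI allI impI ballI notI)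
      fix a b assume "a \<in> \<Union>C" "?r a b"
      then show "b \<in> \<Union>C" using C(1) unfolding \<A>_def by blast
    next
      fix a assume "a \<in> \<Union>C" "neg2 a \<in> \<Union>C"
      then obtain S T where "S \<in> C" "T \<in> C" "a \<in> S" "neg2 a \<in> T" by auto
      then obtain S where "S \<in> C" "a \<in> S" "neg2 a \<in> S" using C(2) by blast
      then show False using C(1) by (auto simp: \<A>_def)
    qed
  qed
  then obtain M where M: "M \<in> \<A>" "\<And>X. X \<in> \<A> \<Longrightarrow> M \<subseteq> X \<Longrightarrow> X = M" by blast
  have cl: "b \<in> M" if "?r\<^sup>*\<^sup>* a b" "a \<in> M" for a b
    using that by induction (use M(1) in \<open>auto simp: \<A>_def\<close>)
  have con: "neg2 a \<notin> M" if "a \<in> M" for a using M(1) that by (auto simp: \<A>_def)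
  \<comment> \<open>Everything implied by \<open>l\<close> can be added to \<open>M\<close>: by
    contraposition a conflict within the addition makes \<open>l\<close> imply
    \<open>neg2 l\<close>, and a conflict with \<open>M\<close> puts \<open>neg2 l\<close> into
    \<open>M\<close>. Maximality then yields \<open>l \<in> M\<close>.\<close>
  have dec: "l \<in> M \<or> neg2 l \<in> M" if nl: "\<not> ?r\<^sup>*\<^sup>* l (neg2 l)" for l
  proof (rule ccontr)
    assume A: "\<not> (l \<in> M \<or> neg2 l \<in> M)"
    let ?X = "M \<union> {m. ?r\<^sup>*\<^sup>* l m}"
    have 1: "\<not> (?r\<^sup>*\<^sup>* l m \<and> ?r\<^sup>*\<^sup>* l (neg2 m))" for m
      using implies2_contra_rtrancl[of CL l "neg2 m"] nl rtranclp_trans[of ?r l m "neg2 l"] by auto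
    have 2: "\<not> (?r\<^sup>*\<^sup>* l m \<and> neg2 m \<in> M)" for m
      using implies2_contra_rtrancl[of CL l m] cl A by blast
    have "?X \<in> \<A>" unfolding \<A>_def
    proof (intro CollectI conjI allI impI ballI notI)
      fix a b assume "a \<in> ?X" "?r a b"
      then show "b \<in> ?X" using cl[of a b] rtranclp.rtrancl_into_rtrancl[of ?r l a b] by blast
    next
      fix a assume "a \<in> ?X" "neg2 a \<in> ?X"
      then consider "a \<in> M" "neg2 a \<in> M" | "a \<in> M" "?r\<^sup>*\<^sup>* l (neg2 a)" | "?r\<^sup>*\<^sup>* l a" "neg2 a \<in> M" | "?r\<^sup>*\<^sup>* l a" "?r\<^sup>*\<^sup>* l (neg2 a)"
        by auto
      then show False
      proof cases
        case 1 then show ?thesis using con by blast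
      next
        case 2 then show ?thesis using \<open>\<And>m. \<not> (?r\<^sup>*\<^sup>* l m \<and> neg2 m \<in> M)\<close>[of "neg2 a"] by simp
      next
        case 3 then show ?thesis using \<open>\<And>m. \<not> (?r\<^sup>*\<^sup>* l m \<and> neg2 m \<in> M)\<close> by blast
      next
        case 4 then show ?thesis using \<open>\<And>m. \<not> (?r\<^sup>*\<^sup>* l m \<and> ?r\<^sup>*\<^sup>* l (neg2 m))\<close> by blast
      qed
    qed
    then have "?X = M" using M(2) by blast
    then show False using A by blast
  qed
  have total: "l \<in> M \<or> neg2 l \<in> M" for l
  proof (cases "?r\<^sup>*\<^sup>* l (neg2 l)")
    case True
    then have "\<not> ?r\<^sup>*\<^sup>* (neg2 l) l" using nc unfolding contradictory2_def neg2_def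
      by (cases l; cases "fst l") auto
    then show ?thesis using dec[of "neg2 l"] by auto
  qed (rule dec)
  define G where "G = {v. (True, v) \<in> M}"
  have v: "val2 G l \<longleftrightarrow> l \<in> M" for l
    using total[of l] con[of l] con[of "neg2 l"] by (cases l; cases "fst l") (auto simp: val2_def G_def neg2_def)
  have "val2 G c \<or> val2 G d" if "(c, d) \<in> CL" for c d
  proof -
    have "?r (neg2 c) d" using that by (simp add: implies2_def)
    then have "d \<in> M" if "neg2 c \<in> M" using cl[of "neg2 c" d] that by blast
    then show ?thesis using v total by blast
  qed
  then show "\<exists>G. \<forall>(c, d)\<in>CL. val2 G c \<or> val2 G d" by blast
qed

section \<open>Closure under majority and the exchange of quantifiers\<close>

definition maj :: "'a set \<Rightarrow> 'a set \<Rightarrow> 'a set \<Rightarrow> 'a set" where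
  "maj X Y Z = (X \<inter> Y) \<union> (X \<inter> Z) \<union> (Y \<inter> Z)"

lemma maj_same [simp]: "maj X X X = X"
  by (auto simp: maj_def)

(* Baker-Pixley: a family of sets closed under majority is determined by its projections to pairs of points. *)
lemma majority_pairs:
  assumes fin: "finite U" and ne: "U \<noteq> {}" and Y: "Y \<subseteq> U"
    and sub: "\<And>Z. \<Psi> Z \<Longrightarrow> Z \<subseteq> U"
    and maj: "\<And>X Y Z. \<Psi> X \<Longrightarrow> \<Psi> Y \<Longrightarrow> \<Psi> Z \<Longrightarrow> \<Psi> (maj X Y Z)"
    and pairs: "\<And>a b. a \<in> U \<Longrightarrow> b \<in> U \<Longrightarrow> \<exists>Z. \<Psi> Z \<and> (a \<in> Z \<longleftrightarrow> a \<in> Y) \<and> (b \<in> Z \<longleftrightarrow> b \<in> Y)"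
  shows "\<Psi> Y"
proof -
  have main: "\<exists>Z. \<Psi> Z \<and> (\<forall>x\<in>D. x \<in> Z \<longleftrightarrow> x \<in> Y)" if "D \<subseteq> U" for D
    using that
  proof (induction "card D" arbitrary: D rule: less_induct)
    case less
    have finD: "finite D" using less.prems fin by (rule finite_subset)
    show ?case
    \<comment> \<open>By induction there are members of the family that are right on
      \<open>D\<close> except possibly at \<open>a\<close>, at \<open>b\<close> and at
      \<open>c\<close>. At each point of \<open>D\<close> at least two of the three are right, hence
      so is their majority.\<close>
    proof (cases "\<exists>a b c. a \<in> D \<and> b \<in> D \<and> c \<in> D \<and> a \<noteq> b \<and> a \<noteq> c \<and> b \<noteq> c")
      case True
      then obtain a b c where abc: "a \<in> D" "b \<in> D" "c \<in> D" "a \<noteq> b" "a \<noteq> c" "b \<noteq> c" by blast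
      have "\<exists>Z. \<Psi> Z \<and> (\<forall>x\<in>D - {d}. x \<in> Z \<longleftrightarrow> x \<in> Y)" if "d \<in> D" for d
        using less.hyps[of "D - {d}"] less.prems finD that by (meson card_Diff1_less Diff_subset subset_trans)
      then obtain Za Zb Zc where Z: "\<Psi> Za" "\<forall>x\<in>D - {a}. x \<in> Za \<longleftrightarrow> x \<in> Y" "\<Psi> Zb" "\<forall>x\<in>D - {b}. x \<in> Zb \<longleftrightarrow> x \<in> Y"
        "\<Psi> Zc" "\<forall>x\<in>D - {c}. x \<in> Zc \<longleftrightarrow> x \<in> Y" using abc by metis
      have "x \<in> maj Za Zb Zc \<longleftrightarrow> x \<in> Y" if "x \<in> D" for x
        using Z abc that unfolding maj_def by (cases "x = a"; cases "x = b"; cases "x = c") auto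
      then show ?thesis using maj[OF Z(1,3,5)] by blast
    next
      case False
      have "\<exists>a\<in>U. \<exists>b\<in>U. D \<subseteq> {a, b}"
      proof (cases "\<exists>a b. a \<in> D \<and> b \<in> D \<and> a \<noteq> b")
        case True
        then obtain a b where ab: "a \<in> D" "b \<in> D" "a \<noteq> b" by blast
        then have "D \<subseteq> {a, b}" using False by blast
        then show ?thesis using ab less.prems by blast
      next
        case False
        show ?thesis
        proof (cases "D = {}")
          case True then show ?thesis using ne by blast
        next
          case False': False
          then obtain a where "a \<in> D" by blast
          then have "D \<subseteq> {a, a}" "a \<in> U" using False less.prems by blast+
          then show ?thesis by blast
        qed
      qed
      then show ?thesis using pairs by blast
    qed
  qed
  obtain Z where "\<Psi> Z" "\<forall>x\<in>U. x \<in> Z \<longleftrightarrow> x \<in> Y" using main[of U] by auto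
  then show ?thesis using sub[of Z] Y by (metis subset_antisym subset_iff)
qed

definition matrix :: "struc \<Rightarrow> nat \<Rightarrow> clause list \<Rightarrow> nat list set list \<Rightarrow> bool" where
  "matrix A m cls Rs \<longleftrightarrow> (\<forall>v. (\<forall>i<m. v i < univ_size A) \<longrightarrow> (\<forall>cl\<in>set cls. cval A Rs v cl))"

text \<open>The relations seen at the index \<open>z\<close>: quantifier \<open>j\<close> looks up
  its family at \<open>take j z\<close>, the indices belonging to the earlier quantifiers.\<close>

primrec rlist :: "qent list \<Rightarrow> (nat list \<Rightarrow> nat list set) \<Rightarrow> (nat list \<Rightarrow> nat list set) \<Rightarrow> nat list \<Rightarrow> nat list set list" where
  "rlist [] F G z = []"
| "rlist (q # qs) F G z = (if is_QAll q then F [] else G []) #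
     rlist qs (\<lambda>zs. F (hd z # zs)) (\<lambda>zs. G (hd z # zs)) (tl z)"

lemma length_rlist [simp]: "length (rlist qs F G z) = length qs"
  by (induction qs arbitrary: F G z) auto

lemma nth_rlist: "j < length qs \<Longrightarrow> length z = length qs \<Longrightarrow>
    rlist qs F G z ! j = (if is_QAll (qs ! j) then F (take j z) else G (take j z))"
proof (induction qs arbitrary: F G z j)
  case (Cons q qs)
  then obtain z0 z' where "z = z0 # z'" by (cases z) auto
  then show ?case using Cons by (cases j) auto
qed simp

definition fam :: "struc \<Rightarrow> qent list \<Rightarrow> (nat list \<Rightarrow> nat list set) \<Rightarrow> bool" where
  "fam A qs F \<longleftrightarrow> (\<forall>zs. length zs < length qs \<longrightarrow> F zs \<in> rels_over A (qarity (qs ! length zs)))"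

definition idx :: "nat \<Rightarrow> nat \<Rightarrow> nat list \<Rightarrow> bool" where
  "idx B l z \<longleftrightarrow> length z = l \<and> (\<forall>x\<in>set z. x < B)"

(* All universal relations come first; a relation quantified after existential ones becomes a family of relations
   indexed by a number below B for each earlier quantifier. *)
definition flat :: "struc \<Rightarrow> nat \<Rightarrow> clause list \<Rightarrow> nat \<Rightarrow> qent list \<Rightarrow> nat list set list \<Rightarrow> bool" where
  "flat A m cls B qs Rs \<longleftrightarrow> (\<forall>F. fam A qs F \<longrightarrow> (\<exists>G. fam A qs G \<and>
     (\<forall>z. idx B (length qs) z \<longrightarrow> matrix A m cls (Rs @ rlist qs F G z))))"

lemma empty_rels_over: "{} \<in> rels_over A a"
  by (simp add: rels_over_def)

lemma rels_over_maj: "X \<in> rels_over A a \<Longrightarrow> Y \<in> rels_over A a \<Longrightarrow> Z \<in> rels_over A a \<Longrightarrow> maj X Y Z \<in> rels_over A a"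
  by (auto simp: rels_over_def maj_def)

lemma fam_Cons: "fam A (q # qs) F \<longleftrightarrow> F [] \<in> rels_over A (qarity q) \<and> (\<forall>z0. fam A qs (\<lambda>zs. F (z0 # zs)))"
proof
  assume F: "fam A (q # qs) F"
  have "F (z0 # zs) \<in> rels_over A (qarity (qs ! length zs))" if "length zs < length qs" for z0 zs
    using F[unfolded fam_def, rule_format, of "z0 # zs"] that by simp
  then show "F [] \<in> rels_over A (qarity q) \<and> (\<forall>z0. fam A qs (\<lambda>zs. F (z0 # zs)))"
    using F[unfolded fam_def, rule_format, of "[]"] by (simp add: fam_def)
next
  assume F: "F [] \<in> rels_over A (qarity q) \<and> (\<forall>z0. fam A qs (\<lambda>zs. F (z0 # zs)))"
  show "fam A (q # qs) F" unfolding fam_def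
  proof (intro allI impI)
    fix zs :: "nat list" assume "length zs < length (q # qs)"
    then show "F zs \<in> rels_over A (qarity ((q # qs) ! length zs))"
      using F by (cases zs) (auto simp: fam_def)
  qed
qed

lemma idx_Suc: "idx B (Suc l) z \<longleftrightarrow> (\<exists>z0 z'. z = z0 # z' \<and> z0 < B \<and> idx B l z')"
  by (cases z) (auto simp: idx_def)

text \<open>Announcing all universal choices in advance only helps the existential side. The answers
  for different indices \<open>z0\<close> are found separately and glued together.\<close>

lemma qsat_flat: "qsat A m cls qs Rs \<Longrightarrow> flat A m cls B qs Rs"
proof (induction qs arbitrary: Rs)
  case Nil then show ?case by (auto simp: flat_def matrix_def fam_def)
next
  case (Cons q qs)
  have comb: "\<exists>G. fam A (q # qs) G \<and> G [] = Y \<and> (\<forall>z0 z. idx B (length qs) z \<longrightarrow>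
      matrix A m cls (Rs @ [R] @ rlist qs (\<lambda>zs. F (z0 # zs)) (\<lambda>zs. G (z0 # zs)) z))"
    if "qsat A m cls qs (Rs @ [R])" "fam A (q # qs) F" "Y \<in> rels_over A (qarity q)" for R F Y
  proof -
    have "\<exists>G. fam A qs G \<and> (\<forall>z. idx B (length qs) z \<longrightarrow> matrix A m cls (Rs @ [R] @ rlist qs (\<lambda>zs. F (z0 # zs)) G z))" for z0
      using Cons.IH[OF that(1)] that(2) unfolding flat_def fam_Cons by simp
    then obtain GG where GG: "\<And>z0. fam A qs (GG z0)"
      "\<And>z0 z. idx B (length qs) z \<Longrightarrow> matrix A m cls (Rs @ [R] @ rlist qs (\<lambda>zs. F (z0 # zs)) (GG z0) z)" by metis
    define G where "G zs = (case zs of [] \<Rightarrow> Y | z0 # zs' \<Rightarrow> GG z0 zs')" for zs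
    have "(\<lambda>zs. G (z0 # zs)) = GG z0" for z0 by (simp add: G_def)
    then show ?thesis using GG that(3) by (intro exI[of _ G]) (simp add: fam_Cons, simp add: G_def)
  qed
  show ?case
  proof (cases q)
    case (QAll a)
    show ?thesis unfolding flat_def
    proof (intro allI impI)
      fix F assume F: "fam A (q # qs) F"
      then have "F [] \<in> rels_over A a" using QAll by (simp add: fam_Cons)
      then have "qsat A m cls qs (Rs @ [F []])" using Cons.prems QAll by simp
      from comb[OF this F empty_rels_over]
      show "\<exists>G. fam A (q # qs) G \<and> (\<forall>z. idx B (length (q # qs)) z \<longrightarrow> matrix A m cls (Rs @ rlist (q # qs) F G z))"
        using QAll by (auto simp: idx_Suc)
    qed
  next
    case (QEx a)
    then obtain Y where Y: "Y \<in> rels_over A (qarity q)" "qsat A m cls qs (Rs @ [Y])" using Cons.prems by auto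
    show ?thesis unfolding flat_def
    proof (intro allI impI)
      fix F assume F: "fam A (q # qs) F"
      from comb[OF Y(2) F Y(1)]
      show "\<exists>G. fam A (q # qs) G \<and> (\<forall>z. idx B (length (q # qs)) z \<longrightarrow> matrix A m cls (Rs @ rlist (q # qs) F G z))"
        using QEx by (auto simp: idx_Suc)
    qed
  qed
qed

definition clauses_ok :: "vocab \<Rightarrow> qent list \<Rightarrow> nat \<Rightarrow> clause list \<Rightarrow> bool" where
  "clauses_ok \<sigma> qs m cls \<longleftrightarrow> (\<forall>(al, h1, h2) \<in> set cls.
      (\<forall>l\<in>set al. alpha_ok \<sigma> qs m (snd l)) \<and> h_ok \<sigma> qs m (snd h1) \<and> h_ok \<sigma> qs m (snd h2))"

text \<open>If the alpha literals of an instance fail, each of the three assignments satisfies one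
  of the two heads. Two of them satisfy the same head, and so does the majority; with three heads
  per clause this counting would break down.\<close>

lemma matrix_maj:
  assumes ok: "clauses_ok \<sigma> P m cls"
    and eq: "\<And>j. j < length P \<Longrightarrow> is_QAll (P ! j) \<Longrightarrow> R1 ! j = R ! j \<and> R2 ! j = R ! j \<and> R3 ! j = R ! j"
    and mj: "\<And>j. j < length P \<Longrightarrow> \<not> is_QAll (P ! j) \<Longrightarrow> R ! j = maj (R1 ! j) (R2 ! j) (R3 ! j)"
    and m: "matrix A m cls R1" "matrix A m cls R2" "matrix A m cls R3"
  shows "matrix A m cls R"
  unfolding matrix_def
proof (intro allI impI ballI)
  fix v cl assume v: "\<forall>i<m. v i < univ_size A" and cl: "cl \<in> set cls"
  obtain al h1 h2 where c: "cl = (al, h1, h2)" by (cases cl)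
  have o: "\<forall>l\<in>set al. alpha_ok \<sigma> P m (snd l)" "h_ok \<sigma> P m (snd h1)" "h_ok \<sigma> P m (snd h2)"
    using ok cl c by (auto simp: clauses_ok_def)
  have al: "lval A R1 v l = lval A R v l" "lval A R2 v l = lval A R v l" "lval A R3 v l = lval A R v l" if "l \<in> set al" for l
  proof -
    have "alpha_ok \<sigma> P m (snd l)" using o that by blast
    then show "lval A R1 v l = lval A R v l" "lval A R2 v l = lval A R v l" "lval A R3 v l = lval A R v l"
      using eq by (cases "snd l"; auto simp: lval_def)+
  qed
  have h: "lval A R v h \<longleftrightarrow> (lval A R1 v h \<and> lval A R2 v h) \<or> (lval A R1 v h \<and> lval A R3 v h) \<or> (lval A R2 v h \<and> lval A R3 v h)"
    if hk: "h_ok \<sigma> P m (snd h)" for h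
  proof -
    obtain j ts where j: "snd h = SV j ts" using hk by (cases "snd h") auto
    then have "R ! j = maj (R1 ! j) (R2 ! j) (R3 ! j)" using hk mj by auto
    then show ?thesis using j by (auto simp: lval_def maj_def)
  qed
  have "cval A R1 v cl" "cval A R2 v cl" "cval A R3 v cl" using m v cl by (auto simp: matrix_def)
  then show "cval A R v cl" unfolding c cval_def prod.case using al h[OF o(2)] h[OF o(3)] by blast
qed

text \<open>The existential quantifier is the hard case. Against a fixed later family
  \<open>F\<close> the admissible values form a majority-closed set, hence are determined by the
  two-literal clauses on points that they satisfy. There are 4 n^(2a) such clauses, and each index
  below this bound presents a family that enforces one of them.\<close>

lemma flat_qsat:
  assumes ok: "clauses_ok \<sigma> P m cls" and n: "0 < univ_size A" and B: "0 < B"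
    and big: "\<And>a. QEx a \<in> set P \<Longrightarrow> 4 * (univ_size A ^ a)\<^sup>2 \<le> B"
  shows "P = pre @ qs \<Longrightarrow> length Rs = length pre \<Longrightarrow> flat A m cls B qs Rs \<Longrightarrow> qsat A m cls qs Rs"
proof (induction qs arbitrary: pre Rs)
  case Nil
  have "fam A [] (\<lambda>_. {})" "idx B 0 []" by (auto simp: fam_def idx_def)
  then show ?case using Nil(3) unfolding flat_def matrix_def by (auto simp del: cval_def)
next
  case (Cons q qs)
  have pre: "P = (pre @ [q]) @ qs" using Cons.prems by simp
  show ?case
  proof (cases q)
    case (QAll a)
    have "flat A m cls B qs (Rs @ [R])" if R: "R \<in> rels_over A a" for R
      unfolding flat_def
    proof (intro allI impI)
      fix F assume F: "fam A qs F"
      define F' where "F' zs = (case zs of [] \<Rightarrow> R | z0 # zs' \<Rightarrow> F zs')" for zs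
      have F'z: "(\<lambda>zs. F' (z0 # zs)) = F" for z0 by (simp add: F'_def)
      have "fam A (q # qs) F'" using F R QAll by (simp add: fam_Cons F'z) (simp add: F'_def)
      then obtain G where G: "fam A (q # qs) G" "\<And>z. idx B (length (q # qs)) z \<Longrightarrow> matrix A m cls (Rs @ rlist (q # qs) F' G z)"
        using Cons.prems(3) unfolding flat_def by blast
      have "matrix A m cls ((Rs @ [R]) @ rlist qs F (\<lambda>zs. G (0 # zs)) z)" if "idx B (length qs) z" for z
        using G(2)[of "0 # z"] that B QAll by (simp add: idx_Suc F'z) (simp add: F'_def)
      moreover have "fam A qs (\<lambda>zs. G (0 # zs))" using G(1) by (simp add: fam_Cons)
      ultimately show "\<exists>G. fam A qs G \<and> (\<forall>z. idx B (length qs) z \<longrightarrow> matrix A m cls ((Rs @ [R]) @ rlist qs F G z))" by blast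
    qed
    then show ?thesis using Cons.IH[OF pre] Cons.prems(2) QAll by simp
  next
    case (QEx a)
    define U where "U = {t. length t = a \<and> (\<forall>x\<in>set t. x < univ_size A)}"
    have U: "U = {t. set t \<subseteq> {..<univ_size A} \<and> length t = a}" by (auto simp: U_def)
    have finU: "finite U" and cU: "card U = univ_size A ^ a"
      unfolding U by (simp_all add: finite_lists_length_eq card_lists_length_eq)
    have neU: "U \<noteq> {}" using cU n by (metis card.empty less_irrefl zero_less_power)
    have rU: "R \<in> rels_over A a \<longleftrightarrow> R \<subseteq> U" for R by (auto simp: rels_over_def U_def)
    \<comment> \<open>\<open>Y\<close> is admissible against \<open>F\<close>: with this value the
      later existential families can still satisfy the matrix at all indices.\<close>
    define \<Psi> where "\<Psi> F Y \<longleftrightarrow> Y \<subseteq> U \<and> (\<exists>G. fam A qs G \<and> (\<forall>z. idx B (length qs) z \<longrightarrow> matrix A m cls (Rs @ [Y] @ rlist qs F G z)))" for F Y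
    have maj: "\<Psi> F (maj Y1 Y2 Y3)" if "\<Psi> F Y1" "\<Psi> F Y2" "\<Psi> F Y3" for F Y1 Y2 Y3
    proof -
      obtain G1 where G1: "fam A qs G1" "\<And>z. idx B (length qs) z \<Longrightarrow> matrix A m cls (Rs @ [Y1] @ rlist qs F G1 z)"
        using \<open>\<Psi> F Y1\<close> \<Psi>_def by blast
      obtain G2 where G2: "fam A qs G2" "\<And>z. idx B (length qs) z \<Longrightarrow> matrix A m cls (Rs @ [Y2] @ rlist qs F G2 z)"
        using \<open>\<Psi> F Y2\<close> \<Psi>_def by blast
      obtain G3 where G3: "fam A qs G3" "\<And>z. idx B (length qs) z \<Longrightarrow> matrix A m cls (Rs @ [Y3] @ rlist qs F G3 z)"
        using \<open>\<Psi> F Y3\<close> \<Psi>_def by blast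
      define G where "G zs = maj (G1 zs) (G2 zs) (G3 zs)" for zs
      have "matrix A m cls (Rs @ [maj Y1 Y2 Y3] @ rlist qs F G z)" if z: "idx B (length qs) z" for z
      proof (rule matrix_maj[OF ok _ _ G1(2)[OF z] G2(2)[OF z] G3(2)[OF z]])
        fix j assume j: "j < length P" "is_QAll (P ! j)"
        have "j \<noteq> length pre" using j(2) QEx Cons.prems(1) by (auto simp: nth_append)
        then show "(Rs @ [Y1] @ rlist qs F G1 z) ! j = (Rs @ [maj Y1 Y2 Y3] @ rlist qs F G z) ! j \<and>
          (Rs @ [Y2] @ rlist qs F G2 z) ! j = (Rs @ [maj Y1 Y2 Y3] @ rlist qs F G z) ! j \<and>
          (Rs @ [Y3] @ rlist qs F G3 z) ! j = (Rs @ [maj Y1 Y2 Y3] @ rlist qs F G z) ! j"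
          using j z Cons.prems(1,2) by (auto simp: nth_append nth_Cons' nth_rlist idx_def split: if_splits)
      next
        fix j assume j: "j < length P" "\<not> is_QAll (P ! j)"
        then show "(Rs @ [maj Y1 Y2 Y3] @ rlist qs F G z) ! j = maj ((Rs @ [Y1] @ rlist qs F G1 z) ! j)
           ((Rs @ [Y2] @ rlist qs F G2 z) ! j) ((Rs @ [Y3] @ rlist qs F G3 z) ! j)"
          using z Cons.prems(1,2) by (auto simp: nth_append nth_Cons' nth_rlist idx_def G_def split: if_splits)
      qed
      moreover have "fam A qs G" using G1(1) G2(1) G3(1) rels_over_maj unfolding fam_def G_def by blast
      moreover have "maj Y1 Y2 Y3 \<subseteq> U" using that unfolding \<Psi>_def maj_def by blast
      ultimately show ?thesis unfolding \<Psi>_def by blast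
    qed
    define Pairs where "Pairs = ((UNIV :: bool set) \<times> U) \<times> ((UNIV :: bool set) \<times> U)"
    have finP: "finite Pairs" using finU by (simp add: Pairs_def)
    have cP: "card Pairs \<le> B"
      using big[of a] QEx Cons.prems(1) by (simp add: Pairs_def card_cartesian_product cU power2_eq_square)
    obtain h where h: "bij_betw h {0..<card Pairs} Pairs" using ex_bij_betw_nat_finite[OF finP] by blast
    define sat_pair where "sat_pair p Y \<longleftrightarrow> val2 Y (fst p) \<or> val2 Y (snd p)" for p :: "nat list lit2 \<times> nat list lit2" and Y
    \<comment> \<open>For a clause \<open>p\<close> on two points, a family whose admissible values
      all satisfy \<open>p\<close>, provided that there is one; the empty family is only a
      default.\<close>
    define FF where "FF p = (if \<exists>F. fam A qs F \<and> (\<forall>Y. \<Psi> F Y \<longrightarrow> sat_pair p Y)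
       then SOME F. fam A qs F \<and> (\<forall>Y. \<Psi> F Y \<longrightarrow> sat_pair p Y) else (\<lambda>_. {}))" for p
    have FF1: "fam A qs (FF p) \<and> (\<forall>Y. \<Psi> (FF p) Y \<longrightarrow> sat_pair p Y)"
      if "\<exists>F. fam A qs F \<and> (\<forall>Y. \<Psi> F Y \<longrightarrow> sat_pair p Y)" for p
      using someI_ex[OF that] unfolding FF_def if_P[OF that] .
    have FF2: "fam A qs (FF p)" for p
    proof (cases "\<exists>F. fam A qs F \<and> (\<forall>Y. \<Psi> F Y \<longrightarrow> sat_pair p Y)")
      case True then show ?thesis using FF1 by blast
    next
      case False
      then have "FF p = (\<lambda>_. {})" unfolding FF_def by (rule if_not_P)
      then show ?thesis by (simp add: fam_def empty_rels_over)
    qed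
    \<comment> \<open>The index belonging to the present quantifier selects the clause, so a single
      family presents \<open>FF p\<close> for all \<open>p\<close> at once.\<close>
    define F where "F zs = (case zs of [] \<Rightarrow> {} | z0 # zs' \<Rightarrow> FF (h z0) zs')" for zs
    have Fz: "(\<lambda>zs. F (z0 # zs)) = FF (h z0)" for z0 by (simp add: F_def)
    have "fam A (q # qs) F" using FF2 by (simp add: fam_Cons Fz) (simp add: F_def empty_rels_over)
    then obtain G where G: "fam A (q # qs) G" "\<And>z. idx B (length (q # qs)) z \<Longrightarrow> matrix A m cls (Rs @ rlist (q # qs) F G z)"
      using Cons.prems(3) unfolding flat_def by blast
    let ?Y = "G []"
    have Ysub: "?Y \<subseteq> U" using G(1) QEx rU by (simp add: fam_Cons)
    have Yall: "\<Psi> (FF (h z0)) ?Y" if "z0 < B" for z0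
      unfolding \<Psi>_def
    proof (intro conjI exI[of _ "\<lambda>zs. G (z0 # zs)"] allI impI)
      show "fam A qs (\<lambda>zs. G (z0 # zs))" using G(1) by (simp add: fam_Cons)
      fix z assume "idx B (length qs) z"
      then show "matrix A m cls (Rs @ [?Y] @ rlist qs (FF (h z0)) (\<lambda>zs. G (z0 # zs)) z)"
        using G(2)[of "z0 # z"] that QEx by (simp add: idx_Suc Fz)
    qed (rule Ysub)
    have "\<Psi> F' ?Y" if F': "fam A qs F'" for F'
    proof (rule majority_pairs[OF finU neU Ysub])
      show "\<And>Z. \<Psi> F' Z \<Longrightarrow> Z \<subseteq> U" by (simp add: \<Psi>_def)
      show "\<And>X Y Z. \<Psi> F' X \<Longrightarrow> \<Psi> F' Y \<Longrightarrow> \<Psi> F' Z \<Longrightarrow> \<Psi> F' (maj X Y Z)" by (rule maj)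
      fix x y assume xy: "x \<in> U" "y \<in> U"
      show "\<exists>Z. \<Psi> F' Z \<and> (x \<in> Z \<longleftrightarrow> x \<in> ?Y) \<and> (y \<in> Z \<longleftrightarrow> y \<in> ?Y)"
      proof (rule ccontr)
        assume no: "\<not> ?thesis"
        \<comment> \<open>The clause says that a value differs from \<open>?Y\<close> at
          \<open>x\<close> or at \<open>y\<close>. By assumption all values admissible against
          \<open>F'\<close> satisfy it, hence so do all values admissible against
          \<open>FF p\<close>; but \<open>?Y\<close> is one of these.\<close>
        define p where "p = ((x \<notin> ?Y, x), (y \<notin> ?Y, y))"
        have "\<forall>Z. \<Psi> F' Z \<longrightarrow> sat_pair p Z" using no by (auto simp: sat_pair_def p_def val2_def)
        then have s: "\<forall>Z. \<Psi> (FF p) Z \<longrightarrow> sat_pair p Z" using FF1 F' by blast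
        have "p \<in> Pairs" using xy by (simp add: p_def Pairs_def)
        then obtain z0 where "z0 < card Pairs" "h z0 = p" using h by (force simp: bij_betw_def image_iff)
        then have "\<Psi> (FF p) ?Y" using Yall[of z0] cP by auto
        then show False using s by (auto simp: sat_pair_def p_def val2_def)
      qed
    qed
    then have "flat A m cls B qs (Rs @ [?Y])" by (auto simp: flat_def \<Psi>_def)
    then have "qsat A m cls qs (Rs @ [?Y])" using Cons.IH[OF pre] Cons.prems(2) by simp
    then show ?thesis using QEx rU Ysub by auto
  qed
qed

section \<open>Reduction to ground two-literal clauses over numbered points\<close>

definition valid :: "nat \<Rightarrow> nat \<Rightarrow> nat list \<Rightarrow> bool" where
  "valid n l t \<longleftrightarrow> length t = l \<and> (\<forall>x\<in>set t. x < n)"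

(* A family of relations stored as the set of pairs (level, number of index list followed by tuple). *)
definition unpack :: "nat \<Rightarrow> nat \<Rightarrow> qent list \<Rightarrow> (nat \<times> nat) set \<Rightarrow> nat list \<Rightarrow> nat list set" where
  "unpack n B P X zs = {t. valid n (qarity (P ! length zs)) t \<and> (length zs, num B (zs @ t)) \<in> X}"

definition pack :: "nat \<Rightarrow> qent list \<Rightarrow> (nat list \<Rightarrow> nat list set) \<Rightarrow> (nat \<times> nat) set" where
  "pack B P F = {(length zs, num B (zs @ t)) |zs t. length zs < length P \<and> (\<forall>x\<in>set zs. x < B) \<and> t \<in> F zs}"

lemma fam_unpack: "fam A P (unpack (univ_size A) B P X)"
  by (auto simp: fam_def unpack_def rels_over_def valid_def)

text \<open>Numerals of equal length with digits below \<open>B\<close> are unique. The entries of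
  tuples are such digits since the structure has at most \<open>B\<close> elements, and the recorded
  level determines the length.\<close>

lemma unpack_pack:
  assumes "fam A P F" "univ_size A \<le> B" "length zs < length P" "\<forall>x\<in>set zs. x < B"
  shows "unpack (univ_size A) B P (pack B P F) zs = F zs"
proof -
  have F: "\<And>zs t. length zs < length P \<Longrightarrow> t \<in> F zs \<Longrightarrow> valid (univ_size A) (qarity (P ! length zs)) t"
    using assms(1) by (auto simp: fam_def rels_over_def valid_def)
  have "t \<in> F zs" if t: "valid (univ_size A) (qarity (P ! length zs)) t" and pk: "(length zs, num B (zs @ t)) \<in> pack B P F" for t
  proof -
    obtain zs' t' where z: "length zs' = length zs" "num B (zs @ t) = num B (zs' @ t')" "\<forall>x\<in>set zs'. x < B" "t' \<in> F zs'"
      using pk by (auto simp: pack_def)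
    have t': "valid (univ_size A) (qarity (P ! length zs)) t'" using F[of zs' t'] z assms(3) by simp
    have "zs @ t = zs' @ t'"
      by (rule num_inj[OF _ _ _ z(2)]) (use z t t' assms(2,4) in \<open>auto simp: valid_def dest: order_less_le_trans\<close>)
    then show ?thesis using z by auto
  qed
  then show ?thesis using F[of zs] assms(3,4) by (auto simp: unpack_def pack_def)
qed

lemma rlist_cong:
  assumes "\<And>zs. length zs < length P \<Longrightarrow> \<forall>x\<in>set zs. x < B \<Longrightarrow> F zs = F' zs \<and> G zs = G' zs" "idx B (length P) z"
  shows "rlist P F G z = rlist P F' G' z"
proof (rule nth_equalityI)
  fix j assume j: "j < length (rlist P F G z)"
  have "\<forall>x\<in>set (take j z). x < B" using assms(2) by (auto simp: idx_def dest: in_set_takeD)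
  then show "rlist P F G z ! j = rlist P F' G' z ! j"
    using j assms(1)[of "take j z"] assms(2) by (auto simp: nth_rlist idx_def)
qed simp

fun atom_code :: "struc \<Rightarrow> nat \<Rightarrow> (nat \<times> nat) set \<Rightarrow> nat list \<Rightarrow> (nat \<Rightarrow> nat) \<Rightarrow> atom \<Rightarrow> bool" where
  "atom_code A B X z v (Rel r ts) = rel A r (map (tval A v) ts)"
| "atom_code A B X z v (Eq s t) = (tval A v s = tval A v t)"
| "atom_code A B X z v (SV j ts) = ((j, num B (take j z @ map (tval A v) ts)) \<in> X)"

text \<open>The second equation is a default for atoms that \<open>h_ok\<close> rules out.\<close>

fun head_code :: "struc \<Rightarrow> nat \<Rightarrow> nat list \<Rightarrow> (nat \<Rightarrow> nat) \<Rightarrow> lit \<Rightarrow> (nat \<times> nat) lit2" where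
  "head_code A B z v (s, SV j ts) = (s, (j, num B (take j z @ map (tval A v) ts)))"
| "head_code A B z v (s, _) = (s, (0, 0))"

text \<open>What is left of the matrix once \<open>X\<close> fixes the universal families: the
  instances whose alpha literals all fail, as clauses over the points of the existential
  families.\<close>

definition ground :: "struc \<Rightarrow> qent list \<Rightarrow> nat \<Rightarrow> clause list \<Rightarrow> nat \<Rightarrow> (nat \<times> nat) set \<Rightarrow>
    ((nat \<times> nat) lit2 \<times> (nat \<times> nat) lit2) set" where
  "ground A P m cls B X = {(head_code A B z v h1, head_code A B z v h2) |z v al h1 h2.
     idx B (length P) z \<and> (\<forall>i<m. v i < univ_size A) \<and> (al, h1, h2) \<in> set cls \<and>
     (\<forall>l\<in>set al. fst l \<noteq> atom_code A B X z v (snd l))}"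

lemma tval_less: "struc_wf \<sigma> A \<Longrightarrow> trm_ok \<sigma> m t \<Longrightarrow> \<forall>i<m. v i < univ_size A \<Longrightarrow> tval A v t < univ_size A"
  by (cases t) (auto simp: struc_wf_def)

lemma matrix_ground:
  assumes ok: "clauses_ok \<sigma> P m cls" and wf: "struc_wf \<sigma> A" and n: "n = univ_size A"
  shows "(\<forall>z. idx B (length P) z \<longrightarrow> matrix A m cls (rlist P (unpack n B P X) (unpack n B P Y) z)) \<longleftrightarrow>
    (\<forall>(c, d)\<in>ground A P m cls B X. val2 Y c \<or> val2 Y d)"
proof -
  let ?R = "\<lambda>z. rlist P (unpack n B P X) (unpack n B P Y) z"
  have sv: "map (tval A v) ts \<in> ?R z ! j \<longleftrightarrow> (j, num B (take j z @ map (tval A v) ts)) \<in> (if is_QAll (P ! j) then X else Y)"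
    if z: "idx B (length P) z" and v: "\<forall>i<m. v i < univ_size A" and j: "j < length P" "length ts = qarity (P ! j)" "\<forall>t\<in>set ts. trm_ok \<sigma> m t" for z v j ts
  proof -
    have "valid n (qarity (P ! j)) (map (tval A v) ts)" using tval_less[OF wf _ v] j(2,3) n by (auto simp: valid_def)
    moreover have "length (take j z) = j" using z j(1) by (simp add: idx_def)
    ultimately show ?thesis using j z by (auto simp: nth_rlist idx_def unpack_def)
  qed
  have main: "cval A (?R z) v (al, h1, h2) \<longleftrightarrow> (\<exists>l\<in>set al. fst l = atom_code A B X z v (snd l)) \<or>
      val2 Y (head_code A B z v h1) \<or> val2 Y (head_code A B z v h2)"
    if z: "idx B (length P) z" and v: "\<forall>i<m. v i < univ_size A" and c: "(al, h1, h2) \<in> set cls" for z v al h1 h2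
  proof -
    have o: "\<forall>l\<in>set al. alpha_ok \<sigma> P m (snd l)" "h_ok \<sigma> P m (snd h1)" "h_ok \<sigma> P m (snd h2)"
      using ok c by (auto simp: clauses_ok_def)
    have "lval A (?R z) v l \<longleftrightarrow> fst l = atom_code A B X z v (snd l)" if "l \<in> set al" for l
    proof -
      have "alpha_ok \<sigma> P m (snd l)" using o that by blast
      then show ?thesis using sv[OF z v] by (cases "snd l") (auto simp: lval_def)
    qed
    moreover have "lval A (?R z) v h \<longleftrightarrow> val2 Y (head_code A B z v h)" if hk: "h_ok \<sigma> P m (snd h)" for h
    proof -
      obtain s j ts where h: "h = (s, SV j ts)" using hk by (cases h; cases "snd h") auto
      then show ?thesis using hk sv[OF z v, of j ts] by (auto simp: lval_def val2_def)
    qed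
    ultimately show ?thesis using o by (simp add: cval_def)
  qed
  have "(\<forall>z. idx B (length P) z \<longrightarrow> matrix A m cls (?R z)) \<longleftrightarrow>
    (\<forall>z v al h1 h2. idx B (length P) z \<longrightarrow> (\<forall>i<m. v i < univ_size A) \<longrightarrow> (al, h1, h2) \<in> set cls \<longrightarrow> cval A (?R z) v (al, h1, h2))"
    by (auto simp: matrix_def)
  also have "\<dots> \<longleftrightarrow> (\<forall>z v al h1 h2. idx B (length P) z \<longrightarrow> (\<forall>i<m. v i < univ_size A) \<longrightarrow> (al, h1, h2) \<in> set cls \<longrightarrow>
     (\<exists>l\<in>set al. fst l = atom_code A B X z v (snd l)) \<or> val2 Y (head_code A B z v h1) \<or> val2 Y (head_code A B z v h2))"
    by (intro iff_allI imp_cong refl; rule main; assumption)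
  also have "\<dots> \<longleftrightarrow> (\<forall>(c, d)\<in>ground A P m cls B X. val2 Y c \<or> val2 Y d)"
  proof (intro iffI allI impI ballI; (elim exE conjE)?)
    fix c assume L: "\<forall>z v al h1 h2. idx B (length P) z \<longrightarrow> (\<forall>i<m. v i < univ_size A) \<longrightarrow> (al, h1, h2) \<in> set cls \<longrightarrow>
        (\<exists>l\<in>set al. fst l = atom_code A B X z v (snd l)) \<or> val2 Y (head_code A B z v h1) \<or> val2 Y (head_code A B z v h2)"
      and "c \<in> ground A P m cls B X"
    then obtain z v al h1 h2 where c: "c = (head_code A B z v h1, head_code A B z v h2)" "idx B (length P) z" "\<forall>i<m. v i < univ_size A"
      "(al, h1, h2) \<in> set cls" "\<forall>l\<in>set al. fst l \<noteq> atom_code A B X z v (snd l)" unfolding ground_def by blast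
    have "(\<exists>l\<in>set al. fst l = atom_code A B X z v (snd l)) \<or> val2 Y (head_code A B z v h1) \<or> val2 Y (head_code A B z v h2)"
      using L c(2-4) by blast
    with c(5) show "case c of (c, d) \<Rightarrow> val2 Y c \<or> val2 Y d" unfolding c(1) by auto
  next
    fix z v al h1 h2
    assume R: "\<forall>(c, d)\<in>ground A P m cls B X. val2 Y c \<or> val2 Y d"
      and a: "idx B (length P) z" "\<forall>i<m. v i < univ_size A" "(al, h1, h2) \<in> set cls"
    show "(\<exists>l\<in>set al. fst l = atom_code A B X z v (snd l)) \<or> val2 Y (head_code A B z v h1) \<or> val2 Y (head_code A B z v h2)"
    proof (cases "\<forall>l\<in>set al. fst l \<noteq> atom_code A B X z v (snd l)")
      case True
      then have "(head_code A B z v h1, head_code A B z v h2) \<in> ground A P m cls B X" using a unfolding ground_def by blast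
      then show ?thesis using R by blast
    qed blast
  qed
  finally show ?thesis .
qed

text \<open>Packing turns the quantifiers over families into quantifiers over sets of numbered
  points, and \<open>two_sat\<close> eliminates the existential one.\<close>

lemma flat_ground:
  assumes ok: "clauses_ok \<sigma> P m cls" and wf: "struc_wf \<sigma> A" and nB: "univ_size A \<le> B"
  shows "flat A m cls B P [] \<longleftrightarrow> (\<forall>X. \<not> contradictory2 (ground A P m cls B X))"
proof -
  let ?u = "unpack (univ_size A) B P"
  have "flat A m cls B P [] \<longleftrightarrow> (\<forall>X. \<exists>Y. \<forall>z. idx B (length P) z \<longrightarrow> matrix A m cls (rlist P (?u X) (?u Y) z))"
  proof
    assume f: "flat A m cls B P []"
    show "\<forall>X. \<exists>Y. \<forall>z. idx B (length P) z \<longrightarrow> matrix A m cls (rlist P (?u X) (?u Y) z)"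
    proof
      fix X
      obtain G where G: "fam A P G" "\<And>z. idx B (length P) z \<Longrightarrow> matrix A m cls (rlist P (?u X) G z)"
        using f fam_unpack unfolding flat_def by fastforce
      have "rlist P (?u X) (?u (pack B P G)) z = rlist P (?u X) G z" if "idx B (length P) z" for z
        by (rule rlist_cong[OF _ that]) (use unpack_pack[OF G(1) nB] in auto)
      then show "\<exists>Y. \<forall>z. idx B (length P) z \<longrightarrow> matrix A m cls (rlist P (?u X) (?u Y) z)"
        using G(2) by (metis (no_types, lifting))
    qed
  next
    assume f: "\<forall>X. \<exists>Y. \<forall>z. idx B (length P) z \<longrightarrow> matrix A m cls (rlist P (?u X) (?u Y) z)"
    show "flat A m cls B P []" unfolding flat_def
    proof (intro allI impI)
      fix F assume F: "fam A P F"
      obtain Y where Y: "\<And>z. idx B (length P) z \<Longrightarrow> matrix A m cls (rlist P (?u (pack B P F)) (?u Y) z)" using f by blast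
      have "rlist P (?u (pack B P F)) (?u Y) z = rlist P F (?u Y) z" if "idx B (length P) z" for z
        by (rule rlist_cong[OF _ that]) (use unpack_pack[OF F nB] in auto)
      then show "\<exists>G. fam A P G \<and> (\<forall>z. idx B (length P) z \<longrightarrow> matrix A m cls ([] @ rlist P F G z))"
        using Y fam_unpack by (intro exI[of _ "?u Y"]) simp
    qed
  qed
  also have "\<dots> \<longleftrightarrow> (\<forall>X. \<exists>Y. \<forall>(c, d)\<in>ground A P m cls B X. val2 Y c \<or> val2 Y d)"
    using matrix_ground[OF ok wf refl] by simp
  finally show ?thesis using two_sat by blast
qed

lemma clauses_ok_SO_EKROM: "\<phi> \<in> SO_EKROM \<sigma> \<longleftrightarrow> clauses_ok \<sigma> (prefix \<phi>) (nvars \<phi>) (clauses \<phi>)"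
  by (simp add: SO_EKROM_def clauses_ok_def)

text \<open>This holds for every \<open>B\<close> not below the size of the structure, also for one
  too small for the converse. A guessed \<open>B\<close> therefore needs no further
  verification.\<close>

theorem not_models_if_contradictory:
  assumes "\<phi> \<in> SO_EKROM \<sigma>" "struc_wf \<sigma> A" "univ_size A \<le> B"
    and "contradictory2 (ground A (prefix \<phi>) (nvars \<phi>) (clauses \<phi>) B X)"
  shows "\<not> models A \<phi>"
  using assms flat_ground[of \<sigma> "prefix \<phi>" "nvars \<phi>" "clauses \<phi>" A B] qsat_flat
  unfolding clauses_ok_SO_EKROM models_def by blast

theorem contradictory_if_not_models:
  assumes "\<phi> \<in> SO_EKROM \<sigma>" "struc_wf \<sigma> A" "univ_size A \<le> B"
    and "\<And>a. QEx a \<in> set (prefix \<phi>) \<Longrightarrow> 4 * (univ_size A ^ a)\<^sup>2 \<le> B" "\<not> models A \<phi>"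
  shows "\<exists>X. contradictory2 (ground A (prefix \<phi>) (nvars \<phi>) (clauses \<phi>) B X)"
proof -
  have ok: "clauses_ok \<sigma> (prefix \<phi>) (nvars \<phi>) (clauses \<phi>)" using assms(1) by (simp add: clauses_ok_SO_EKROM)
  have n: "0 < univ_size A" using assms(2) by (simp add: struc_wf_def)
  have "\<not> flat A (nvars \<phi>) (clauses \<phi>) B (prefix \<phi>) []"
    using flat_qsat[OF ok n _ assms(4), where pre = "[]" and qs = "prefix \<phi>" and Rs = "[]"] n assms(3,5)
    by (auto simp: models_def)
  then show ?thesis using flat_ground[OF ok assms(2,3)] by blast
qed

section \<open>A formula for the contradictory cycle, and membership in co-NP\<close>

section \<open>Refuting SO-EKROM sentences in NP\<close>

primrec FExs :: "nat \<Rightarrow> nat \<Rightarrow> fm \<Rightarrow> fm" where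
  "FExs k 0 f = f"
| "FExs k (Suc l) f = FEx k (FExs (k + 1) l f)"

primrec upds :: "env \<Rightarrow> nat \<Rightarrow> nat list \<Rightarrow> env" where
  "upds e k [] = e"
| "upds e k (x # xs) = upds (e(k := x)) (k + 1) xs"

lemma upds_apply: "upds e k xs r = (if k \<le> r \<and> r < k + length xs then xs ! (r - k) else e r)"
proof (induction xs arbitrary: e k)
  case (Cons x xs)
  show ?case unfolding upds.simps Cons by (auto simp: nth_Cons')
qed simp

declare upds.simps [simp del]

lemma map_upds: "map (upds e k xs) [k..<k + length xs] = xs"
  by (rule nth_equalityI) (auto simp: upds_apply)

lemma sat_FExs: "sat u (FExs k l f) e \<longleftrightarrow>
    (\<exists>xs. length xs = l \<and> (\<forall>x\<in>set xs. x < length u) \<and> sat u f (upds e k xs))"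
proof (induction l arbitrary: k e)
  case 0 then show ?case by (simp add: upds.simps)
next
  case (Suc l)
  have IH: "sat u (FExs k' l f) e' \<longleftrightarrow> (\<exists>xs. length xs = l \<and> (\<forall>x\<in>set xs. x < length u) \<and> sat u f (upds e' k' xs))" for k' and e' :: env
    by (rule Suc)
  have "sat u (FExs k (Suc l) f) e \<longleftrightarrow> (\<exists>v<length u. \<exists>xs. length xs = l \<and> (\<forall>x\<in>set xs. x < length u) \<and>
      sat u f (upds e k (v # xs)))"
    unfolding FExs.simps sat.simps upds.simps IH ..
  also have "\<dots> \<longleftrightarrow> (\<exists>xs. length xs = Suc l \<and> (\<forall>x\<in>set xs. x < length u) \<and> sat u f (upds e k xs))"
  proof
    assume "\<exists>v<length u. \<exists>xs. length xs = l \<and> (\<forall>x\<in>set xs. x < length u) \<and> sat u f (upds e k (v # xs))"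
    then obtain v xs where "v < length u" "length xs = l" "\<forall>x\<in>set xs. x < length u" "sat u f (upds e k (v # xs))" by blast
    then show "\<exists>xs. length xs = Suc l \<and> (\<forall>x\<in>set xs. x < length u) \<and> sat u f (upds e k xs)"
      by (intro exI[of _ "v # xs"]) simp
  next
    assume "\<exists>xs. length xs = Suc l \<and> (\<forall>x\<in>set xs. x < length u) \<and> sat u f (upds e k xs)"
    then obtain ys where ys: "length ys = Suc l" "\<forall>x\<in>set ys. x < length u" "sat u f (upds e k ys)" by blast
    then obtain v xs where "ys = v # xs" by (cases ys) auto
    then show "\<exists>v<length u. \<exists>xs. length xs = l \<and> (\<forall>x\<in>set xs. x < length u) \<and> sat u f (upds e k (v # xs))"
      using ys by (intro exI[of _ v] conjI exI[of _ xs]) auto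
  qed
  finally show ?case .
qed

lemma wf_FExs [simp]: "fm_wf (FExs k l f) \<longleftrightarrow> fm_wf f"
  by (induction l arbitrary: k) auto

lemma env_ok_upds: "env_ok u e \<Longrightarrow> \<forall>x\<in>set xs. x < length u \<Longrightarrow> env_ok u (upds e k xs)"
  by (auto simp: env_ok_def upds_apply)

text \<open>\<open>vb\<close> is the first of the registers that hold the first-order variables. A
  constant is found as the element below the size whose bit in the block of this constant is True;
  the 2 skips the two blocks that encode the size.\<close>

fun FTerm :: "vocab \<Rightarrow> nat \<Rightarrow> nat \<Rightarrow> trm \<Rightarrow> nat \<Rightarrow> fm" where
  "FTerm \<sigma> k vb (V i) x = FEq x (vb + i)"
| "FTerm \<sigma> k vb (C c) x = FAnd (FLess k x 0) (FBit \<sigma> k 0 (2 + length (rel_arity \<sigma>) + c) [x] True)"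

lemma tval_cong: "trm_ok \<sigma> m t \<Longrightarrow> (\<And>i. i < m \<Longrightarrow> v i = v' i) \<Longrightarrow> tval A v t = tval A v' t"
  by (cases t) auto

lemma map_tval_cong:
  "\<forall>t\<in>set ts. trm_ok \<sigma> m t \<Longrightarrow> (\<And>i. i < m \<Longrightarrow> v i = v' i) \<Longrightarrow> map (tval A v) ts = map (tval A v') ts"
  using tval_cong[of \<sigma> m _ v v' A] by simp

text \<open>The families are looked up on the tape, so the number of a point has to be a position of
  the word.\<close>

fun code_less :: "struc \<Rightarrow> nat \<Rightarrow> nat list \<Rightarrow> (nat \<Rightarrow> nat) \<Rightarrow> nat \<Rightarrow> atom \<Rightarrow> bool" where
  "code_less A B z v W (SV j ts) = (num B (take j z @ map (tval A v) ts) < W)"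
| "code_less A B z v W _ = True"

lemma atom_code_cong:
  assumes "alpha_ok \<sigma> P m a" and v: "\<And>i. i < m \<Longrightarrow> v i = v' i"
  shows "atom_code A B X z v a = atom_code A B X z v' a" "code_less A B z v W a = code_less A B z v' W a"
proof -
  have "atom_code A B X z v a = atom_code A B X z v' a \<and> code_less A B z v W a = code_less A B z v' W a"
  proof (cases a)
    case (Rel r ts)
    then have t: "\<forall>t\<in>set ts. trm_ok \<sigma> m t" using assms(1) by auto
    have "map (tval A v) ts = map (tval A v') ts" by (rule map_tval_cong[OF t v])
    then show ?thesis using Rel by (simp del: map_eq_conv)
  next
    case (Eq s t)
    then have "trm_ok \<sigma> m s" "trm_ok \<sigma> m t" using assms(1) by auto
    then have "tval A v s = tval A v' s" "tval A v t = tval A v' t" by (auto intro: tval_cong[OF _ v])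
    then show ?thesis using Eq by simp
  next
    case (SV j ts)
    then have t: "\<forall>t\<in>set ts. trm_ok \<sigma> m t" using assms(1) by auto
    have "map (tval A v) ts = map (tval A v') ts" by (rule map_tval_cong[OF t v])
    then show ?thesis using SV by (simp del: map_eq_conv)
  qed
  then show "atom_code A B X z v a = atom_code A B X z v' a" "code_less A B z v W a = code_less A B z v' W a" by auto
qed

lemma head_code_cong:
  assumes "h_ok \<sigma> P m (snd h)" and v: "\<And>i. i < m \<Longrightarrow> v i = v' i"
  shows "head_code A B z v h = head_code A B z v' h"
proof -
  obtain s j ts where h: "h = (s, SV j ts)" using assms(1) by (cases h; cases "snd h") auto
  then have t: "\<forall>t\<in>set ts. trm_ok \<sigma> m t" using assms(1) by auto
  have "map (tval A v) ts = map (tval A v') ts" by (rule map_tval_cong[OF t v])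
  then show ?thesis using h by (simp del: map_eq_conv)
qed

definition FVals :: "vocab \<Rightarrow> nat \<Rightarrow> nat \<Rightarrow> trm list \<Rightarrow> fm \<Rightarrow> fm" where
  "FVals \<sigma> k vb ts f = FExs k (length ts)
     (FAnd (FAll (map (\<lambda>i. FTerm \<sigma> (k + length ts) vb (ts ! i) (k + i)) [0..<length ts])) f)"

definition FCode :: "nat \<Rightarrow> nat list \<Rightarrow> nat \<Rightarrow> nat \<Rightarrow> nat \<Rightarrow> fm" where
  "FCode k zs j l x = FNum (k + l) 1 (take j zs @ [k..<k + l]) x"

text \<open>\<open>b\<close> is the wanted truth value. Falsity has a positive form in each case:
  the opposite bit of a block, a strict inequality in one direction or the other, a letter without
  the track.\<close>

fun FAtom :: "vocab \<Rightarrow> nat \<Rightarrow> nat \<Rightarrow> nat list \<Rightarrow> atom \<Rightarrow> bool \<Rightarrow> fm" where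
  "FAtom \<sigma> k vb zs (Rel r ts) b = FVals \<sigma> k vb ts (FBit \<sigma> (k + length ts) 0 (2 + r) [k..<k + length ts] b)"
| "FAtom \<sigma> k vb zs (Eq s t) b = FVals \<sigma> k vb [s, t]
     (if b then FEq k (k + 1) else FOr (FLess (k + 2) k (k + 1)) (FLess (k + 2) (k + 1) k))"
| "FAtom \<sigma> k vb zs (SV j ts) b = FEx k (FVals \<sigma> (k + 1) vb ts
     (FAnd (FCode (k + 1) zs j (length ts) k) (FLet k {l. (j \<in> snd l) = b})))"

text \<open>\<open>b\<close> chooses between the literal and its negation, and
  \<open>of_bool (s = b)\<close> is the resulting sign.\<close>

fun FHead :: "vocab \<Rightarrow> nat \<Rightarrow> nat \<Rightarrow> nat list \<Rightarrow> lit \<Rightarrow> bool \<Rightarrow> nat \<Rightarrow> nat \<Rightarrow> fm" where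
  "FHead \<sigma> k vb zs (s, SV j ts) b c x = FVals \<sigma> k vb ts
     (FAnd (FConst (k + length ts) (2 * j + of_bool (s = b)) c) (FCode k zs j (length ts) x))"
| "FHead \<sigma> k vb zs (s, _) b c x = FFalse"

text \<open>The two disjuncts are the two contrapositive edges of a ground clause.\<close>

definition FClause :: "vocab \<Rightarrow> nat \<Rightarrow> nat \<Rightarrow> nat list \<Rightarrow> clause \<Rightarrow> nat \<Rightarrow> nat \<Rightarrow> nat \<Rightarrow> nat \<Rightarrow> fm" where
  "FClause \<sigma> k vb zs cl c x c' x' = (case cl of (al, h1, h2) \<Rightarrow>
     FAnd (FAll (map (\<lambda>l. FAtom \<sigma> k vb zs (snd l) (\<not> fst l)) al))
      (FOr (FAnd (FHead \<sigma> k vb zs h1 False c x) (FHead \<sigma> k vb zs h2 True c' x'))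
           (FAnd (FHead \<sigma> k vb zs h2 False c x) (FHead \<sigma> k vb zs h1 True c' x'))))"

(* Registers 0 and 1 hold the size of the structure and the bound B on the indices; the edge leads from the pair in
   registers k, k + 1 to the pair in registers k + 2, k + 3. *)
definition FEdge :: "vocab \<Rightarrow> nat \<Rightarrow> nat \<Rightarrow> clause list \<Rightarrow> nat \<Rightarrow> fm" where
  "FEdge \<sigma> q m cls k = FExs (k + 4) q (FExs (k + 4 + q) m
     (FAnd (FAll (map (\<lambda>z. FLess (k + 4 + q + m) z 1) [k + 4..<k + 4 + q]))
     (FAnd (FAll (map (\<lambda>v. FLess (k + 4 + q + m) v 0) [k + 4 + q..<k + 4 + q + m]))
       (FAny (map (\<lambda>cl. FClause \<sigma> (k + 4 + q + m) (k + 4 + q) [k + 4..<k + 4 + q] cl k (k + 1) (k + 2) (k + 3)) cls)))))"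

text \<open>Register 3 holds the number of the point, registers 2 and 4 its level with positive and
  with negative sign; the two reachability tests close the cycle. The bound in register 1 is guessed
  and only compared with the size in register 0.\<close>

definition FCycle :: "vocab \<Rightarrow> nat \<Rightarrow> nat \<Rightarrow> clause list \<Rightarrow> fm" where
  "FCycle \<sigma> q m cls = FEx 0 (FEx 1 (FAnd (FSize 2 0) (FAnd (FOr (FEq 0 1) (FLess 2 0 1))
     (FEx 2 (FEx 3 (FEx 4 (FAny (map (\<lambda>j. FAnd (FConst 5 (2 * j + 1) 2) (FAnd (FConst 5 (2 * j) 4)
        (FAnd (FR 5 2 3 4 3 (FEdge \<sigma> q m cls 5)) (FR 5 4 3 2 3 (FEdge \<sigma> q m cls 5))))) [0..<q]))))))))"

lemma wf_FTerm [simp]: "fm_wf (FTerm \<sigma> k vb t x)"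
  by (cases t) auto

lemma wf_FVals [simp]: "fm_wf (FVals \<sigma> k vb ts f) \<longleftrightarrow> fm_wf f"
  by (auto simp: FVals_def)

lemma wf_FAtom [simp]: "fm_wf (FAtom \<sigma> k vb zs a b)"
  by (cases a) (auto simp: FCode_def)

lemma wf_FHead [simp]: "fm_wf (FHead \<sigma> k vb zs h b c x)"
  by (cases h; cases "snd h") (auto simp: FCode_def FFalse_def)

lemma wf_FCycle: "fm_wf (FCycle \<sigma> q m cls)"
  by (auto simp: FCycle_def FEdge_def FClause_def split: prod.splits)

lemma blocks_nth:
  "r < length (rel_arity \<sigma>) \<Longrightarrow> blocks \<sigma> ! (2 + r) = BRel r"
  "c < nconsts \<sigma> \<Longrightarrow> blocks \<sigma> ! (2 + length (rel_arity \<sigma>) + c) = BCst c"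
  "length (blocks \<sigma>) = 2 + length (rel_arity \<sigma>) + nconsts \<sigma>"
  by (simp_all add: blocks_def nth_append)

text \<open>Packing the sign into the level leaves two numbers per literal, as reachability between
  pairs requires.\<close>

definition lcode :: "(nat \<times> nat) lit2 \<Rightarrow> nat \<times> nat" where
  "lcode l = (2 * fst (snd l) + of_bool (fst l), snd (snd l))"

lemma lcode_inject: "lcode l = lcode l' \<longleftrightarrow> l = l'"
proof
  assume a: "lcode l = lcode l'"
  obtain s j x s' j' x' where l: "l = (s, (j, x))" "l' = (s', (j', x'))" by (metis prod.exhaust)
  have "2 * j + of_bool s = 2 * j' + (of_bool s' :: nat)" "x = x'" using a by (simp_all add: lcode_def l)
  then have "j = j' \<and> s = s'" by (cases s; cases s') (simp_all, presburger+)
  then show "l = l'" using \<open>x = x'\<close> l by simp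
qed simp

locale encoded =
  fixes \<sigma> :: vocab and A :: struc and u :: "letter list" and R :: nat
  assumes wf: "struc_wf \<sigma> A" and ext: "ext R (enc \<sigma> A) u"
begin

abbreviation "n \<equiv> univ_size A"

lemma n_pos: "0 < n"
  using wf by (simp add: struc_wf_def)

text \<open>The guess on the tape, read as the packed universal families.\<close>

definition tracks :: "(nat \<times> nat) set" where
  "tracks = {(j, p). p < length u \<and> j \<in> snd (u ! p)}"

text \<open>Position \<open>n\<close> holds the separator behind the unary size.\<close>

lemma size_less: "n < length u"
proof -
  have "offset \<sigma> n 1 + num n [] < length (enc \<sigma> A)"
    by (rule enc_nth) (auto simp: blocks_def)
  then show ?thesis using ext by (simp add: offset_def blocks_def ext_def)
qed

lemma sat_FTerm:
  assumes "env_ok u e" "e 0 = n" "trm_ok \<sigma> m t" "vb + m \<le> k" "x < k" "0 < k" "\<forall>i<m. e (vb + i) < n"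
  shows "sat u (FTerm \<sigma> k vb t x) e \<longleftrightarrow> e x = tval A (\<lambda>i. e (vb + i)) t"
proof (cases t)
  case (V i) then show ?thesis by simp
next
  case (C c)
  then have c: "c < nconsts \<sigma>" using assms(3) by simp
  have cn: "cst A c < n" using wf c by (auto simp: struc_wf_def)
  let ?i = "2 + length (rel_arity \<sigma>) + c"
  have "sat u (FBit \<sigma> k 0 ?i [x] True) e \<longleftrightarrow> block_val A (blocks \<sigma> ! ?i) (map e [x]) = True" if "e x < n"
    by (rule sat_FBit[OF assms(1) _ _ ext]) (use assms that c n_pos blocks_nth in auto)
  then have "sat u (FTerm \<sigma> k vb t x) e \<longleftrightarrow> e x < n \<and> cst A c = e x"
    using sat_FLess[of u e x k 0] assms C blocks_nth(2)[OF c] by (auto simp del: One_nat_def)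
  then show ?thesis using cn C by auto
qed

lemma sat_FVals:
  assumes "env_ok u e" "e 0 = n" "\<forall>t\<in>set ts. trm_ok \<sigma> m t" "vb + m \<le> k" "0 < k" "\<forall>i<m. e (vb + i) < n"
  shows "sat u (FVals \<sigma> k vb ts f) e \<longleftrightarrow> sat u f (upds e k (map (tval A (\<lambda>i. e (vb + i))) ts))"
proof -
  let ?v = "\<lambda>i. e (vb + i)"
  have "sat u (FAll (map (\<lambda>i. FTerm \<sigma> (k + length ts) vb (ts ! i) (k + i)) [0..<length ts])) (upds e k xs)
      \<longleftrightarrow> xs = map (tval A ?v) ts" if xs: "length xs = length ts" "\<forall>x\<in>set xs. x < length u" for xs
  proof -
    let ?e = "upds e k xs"
    have ok: "env_ok u ?e" using assms(1) xs by (simp add: env_ok_upds)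
    have e0: "?e 0 = n" using assms by (simp add: upds_apply)
    have ev: "?e (vb + i) = e (vb + i)" if "i < m" for i using that assms(4) by (simp add: upds_apply)
    have tv: "tval A (\<lambda>i. ?e (vb + i)) t = tval A ?v t" if "trm_ok \<sigma> m t" for t by (rule tval_cong[OF that]) (rule ev)
    have "sat u (FTerm \<sigma> (k + length ts) vb (ts ! i) (k + i)) ?e \<longleftrightarrow> xs ! i = tval A ?v (ts ! i)" if i: "i < length ts" for i
    proof -
      have t: "trm_ok \<sigma> m (ts ! i)" using i assms(3) by simp
      have "sat u (FTerm \<sigma> (k + length ts) vb (ts ! i) (k + i)) ?e \<longleftrightarrow> ?e (k + i) = tval A (\<lambda>i. ?e (vb + i)) (ts ! i)"
        by (rule sat_FTerm[OF ok e0 t]) (use i assms ev in auto)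
      then show ?thesis unfolding tv[OF t] using i xs by (simp add: upds_apply)
    qed
    then have "sat u (FAll (map (\<lambda>i. FTerm \<sigma> (k + length ts) vb (ts ! i) (k + i)) [0..<length ts])) ?e
        \<longleftrightarrow> (\<forall>i<length ts. xs ! i = tval A ?v (ts ! i))"
      unfolding sat_FAll set_map ball_simps set_upt by (simp add: Ball_def)
    also have "\<dots> \<longleftrightarrow> xs = map (tval A ?v) ts" using xs(1) by (simp add: list_eq_iff_nth_eq)
    finally show ?thesis .
  qed
  then have "sat u (FVals \<sigma> k vb ts f) e \<longleftrightarrow> (\<exists>xs. length xs = length ts \<and> (\<forall>x\<in>set xs. x < length u) \<and>
      xs = map (tval A ?v) ts \<and> sat u f (upds e k xs))"
    unfolding FVals_def sat_FExs sat.simps by (simp cong: conj_cong)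
  moreover have "\<forall>x\<in>set (map (tval A ?v) ts). x < length u"
    using tval_less[OF wf _ assms(6)] assms(3) size_less by fastforce
  ultimately show ?thesis by auto
qed

lemma sat_FCode:
  assumes "env_ok u e" "x < k + length vals" "1 < k" "\<forall>z\<in>set zs. z < k" "\<forall>y\<in>set vals. y < length u" "0 < e 1"
  shows "sat u (FCode k zs j (length vals) x) (upds e k vals) \<longleftrightarrow>
    upds e k vals x = num (e 1) (take j (map e zs) @ vals)"
proof -
  let ?e = "upds e k vals"
  have ok: "env_ok u ?e" using assms by (simp add: env_ok_upds)
  have m: "map ?e (take j zs @ [k..<k + length vals]) = take j (map e zs) @ vals"
  proof -
    have "map ?e (take j zs) = take j (map e zs)" unfolding take_map
      using assms(4) in_set_takeD[of _ j zs] by (intro map_cong refl) (fastforce simp: upds_apply)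
    then show ?thesis using map_upds[of e k vals] by simp
  qed
  have 1: "?e 1 = e 1" using assms(3) by (simp add: upds_apply)
  show ?thesis unfolding FCode_def
    using sat_FNum[OF ok, of 1 "k + length vals" x "take j zs @ [k..<k + length vals]", unfolded m 1] assms
    by (fastforce dest: in_set_takeD)
qed

definition framed :: "env \<Rightarrow> nat \<Rightarrow> nat \<Rightarrow> nat \<Rightarrow> nat list \<Rightarrow> bool" where
  "framed e m vb k zs \<longleftrightarrow> env_ok u e \<and> e 0 = n \<and> 0 < e 1 \<and> vb + m \<le> k \<and> 1 < k \<and> (\<forall>i<m. e (vb + i) < n) \<and> (\<forall>z\<in>set zs. z < k)"

lemma vals_less:
  assumes "framed e m vb k zs" "\<forall>t\<in>set ts. trm_ok \<sigma> m t"
  shows "\<forall>x\<in>set (map (tval A (\<lambda>i. e (vb + i))) ts). x < n" "\<forall>x\<in>set (map (tval A (\<lambda>i. e (vb + i))) ts). x < length u"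
proof -
  have "\<forall>i<m. e (vb + i) < n" using assms(1) by (simp add: framed_def)
  then show "\<forall>x\<in>set (map (tval A (\<lambda>i. e (vb + i))) ts). x < n"
    using tval_less[OF wf, of m _ "\<lambda>i. e (vb + i)"] assms(2) by auto
  then show "\<forall>x\<in>set (map (tval A (\<lambda>i. e (vb + i))) ts). x < length u" using size_less by fastforce
qed

lemma sat_FAtom:
  assumes s: "framed e m vb k zs" and ok: "alpha_ok \<sigma> P m a"
  shows "sat u (FAtom \<sigma> k vb zs a b) e \<longleftrightarrow> atom_code A (e 1) tracks (map e zs) (\<lambda>i. e (vb + i)) a = b \<and>
     code_less A (e 1) (map e zs) (\<lambda>i. e (vb + i)) (length u) a"
proof -
  have S: "env_ok u e" "e 0 = n" "0 < e 1" "vb + m \<le> k" "1 < k" "0 < k" "\<forall>i<m. e (vb + i) < n" "\<forall>z\<in>set zs. z < k"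
    using s by (auto simp: framed_def)
  let ?v = "\<lambda>i. e (vb + i)"
  show ?thesis
  proof (cases a)
    case (Rel r ts)
    then have r: "r < length (rel_arity \<sigma>)" "length ts = rel_arity \<sigma> ! r" "\<forall>t\<in>set ts. trm_ok \<sigma> m t" using ok by auto
    note v = vals_less[OF s r(3)]
    let ?e = "upds e k (map (tval A ?v) ts)"
    have m: "map ?e [k..<k + length ts] = map (tval A ?v) ts" using map_upds[of e k "map (tval A ?v) ts"] by simp
    have "sat u (FBit \<sigma> (k + length ts) 0 (2 + r) [k..<k + length ts] b) ?e \<longleftrightarrow>
       block_val A (blocks \<sigma> ! (2 + r)) (map ?e [k..<k + length ts]) = b"
    proof (rule sat_FBit[OF _ _ _ ext])
      show "\<forall>x\<in>set [k..<k + length ts]. ?e x < n" using v(1) m by (metis (no_types, lifting) image_eqI set_map)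
    qed (use S v r n_pos blocks_nth in \<open>auto simp: env_ok_upds upds_apply\<close>)
    then have "sat u (FBit \<sigma> (k + length ts) 0 (2 + r) [k..<k + length ts] b) ?e \<longleftrightarrow> rel A r (map (tval A ?v) ts) = b"
      unfolding m blocks_nth(1)[OF r(1)] by simp
    then show ?thesis using sat_FVals[OF S(1,2) r(3) S(4,6,7)] Rel by simp
  next
    case (Eq t1 t2)
    then have t: "\<forall>t\<in>set [t1, t2]. trm_ok \<sigma> m t" using ok by auto
    let ?e = "upds e k (map (tval A ?v) [t1, t2])"
    have oke: "env_ok u ?e" using S vals_less[OF s t] by (intro env_ok_upds) auto
    have 1: "?e k = tval A ?v t1" "?e (k + 1) = tval A ?v t2" by (auto simp: upds_apply)
    have 2: "sat u (FLess (k + 2) k (k + 1)) ?e \<longleftrightarrow> ?e k < ?e (k + 1)" "sat u (FLess (k + 2) (k + 1) k) ?e \<longleftrightarrow> ?e (k + 1) < ?e k"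
      by (rule sat_FLess[OF oke]; simp)+
    have "sat u (if b then FEq k (k + 1) else FOr (FLess (k + 2) k (k + 1)) (FLess (k + 2) (k + 1) k)) ?e \<longleftrightarrow>
      (tval A ?v t1 = tval A ?v t2) = b"
      using 2 unfolding 1 by (cases b) (auto simp: 1[simplified])
    then show ?thesis using sat_FVals[OF S(1,2) t S(4,6,7)] Eq by simp
  next
    case (SV j ts)
    then have t: "\<forall>t\<in>set ts. trm_ok \<sigma> m t" using ok by auto
    let ?vals = "map (tval A ?v) ts"
    let ?N = "num (e 1) (take j (map e zs) @ ?vals)"
    have "sat u (FVals \<sigma> (k + 1) vb ts (FAnd (FCode (k + 1) zs j (length ts) k) (FLet k {l. (j \<in> snd l) = b}))) (e(k := p)) \<longleftrightarrow>
       p = ?N \<and> (j \<in> snd (u ! p)) = b" if p: "p < length u" for p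
    proof -
      let ?e = "e(k := p)"
      have ev: "?e (vb + i) = e (vb + i)" if "i < m" for i using that S(4) by simp
      have "tval A (\<lambda>i. ?e (vb + i)) t = tval A ?v t" if "t \<in> set ts" for t
        by (rule tval_cong[OF bspec[OF t that]]) (rule ev)
      then have vv: "map (tval A (\<lambda>i. ?e (vb + i))) ts = ?vals" by simp
      have zz: "map ?e zs = map e zs" using S(8) by auto
      have oke: "env_ok u ?e" using S(1) p by (simp add: env_ok_upd)
      have "sat u (FCode (k + 1) zs j (length ?vals) k) (upds ?e (k + 1) ?vals) \<longleftrightarrow>
         upds ?e (k + 1) ?vals k = num (?e 1) (take j (map ?e zs) @ ?vals)"
        by (rule sat_FCode[OF oke]) (use S vals_less[OF s t] in auto)
      then have c: "sat u (FCode (k + 1) zs j (length ts) k) (upds ?e (k + 1) ?vals) \<longleftrightarrow> p = ?N"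
        using zz S(5) by (simp add: upds_apply)
      have "sat u (FVals \<sigma> (k + 1) vb ts (FAnd (FCode (k + 1) zs j (length ts) k) (FLet k {l. (j \<in> snd l) = b}))) ?e \<longleftrightarrow>
        sat u (FAnd (FCode (k + 1) zs j (length ts) k) (FLet k {l. (j \<in> snd l) = b})) (upds ?e (k + 1) ?vals)"
        unfolding vv[symmetric] by (rule sat_FVals[OF oke _ t]) (use S ev in auto)
      also have "\<dots> \<longleftrightarrow> p = ?N \<and> (j \<in> snd (u ! p)) = b" using c by (simp add: upds_apply)
      finally show ?thesis .
    qed
    then have "sat u (FAtom \<sigma> k vb zs a b) e \<longleftrightarrow> ?N < length u \<and> (j \<in> snd (u ! ?N)) = b"
      unfolding SV FAtom.simps sat.simps(7) by auto
    then show ?thesis unfolding SV by (auto simp: tracks_def)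
  qed
qed

lemma sat_FHead:
  assumes s: "framed e m vb k zs" and ok: "h_ok \<sigma> P m (snd h)" and cx: "c < k" "x < k"
  shows "sat u (FHead \<sigma> k vb zs h b c x) e \<longleftrightarrow> (e c, e x) =
    lcode ((if b then id else neg2) (head_code A (e 1) (map e zs) (\<lambda>i. e (vb + i)) h))"
proof -
  have S: "env_ok u e" "e 0 = n" "0 < e 1" "vb + m \<le> k" "1 < k" "0 < k" "\<forall>i<m. e (vb + i) < n" "\<forall>z\<in>set zs. z < k"
    using s by (auto simp: framed_def)
  let ?v = "\<lambda>i. e (vb + i)"
  obtain sg j ts where h: "h = (sg, SV j ts)" using ok by (cases h; cases "snd h") auto
  then have t: "\<forall>t\<in>set ts. trm_ok \<sigma> m t" using ok by auto
  let ?vals = "map (tval A ?v) ts" let ?e = "upds e k ?vals"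
  have oke: "env_ok u ?e" using S vals_less[OF s t] by (intro env_ok_upds) auto
  have 1: "sat u (FConst (k + length ts) (2 * j + of_bool (sg = b)) c) ?e \<longleftrightarrow> e c = 2 * j + of_bool (sg = b)"
    using sat_FConst[OF oke, of c "k + length ts"] cx by (simp add: upds_apply)
  have 2: "sat u (FCode k zs j (length ts) x) ?e \<longleftrightarrow> e x = num (e 1) (take j (map e zs) @ ?vals)"
    using sat_FCode[of e x k ?vals zs j] S vals_less[OF s t] cx by (simp add: upds_apply)
  show ?thesis unfolding h FHead.simps sat_FVals[OF S(1,2) t S(4,6,7)] sat.simps 1 2
    by (cases b) (auto simp: lcode_def neg2_def)
qed

definition fits :: "nat \<Rightarrow> nat \<Rightarrow> nat \<Rightarrow> clause list \<Rightarrow> bool" where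
  "fits B q m cls \<longleftrightarrow> (\<forall>z v. idx B q z \<longrightarrow> (\<forall>i<m. v i < n) \<longrightarrow> (\<forall>(al, h1, h2)\<in>set cls.
     (\<forall>a \<in> snd ` set al \<union> {snd h1, snd h2}. code_less A B z v (length u) a)))"

lemma ground_iff: "(c, d) \<in> ground A P m cls B X \<longleftrightarrow> (\<exists>z v al h1 h2. c = head_code A B z v h1 \<and> d = head_code A B z v h2 \<and>
     idx B (length P) z \<and> (\<forall>i<m. v i < univ_size A) \<and> (al, h1, h2) \<in> set cls \<and>
     (\<forall>l\<in>set al. fst l \<noteq> atom_code A B X z v (snd l)))"
  by (auto simp: ground_def)

text \<open>A point whose number lies beyond the word makes the formula false, never wrongly true.
  Hence only the second half relies on \<open>fits\<close>.\<close>

lemma sat_FEdge: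
  assumes e: "env_ok u e" "e 0 = n" "0 < e 1" "1 < k" and ok: "clauses_ok \<sigma> P m cls" and q: "q = length P"
  shows "sat u (FEdge \<sigma> q m cls k) e \<Longrightarrow>
      \<exists>a b. (e k, e (k + 1)) = lcode a \<and> (e (k + 2), e (k + 3)) = lcode b \<and> implies2 (ground A P m cls (e 1) tracks) a b"
    and "fits (e 1) q m cls \<Longrightarrow> (e k, e (k + 1)) = lcode a \<Longrightarrow> (e (k + 2), e (k + 3)) = lcode b \<Longrightarrow>
      implies2 (ground A P m cls (e 1) tracks) a b \<Longrightarrow> sat u (FEdge \<sigma> q m cls k) e"
proof -
  let ?k = "k + 4 + q + m" and ?vb = "k + 4 + q" and ?zs = "[k + 4..<k + 4 + q]"
  let ?B = "e 1"
  define ev where "ev z vs = upds (upds e (k + 4) z) (k + 4 + q) vs" for z vs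
  have le: "e r < length u" for r using e(1) by (simp add: env_ok_def)
  have S: "sat u (FEdge \<sigma> q m cls k) e \<longleftrightarrow> (\<exists>z vs. idx ?B q z \<and> length vs = m \<and> (\<forall>x\<in>set vs. x < n) \<and>
     (\<exists>cl\<in>set cls. sat u (FClause \<sigma> ?k ?vb ?zs cl k (k + 1) (k + 2) (k + 3)) (ev z vs)))"
  proof -
    have Z: "sat u (FAll (map (\<lambda>z. FLess ?k z 1) ?zs)) (ev z vs) \<longleftrightarrow> (\<forall>x\<in>set z. x < ?B)"
      "sat u (FAll (map (\<lambda>v. FLess ?k v 0) [k + 4 + q..<k + 4 + q + m])) (ev z vs) \<longleftrightarrow> (\<forall>x\<in>set vs. x < n)"
      if l: "length z = q" "length vs = m" "\<forall>x\<in>set z. x < length u" "\<forall>x\<in>set vs. x < length u" for z vs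
    proof -
      have oke: "env_ok u (ev z vs)" unfolding ev_def using e(1) l by (intro env_ok_upds) auto
      have v01: "ev z vs 1 = ?B" "ev z vs 0 = n" using e by (auto simp: ev_def upds_apply)
      have mz: "map (ev z vs) ?zs = z"
        by (rule nth_equalityI) (use l in \<open>auto simp: ev_def upds_apply\<close>)
      have mv: "map (ev z vs) [k + 4 + q..<k + 4 + q + m] = vs"
        by (rule nth_equalityI) (use l in \<open>auto simp: ev_def upds_apply\<close>)
      have "sat u (FAll (map (\<lambda>z. FLess ?k z 1) ?zs)) (ev z vs) \<longleftrightarrow> (\<forall>y\<in>set ?zs. ev z vs y < ?B)"
        using sat_FLess[OF oke, of _ ?k 1] v01 e(4) by auto
      also have "\<dots> \<longleftrightarrow> (\<forall>x\<in>set (map (ev z vs) ?zs). x < ?B)" by simp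
      finally show "sat u (FAll (map (\<lambda>z. FLess ?k z 1) ?zs)) (ev z vs) \<longleftrightarrow> (\<forall>x\<in>set z. x < ?B)" unfolding mz .
      have "sat u (FAll (map (\<lambda>v. FLess ?k v 0) [k + 4 + q..<k + 4 + q + m])) (ev z vs) \<longleftrightarrow> (\<forall>y\<in>set [k + 4 + q..<k + 4 + q + m]. ev z vs y < n)"
        using sat_FLess[OF oke, of _ ?k 0] v01 e(4) by auto
      also have "\<dots> \<longleftrightarrow> (\<forall>x\<in>set (map (ev z vs) [k + 4 + q..<k + 4 + q + m]). x < n)" by simp
      finally show "sat u (FAll (map (\<lambda>v. FLess ?k v 0) [k + 4 + q..<k + 4 + q + m])) (ev z vs) \<longleftrightarrow> (\<forall>x\<in>set vs. x < n)" unfolding mv .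
    qed
    have "sat u (FEdge \<sigma> q m cls k) e \<longleftrightarrow> (\<exists>z. length z = q \<and> (\<forall>x\<in>set z. x < length u) \<and> (\<exists>vs. length vs = m \<and> (\<forall>x\<in>set vs. x < length u) \<and>
      (\<forall>x\<in>set z. x < ?B) \<and> (\<forall>x\<in>set vs. x < n) \<and>
      (\<exists>cl\<in>set cls. sat u (FClause \<sigma> ?k ?vb ?zs cl k (k + 1) (k + 2) (k + 3)) (ev z vs))))"
      unfolding FEdge_def sat_FExs sat.simps(5) ev_def[symmetric] using Z by (simp cong: conj_cong)
    moreover have "\<forall>x\<in>set z. x < ?B \<Longrightarrow> \<forall>x\<in>set z. x < length u" "\<forall>x\<in>set z. x < n \<Longrightarrow> \<forall>x\<in>set z. x < length u" for z
      using le[of 1] size_less by fastforce+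
    ultimately show ?thesis unfolding idx_def by blast
  qed
  have C: "sat u (FClause \<sigma> ?k ?vb ?zs (al, h1, h2) k (k + 1) (k + 2) (k + 3)) (ev z vs) \<longleftrightarrow>
     (\<forall>l\<in>set al. atom_code A ?B tracks z (\<lambda>i. vs ! i) (snd l) = (\<not> fst l) \<and>
        code_less A ?B z (\<lambda>i. vs ! i) (length u) (snd l)) \<and>
     ((e k, e (k + 1)) = lcode (neg2 (head_code A ?B z (\<lambda>i. vs ! i) h1)) \<and> (e (k + 2), e (k + 3)) = lcode (head_code A ?B z (\<lambda>i. vs ! i) h2) \<or>
      (e k, e (k + 1)) = lcode (neg2 (head_code A ?B z (\<lambda>i. vs ! i) h2)) \<and> (e (k + 2), e (k + 3)) = lcode (head_code A ?B z (\<lambda>i. vs ! i) h1))"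
    if z: "idx ?B q z" and vs: "length vs = m" "\<forall>x\<in>set vs. x < n" and c: "(al, h1, h2) \<in> set cls" for z vs al h1 h2
  proof -
    let ?e = "ev z vs"
    have o: "\<forall>l\<in>set al. alpha_ok \<sigma> P m (snd l)" "h_ok \<sigma> P m (snd h1)" "h_ok \<sigma> P m (snd h2)"
      using ok c by (auto simp: clauses_ok_def)
    have zz: "length z = q" "\<forall>x\<in>set z. x < ?B" using z by (auto simp: idx_def)
    have ev_v: "?e (?vb + i) = vs ! i" if "i < m" for i using that vs by (simp add: ev_def upds_apply)
    have ev_z: "map ?e ?zs = z" by (rule nth_equalityI) (use zz in \<open>auto simp: ev_def upds_apply\<close>)
    have ev_k: "?e r = e r" if "r < k + 4" for r using that by (simp add: ev_def upds_apply)
    have ok': "env_ok u ?e" unfolding ev_def using e(1) zz vs le[of 1] size_less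
      by (intro env_ok_upds) (auto intro: less_trans)
    have st: "framed ?e m ?vb ?k ?zs" unfolding framed_def
      using ok' ev_k[of 0] ev_k[of 1] e ev_v vs by auto
    have at: "sat u (FAtom \<sigma> ?k ?vb ?zs a b) ?e \<longleftrightarrow> atom_code A ?B tracks z (\<lambda>i. vs ! i) a = b \<and>
        code_less A ?B z (\<lambda>i. vs ! i) (length u) a" if al: "alpha_ok \<sigma> P m a" for a b
    proof -
      have e1: "?e 1 = ?B" using ev_k[of 1] by simp
      show ?thesis unfolding sat_FAtom[OF st al] ev_z e1
        using atom_code_cong[OF al, of "\<lambda>i. ?e (?vb + i)" "\<lambda>i. vs ! i"] ev_v by simp
    qed
    have hd: "head_code A (?e 1) (map ?e ?zs) (\<lambda>i. ?e (?vb + i)) h = head_code A ?B z (\<lambda>i. vs ! i) h" if hk: "h_ok \<sigma> P m (snd h)" for h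
      unfolding ev_z using head_code_cong[OF hk, of "\<lambda>i. ?e (?vb + i)" "\<lambda>i. vs ! i"] ev_v ev_k[of 1] by simp
    note H1 = sat_FHead[OF st o(2), unfolded hd[OF o(2)]] and H2 = sat_FHead[OF st o(3), unfolded hd[OF o(3)]]
    show ?thesis unfolding FClause_def prod.case sat.simps sat_FAll
      using at o(1) H1[of k "k+1" False] H1[of "k+2" "k+3" True] H2[of k "k+1" False] H2[of "k+2" "k+3" True]
        ev_k[of k] ev_k[of "k+1"] ev_k[of "k+2"] ev_k[of "k+3"] by simp
  qed
  show "\<exists>a b. (e k, e (k + 1)) = lcode a \<and> (e (k + 2), e (k + 3)) = lcode b \<and> implies2 (ground A P m cls (e 1) tracks) a b"
    if se: "sat u (FEdge \<sigma> q m cls k) e"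
  proof -
    obtain z vs al h1 h2 where 1: "idx ?B q z" "length vs = m" "\<forall>x\<in>set vs. x < n" "(al, h1, h2) \<in> set cls"
      "sat u (FClause \<sigma> ?k ?vb ?zs (al, h1, h2) k (k + 1) (k + 2) (k + 3)) (ev z vs)"
      using se[unfolded S] by (metis prod.exhaust)
    note 2 = C[OF 1(1-4), THEN iffD1, OF 1(5)]
    have "(head_code A ?B z (\<lambda>i. vs ! i) h1, head_code A ?B z (\<lambda>i. vs ! i) h2) \<in> ground A P m cls ?B tracks"
      unfolding ground_iff using 1 2 q by (intro exI[of _ z] exI[of _ "\<lambda>i. vs ! i"] exI[of _ al] exI[of _ h1] exI[of _ h2]) auto
    then have "implies2 (ground A P m cls ?B tracks) (neg2 (head_code A ?B z (\<lambda>i. vs ! i) h1)) (head_code A ?B z (\<lambda>i. vs ! i) h2)"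
      "implies2 (ground A P m cls ?B tracks) (neg2 (head_code A ?B z (\<lambda>i. vs ! i) h2)) (head_code A ?B z (\<lambda>i. vs ! i) h1)"
      by (simp_all add: implies2_def)
    then show ?thesis using 2 by blast
  qed
  show "sat u (FEdge \<sigma> q m cls k) e" if f: "fits (e 1) q m cls" and ab: "(e k, e (k + 1)) = lcode a" "(e (k + 2), e (k + 3)) = lcode b"
    and i: "implies2 (ground A P m cls (e 1) tracks) a b"
  proof -
    obtain z v al h1 h2 where g: "idx ?B q z" "\<forall>i<m. v i < n" "(al, h1, h2) \<in> set cls"
      "\<forall>l\<in>set al. fst l \<noteq> atom_code A ?B tracks z v (snd l)"
      "neg2 a = head_code A ?B z v h1 \<and> b = head_code A ?B z v h2 \<or> b = head_code A ?B z v h1 \<and> neg2 a = head_code A ?B z v h2"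
      using i unfolding implies2_def ground_iff q by blast
    let ?vs = "map v [0..<m]"
    have vv: "length ?vs = m" "\<forall>x\<in>set ?vs. x < n" using g(2) by auto
    have o: "\<forall>l\<in>set al. alpha_ok \<sigma> P m (snd l)" "h_ok \<sigma> P m (snd h1)" "h_ok \<sigma> P m (snd h2)"
      using ok g(3) by (auto simp: clauses_ok_def)
    have vi: "\<And>i. i < m \<Longrightarrow> ?vs ! i = v i" by simp
    have at: "alpha_ok \<sigma> P m a \<Longrightarrow> atom_code A ?B tracks z (\<lambda>i. ?vs ! i) a = atom_code A ?B tracks z v a"
      "alpha_ok \<sigma> P m a \<Longrightarrow> code_less A ?B z (\<lambda>i. ?vs ! i) (length u) a = code_less A ?B z v (length u) a" for a
      by (erule atom_code_cong, rule vi, assumption)+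
    have hd: "h_ok \<sigma> P m (snd h) \<Longrightarrow> head_code A ?B z (\<lambda>i. ?vs ! i) h = head_code A ?B z v h" for h
      by (erule head_code_cong, rule vi)
    have fit: "code_less A ?B z v (length u) (snd l)" if "l \<in> set al" for l
    proof -
      have "case (al, h1, h2) of (al, h1, h2) \<Rightarrow> \<forall>a\<in>snd ` set al \<union> {snd h1, snd h2}. code_less A ?B z v (length u) a"
        using f g(1-3) unfolding fits_def by blast
      then show ?thesis using that by simp
    qed
    have "sat u (FClause \<sigma> ?k ?vb ?zs (al, h1, h2) k (k + 1) (k + 2) (k + 3)) (ev z ?vs)"
      unfolding C[OF g(1) vv g(3)] hd[OF o(2)] hd[OF o(3)]
    proof (intro conjI ballI allI impI)
      fix l assume l: "l \<in> set al"
      then have lo: "alpha_ok \<sigma> P m (snd l)" using o(1) by blast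
      show "atom_code A ?B tracks z (\<lambda>i. ?vs ! i) (snd l) = (\<not> fst l)" using at(1)[OF lo] bspec[OF g(4) l] by blast
      show "code_less A ?B z (\<lambda>i. ?vs ! i) (length u) (snd l)" using at(2)[OF lo] fit[OF l] by blast
    next
      have "a = neg2 (head_code A ?B z v h1) \<and> b = head_code A ?B z v h2 \<or> a = neg2 (head_code A ?B z v h2) \<and> b = head_code A ?B z v h1"
        using g(5) neg2_neg2[of a] by metis
      then show "(e k, e (k + 1)) = lcode (neg2 (head_code A ?B z v h1)) \<and> (e (k + 2), e (k + 3)) = lcode (head_code A ?B z v h2) \<or>
         (e k, e (k + 1)) = lcode (neg2 (head_code A ?B z v h2)) \<and> (e (k + 2), e (k + 3)) = lcode (head_code A ?B z v h1)"
        using ab by auto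
    qed
    then show ?thesis using S g(1,3) vv by blast
  qed
qed

end

context encoded
begin

lemma size_exact: "fst (u ! n) = 1 \<and> (\<forall>i<n. fst (u ! i) = 2)"
proof -
  have e: "fst (u ! i) = bit_code (enc \<sigma> A ! i)" if "i < length (enc \<sigma> A)" for i
    using ext that by (simp add: ext_def)
  have t: "fst (u ! i) = 2" if "i < n" for i
  proof -
    have "offset \<sigma> n 0 + num n [i] < length (enc \<sigma> A)" "enc \<sigma> A ! (offset \<sigma> n 0 + num n [i]) = block_val A (blocks \<sigma> ! 0) [i]"
      by (rule enc_nth; use that in \<open>auto simp: blocks_def\<close>)+
    then show ?thesis using e[of i] by (simp add: offset_def blocks_def bit_code_def)
  qed
  have "offset \<sigma> n 1 + num n [] < length (enc \<sigma> A)" "enc \<sigma> A ! (offset \<sigma> n 1 + num n []) = block_val A (blocks \<sigma> ! 1) []"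
    by (rule enc_nth; auto simp: blocks_def)+
  then have "fst (u ! n) = 1" using e[of n] by (simp add: offset_def blocks_def bit_code_def)
  then show ?thesis using t by blast
qed

lemma size_unique: "fst (u ! x) = 1 \<Longrightarrow> \<forall>i<x. fst (u ! i) = 2 \<Longrightarrow> x = n"
  using size_exact by (metis linorder_neqE_nat num.distinct(1) one_eq_numeral_iff)

definition edge_rel :: "nat \<Rightarrow> nat \<Rightarrow> clause list \<Rightarrow> env \<Rightarrow> nat \<times> nat \<Rightarrow> nat \<times> nat \<Rightarrow> bool" where
  "edge_rel q m cls e c c' \<longleftrightarrow> bnd (length u) c' \<and>
     sat u (FEdge \<sigma> q m cls 5) (e(5 := fst c, 6 := snd c, 7 := fst c', 8 := snd c'))"

lemma sat_FR_edge:
  assumes "env_ok u e" "a1 < 5" "a2 < 5" "b1 < 5" "b2 < 5"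
  shows "sat u (FR 5 a1 a2 b1 b2 (FEdge \<sigma> q m cls 5)) e \<longleftrightarrow> (edge_rel q m cls e)\<^sup>*\<^sup>* (e a1, e a2) (e b1, e b2)"
proof -
  have "sat u (FR 5 a1 a2 b1 b2 (FEdge \<sigma> q m cls 5)) e \<longleftrightarrow>
    (\<lambda>c c'. bnd (length u) c' \<and> sat u (FEdge \<sigma> q m cls 5) (e(5 := fst c, 6 := snd c, 7 := fst c', 8 := snd c')))\<^sup>*\<^sup>* (e a1, e a2) (e b1, e b2)"
    by (rule sat_FR[OF assms]) simp
  then show ?thesis unfolding edge_rel_def[abs_def] .
qed

lemma edge_rel_iff:
  assumes e: "env_ok u e" "e 0 = n" "0 < e 1" and ok: "clauses_ok \<sigma> P m cls" and q: "q = length P"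
    and b: "bnd (length u) c" "bnd (length u) c'"
  shows "edge_rel q m cls e c c' \<Longrightarrow>
      \<exists>a b. c = lcode a \<and> c' = lcode b \<and> implies2 (ground A P m cls (e 1) tracks) a b"
    and "fits (e 1) q m cls \<Longrightarrow> c = lcode x \<Longrightarrow> c' = lcode y \<Longrightarrow>
      implies2 (ground A P m cls (e 1) tracks) x y \<Longrightarrow> edge_rel q m cls e c c'"
proof -
  let ?e = "e(5 := fst c, 6 := snd c, 7 := fst c', 8 := snd c')"
  have oke: "env_ok u ?e" using e(1) b by (auto simp: env_ok_def bnd_def)
  have v: "?e 0 = n" "0 < ?e 1" "?e 1 = e 1" "?e 5 = fst c" "?e (5 + 1) = snd c" "?e (5 + 2) = fst c'" "?e (5 + 3) = snd c'"
    using e by auto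
  have "(1 :: nat) < 5" by simp
  note E = sat_FEdge[OF oke v(1,2) this ok q, unfolded v(3-7) prod.collapse]
  show "\<exists>a b. c = lcode a \<and> c' = lcode b \<and> implies2 (ground A P m cls (e 1) tracks) a b" if "edge_rel q m cls e c c'"
    using E(1) that unfolding edge_rel_def by blast
  show "edge_rel q m cls e c c'" if "fits (e 1) q m cls" "c = lcode x" "c' = lcode y" "implies2 (ground A P m cls (e 1) tracks) x y"
    using E(2)[OF that] b(2) unfolding edge_rel_def by blast
qed

lemma edge_rel_sound:
  assumes e: "env_ok u e" "e 0 = n" "0 < e 1" and ok: "clauses_ok \<sigma> P m cls" and q: "q = length P"
    and r: "(edge_rel q m cls e)\<^sup>*\<^sup>* (lcode a) (lcode b)" and bd: "bnd (length u) (lcode a)"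
  shows "(implies2 (ground A P m cls (e 1) tracks))\<^sup>*\<^sup>* a b"
proof -
  have "bnd (length u) c \<and> (\<exists>b. c = lcode b \<and> (implies2 (ground A P m cls (e 1) tracks))\<^sup>*\<^sup>* a b)"
    if "(edge_rel q m cls e)\<^sup>*\<^sup>* (lcode a) c" for c
    using that
  proof induction
    case base then show ?case using bd by blast
  next
    case (step c c')
    then obtain b where b: "c = lcode b" "(implies2 (ground A P m cls (e 1) tracks))\<^sup>*\<^sup>* a b" "bnd (length u) c" by blast
    have bc: "bnd (length u) c'" using step(2) by (simp add: edge_rel_def)
    obtain x y where "c = lcode x" "c' = lcode y" "implies2 (ground A P m cls (e 1) tracks) x y"
      using edge_rel_iff(1)[OF e ok q b(3) bc step(2)] by blast
    then show ?case using b bc lcode_inject by (metis rtranclp.rtrancl_into_rtrancl)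
  qed
  from this[OF r] show ?thesis using lcode_inject by metis
qed

lemma ground_bnd:
  assumes ok: "clauses_ok \<sigma> P m cls" and f: "fits B (length P) m cls" and W: "2 * length P \<le> length u"
    and g: "(c, d) \<in> ground A P m cls B X" and x: "x \<in> {c, d}"
  shows "fst (snd x) < length P \<and> snd (snd x) < length u"
proof -
  obtain z v al h1 h2 where 1: "c = head_code A B z v h1" "d = head_code A B z v h2" "idx B (length P) z" "\<forall>i<m. v i < n"
    "(al, h1, h2) \<in> set cls" using g unfolding ground_iff by blast
  have "case (al, h1, h2) of (al, h1, h2) \<Rightarrow> \<forall>a\<in>snd ` set al \<union> {snd h1, snd h2}. code_less A B z v (length u) a"
    using f 1(3-5) unfolding fits_def by blast
  then have 2: "code_less A B z v (length u) (snd h1)" "code_less A B z v (length u) (snd h2)" by auto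
  have 3: "h_ok \<sigma> P m (snd h1)" "h_ok \<sigma> P m (snd h2)" using ok 1(5) by (auto simp: clauses_ok_def)
  have "fst (snd (head_code A B z v h)) < length P \<and> snd (snd (head_code A B z v h)) < length u"
    if hk: "h_ok \<sigma> P m (snd h)" "code_less A B z v (length u) (snd h)" for h
  proof -
    obtain s j ts where h: "h = (s, SV j ts)" using hk by (cases h; cases "snd h") auto
    then show ?thesis using hk by auto
  qed
  then have "fst (snd c) < length P \<and> snd (snd c) < length u" "fst (snd d) < length P \<and> snd (snd d) < length u"
    unfolding 1(1,2) using 2 3 by blast+
  then show ?thesis using x by blast
qed

lemma implies2_bnd:
  assumes "clauses_ok \<sigma> P m cls" "fits B (length P) m cls" "2 * length P \<le> length u"
    and i: "implies2 (ground A P m cls B X) a b"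
  shows "fst (snd a) < length P \<and> snd (snd a) < length u" "fst (snd b) < length P \<and> snd (snd b) < length u"
proof -
  have n: "snd (neg2 a) = snd a" by (simp add: neg2_def)
  show "fst (snd a) < length P \<and> snd (snd a) < length u"
    using i ground_bnd[OF assms(1-3), of _ _ X "neg2 a"] unfolding implies2_def n by blast
  show "fst (snd b) < length P \<and> snd (snd b) < length u"
    using i ground_bnd[OF assms(1-3), of _ _ X b] unfolding implies2_def by blast
qed

text \<open>The largest signed level is \<open>2 * (q - 1) + 1\<close>, hence the demand on the
  length of the word.\<close>

lemma bnd_lcode:
  "fst (snd a) < q \<and> snd (snd a) < length u \<Longrightarrow> 2 * q \<le> length u \<Longrightarrow> bnd (length u) (lcode a)"
  by (auto simp: bnd_def lcode_def of_bool_def)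

lemma edge_rel_complete:
  assumes e: "env_ok u e" "e 0 = n" "0 < e 1" and ok: "clauses_ok \<sigma> P m cls" and q: "q = length P"
    and f: "fits (e 1) q m cls" and W: "2 * q \<le> length u"
    and r: "(implies2 (ground A P m cls (e 1) tracks))\<^sup>*\<^sup>* a b"
  shows "(edge_rel q m cls e)\<^sup>*\<^sup>* (lcode a) (lcode b)"
  using r
proof induction
  case (step b c)
  note b = implies2_bnd[OF ok f[unfolded q] W[unfolded q] step(2)]
  have "edge_rel q m cls e (lcode b) (lcode c)"
    by (rule edge_rel_iff(2)[OF e ok q _ _ f refl refl step(2)])
      (use b bnd_lcode[of _ q] W q in auto)
  then show ?case using step by (meson rtranclp.rtrancl_into_rtrancl)
qed simp

lemma FCycle_sound:
  assumes ok: "clauses_ok \<sigma> P m cls" and q: "q = length P" and s: "sat u (FCycle \<sigma> q m cls) (\<lambda>_. 0)"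
  shows "\<exists>B\<ge>n. contradictory2 (ground A P m cls B tracks)"
proof -
  obtain x0 x1 where x: "x0 < length u" "x1 < length u" "sat u (FSize 2 0) ((\<lambda>_. 0)(0 := x0, 1 := x1))"
    "sat u (FOr (FEq 0 1) (FLess 2 0 1)) ((\<lambda>_. 0)(0 := x0, 1 := x1))"
    "sat u (FEx 2 (FEx 3 (FEx 4 (FAny (map (\<lambda>j. FAnd (FConst 5 (2 * j + 1) 2) (FAnd (FConst 5 (2 * j) 4)
        (FAnd (FR 5 2 3 4 3 (FEdge \<sigma> q m cls 5)) (FR 5 4 3 2 3 (FEdge \<sigma> q m cls 5))))) [0..<q]))))) ((\<lambda>_. 0)(0 := x0, 1 := x1))"
    using s unfolding FCycle_def sat.simps(7) sat.simps(5) by blast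
  obtain x2 x3 x4 j where y: "x2 < length u" "x3 < length u" "x4 < length u" "j < q"
    "sat u (FAnd (FConst 5 (2 * j + 1) 2) (FAnd (FConst 5 (2 * j) 4)
        (FAnd (FR 5 2 3 4 3 (FEdge \<sigma> q m cls 5)) (FR 5 4 3 2 3 (FEdge \<sigma> q m cls 5)))))
      ((\<lambda>_. 0)(0 := x0, 1 := x1, 2 := x2, 3 := x3, 4 := x4))"
    using x(5) unfolding sat.simps(7) sat_FAny by auto
  let ?e1 = "(\<lambda>_ :: nat. 0 :: nat)(0 := x0, 1 := x1)"
  let ?e = "(\<lambda>_ :: nat. 0 :: nat)(0 := x0, 1 := x1, 2 := x2, 3 := x3, 4 := x4)"
  have ok1: "env_ok u ?e1" and ok2: "env_ok u ?e" using x(1,2) y(1-3) by (auto simp: env_ok_def)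
  have x0: "x0 = n" using x(3) sat_FSize[OF ok1, of 0 2] size_unique by auto
  have x1: "n \<le> x1" using x(4) sat_FLess[OF ok1, of 0 2 1] x0 by auto
  have c: "x2 = 2 * j + 1" "x4 = 2 * j"
    using y(5) sat_FConst[OF ok2, of 2 5 "2 * j + 1"] sat_FConst[OF ok2, of 4 5 "2 * j"] by (auto simp del: FConst.simps)
  have r: "(edge_rel q m cls ?e)\<^sup>*\<^sup>* (?e 2, ?e 3) (?e 4, ?e 3)" "(edge_rel q m cls ?e)\<^sup>*\<^sup>* (?e 4, ?e 3) (?e 2, ?e 3)"
    using y(5) sat_FR_edge[OF ok2, of 2 3 4 3] sat_FR_edge[OF ok2, of 4 3 2 3] unfolding sat.simps(5) by auto
  have l: "lcode (True, (j, x3)) = (?e 2, ?e 3)" "lcode (False, (j, x3)) = (?e 4, ?e 3)"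
    using c by (auto simp: lcode_def)
  have e: "?e 0 = n" "0 < ?e 1" "?e 1 = x1" using x0 x1 n_pos by auto
  have bd: "bnd (length u) (lcode (True, (j, x3)))" "bnd (length u) (lcode (False, (j, x3)))"
    unfolding l using y(1-3) by (auto simp: bnd_def)
  have "(implies2 (ground A P m cls x1 tracks))\<^sup>*\<^sup>* (True, (j, x3)) (False, (j, x3))"
    "(implies2 (ground A P m cls x1 tracks))\<^sup>*\<^sup>* (False, (j, x3)) (True, (j, x3))"
    using edge_rel_sound[OF ok2 e(1,2) ok q, unfolded e(3)] r bd unfolding l[symmetric] by blast+
  then show ?thesis using x1 unfolding contradictory2_def by blast
qed

lemma FCycle_complete:
  assumes ok: "clauses_ok \<sigma> P m cls" and q: "q = length P" and B: "n \<le> B" "B < length u"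
    and f: "fits B q m cls" and W: "2 * q \<le> length u" and c: "contradictory2 (ground A P m cls B tracks)"
  shows "sat u (FCycle \<sigma> q m cls) (\<lambda>_. 0)"
proof -
  let ?CL = "ground A P m cls B tracks"
  obtain j x where v: "(implies2 ?CL)\<^sup>*\<^sup>* (True, (j, x)) (False, (j, x))" "(implies2 ?CL)\<^sup>*\<^sup>* (False, (j, x)) (True, (j, x))"
    using c unfolding contradictory2_def by auto
  \<comment> \<open>The endpoints differ in sign, so the path has an initial edge, and the clause
    behind this edge bounds the point.\<close>
  obtain b where "implies2 ?CL (True, (j, x)) b" using v(1) by (cases rule: converse_rtranclpE) auto
  from implies2_bnd(1)[OF ok f[unfolded q] W[unfolded q] this] have jx: "j < q" "x < length u" using q by auto
  let ?e1 = "(\<lambda>_ :: nat. 0 :: nat)(0 := n, 1 := B)"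
  let ?e = "(\<lambda>_ :: nat. 0 :: nat)(0 := n, 1 := B, 2 := 2 * j + 1, 3 := x, 4 := 2 * j)"
  have j: "2 * j + 1 < length u" "2 * j < length u" using jx W by auto
  have pos: "0 < length u" using j by linarith
  have ok1: "env_ok u ?e1" and ok2: "env_ok u ?e" using size_less B jx j pos by (auto simp: env_ok_def)
  have e: "?e 0 = n" "0 < ?e 1" "?e 1 = B" using B n_pos by auto
  have l: "lcode (True, (j, x)) = (?e 2, ?e 3)" "lcode (False, (j, x)) = (?e 4, ?e 3)" by (auto simp: lcode_def)
  have f': "fits (?e 1) q m cls" using f by simp
  have C: "(edge_rel q m cls ?e)\<^sup>*\<^sup>* (lcode a) (lcode b)" if "(implies2 ?CL)\<^sup>*\<^sup>* a b" for a b
    by (rule edge_rel_complete[OF ok2 e(1,2) ok q f' W]) (use that in simp)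
  have r: "sat u (FR 5 2 3 4 3 (FEdge \<sigma> q m cls 5)) ?e" "sat u (FR 5 4 3 2 3 (FEdge \<sigma> q m cls 5)) ?e"
    using sat_FR_edge[OF ok2, of 2 3 4 3] sat_FR_edge[OF ok2, of 4 3 2 3] C[OF v(1)] C[OF v(2)] unfolding l by auto
  have k: "sat u (FConst 5 (2 * j + 1) 2) ?e" "sat u (FConst 5 (2 * j) 4) ?e"
    using sat_FConst[OF ok2, of 2 5 "2 * j + 1"] sat_FConst[OF ok2, of 4 5 "2 * j"] by (auto simp del: FConst.simps)
  have "sat u (FAny (map (\<lambda>j. FAnd (FConst 5 (2 * j + 1) 2) (FAnd (FConst 5 (2 * j) 4)
        (FAnd (FR 5 2 3 4 3 (FEdge \<sigma> q m cls 5)) (FR 5 4 3 2 3 (FEdge \<sigma> q m cls 5))))) [0..<q])) ?e"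
    unfolding sat_FAny set_map bex_simps using r k jx(1) by (intro bexI[of _ j]) auto
  then have 1: "sat u (FEx 2 (FEx 3 (FEx 4 (FAny (map (\<lambda>j. FAnd (FConst 5 (2 * j + 1) 2) (FAnd (FConst 5 (2 * j) 4)
        (FAnd (FR 5 2 3 4 3 (FEdge \<sigma> q m cls 5)) (FR 5 4 3 2 3 (FEdge \<sigma> q m cls 5))))) [0..<q]))))) ?e1"
    unfolding sat.simps(7) using j jx(2) by (intro exI[of _ "2 * j + 1"] exI[of _ x] exI[of _ "2 * j"] conjI)
  have 2: "sat u (FSize 2 0) ?e1" using sat_FSize[OF ok1, of 0 2] size_exact by simp
  have 3: "sat u (FOr (FEq 0 1) (FLess 2 0 1)) ?e1" using sat_FLess[OF ok1, of 0 2 1] B by auto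
  have "sat u (FAnd (FSize 2 0) (FAnd (FOr (FEq 0 1) (FLess 2 0 1)) (FEx 2 (FEx 3 (FEx 4 (FAny (map (\<lambda>j.
      FAnd (FConst 5 (2 * j + 1) 2) (FAnd (FConst 5 (2 * j) 4)
        (FAnd (FR 5 2 3 4 3 (FEdge \<sigma> q m cls 5)) (FR 5 4 3 2 3 (FEdge \<sigma> q m cls 5))))) [0..<q]))))))) ?e1"
    unfolding sat.simps(5) by (intro conjI 1 2 3)
  then show ?thesis unfolding FCycle_def sat.simps(7)[of u 0] sat.simps(7)[of u 1]
    by (intro exI[of _ n] exI[of _ B] conjI size_less B(2))
qed

end

lemma contradictory2_mono: "contradictory2 CL \<Longrightarrow> CL \<subseteq> CL' \<Longrightarrow> contradictory2 CL'"
proof -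
  assume A: "contradictory2 CL" "CL \<subseteq> CL'"
  have "implies2 CL \<le> implies2 CL'" using A(2) by (auto simp: implies2_def)
  then have "(implies2 CL)\<^sup>*\<^sup>* \<le> (implies2 CL')\<^sup>*\<^sup>*" by (rule rtranclp_mono)
  then show ?thesis using A(1) unfolding contradictory2_def by blast
qed

theorem SO_EKROM_coNP:
  assumes "\<phi> \<in> SO_EKROM \<sigma>"
  shows "coNP_on \<sigma> (ordered_strucs \<sigma>) {A. models A \<phi>}"
proof -
  define P where "P = prefix \<phi>"
  define m where "m = nvars \<phi>"
  define cls where "cls = clauses \<phi>"
  define q where "q = length P"
  define a where "a = (\<Sum>x\<leftarrow>P. qarity x)"
  \<comment> \<open>A point is numbered by at most \<open>q\<close> indices followed by at most
    \<open>a\<close> entries, so all numbers are below \<open>B ^ k\<close>. The extra 1 gives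
    \<open>B \<le> B ^ k\<close> even if \<open>q + a\<close> is 0.\<close>
  define k where "k = q + a + 1"
  have ok: "clauses_ok \<sigma> P m cls" using assms by (simp add: clauses_ok_SO_EKROM P_def m_def cls_def)
  have ar: "qarity (P ! j) \<le> a" if "j < q" for j
    unfolding a_def by (rule elem_le_sum_list[of j "map qarity P", simplified]) (use that in \<open>simp add: q_def\<close>)
  obtain k0 where "fm_ok k0 (FCycle \<sigma> q m cls)" using fm_wf_ok[OF wf_FCycle] by blast
  from fm_ntm[OF this, of q] obtain M c d where M: "finite (delta M)"
    "\<And>w t. w \<noteq> [] \<Longrightarrow> accepts_within M w t \<Longrightarrow> \<exists>u. ext q w u \<and> sat u (FCycle \<sigma> q m cls) (\<lambda>_. 0)"
    "\<And>w u. w \<noteq> [] \<Longrightarrow> ext q w u \<Longrightarrow> sat u (FCycle \<sigma> q m cls) (\<lambda>_. 0) \<Longrightarrow> accepts_within M w (c * (length u + 1) ^ d)"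
    by metis
  \<comment> \<open>With \<open>B\<close> chosen below as \<open>4 * n ^ (2 * a + 1)\<close>, the
    power \<open>B ^ k\<close> is \<open>4 ^ k * n ^ D\<close>; \<open>c1\<close> collects the
    coefficients of the tape length.\<close>
  define D where "D = (2 * a + 1) * k"
  define c1 where "c1 = 4 ^ k + 2 * q + 4"
  define L where "L = {w. \<not> accepts_within M w (c * c1 ^ d * (length w + 1) ^ (D * d))}"
  have "- L \<in> NP" unfolding NP_def L_def using M(1) by auto
  then have "L \<in> coNP" by (simp add: coNP_def)
  moreover have "A \<in> {A. models A \<phi>} \<longleftrightarrow> enc \<sigma> A \<in> L" if A: "A \<in> ordered_strucs \<sigma>" for A
  proof -
    let ?w = "enc \<sigma> A" let ?n = "univ_size A"
    have wf: "struc_wf \<sigma> A" using A by (simp add: ordered_strucs_def ordered_struc_def)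
    have n: "0 < ?n" using wf by (simp add: struc_wf_def)
    have "offset \<sigma> ?n 1 + num ?n [] < length ?w" by (rule enc_nth) (auto simp: blocks_def)
    then have nw: "?n < length ?w" by (simp add: offset_def blocks_def)
    then have w: "?w \<noteq> []" by auto
    have "\<not> models A \<phi>" if "accepts_within M ?w t" for t
    proof -
      obtain u where u: "ext q ?w u" "sat u (FCycle \<sigma> q m cls) (\<lambda>_. 0)" using M(2)[OF w \<open>accepts_within M ?w t\<close>] by blast
      interpret encoded \<sigma> A u q by standard (use wf u in auto)
      obtain B where "?n \<le> B" "contradictory2 (ground A P m cls B tracks)" using FCycle_sound[OF ok q_def u(2)] by blast
      then show ?thesis using not_models_if_contradictory[OF assms wf] unfolding P_def m_def cls_def by blast
    qed
    moreover have "accepts_within M ?w (c * c1 ^ d * (length ?w + 1) ^ (D * d))" if nm: "\<not> models A \<phi>"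
    proof -
      \<comment> \<open>Every arity is at most \<open>a\<close>, so this exceeds the number of
        two-literal clauses for each existential relation; the additional factor \<open>n\<close>
        ensures \<open>n \<le> B\<close>.\<close>
      define B where "B = 4 * ?n ^ (2 * a + 1)"
      have B0: "0 < B" using n by (simp add: B_def)
      have "?n ^ 1 \<le> ?n ^ (2 * a + 1)" by (rule power_increasing) (use n in auto)
      then have nB: "?n \<le> B" by (simp add: B_def)
      have "4 * (?n ^ b)\<^sup>2 \<le> B" if QEx: "QEx b \<in> set P" for b
      proof -
        obtain j where "j < q" "P ! j = QEx b" using QEx by (auto simp: in_set_conv_nth q_def)
        then have "b \<le> a" using ar[of j] by simp
        then have "?n ^ (2 * b) \<le> ?n ^ (2 * a + 1)" by (intro power_increasing) (use n in auto)
        then show ?thesis by (simp add: B_def power_even_eq)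
      qed
      then obtain X where X: "contradictory2 (ground A P m cls B X)"
        using contradictory_if_not_models[OF assms wf nB _ nm] unfolding P_def m_def cls_def by blast
      \<comment> \<open>Room for the input, for the numbers of all points, for \<open>B\<close>
        itself and for the signed levels.\<close>
      define W where "W = length ?w + B ^ k + 2 * q + 2"
      define u where "u = map (\<lambda>p. (if p < length ?w then bit_code (?w ! p) else 0, {j. j < q \<and> (j, p) \<in> X})) [0..<W]"
      have lu: "length u = W" by (simp add: u_def)
      have un: "u ! p = (if p < length ?w then bit_code (?w ! p) else 0, {j. j < q \<and> (j, p) \<in> X})" if "p < W" for p
        using that by (simp add: u_def)
      have "length ?w \<le> W" by (simp add: W_def)
      then have u: "ext q ?w u" by (auto simp: ext_def lu un)
      interpret encoded \<sigma> A u q by standard (use wf u in auto)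
      have tr: "(j, p) \<in> tracks \<longleftrightarrow> (j, p) \<in> X" if "j < q" "p < W" for j p
        using that by (simp add: tracks_def lu un)
      have BW: "B ^ (q + a) < W"
      proof -
        have "B ^ (q + a) \<le> B ^ k" by (rule power_increasing) (use B0 in \<open>auto simp: k_def\<close>)
        then show ?thesis by (simp add: W_def)
      qed
      have nl: "num B (take j z @ map (tval A v) ts) < W"
        if "idx B q z" "\<forall>i<m. v i < ?n" "j < q" "length ts = qarity (P ! j)" "\<forall>t\<in>set ts. trm_ok \<sigma> m t" for z v j ts
      proof -
        have "num B (take j z @ map (tval A v) ts) < B ^ length (take j z @ map (tval A v) ts)"
        proof (rule num_less, rule ballI)
          fix y assume "y \<in> set (take j z @ map (tval A v) ts)"
          moreover have "tval A v t < B" if "t \<in> set ts" for t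
            using tval_less[OF wf bspec[OF \<open>\<forall>t\<in>set ts. trm_ok \<sigma> m t\<close> that] \<open>\<forall>i<m. v i < ?n\<close>] nB by simp
          ultimately show "y < B" using that(1) by (auto simp: idx_def dest: in_set_takeD)
        qed
        also have "\<dots> \<le> B ^ (q + a)"
          by (rule power_increasing) (use that ar[of j] B0 in \<open>auto simp: idx_def\<close>)
        finally show ?thesis using BW by simp
      qed
      have f: "fits B q m cls" unfolding fits_def lu
      proof (intro allI impI ballI, clarify)
        fix z v al h1 h2 s j ts
        assume z: "idx B q z" "\<forall>i<m. v i < ?n" and cl: "(al, h1, h2) \<in> set cls"
        have o: "\<forall>l\<in>set al. alpha_ok \<sigma> P m (snd l)" "h_ok \<sigma> P m (snd h1)" "h_ok \<sigma> P m (snd h2)"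
          using ok cl by (auto simp: clauses_ok_def)
        fix x assume "x \<in> snd ` set al \<union> {snd h1, snd h2}"
        then have "alpha_ok \<sigma> P m x \<or> h_ok \<sigma> P m x" using o by blast
        then show "code_less A B z v W x" using nl[OF z] by (cases x) (auto simp: q_def)
      qed
      \<comment> \<open>The clauses consult \<open>X\<close> only at points whose numbers lie on the
        tape, so cutting \<open>X\<close> down to the tape loses none of them.\<close>
      have "ground A P m cls B X \<subseteq> ground A P m cls B tracks"
      proof (intro subrelI)
        fix x y assume "(x, y) \<in> ground A P m cls B X"
        then obtain z v al h1 h2 where g: "x = head_code A B z v h1" "y = head_code A B z v h2" "idx B (length P) z"
          "\<forall>i<m. v i < ?n" "(al, h1, h2) \<in> set cls" "\<forall>l\<in>set al. fst l \<noteq> atom_code A B X z v (snd l)"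
          unfolding ground_iff by blast
        have "atom_code A B X z v (snd l) = atom_code A B tracks z v (snd l)" if "l \<in> set al" for l
        proof -
          have "alpha_ok \<sigma> P m (snd l)" using ok g(5) that by (auto simp: clauses_ok_def)
          then show ?thesis using tr nl[OF g(3)[folded q_def] g(4)] by (cases "snd l") (auto simp: q_def)
        qed
        then show "(x, y) \<in> ground A P m cls B tracks" unfolding ground_iff using g by blast
      qed
      from contradictory2_mono[OF X this] have ct: "contradictory2 (ground A P m cls B tracks)" .
      have "B ^ 1 \<le> B ^ k" by (rule power_increasing) (use B0 in \<open>auto simp: k_def\<close>)
      then have BW': "B < length u" unfolding lu W_def by simp
      have "sat u (FCycle \<sigma> q m cls) (\<lambda>_. 0)"
        by (rule FCycle_complete[OF ok q_def nB BW' f _ ct]) (simp add: lu W_def)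
      then have acc: "accepts_within M ?w (c * (length u + 1) ^ d)" by (rule M(3)[OF w u])
      have "length u + 1 \<le> c1 * (length ?w + 1) ^ D"
      proof -
        let ?l = "length ?w + 1"
        have "B ^ k = 4 ^ k * ?n ^ D" by (simp only: B_def D_def power_mult_distrib power_mult)
        also have "\<dots> \<le> 4 ^ k * ?l ^ D" using nw by (intro mult_le_mono2 power_mono) auto
        finally have 1: "B ^ k \<le> 4 ^ k * ?l ^ D" .
        have 2: "?l \<le> ?l ^ D" by (rule self_le_power) (auto simp: D_def k_def)
        have "1 \<le> ?l ^ D" by simp
        then have 3: "(2 * q + 2) * 1 \<le> (2 * q + 2) * ?l ^ D" by (rule mult_le_mono2)
        have "length u + 1 = ?l + B ^ k + (2 * q + 2) * 1" unfolding lu W_def by simp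
        also have "\<dots> \<le> ?l ^ D + 4 ^ k * ?l ^ D + (2 * q + 2) * ?l ^ D" by (intro add_mono 1 2 3)
        also have "\<dots> \<le> c1 * ?l ^ D" by (simp add: c1_def algebra_simps)
        finally show ?thesis .
      qed
      then have "(length u + 1) ^ d \<le> (c1 * (length ?w + 1) ^ D) ^ d" by (rule power_mono) simp
      then have "c * (length u + 1) ^ d \<le> c * c1 ^ d * (length ?w + 1) ^ (D * d)"
        by (simp add: power_mult_distrib power_mult)
      then show ?thesis using acc unfolding accepts_within_def by (meson le_trans)
    qed
    ultimately show ?thesis by (auto simp: L_def)
  qed
  ultimately show ?thesis unfolding coNP_on_def by blast
qed

section \<open>Ranks of elements, and tuples as numerals in base n\<close>

section \<open>Numbers in ordered structures\<close>

locale ordered =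
  fixes \<sigma> :: vocab and A :: struc
  assumes voc: "ordered_vocab \<sigma>" and ord: "ordered_struc \<sigma> A"
begin

abbreviation "n \<equiv> univ_size A"

abbreviation le :: "nat \<Rightarrow> nat \<Rightarrow> bool" where "le x y \<equiv> rel A 0 [x, y]"

lemma wfA: "struc_wf \<sigma> A" and n_pos: "0 < n"
  using ord by (auto simp: ordered_struc_def struc_wf_def)

lemmas order_facts =
  ord[unfolded ordered_struc_def Let_def, THEN conjunct2, THEN conjunct1]
  ord[unfolded ordered_struc_def Let_def, THEN conjunct2, THEN conjunct2, THEN conjunct1]
  ord[unfolded ordered_struc_def Let_def, THEN conjunct2, THEN conjunct2, THEN conjunct2, THEN conjunct1]
  ord[unfolded ordered_struc_def Let_def, THEN conjunct2, THEN conjunct2, THEN conjunct2, THEN conjunct2, THEN conjunct1]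
  ord[unfolded ordered_struc_def Let_def, THEN conjunct2, THEN conjunct2, THEN conjunct2, THEN conjunct2, THEN conjunct2, THEN conjunct1]
  ord[unfolded ordered_struc_def Let_def, THEN conjunct2, THEN conjunct2, THEN conjunct2, THEN conjunct2, THEN conjunct2, THEN conjunct2, THEN conjunct1]
  ord[unfolded ordered_struc_def Let_def, THEN conjunct2, THEN conjunct2, THEN conjunct2, THEN conjunct2, THEN conjunct2, THEN conjunct2, THEN conjunct2]

lemma le_refl: "x < n \<Longrightarrow> le x x"
  using order_facts(1) by blast

lemma le_antisym: "x < n \<Longrightarrow> y < n \<Longrightarrow> le x y \<Longrightarrow> le y x \<Longrightarrow> x = y"
  using order_facts(2) by blast

lemma le_trans: "x < n \<Longrightarrow> y < n \<Longrightarrow> z < n \<Longrightarrow> le x y \<Longrightarrow> le y z \<Longrightarrow> le x z"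
  using order_facts(3) by blast

lemma le_total: "x < n \<Longrightarrow> y < n \<Longrightarrow> le x y \<or> le y x"
  using order_facts(4) by blast

lemma succ_iff: "x < n \<Longrightarrow> y < n \<Longrightarrow> rel A 1 [x, y] \<longleftrightarrow> le x y \<and> x \<noteq> y \<and> (\<forall>z<n. le x z \<and> le z y \<longrightarrow> z = x \<or> z = y)"
  by (rule order_facts(5)[rule_format])

lemma min_le: "x < n \<Longrightarrow> le (cst A 0) x"
  using order_facts(6) by blast

lemma le_max: "x < n \<Longrightarrow> le x (cst A 1)"
  using order_facts(7) by blast

lemma cst_less: "c < nconsts \<sigma> \<Longrightarrow> cst A c < n"
  using wfA by (simp add: struc_wf_def)

lemma cst01: "cst A 0 < n" "cst A 1 < n"
  using voc by (auto intro!: cst_less simp: ordered_vocab_def)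

definition rank :: "nat \<Rightarrow> nat" where
  "rank x = card {y. y < n \<and> le y x \<and> y \<noteq> x}"

lemma rank_mono: "x < n \<Longrightarrow> y < n \<Longrightarrow> le x y \<Longrightarrow> x \<noteq> y \<Longrightarrow> rank x < rank y"
  unfolding rank_def
proof (rule psubset_card_mono)
  assume a: "x < n" "y < n" "le x y" "x \<noteq> y"
  show "{z. z < n \<and> le z x \<and> z \<noteq> x} \<subset> {z. z < n \<and> le z y \<and> z \<noteq> y}"
  proof
    show "{z. z < n \<and> le z x \<and> z \<noteq> x} \<subseteq> {z. z < n \<and> le z y \<and> z \<noteq> y}"
      using a le_trans le_antisym by blast
    show "{z. z < n \<and> le z x \<and> z \<noteq> x} \<noteq> {z. z < n \<and> le z y \<and> z \<noteq> y}" using a by blast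
  qed
qed simp

lemma rank_less: "x < n \<Longrightarrow> rank x < n"
proof -
  assume x: "x < n"
  have "rank x \<le> card ({..<n} - {x})" unfolding rank_def by (rule card_mono) auto
  then show ?thesis using x by simp
qed

lemma rank_bij: "bij_betw rank {..<n} {..<n}"
proof -
  have "inj_on rank {..<n}"
  proof (rule inj_onI)
    fix x y assume "x \<in> {..<n}" "y \<in> {..<n}" "rank x = rank y"
    then show "x = y" using rank_mono[of x y] rank_mono[of y x] le_total[of x y] by fastforce
  qed
  moreover have "rank ` {..<n} \<subseteq> {..<n}" using rank_less by auto
  ultimately show ?thesis by (simp add: bij_betw_def endo_inj_surj)
qed

lemma rank_inj: "x < n \<Longrightarrow> y < n \<Longrightarrow> rank x = rank y \<Longrightarrow> x = y"
  using rank_bij by (auto simp: bij_betw_def inj_on_def)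

lemma le_rank: "x < n \<Longrightarrow> y < n \<Longrightarrow> le x y \<longleftrightarrow> rank x \<le> rank y"
  using rank_mono[of x y] rank_mono[of y x] le_total[of x y] le_refl[of x] by (cases "x = y") (auto simp: not_le)

definition unrank :: "nat \<Rightarrow> nat" where
  "unrank = inv_into {..<n} rank"

lemma unrank_less: "i < n \<Longrightarrow> unrank i < n"
  and rank_unrank: "i < n \<Longrightarrow> rank (unrank i) = i"
  and unrank_rank: "x < n \<Longrightarrow> unrank (rank x) = x"
  unfolding unrank_def
  using rank_bij by (auto simp: bij_betw_def f_inv_into_f inv_into_f_f) (metis inv_into_into lessThan_iff)

lemma rank_min: "rank (cst A 0) = 0"
proof -
  have "{y. y < n \<and> le y (cst A 0) \<and> y \<noteq> cst A 0} = {}" using min_le le_antisym cst01 by blast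
  then show ?thesis by (simp add: rank_def)
qed

lemma rank_max: "rank (cst A 1) = n - 1"
proof -
  have "n - 1 < n" using n_pos by simp
  then have "n - 1 \<le> rank (cst A 1)"
    using le_rank[OF unrank_less cst01(2)] le_max[OF unrank_less] rank_unrank by metis
  then show ?thesis using rank_less[OF cst01(2)] by simp
qed

lemma succ_rank: "x < n \<Longrightarrow> y < n \<Longrightarrow> rel A 1 [x, y] \<longleftrightarrow> rank y = Suc (rank x)"
proof
  assume xy: "x < n" "y < n" and s: "rel A 1 [x, y]"
  have l: "rank x < rank y" using s succ_iff[OF xy] rank_mono[OF xy] by blast
  show "rank y = Suc (rank x)"
  proof (rule ccontr)
    assume "rank y \<noteq> Suc (rank x)"
    then have m: "Suc (rank x) < rank y" "Suc (rank x) < n" using l rank_less[OF xy(2)] by auto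
    let ?z = "unrank (Suc (rank x))"
    have z: "?z < n" "rank ?z = Suc (rank x)" using unrank_less[OF m(2)] rank_unrank[OF m(2)] by auto
    have "le x ?z" "le ?z y" using le_rank[OF xy(1) z(1)] le_rank[OF z(1) xy(2)] z(2) m(1) by auto
    then have "?z = x \<or> ?z = y" using s succ_iff[OF xy] z(1) by blast
    then show False using z(2) m(1) by auto
  qed
next
  assume xy: "x < n" "y < n" and s: "rank y = Suc (rank x)"
  have "z = x \<or> z = y" if "z < n" "le x z" "le z y" for z
  proof -
    have "rank x \<le> rank z" "rank z \<le> rank y" using le_rank xy that by auto
    then have "rank z = rank x \<or> rank z = rank y" using s by auto
    then show ?thesis using rank_inj xy that(1) by blast
  qed
  then show "rel A 1 [x, y]" using succ_iff[OF xy] le_rank[OF xy] s by auto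
qed

(* The copy of A on which the given order is the natural order, the one used by the encoding. *)
definition nat_copy :: struc where
  "nat_copy = \<lparr>univ_size = n,
     rel = \<lambda>r t. r < length (rel_arity \<sigma>) \<and> length t = rel_arity \<sigma> ! r \<and> (\<forall>x\<in>set t. x < n) \<and> rel A r (map unrank t),
     cst = \<lambda>c. rank (cst A c)\<rparr>"

lemma nat_copy_simps [simp]: "univ_size nat_copy = n" "cst nat_copy c = rank (cst A c)"
  by (simp_all add: nat_copy_def)

lemma rel_nat_copy: "rel nat_copy r t \<longleftrightarrow>
    r < length (rel_arity \<sigma>) \<and> length t = rel_arity \<sigma> ! r \<and> (\<forall>x\<in>set t. x < n) \<and> rel A r (map unrank t)"
  by (simp add: nat_copy_def)

lemma nat_copy_wf: "struc_wf \<sigma> nat_copy"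
  using n_pos rank_less cst_less by (auto simp: struc_wf_def rel_nat_copy)

lemma nat_copy_le: "x < n \<Longrightarrow> y < n \<Longrightarrow> rel nat_copy 0 [x, y] \<longleftrightarrow> x \<le> y"
  using voc le_rank[of "unrank x" "unrank y"] by (auto simp: rel_nat_copy ordered_vocab_def unrank_less rank_unrank)

lemma nat_copy_succ: "x < n \<Longrightarrow> y < n \<Longrightarrow> rel nat_copy 1 [x, y] \<longleftrightarrow> y = Suc x"
  using voc succ_rank[of "unrank x" "unrank y"] by (auto simp: rel_nat_copy ordered_vocab_def unrank_less rank_unrank)

lemma nat_copy_ordered: "ordered_struc \<sigma> nat_copy"
proof -
  have c0: "cst nat_copy 0 = 0" using rank_min by simp
  have c1: "cst nat_copy 1 = n - 1" using rank_max by simp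
  show ?thesis unfolding ordered_struc_def Let_def nat_copy_simps(1)
  proof (intro conjI allI impI)
    fix x y assume xy: "x < n" "y < n"
    have s: "rel nat_copy 1 [x, y] \<longleftrightarrow> y = Suc x" by (rule nat_copy_succ[OF xy])
    show "rel nat_copy 1 [x, y] = (rel nat_copy 0 [x, y] \<and> x \<noteq> y \<and>
      (\<forall>z<n. rel nat_copy 0 [x, z] \<and> rel nat_copy 0 [z, y] \<longrightarrow> z = x \<or> z = y))"
    proof
      assume "rel nat_copy 1 [x, y]"
      then show "rel nat_copy 0 [x, y] \<and> x \<noteq> y \<and> (\<forall>z<n. rel nat_copy 0 [x, z] \<and> rel nat_copy 0 [z, y] \<longrightarrow> z = x \<or> z = y)"
        using s nat_copy_le xy by auto
    next
      assume h: "rel nat_copy 0 [x, y] \<and> x \<noteq> y \<and> (\<forall>z<n. rel nat_copy 0 [x, z] \<and> rel nat_copy 0 [z, y] \<longrightarrow> z = x \<or> z = y)"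
      then have l: "x < y" using nat_copy_le[OF xy] by auto
      then have "Suc x < n" using xy by simp
      then have "rel nat_copy 0 [x, Suc x]" "rel nat_copy 0 [Suc x, y]" "Suc x < n" using nat_copy_le xy l by auto
      then have "Suc x = x \<or> Suc x = y" using h by blast
      then show "rel nat_copy 1 [x, y]" using s by auto
    qed
  qed (use nat_copy_wf nat_copy_le c0 c1 n_pos in auto)
qed

text \<open>Both directions are recorded because \<open>iso_closed_in\<close> transfers membership
  one way only.\<close>

lemma nat_copy_iso: "struc_iso \<sigma> A nat_copy" "struc_iso \<sigma> nat_copy A"
proof -
  have "rel nat_copy r (map rank t) \<longleftrightarrow> rel A r t"
    if "r < length (rel_arity \<sigma>)" "length t = rel_arity \<sigma> ! r" "\<forall>x\<in>set t. x < n" for r t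
  proof -
    have "map unrank (map rank t) = t" using that(3) unrank_rank by (auto simp: map_idI)
    then show ?thesis using that rank_less by (auto simp: rel_nat_copy)
  qed
  then show "struc_iso \<sigma> A nat_copy" using rank_bij by (auto simp: struc_iso_def intro!: exI[of _ rank])
  have "bij_betw unrank {..<n} {..<n}" unfolding unrank_def by (rule bij_betw_inv_into[OF rank_bij])
  then show "struc_iso \<sigma> nat_copy A"
    using unrank_rank cst_less by (auto simp: struc_iso_def rel_nat_copy intro!: exI[of _ unrank])
qed

text \<open>The rank of a tuple in the lexicographic order that the given order induces.\<close>

definition N :: "nat list \<Rightarrow> nat" where
  "N t = num n (map rank t)"

lemma N_less: "valid n l t \<Longrightarrow> N t < n ^ l"
  using num_less[of "map rank t" n] rank_less by (auto simp: N_def valid_def)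

lemma N_inj: "valid n l t \<Longrightarrow> valid n l t' \<Longrightarrow> N t = N t' \<Longrightarrow> t = t'"
proof -
  assume a: "valid n l t" "valid n l t'" "N t = N t'"
  have "map rank t = map rank t'"
    by (rule num_inj[of _ _ n]) (use a rank_less in \<open>auto simp: valid_def N_def\<close>)
  then show ?thesis using a(1,2) rank_inj by (auto simp: valid_def list_eq_iff_nth_eq)
qed

lemma N_append: "N (s @ t) = N s * n ^ length t + N t"
  by (simp add: N_def num_append)

lemma N_surj: "k < n ^ l \<Longrightarrow> \<exists>t. valid n l t \<and> N t = k"
proof (induction l arbitrary: k)
  case 0 then show ?case by (auto simp: valid_def N_def)
next
  case (Suc l)
  have "k mod n ^ l < n ^ l" using n_pos by simp
  then obtain t where t: "valid n l t" "N t = k mod n ^ l" using Suc.IH by blast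
  have d: "k div n ^ l < n" using Suc.prems by (simp add: less_mult_imp_div_less)
  have "valid n (Suc l) (unrank (k div n ^ l) # t)" using t d unrank_less by (auto simp: valid_def)
  moreover have "N (unrank (k div n ^ l) # t) = k"
    using t rank_unrank[OF d] div_mult_mod_eq[of k "n ^ l"] by (auto simp: N_def valid_def)
  ultimately show ?case by blast
qed

definition tup :: "nat \<Rightarrow> nat \<Rightarrow> nat list" where
  "tup l k = (SOME t. valid n l t \<and> N t = k)"

lemma tup: "k < n ^ l \<Longrightarrow> valid n l (tup l k) \<and> N (tup l k) = k"
  unfolding tup_def by (rule someI_ex[OF N_surj])

lemma tup_N: "valid n l t \<Longrightarrow> tup l (N t) = t"
  using tup[OF N_less] N_inj by blast

lemma N_min: "N (replicate k (cst A 0)) = 0"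
  by (induction k) (simp_all add: N_def rank_min)

lemma N_max: "N (replicate k (cst A 1)) + 1 = n ^ k"
proof (induction k)
  case (Suc k)
  have "N (replicate (Suc k) (cst A 1)) + 1 = (n - 1) * n ^ k + n ^ k" using Suc by (simp add: N_def rank_max[unfolded One_nat_def])
  also have "\<dots> = n ^ Suc k" using n_pos by (cases n) auto
  finally show ?case .
qed (simp add: N_def)

text \<open>The carry rule of base \<open>n\<close>: a tail of greatest digits becomes a tail of
  least ones while the digit before it goes up by one.\<close>

lemma N_succ:
  assumes "rank b = Suc (rank a)"
  shows "N (s @ [b] @ replicate r (cst A 0)) = Suc (N (s @ [a] @ replicate r (cst A 1)))"
proof -
  have 1: "N [x] = rank x" for x by (simp add: N_def)
  have "N (s @ [b] @ replicate r (cst A 0)) = (N s * n + Suc (rank a)) * n ^ r"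
    unfolding append_assoc[symmetric] N_append[of _ "replicate r _"] N_append[of s] 1 assms N_min by simp
  moreover have "N (s @ [a] @ replicate r (cst A 1)) = (N s * n + rank a) * n ^ r + N (replicate r (cst A 1))"
    unfolding append_assoc[symmetric] N_append[of _ "replicate r _"] N_append[of s] 1 by simp
  ultimately show ?thesis using N_max[of r] by (simp add: algebra_simps)
qed

lemma N_pos_split:
  "valid n l t \<Longrightarrow> 0 < N t \<Longrightarrow> \<exists>s b r. t = s @ [b] @ replicate r (cst A 0) \<and> 0 < rank b"
proof (induction t arbitrary: l rule: rev_induct)
  case Nil then show ?case by (simp add: N_def)
next
  case (snoc x t)
  show ?case
  proof (cases "rank x = 0")
    case True
    then have x: "x = cst A 0" using rank_inj[of x "cst A 0"] rank_min cst01 snoc.prems by (simp add: valid_def)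
    have "N [x] = 0" using True by (simp add: N_def)
    then have "0 < N t" using snoc.prems(2) by (simp add: N_append)
    then obtain s b r where "t = s @ [b] @ replicate r (cst A 0)" "0 < rank b"
      using snoc.IH[of "length t"] snoc.prems by (auto simp: valid_def)
    then have "t @ [x] = s @ [b] @ replicate (Suc r) (cst A 0)" using x by (simp add: replicate_append_same)
    then show ?thesis using \<open>0 < rank b\<close> by blast
  next
    case False then show ?thesis by (intro exI[of _ t] exI[of _ x] exI[of _ 0]) simp
  qed
qed

text \<open>Conversely, consecutive tuples always differ by one carry. The lexicographic successor
  is thus described by finitely many clauses with SUCC, one for each digit at which the carry can
  stop.\<close>

lemma N_succ_split:
  assumes t: "valid n l t" and t': "valid n l t'" and s: "N t' = Suc (N t)"
  shows "\<exists>j<l. \<exists>a b. a < n \<and> b < n \<and> rel A 1 [a, b] \<and> t = take j t @ [a] @ replicate (l - j - 1) (cst A 1) \<and>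
    t' = take j t @ [b] @ replicate (l - j - 1) (cst A 0)"
proof -
  obtain u b r where u: "t' = u @ [b] @ replicate r (cst A 0)" "0 < rank b"
    using N_pos_split[OF t'] s by auto
  have bu: "b < n" "valid n (length u) u" "l = length u + 1 + r" using t' u by (auto simp: valid_def)
  define a where "a = unrank (rank b - 1)"
  have rb: "rank b - 1 < n" using rank_less[OF bu(1)] by simp
  have a: "a < n" "rank b = Suc (rank a)" using unrank_less[OF rb] rank_unrank[OF rb] u(2) by (auto simp: a_def)
  let ?t = "u @ [a] @ replicate r (cst A 1)"
  have "valid n l ?t" using bu a cst01 by (auto simp: valid_def)
  moreover have "N ?t = N t" using N_succ[OF a(2), of u r] u(1) s by simp
  ultimately have "t = ?t" using N_inj t by metis
  then have "t = take (length u) t @ [a] @ replicate (l - length u - 1) (cst A 1)" "take (length u) t = u"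
    using bu(3) by auto
  then show ?thesis using u(1) a bu succ_rank[OF a(1) bu(1)]
    by (intro exI[of _ "length u"]) auto
qed

end

section \<open>An existential first-order quantifier in Krom form, by a scan along the order\<close>

section \<open>Existential first-order quantifiers\<close>

definition first_tuple :: "nat \<Rightarrow> trm list" where "first_tuple m = replicate m (C 0)"
definition last_tuple :: "nat \<Rightarrow> trm list" where "last_tuple m = replicate m (C 1)"
text \<open>\<open>lower m j\<close> and \<open>upper m j\<close> are the two sides of the carry
  rule at digit \<open>j\<close>. The variable \<open>V m\<close>, one beyond those of the tuple, is
  the digit after the increment.\<close>

definition lower :: "nat \<Rightarrow> nat \<Rightarrow> trm list" where
  "lower m j = map V [0..<j] @ [V j] @ replicate (m - j - 1) (C 1)"
definition upper :: "nat \<Rightarrow> nat \<Rightarrow> trm list" where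
  "upper m j = map V [0..<j] @ [V m] @ replicate (m - j - 1) (C 0)"

(* The existential relation number M + i holds at a tuple as long as the scan of all pairs (tuple, clause), in
   lexicographic order, has met no violated clause before clause i at this tuple. *)
definition scan_clauses :: "nat \<Rightarrow> nat \<Rightarrow> lit list list \<Rightarrow> clause list" where
  "scan_clauses M m L = (let c = length L in
     ([], (True, SV M (first_tuple m)), (True, SV M (first_tuple m))) #
     ([], (False, SV (M + c) (last_tuple m)), (False, SV (M + c) (last_tuple m))) #
     concat (map (\<lambda>i. map (\<lambda>l. ([(\<not> fst l, snd l)], (False, SV (M + i) (map V [0..<m])),
        (True, SV (M + Suc i) (map V [0..<m])))) (L ! i)) [0..<c]) @
     map (\<lambda>j. ([(False, Rel 1 [V j, V m])], (False, SV (M + c) (lower m j)), (True, SV M (upper m j)))) [0..<m])"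

text \<open>States that for all relations some clause of \<open>L\<close> fails somewhere. There is
  an existential relation before each clause and one behind the last, and one first-order variable
  is added for the carry.\<close>

definition scan :: "nat \<Rightarrow> (nat \<Rightarrow> nat) \<Rightarrow> nat \<Rightarrow> lit list list \<Rightarrow> ekrom" where
  "scan M ar m L = Ekrom (map QAll (map ar [0..<M]) @ map QEx (replicate (Suc (length L)) m)) (Suc m) (scan_clauses M m L)"

lemma trm_ok_mono: "trm_ok \<sigma> m t \<Longrightarrow> m \<le> m' \<Longrightarrow> trm_ok \<sigma> m' t"
  by (cases t) auto

lemma alpha_ok_append: "alpha_ok \<sigma> qs m a \<Longrightarrow> m \<le> m' \<Longrightarrow> alpha_ok \<sigma> (qs @ qs') m' a"
  by (cases a) (auto simp: nth_append intro: trm_ok_mono)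

lemma scan_Pi12:
  assumes voc: "ordered_vocab \<sigma>"
    and L: "\<forall>C\<in>set L. \<forall>l\<in>set C. alpha_ok \<sigma> (map QAll (map ar [0..<M])) m (snd l)"
  shows "scan M ar m L \<in> Pi12_EKROM \<sigma>"
proof -
  let ?P = "map QAll (map ar [0..<M]) @ map QEx (replicate (Suc (length L)) m)"
  have h: "h_ok \<sigma> ?P (Suc m) (SV (M + i) ts)" if "i \<le> length L" "length ts = m" "\<forall>t\<in>set ts. trm_ok \<sigma> (Suc m) t" for i ts
    using that by (simp add: nth_append del: replicate_Suc)
  have t: "\<forall>t\<in>set (first_tuple m). trm_ok \<sigma> (Suc m) t" "\<forall>t\<in>set (last_tuple m). trm_ok \<sigma> (Suc m) t"
    "\<forall>t\<in>set (map V [0..<m]). trm_ok \<sigma> (Suc m) t"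
    "length (first_tuple m) = m" "length (last_tuple m) = m" "length (map V [0..<m]) = m"
    using voc by (auto simp: first_tuple_def last_tuple_def ordered_vocab_def)
  have t2: "\<forall>t\<in>set (lower m j). trm_ok \<sigma> (Suc m) t" "\<forall>t\<in>set (upper m j). trm_ok \<sigma> (Suc m) t"
    "length (lower m j) = m" "length (upper m j) = m" if "j < m" for j
    using voc that by (auto simp: lower_def upper_def ordered_vocab_def)
  have r: "alpha_ok \<sigma> ?P (Suc m) (Rel 1 [V j, V m])" if "j < m" for j
    using voc that by (auto simp: ordered_vocab_def)
  have a: "alpha_ok \<sigma> ?P (Suc m) (snd l)" if "i < length L" "l \<in> set (L ! i)" for i l
    by (rule alpha_ok_append) (use L that in auto)
  have h3: "h_ok \<sigma> ?P (Suc m) (SV (M + Suc i) (map V [0..<m]))" if "i < length L" for i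
    by (rule h[OF _ t(6,3)]) (use that in simp)
  have "clauses_ok \<sigma> ?P (Suc m) (scan_clauses M m L)"
    unfolding clauses_ok_def scan_clauses_def Let_def
    using h[of 0, OF _ t(4,1)] h[of "length L", OF _ t(5,2)] h[OF _ t(6,3)] h[of 0, OF _ t2(4,2)] h[of "length L", OF _ t2(3,1)] h3 r a
    by (auto simp del: h_ok.simps alpha_ok.simps map_append map_replicate replicate_Suc)
  then show ?thesis unfolding Pi12_EKROM_def clauses_ok_SO_EKROM mem_Collect_eq
    by (simp add: scan_def clauses_ok_SO_EKROM del: map_map replicate_Suc map_replicate) blast
qed

lemma qsat_QAll: "qsat A m cls (map QAll as @ qs) Rs \<longleftrightarrow>
    (\<forall>Is. list_all2 (\<lambda>R a. R \<in> rels_over A a) Is as \<longrightarrow> qsat A m cls qs (Rs @ Is))"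
  by (induction as arbitrary: Rs) (auto simp: list_all2_Cons2)

lemma qsat_QEx: "qsat A m cls (map QEx as) Rs \<longleftrightarrow>
    (\<exists>Is. list_all2 (\<lambda>R a. R \<in> rels_over A a) Is as \<and> matrix A m cls (Rs @ Is))"
proof (induction as arbitrary: Rs)
  case Nil then show ?case by (simp add: matrix_def)
next
  case (Cons a as)
  have "qsat A m cls (map QEx (a # as)) Rs \<longleftrightarrow> (\<exists>R\<in>rels_over A a. \<exists>Is. list_all2 (\<lambda>R a. R \<in> rels_over A a) Is as \<and> matrix A m cls (Rs @ R # Is))"
    using Cons by simp
  also have "\<dots> \<longleftrightarrow> (\<exists>Is. list_all2 (\<lambda>R a. R \<in> rels_over A a) Is (a # as) \<and> matrix A m cls (Rs @ Is))"
    unfolding list_all2_Cons2 by blast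
  finally show ?case .
qed

lemma lval_append: "alpha_ok \<sigma> qs m (snd l) \<Longrightarrow> length Rs = length qs \<Longrightarrow> lval A (Rs @ Rs') v l = lval A Rs v l"
  by (cases "snd l") (auto simp: lval_def nth_append)

lemma lval_cong: "alpha_ok \<sigma> qs m (snd l) \<Longrightarrow> (\<And>i. i < m \<Longrightarrow> v i = v' i) \<Longrightarrow> lval A Rs v l = lval A Rs v' l"
proof -
  assume ok: "alpha_ok \<sigma> qs m (snd l)" and v: "\<And>i. i < m \<Longrightarrow> v i = v' i"
  have m: "map (tval A v) ts = map (tval A v') ts" if "\<forall>t\<in>set ts. trm_ok \<sigma> m t" for ts
    by (rule map_tval_cong[OF that v])
  have t: "tval A v t = tval A v' t" if "trm_ok \<sigma> m t" for t by (rule tval_cong[OF that v])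
  show ?thesis
  proof (cases "snd l")
    case (Rel r ts) then show ?thesis using ok m[of ts] by (simp add: lval_def del: map_eq_conv)
  next
    case (Eq s t') then show ?thesis using ok t by (simp add: lval_def)
  next
    case (SV j ts) then show ?thesis using ok m[of ts] by (simp add: lval_def del: map_eq_conv)
  qed
qed

context ordered
begin

lemma tval_tuples:
  "map (tval A v) (first_tuple m) = replicate m (cst A 0)"
  "map (tval A v) (last_tuple m) = replicate m (cst A 1)"
  "map (tval A v) (map V [0..<m]) = map v [0..<m]"
  "map (tval A v) (lower m j) = map v [0..<j] @ [v j] @ replicate (m - j - 1) (cst A 1)"
  "map (tval A v) (upper m j) = map v [0..<j] @ [v m] @ replicate (m - j - 1) (cst A 0)"
  by (simp_all add: first_tuple_def last_tuple_def lower_def upper_def)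

lemma scan_matrix:
  assumes lI: "length Is = M" and lY: "length Ys = Suc (length L)"
    and L: "\<forall>C\<in>set L. \<forall>l\<in>set C. alpha_ok \<sigma> (map QAll (map ar [0..<M])) m (snd l)"
  shows "matrix A (Suc m) (scan_clauses M m L) (Is @ Ys) \<longleftrightarrow> (\<forall>v. (\<forall>i<Suc m. v i < n) \<longrightarrow>
     replicate m (cst A 0) \<in> Ys ! 0 \<and> replicate m (cst A 1) \<notin> Ys ! length L \<and>
     (\<forall>i<length L. \<forall>l\<in>set (L ! i). map v [0..<m] \<in> Ys ! i \<longrightarrow> lval A Is v l \<longrightarrow> map v [0..<m] \<in> Ys ! Suc i) \<and>
     (\<forall>j<m. rel A 1 [v j, v m] \<longrightarrow> map v [0..<j] @ [v j] @ replicate (m - j - 1) (cst A 1) \<in> Ys ! length L \<longrightarrow>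
        map v [0..<j] @ [v m] @ replicate (m - j - 1) (cst A 0) \<in> Ys ! 0))"
proof -
  have Y: "(Is @ Ys) ! (M + i) = Ys ! i" for i using lI by (simp add: nth_append)
  have Y0: "(Is @ Ys) ! M = Ys ! 0" using Y[of 0] by simp
  have S: "lval A (Is @ Ys) v (s, SV (M + i) ts) \<longleftrightarrow> s = (map (tval A v) ts \<in> Ys ! i)" for v s i ts
    using Y by (auto simp: lval_def)
  have S0: "lval A (Is @ Ys) v (s, SV M ts) \<longleftrightarrow> s = (map (tval A v) ts \<in> Ys ! 0)" for v s ts
    using Y0 by (auto simp: lval_def)
  have N: "lval A (Is @ Ys) v (\<not> fst l, snd l) \<longleftrightarrow> \<not> lval A Is v l" if "i < length L" "l \<in> set (L ! i)" for v i l
  proof -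
    have "alpha_ok \<sigma> (map QAll (map ar [0..<M])) m (snd l)" using L that by auto
    then have "lval A (Is @ Ys) v l = lval A Is v l" by (rule lval_append) (simp add: lI)
    then show ?thesis by (auto simp: lval_def)
  qed
  have R: "lval A (Is @ Ys) v (False, Rel 1 [V j, V m]) \<longleftrightarrow> \<not> rel A 1 [v j, v m]" for v j
    by (simp add: lval_def)
  have "(\<forall>cl\<in>set (scan_clauses M m L). cval A (Is @ Ys) v cl) \<longleftrightarrow>
     replicate m (cst A 0) \<in> Ys ! 0 \<and> replicate m (cst A 1) \<notin> Ys ! length L \<and>
     (\<forall>i<length L. \<forall>l\<in>set (L ! i). map v [0..<m] \<in> Ys ! i \<longrightarrow> lval A Is v l \<longrightarrow> map v [0..<m] \<in> Ys ! Suc i) \<and>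
     (\<forall>j<m. rel A 1 [v j, v m] \<longrightarrow> map v [0..<j] @ [v j] @ replicate (m - j - 1) (cst A 1) \<in> Ys ! length L \<longrightarrow>
        map v [0..<j] @ [v m] @ replicate (m - j - 1) (cst A 0) \<in> Ys ! 0)" for v
  proof -
    have 3: "(\<forall>cl\<in>set (concat (map (\<lambda>i. map (\<lambda>l. ([(\<not> fst l, snd l)], (False, SV (M + i) (map V [0..<m])),
        (True, SV (M + Suc i) (map V [0..<m])))) (L ! i)) [0..<length L])). cval A (Is @ Ys) v cl) \<longleftrightarrow>
      (\<forall>i<length L. \<forall>l\<in>set (L ! i). map v [0..<m] \<in> Ys ! i \<longrightarrow> lval A Is v l \<longrightarrow> map v [0..<m] \<in> Ys ! Suc i)"
    proof -
      have "cval A (Is @ Ys) v ([(\<not> fst l, snd l)], (False, SV (M + i) (map V [0..<m])), (True, SV (M + Suc i) (map V [0..<m])))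
        \<longleftrightarrow> (map v [0..<m] \<in> Ys ! i \<longrightarrow> lval A Is v l \<longrightarrow> map v [0..<m] \<in> Ys ! Suc i)" if "i < length L" "l \<in> set (L ! i)" for i l
        unfolding cval_def prod.case S tval_tuples using N[OF that] by auto
      then show ?thesis by auto
    qed
    have 4: "cval A (Is @ Ys) v ([(False, Rel 1 [V j, V m])], (False, SV (M + length L) (lower m j)), (True, SV M (upper m j))) \<longleftrightarrow>
      (rel A 1 [v j, v m] \<longrightarrow> map v [0..<j] @ [v j] @ replicate (m - j - 1) (cst A 1) \<in> Ys ! length L \<longrightarrow>
        map v [0..<j] @ [v m] @ replicate (m - j - 1) (cst A 0) \<in> Ys ! 0)" for j
      unfolding cval_def prod.case S S0 tval_tuples using R by auto
    have 1: "cval A (Is @ Ys) v ([], (True, SV M (first_tuple m)), (True, SV M (first_tuple m))) \<longleftrightarrow> replicate m (cst A 0) \<in> Ys ! 0"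
      "cval A (Is @ Ys) v ([], (False, SV (M + length L) (last_tuple m)), (False, SV (M + length L) (last_tuple m))) \<longleftrightarrow> replicate m (cst A 1) \<notin> Ys ! length L"
      unfolding cval_def prod.case S S0 tval_tuples by auto
    show ?thesis unfolding scan_clauses_def Let_def set_append ball_Un list.set ball_simps 1 3 set_map set_upt 4 by auto
  qed
  then show ?thesis by (simp only: matrix_def)
qed

text \<open>If all clauses hold everywhere, the implications drive the scan through all tuples, and
  it ends in the conflict at the last one. If some clause fails, its literals are all false there,
  so the scan may stop at this place.\<close>

theorem models_scan:
  assumes L: "\<forall>C\<in>set L. \<forall>l\<in>set C. alpha_ok \<sigma> (map QAll (map ar [0..<M])) m (snd l)"
  shows "models A (scan M ar m L) \<longleftrightarrow> \<not> (\<exists>I. (\<forall>j<M. I j \<in> rels_over A (ar j)) \<and>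
    (\<forall>v. (\<forall>i<m. v i < n) \<longrightarrow> (\<forall>C\<in>set L. \<exists>l\<in>set C. lval A (map I [0..<M]) v l)))"
proof -
  let ?c = "length L"
  have mod: "models A (scan M ar m L) \<longleftrightarrow> (\<forall>Is. list_all2 (\<lambda>R a. R \<in> rels_over A a) Is (map ar [0..<M]) \<longrightarrow>
     (\<exists>Ys. list_all2 (\<lambda>R a. R \<in> rels_over A a) Ys (replicate (Suc ?c) m) \<and> matrix A (Suc m) (scan_clauses M m L) (Is @ Ys)))"
    unfolding models_def scan_def ekrom.sel qsat_QAll qsat_QEx by simp
  show ?thesis
  proof
    assume "models A (scan M ar m L)"
    show "\<not> (\<exists>I. (\<forall>j<M. I j \<in> rels_over A (ar j)) \<and>
      (\<forall>v. (\<forall>i<m. v i < n) \<longrightarrow> (\<forall>C\<in>set L. \<exists>l\<in>set C. lval A (map I [0..<M]) v l)))"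
    proof
      assume "\<exists>I. (\<forall>j<M. I j \<in> rels_over A (ar j)) \<and>
        (\<forall>v. (\<forall>i<m. v i < n) \<longrightarrow> (\<forall>C\<in>set L. \<exists>l\<in>set C. lval A (map I [0..<M]) v l))"
      then obtain I where I: "\<forall>j<M. I j \<in> rels_over A (ar j)"
        "\<And>v C. \<forall>i<m. v i < n \<Longrightarrow> C \<in> set L \<Longrightarrow> \<exists>l\<in>set C. lval A (map I [0..<M]) v l" by blast
      let ?Is = "map I [0..<M]"
      have "list_all2 (\<lambda>R a. R \<in> rels_over A a) ?Is (map ar [0..<M])" using I(1) by (simp add: list_all2_conv_all_nth)
      then obtain Ys where Ys: "list_all2 (\<lambda>R a. R \<in> rels_over A a) Ys (replicate (Suc ?c) m)"
        "matrix A (Suc m) (scan_clauses M m L) (?Is @ Ys)" using mod \<open>models A (scan M ar m L)\<close> by blast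
      have lY: "length Ys = Suc ?c" using Ys(1) by (auto dest: list_all2_lengthD)
      note mx = Ys(2)[unfolded scan_matrix[OF _ lY L, of ?Is, simplified], rule_format]
      define v0 where "v0 = (\<lambda>_ :: nat. cst A 0)"
      have v0: "\<And>i. v0 i < n" using cst01 by (simp add: v0_def)
      have up: "\<forall>i\<le>?c. t \<in> Ys ! i" if t: "valid n m t" "t \<in> Ys ! 0" for t
      proof (intro allI impI)
        fix i assume "i \<le> ?c"
        then show "t \<in> Ys ! i"
        proof (induction i)
          case (Suc i)
          define v where "v = (\<lambda>i. if i < m then t ! i else cst A 0)"
          have vn: "\<And>i. v i < n" using t cst01 by (auto simp: v_def valid_def)
          have vt: "map v [0..<m] = t" using t by (auto simp: v_def valid_def list_eq_iff_nth_eq)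
          obtain l where l: "l \<in> set (L ! i)" "lval A ?Is v l" using I(2)[of v "L ! i"] vn Suc.prems by auto
          have "map v [0..<m] \<in> Ys ! i" "i < ?c" using Suc vt by auto
          then have "map v [0..<m] \<in> Ys ! Suc i" using mx[of v] vn l by blast
          then show ?case unfolding vt .
        qed (use t in simp)
      qed
      have all: "valid n m t \<Longrightarrow> N t = k \<Longrightarrow> t \<in> Ys ! 0" for k t
      proof (induction k arbitrary: t)
        case 0
        have "valid n m (replicate m (cst A 0))" using cst01 by (simp add: valid_def)
        then have "t = replicate m (cst A 0)" using N_inj 0 N_min by metis
        then show ?case using mx[of v0] v0 by simp
      next
        case (Suc k)
        have "k < n ^ m" using N_less[OF Suc.prems(1)] Suc.prems(2) by simp
        then obtain s where s: "valid n m s" "N s = k" using N_surj by blast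
        obtain j a b where j: "j < m" "a < n" "b < n" "rel A 1 [a, b]" "s = take j s @ [a] @ replicate (m - j - 1) (cst A 1)"
          "t = take j s @ [b] @ replicate (m - j - 1) (cst A 0)"
          using N_succ_split[OF s(1) Suc.prems(1)] Suc.prems(2) s(2) by blast
        define v where "v = (\<lambda>i. if i < m then s ! i else b)"
        have vn: "\<And>i. v i < n" using s j by (auto simp: v_def valid_def)
        have vj: "map v [0..<j] = take j s" using s j by (auto simp: v_def valid_def list_eq_iff_nth_eq)
        have "s ! j = a" using j(1) s(1) by (subst j(5)) (simp add: nth_append valid_def)
        then have "v j = a" "v m = b" using j(1) by (auto simp: v_def)
        moreover have "s \<in> Ys ! ?c" using up[OF s(1)] Suc.IH[OF s] by blast
        ultimately have "map v [0..<j] @ [v m] @ replicate (m - j - 1) (cst A 0) \<in> Ys ! 0"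
          using mx[of v] vn j(1,4,5) vj by auto
        then show ?case using \<open>v m = b\<close> vj j(6) by simp
      qed
      have "valid n m (replicate m (cst A 1))" using cst01 by (simp add: valid_def)
      then have "replicate m (cst A 1) \<in> Ys ! ?c" using all up by blast
      then show False using mx[of v0] v0 by simp
    qed
  next
    assume no: "\<not> (\<exists>I. (\<forall>j<M. I j \<in> rels_over A (ar j)) \<and>
      (\<forall>v. (\<forall>i<m. v i < n) \<longrightarrow> (\<forall>C\<in>set L. \<exists>l\<in>set C. lval A (map I [0..<M]) v l)))"
    show "models A (scan M ar m L)" unfolding mod
    proof (intro allI impI)
      fix Is assume "list_all2 (\<lambda>R a. R \<in> rels_over A a) Is (map ar [0..<M])"
      then have Is: "length Is = M" "\<forall>j<M. Is ! j \<in> rels_over A (ar j)" by (auto simp: list_all2_conv_all_nth)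
      have "map ((!) Is) [0..<M] = Is" using Is(1) map_nth by blast
      then obtain v1 C where v1: "\<forall>i<m. v1 i < n" "C \<in> set L" "\<forall>l\<in>set C. \<not> lval A Is v1 l" using no Is(2) by metis
      obtain i1 where i1: "i1 < ?c" "C = L ! i1" using v1(2) by (auto simp: in_set_conv_nth)
      define t1 where "t1 = map v1 [0..<m]"
      \<comment> \<open>The part of the scan up to the violated clause \<open>i1\<close> at the
        tuple \<open>t1\<close>, inclusive.\<close>
      define Y where "Y i = {t. valid n m t \<and> (N t < N t1 \<or> t = t1 \<and> i \<le> i1)}" for i
      define Ys where "Ys = map Y [0..<Suc ?c]"
      have lY: "length Ys = Suc ?c" by (simp add: Ys_def)
      have Yi: "Ys ! i = Y i" if "i \<le> ?c" for i
        using nth_map_upt[of i "Suc ?c" 0 Y] that unfolding Ys_def by simp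
      have t1: "valid n m t1" using v1(1) by (auto simp: t1_def valid_def)
      have "list_all2 (\<lambda>R a. R \<in> rels_over A a) Ys (replicate (Suc ?c) m)"
        unfolding list_all2_conv_all_nth using lY Yi by (auto simp: Y_def valid_def rels_over_def less_Suc_eq_le nth_replicate simp del: replicate_Suc)
      moreover have "matrix A (Suc m) (scan_clauses M m L) (Is @ Ys)"
        unfolding scan_matrix[OF Is(1) lY L] Yi[OF le0] Yi[OF order_refl]
      proof (intro allI impI conjI ballI)
        fix v assume v: "\<forall>i<Suc m. v i < n"
        have vt: "valid n m (map v [0..<m])" using v by (auto simp: valid_def)
        have z: "valid n m (replicate m (cst A 0))" "N (replicate m (cst A 0)) = 0" using cst01 N_min by (auto simp: valid_def)
        show "replicate m (cst A 0) \<in> Y 0"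
          using z N_inj[OF z(1) t1] by (cases "N t1 = 0") (auto simp: Y_def)
        have "N t1 \<le> N (replicate m (cst A 1))" using N_less[OF t1] N_max[of m] by simp
        then show "replicate m (cst A 1) \<notin> Y ?c" using i1 by (auto simp: Y_def)
        fix i assume i: "i < ?c"
        have Y2: "Ys ! i = Y i" "Ys ! Suc i = Y (Suc i)" using Yi i by auto
        fix l assume l: "l \<in> set (L ! i)" "map v [0..<m] \<in> Ys ! i" "lval A Is v l"
        have "\<not> (map v [0..<m] = t1 \<and> i = i1)"
        proof
          assume a: "map v [0..<m] = t1 \<and> i = i1"
          then have e: "\<And>i. i < m \<Longrightarrow> v i = v1 i" by (auto simp: t1_def)
          have "alpha_ok \<sigma> (map QAll (map ar [0..<M])) m (snd l)" using L l(1) i by auto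
          from lval_cong[OF this e] have "lval A Is v1 l" using l(3) by simp
          then show False using v1(3) i1(2) l(1) a by blast
        qed
        then show "map v [0..<m] \<in> Ys ! Suc i" using l(2) unfolding Y2 by (auto simp: Y_def)
      next
        fix v j assume v: "\<forall>i<Suc m. v i < n" and j: "j < m" and r: "rel A 1 [v j, v m]"
          and y: "map v [0..<j] @ [v j] @ replicate (m - j - 1) (cst A 1) \<in> Y ?c"
        let ?s = "map v [0..<j] @ [v j] @ replicate (m - j - 1) (cst A 1)"
        let ?t = "map v [0..<j] @ [v m] @ replicate (m - j - 1) (cst A 0)"
        have vm: "v j < n" "v m < n" using v j by auto
        have "N ?t = Suc (N ?s)" using N_succ succ_rank[OF vm] r by blast
        moreover have "N ?s < N t1" using y i1(1) by (auto simp: Y_def)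
        moreover have "valid n m ?t" using v j cst01 by (auto simp: valid_def)
        ultimately show "?t \<in> Y 0" using N_inj[OF _ t1, of ?t] by (cases "N ?t = N t1") (auto simp: Y_def)
      qed
      ultimately show "\<exists>Ys. list_all2 (\<lambda>R a. R \<in> rels_over A a) Ys (replicate (Suc ?c) m) \<and>
        matrix A (Suc m) (scan_clauses M m L) (Is @ Ys)" by blast
    qed
  qed
qed

end

(* Names of the guessed relations: successor and strict order on numbers, positions of the input blocks, the blank
   parts of the tape left and right of the input, the end of the input, tape contents, head position, state,
   transition used, and the arithmetic that computes the time bound. *)
datatype rname = Sc | Lt | Pos nat | Lft | Rgt | RS | Tp nat | Hd | St nat | Tr nat | Ad | Mu | Ln | Vl nat | Kn nat | Dl

instance rname :: countable by countable_datatype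

fun nargs :: "rname \<Rightarrow> nat" where
  "nargs Sc = 2" | "nargs Lt = 2" | "nargs (Pos b) = 2" | "nargs Lft = 1" | "nargs Rgt = 1" | "nargs RS = 1"
| "nargs (Tp s) = 2" | "nargs Hd = 2" | "nargs (St q) = 1" | "nargs (Tr i) = 1" | "nargs Ad = 3" | "nargs Mu = 3"
| "nargs Ln = 1" | "nargs (Vl j) = 1" | "nargs (Kn i) = 1" | "nargs Dl = 1"

(* A slot denotes a number below n ^ D, written with D digits; Pad k g keeps only the k leading digits of variable
   group g, so it ranges over the numbers below n ^ k. *)
datatype slot = Grp nat | Zero | Origin | Pad nat nat | PadMax nat

datatype nlit = Rl bool rname "slot list" | Bit bool block nat

fun slot_terms :: "nat \<Rightarrow> slot \<Rightarrow> trm list" where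
  "slot_terms D (Grp g) = map V [g * D..<g * D + D]"
| "slot_terms D Zero = replicate D (C 0)"
| "slot_terms D Origin = C 1 # replicate (D - 1) (C 0)"
| "slot_terms D (Pad k g) = replicate (D - k) (C 0) @ map V [g * D..<g * D + k]"
| "slot_terms D (PadMax k) = replicate (D - k) (C 0) @ replicate k (C 1)"

fun slot_ok :: "nat \<Rightarrow> slot \<Rightarrow> bool" where
  "slot_ok D (Grp g) = (g < 5)"
| "slot_ok D Zero = True"
| "slot_ok D Origin = True"
| "slot_ok D (Pad k g) = (k \<le> D \<and> g < 5)"
| "slot_ok D (PadMax k) = (k \<le> D)"

text \<open>Group \<open>g\<close> consists of the \<open>D\<close> variables from
  \<open>g * D\<close> on; five groups are available. \<open>Bit\<close> reads a block at the
  leading digits of a group, and the two blocks for the size, being constant, become trivial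
  equations.\<close>

fun to_lit :: "vocab \<Rightarrow> nat \<Rightarrow> nlit \<Rightarrow> lit" where
  "to_lit \<sigma> D (Rl s nm sl) = (s, SV (to_nat nm) (concat (map (slot_terms D) sl)))"
| "to_lit \<sigma> D (Bit s b g) = (case b of BTrue \<Rightarrow> (s, Eq (C 0) (C 0)) | BFalse \<Rightarrow> (\<not> s, Eq (C 0) (C 0))
     | BRel r \<Rightarrow> (s, Rel r (map V [g * D..<g * D + rel_arity \<sigma> ! r])) | BCst c \<Rightarrow> (s, Eq (C c) (V (g * D))))"

fun nlit_ok :: "vocab \<Rightarrow> nat \<Rightarrow> nat \<Rightarrow> nlit \<Rightarrow> bool" where
  "nlit_ok \<sigma> D M (Rl s nm sl) = (to_nat nm < M \<and> length sl = nargs nm \<and> (\<forall>x\<in>set sl. slot_ok D x))"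
| "nlit_ok \<sigma> D M (Bit s b g) = (b \<in> set (blocks \<sigma>) \<and> block_arity \<sigma> b \<le> D \<and> g < 5)"

text \<open>The least and the greatest element coincide exactly in one-element structures, so this
  literal switches a clause on or off by size.\<close>

definition guard_lit :: "bool \<Rightarrow> lit" where
  "guard_lit s = (s, Eq (C 0) (C 1))"

text \<open>Lifts SUCC from elements to \<open>Sc\<close> on numbers of \<open>D\<close> digits, for
  a carry that stops at digit \<open>j\<close>. The variable \<open>V D\<close> is the incremented
  digit.\<close>

definition succ_clause :: "nat \<Rightarrow> nat \<Rightarrow> lit list" where
  "succ_clause D j = [(False, Rel 1 [V j, V D]), (True, SV (to_nat Sc) (lower D j @ upper D j))]"

text \<open>In a one-element structure the clause fails exactly if the relations follow
  \<open>\<beta>\<close>. Since the sentence asserts a failure, it becomes true for the listed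
  patterns.\<close>

definition pattern_clause :: "vocab \<Rightarrow> bool list \<Rightarrow> lit list" where
  "pattern_clause \<sigma> \<beta> = map (\<lambda>r. (\<not> \<beta> ! r, Rel r (replicate (rel_arity \<sigma> ! r) (C 0)))) [0..<length (rel_arity \<sigma>)]"

(* Structures with one element are treated apart, since n ^ D does not grow for n = 1. *)
definition raw_clauses :: "vocab \<Rightarrow> nat \<Rightarrow> nlit list list \<Rightarrow> bool list list \<Rightarrow> lit list list" where
  "raw_clauses \<sigma> D cl pats = map (\<lambda>C. guard_lit True # map (to_lit \<sigma> D) C) cl @
     map (\<lambda>j. guard_lit True # succ_clause D j) [0..<D] @
     map (\<lambda>\<beta>. guard_lit False # pattern_clause \<sigma> \<beta>) pats"

text \<open>Names are numbered by \<open>to_nat\<close>. A number that belongs to no name receives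
  some arity and occurs in no clause.\<close>

definition rel_ar :: "nat \<Rightarrow> nat \<Rightarrow> nat" where
  "rel_ar D j = D * nargs (from_nat j)"

definition horn_formula :: "vocab \<Rightarrow> nat \<Rightarrow> nat \<Rightarrow> nlit list list \<Rightarrow> bool list list \<Rightarrow> ekrom" where
  "horn_formula \<sigma> D M cl pats = scan M (rel_ar D) (5 * D) (raw_clauses \<sigma> D cl pats)"

lemma group_bound: "g < 5 \<Longrightarrow> i < g * D + D \<Longrightarrow> i < 5 * (D :: nat)"
proof -
  assume "g < 5" "i < g * D + D"
  moreover have "g * D + D = Suc g * D" by simp
  moreover have "Suc g * D \<le> 5 * D" using \<open>g < 5\<close> by (intro mult_le_mono1) simp
  ultimately show ?thesis by linarith
qed

lemma slot_terms_ok: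
  assumes "ordered_vocab \<sigma>" "0 < D" "slot_ok D s"
  shows "length (slot_terms D s) = D" "\<forall>t\<in>set (slot_terms D s). trm_ok \<sigma> (5 * D) t"
proof -
  have c: "0 < nconsts \<sigma>" "1 < nconsts \<sigma>" using assms(1) by (auto simp: ordered_vocab_def)
  show "length (slot_terms D s) = D" using assms by (cases s) auto
  show "\<forall>t\<in>set (slot_terms D s). trm_ok \<sigma> (5 * D) t"
  proof (cases s)
    case (Grp g) then show ?thesis using assms(3) group_bound by auto
  next
    case (Pad k g)
    have "i < 5 * D" if "i < g * D + k" for i using group_bound[of g i D] assms(3) Pad that by simp
    then show ?thesis using c Pad by auto
  qed (use c in auto)
qed

lemma sum_const_list: "(\<forall>x\<in>set xs. length x = D) \<Longrightarrow> length (concat xs) = D * length xs"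
  by (induction xs) auto

lemma blocks_iff:
  "BRel r \<in> set (blocks \<sigma>) \<longleftrightarrow> r < length (rel_arity \<sigma>)" "BCst c \<in> set (blocks \<sigma>) \<longleftrightarrow> c < nconsts \<sigma>"
  by (auto simp: blocks_def)

lemma raw_ok:
  assumes voc: "ordered_vocab \<sigma>" and D: "0 < D" and M: "to_nat Sc < M"
    and cl: "\<forall>C\<in>set cl. \<forall>l\<in>set C. nlit_ok \<sigma> D M l"
  shows "\<forall>C\<in>set (raw_clauses \<sigma> D cl pats). \<forall>l\<in>set C. alpha_ok \<sigma> (map QAll (map (rel_ar D) [0..<M])) (5 * D) (snd l)"
proof -
  let ?P = "map QAll (map (rel_ar D) [0..<M])"
  have c: "0 < nconsts \<sigma>" "1 < nconsts \<sigma>" using voc by (auto simp: ordered_vocab_def)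
  have g: "alpha_ok \<sigma> ?P (5 * D) (snd (guard_lit s))" for s using c by (simp add: guard_lit_def)
  have l: "alpha_ok \<sigma> ?P (5 * D) (snd (to_lit \<sigma> D l))" if "nlit_ok \<sigma> D M l" for l
  proof (cases l)
    case (Rl s nm sl)
    have "\<forall>t\<in>set (concat (map (slot_terms D) sl)). trm_ok \<sigma> (5 * D) t"
      using slot_terms_ok(2)[OF voc D] that Rl by auto
    moreover have "length (concat (map (slot_terms D) sl)) = D * length (map (slot_terms D) sl)"
      by (rule sum_const_list) (use slot_terms_ok(1)[OF voc D] that Rl in auto)
    ultimately show ?thesis using that Rl by (simp add: rel_ar_def del: length_concat)
  next
    case (Bit s b g)
    then have b: "b \<in> set (blocks \<sigma>)" "block_arity \<sigma> b \<le> D" "g < 5" using that by auto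
    have "i < 5 * D" if "i < g * D + block_arity \<sigma> b" for i using group_bound[OF b(3), of i D] b(2) that by simp
    then show ?thesis using Bit b c blocks_iff by (cases b) auto
  qed
  have s: "\<forall>l\<in>set (succ_clause D j). alpha_ok \<sigma> ?P (5 * D) (snd l)" if "j < D" for j
  proof -
    have "\<forall>t\<in>set (lower D j @ upper D j). trm_ok \<sigma> (5 * D) t" "length (lower D j @ upper D j) = D * 2"
      using that D c by (auto simp: lower_def upper_def)
    then show ?thesis using voc that D M by (auto simp: succ_clause_def rel_ar_def ordered_vocab_def simp del: set_append length_append)
  qed
  have p: "\<forall>l\<in>set (pattern_clause \<sigma> \<beta>). alpha_ok \<sigma> ?P (5 * D) (snd l)" for \<beta>
    using c by (auto simp: pattern_clause_def)
  show ?thesis unfolding raw_clauses_def set_append ball_Un set_map ball_simps list.set set_upt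
    using g l cl s p by (simp del: alpha_ok.simps split_paired_All)
qed

section \<open>The clauses read as statements about numbers\<close>

context ordered
begin

definition sval :: "nat \<Rightarrow> (nat \<Rightarrow> nat) \<Rightarrow> slot \<Rightarrow> nat" where
  "sval D x s = (case s of Grp g \<Rightarrow> x g | Zero \<Rightarrow> 0 | Origin \<Rightarrow> (n - 1) * n ^ (D - 1)
     | Pad k g \<Rightarrow> x g div n ^ (D - k) | PadMax k \<Rightarrow> n ^ k - 1)"

text \<open>The bit of the encoding of \<open>nat_copy\<close> at entry \<open>y\<close> of block
  \<open>b\<close>.\<close>

definition bit :: "block \<Rightarrow> nat \<Rightarrow> bool" where
  "bit b y = block_val nat_copy b (map rank (tup (block_arity \<sigma> b) y))"

definition nholds :: "nat \<Rightarrow> (rname \<Rightarrow> nat list \<Rightarrow> bool) \<Rightarrow> (nat \<Rightarrow> nat) \<Rightarrow> nlit \<Rightarrow> bool" where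
  "nholds D R x l = (case l of Rl s nm sl \<Rightarrow> s = R nm (map (sval D x) sl)
     | Bit s b g \<Rightarrow> s = bit b (x g div n ^ (D - block_arity \<sigma> b)))"

definition groups :: "nat \<Rightarrow> (nat \<Rightarrow> nat) \<Rightarrow> nat \<Rightarrow> nat" where
  "groups D v g = N (map v [g * D..<g * D + D])"

lemma take_group:
  assumes "valid n D t" "k \<le> D"
  shows "N (take k t) = N t div n ^ (D - k)"
proof -
  have "N t = N (take k t) * n ^ (D - k) + N (drop k t)"
    using N_append[of "take k t" "drop k t"] assms by (simp add: valid_def)
  moreover have "N (drop k t) < n ^ (D - k)"
    by (rule N_less) (use assms in \<open>auto simp: valid_def dest: in_set_dropD\<close>)
  ultimately show ?thesis using n_pos by simp
qed

lemma valid_group: "\<forall>i<5 * D. v i < n \<Longrightarrow> g < 5 \<Longrightarrow> valid n D (map v [g * D..<g * D + D])"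
  using group_bound by (auto simp: valid_def)

lemma take_map_group: "k \<le> D \<Longrightarrow> take k (map v [g * D..<g * D + D]) = map v [g * D..<g * D + k]"
  by (simp add: take_map)

lemma slot_value:
  assumes D: "0 < D" and v: "\<forall>i<5 * D. v i < n" and s: "slot_ok D s"
  shows "valid n D (map (tval A v) (slot_terms D s))" "N (map (tval A v) (slot_terms D s)) = sval D (groups D v) s"
proof -
  have "\<forall>t\<in>set (slot_terms D s). tval A v t < n"
    using slot_terms_ok(2)[OF voc D s] tval_less[OF wfA _ v] by blast
  then show "valid n D (map (tval A v) (slot_terms D s))" using slot_terms_ok(1)[OF voc D s] by (simp add: valid_def)
  have G: "map (tval A v) (map V xs) = map v xs" for xs by simp
  show "N (map (tval A v) (slot_terms D s)) = sval D (groups D v) s"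
  proof (cases s)
    case (Grp g) then show ?thesis by (simp add: sval_def groups_def comp_def)
  next
    case Zero then show ?thesis by (simp add: sval_def N_min)
  next
    case Origin
    have "N (cst A 1 # replicate (D - 1) (cst A 0)) = N ([cst A 1] @ replicate (D - 1) (cst A 0))" by simp
    also have "\<dots> = (n - 1) * n ^ (D - 1)" unfolding N_append N_min using rank_max by (simp add: N_def)
    finally show ?thesis using Origin by (simp add: sval_def)
  next
    case (Pad k g)
    have "N (map v [g * D..<g * D + k]) = groups D v g div n ^ (D - k)"
      using take_group[OF valid_group[OF v], of g k] take_map_group[of k D v g] Pad s by (simp add: groups_def)
    then show ?thesis using Pad N_min by (simp add: sval_def N_append comp_def)
  next
    case (PadMax k)
    have "N (replicate k (cst A 1)) = n ^ k - 1" using N_max[of k] by simp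
    then show ?thesis using PadMax N_min by (simp add: sval_def N_append)
  qed
qed

lemma nholds_bit:
  assumes v: "\<forall>i<5 * D. v i < n" and ok: "nlit_ok \<sigma> D M (Bit s b g)"
  shows "lval A Is v (to_lit \<sigma> D (Bit s b g)) \<longleftrightarrow> nholds D R (groups D v) (Bit s b g)"
proof -
  let ?k = "block_arity \<sigma> b"
  have b: "b \<in> set (blocks \<sigma>)" "?k \<le> D" "g < 5" using ok by auto
  let ?t = "map v [g * D..<g * D + ?k]"
  have vt: "valid n ?k ?t" using v group_bound[OF b(3), of _ D] b(2) by (auto simp: valid_def)
  have "groups D v g div n ^ (D - ?k) = N ?t"
    using take_group[OF valid_group[OF v b(3)] b(2)] take_map_group[OF b(2), of v g] by (simp add: groups_def)
  then have bit: "bit b (groups D v g div n ^ (D - ?k)) = block_val nat_copy b (map rank ?t)"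
    using tup_N[OF vt] by (simp add: bit_def)
  have u: "map unrank (map rank ?t) = ?t" using vt unrank_rank by (auto simp: valid_def intro: map_idI)
  have r: "\<forall>x\<in>set (map rank ?t). x < n" using vt rank_less by (auto simp: valid_def)
  show ?thesis
  proof (cases b)
    case (BRel r)
    then have "r < length (rel_arity \<sigma>)" "length (map rank ?t) = rel_arity \<sigma> ! r" using b(1) blocks_iff by auto
    then have "rel nat_copy r (map rank ?t) \<longleftrightarrow> rel A r (map unrank (map rank ?t))"
      unfolding rel_nat_copy using r by blast
    then have "block_val nat_copy b (map rank ?t) \<longleftrightarrow> rel A r ?t" unfolding u using BRel by (simp only: block_val.simps)
    then show ?thesis unfolding nholds_def nlit.case bit using BRel by (auto simp: lval_def comp_def)
  next
    case (BCst c)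
    then have c: "c < nconsts \<sigma>" using b(1) blocks_iff by auto
    have t: "?t = [v (g * D)]" "v (g * D) < n" using vt BCst by (auto simp: valid_def)
    have "block_val nat_copy b (map rank ?t) \<longleftrightarrow> cst A c = v (g * D)"
      using rank_inj[OF cst_less[OF c] t(2)] t BCst by auto
    then show ?thesis unfolding nholds_def nlit.case bit using BCst by (auto simp: lval_def)
  next
    case BTrue then show ?thesis unfolding nholds_def nlit.case bit by (auto simp: lval_def)
  next
    case BFalse then show ?thesis unfolding nholds_def nlit.case bit by (auto simp: lval_def)
  qed
qed

lemma nholds_rel:
  assumes D: "0 < D" and v: "\<forall>i<5 * D. v i < n" and ok: "nlit_ok \<sigma> D M (Rl s nm sl)"
    and I: "\<And>xs. length xs = nargs nm \<Longrightarrow> \<forall>x\<in>set xs. x < n ^ D \<Longrightarrow> concat (map (tup D) xs) \<in> I (to_nat nm) \<longleftrightarrow> R nm xs"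
  shows "lval A (map I [0..<M]) v (to_lit \<sigma> D (Rl s nm sl)) \<longleftrightarrow> nholds D R (groups D v) (Rl s nm sl)"
proof -
  have sl: "map (map (tval A v)) (map (slot_terms D) sl) = map (tup D) (map (sval D (groups D v)) sl)"
    "\<forall>x\<in>set (map (sval D (groups D v)) sl). x < n ^ D"
  proof -
    have "map (tval A v) (slot_terms D s) = tup D (sval D (groups D v) s) \<and> sval D (groups D v) s < n ^ D" if "s \<in> set sl" for s
      using slot_value[OF D v, of s] ok that tup_N[of D "map (tval A v) (slot_terms D s)"] N_less[of D "map (tval A v) (slot_terms D s)"] by auto
    then show "map (map (tval A v)) (map (slot_terms D) sl) = map (tup D) (map (sval D (groups D v)) sl)"
      "\<forall>x\<in>set (map (sval D (groups D v)) sl). x < n ^ D" by auto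
  qed
  have "map (tval A v) (concat (map (slot_terms D) sl)) = concat (map (tup D) (map (sval D (groups D v)) sl))"
    unfolding map_concat sl(1) ..
  moreover have "length (map (sval D (groups D v)) sl) = nargs nm" using ok by simp
  ultimately show ?thesis using I[OF _ sl(2)] ok by (auto simp: lval_def nholds_def simp del: map_map)
qed

lemma nholds_cong:
  assumes "nlit_ok \<sigma> D M l" "\<And>g. g < 5 \<Longrightarrow> x g = y g"
  shows "nholds D R x l = nholds D R y l"
proof (cases l)
  case (Rl s nm sl)
  have "sval D x s = sval D y s" if "s \<in> set sl" for s
    using assms that Rl by (cases s) (auto simp: sval_def)
  then have "map (sval D x) sl = map (sval D y) sl" by simp
  then show ?thesis using Rl by (simp add: nholds_def del: map_eq_conv)
next
  case (Bit s b g) then show ?thesis using assms by (simp add: nholds_def)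
qed

lemma groups_surj:
  assumes D: "0 < D" and x: "\<forall>g<5. x g < n ^ D"
  shows "\<exists>v. (\<forall>i<5 * D. v i < n) \<and> (\<forall>g<5. groups D v g = x g)"
proof -
  define v where "v i = tup D (x (i div D)) ! (i mod D)" for i
  have t: "valid n D (tup D (x g))" "N (tup D (x g)) = x g" if "g < 5" for g using tup x that by auto
  have "v i < n" if "i < 5 * D" for i
  proof -
    have "i div D < 5" using that by (simp add: less_mult_imp_div_less)
    then show ?thesis using t(1)[of "i div D"] D by (auto simp: v_def valid_def)
  qed
  moreover have "map v [g * D..<g * D + D] = tup D (x g)" if "g < 5" for g
  proof (rule nth_equalityI)
    show "length (map v [g * D..<g * D + D]) = length (tup D (x g))" using t[OF that] by (simp add: valid_def)
    fix i assume "i < length (map v [g * D..<g * D + D])"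
    then show "map v [g * D..<g * D + D] ! i = tup D (x g) ! i" using D by (simp add: v_def)
  qed
  ultimately show ?thesis using t(2) by (intro exI[of _ v]) (auto simp: groups_def)
qed

text \<open>\<open>Sc\<close> has to contain all true successor facts but may hold elsewhere, since
  the clauses only produce facts for it.\<close>

definition numeric_model :: "nat \<Rightarrow> nlit list list \<Rightarrow> (rname \<Rightarrow> nat list \<Rightarrow> bool) \<Rightarrow> bool" where
  "numeric_model D cl R \<longleftrightarrow> (\<forall>x. Suc x < n ^ D \<longrightarrow> R Sc [x, Suc x]) \<and>
     (\<forall>x. (\<forall>g<5. x g < n ^ D) \<longrightarrow> (\<forall>C\<in>set cl. \<exists>l\<in>set C. nholds D R x l))"

text \<open>\<open>N\<close> and \<open>tup\<close> identify tuples of length \<open>D\<close> with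
  numbers below \<open>n ^ D\<close>, and relations on elements with relations on numbers. The scan
  sentence denies that relations satisfying the clauses exist, hence the negation.\<close>

theorem models_horn_formula:
  assumes D: "0 < D" and M: "to_nat Sc < M" and n2: "2 \<le> n"
    and cl: "\<forall>C\<in>set cl. \<forall>l\<in>set C. nlit_ok \<sigma> D M l"
  shows "models A (horn_formula \<sigma> D M cl pats) \<longleftrightarrow> \<not> (\<exists>R. numeric_model D cl R)"
proof -
  let ?L = "raw_clauses \<sigma> D cl pats"
  have c01: "cst A 0 \<noteq> cst A 1"
  proof
    assume "cst A 0 = cst A 1"
    then have "n - 1 = 0" using rank_min rank_max by metis
    then show False using n2 by simp
  qed
  have gF: "\<not> lval A Is v (guard_lit True)" "lval A Is v (guard_lit False)" for Is v
    using c01 by (simp_all add: guard_lit_def lval_def)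
  have raw: "(\<forall>C\<in>set ?L. \<exists>l\<in>set C. lval A Is v l) \<longleftrightarrow> (\<forall>C\<in>set cl. \<exists>l\<in>set C. lval A Is v (to_lit \<sigma> D l)) \<and>
    (\<forall>j<D. \<exists>l\<in>set (succ_clause D j). lval A Is v l)" for Is v
    unfolding raw_clauses_def set_append ball_Un set_map ball_simps bex_simps list.set set_upt using gF by auto
  have lower: "map (tval A v) (lower D j) = map v [0..<j] @ [v j] @ replicate (D - j - 1) (cst A 1)"
    "map (tval A v) (upper D j) = map v [0..<j] @ [v D] @ replicate (D - j - 1) (cst A 0)" for v j
    by (simp_all add: lower_def upper_def)
  have sc: "(\<exists>l\<in>set (succ_clause D j). lval A (map I [0..<M]) v l) \<longleftrightarrow> (rel A 1 [v j, v D] \<longrightarrow>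
      (map v [0..<j] @ [v j] @ replicate (D - j - 1) (cst A 1)) @ (map v [0..<j] @ [v D] @ replicate (D - j - 1) (cst A 0)) \<in> I (to_nat Sc))" for I v j
    using M unfolding succ_clause_def lval_def by (auto simp: lower[simplified])
  have D5: "D < 5 * D" using D by simp
  have "(\<exists>I. (\<forall>j<M. I j \<in> rels_over A (rel_ar D j)) \<and>
    (\<forall>v. (\<forall>i<5 * D. v i < n) \<longrightarrow> (\<forall>C\<in>set ?L. \<exists>l\<in>set C. lval A (map I [0..<M]) v l))) \<longleftrightarrow> (\<exists>R. numeric_model D cl R)"
  proof
    assume "\<exists>I. (\<forall>j<M. I j \<in> rels_over A (rel_ar D j)) \<and>
      (\<forall>v. (\<forall>i<5 * D. v i < n) \<longrightarrow> (\<forall>C\<in>set ?L. \<exists>l\<in>set C. lval A (map I [0..<M]) v l))"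
    then obtain I where I: "\<And>v C. \<forall>i<5 * D. v i < n \<Longrightarrow> (\<forall>C\<in>set cl. \<exists>l\<in>set C. lval A (map I [0..<M]) v (to_lit \<sigma> D l))"
      "\<And>v j. \<forall>i<5 * D. v i < n \<Longrightarrow> j < D \<Longrightarrow> rel A 1 [v j, v D] \<Longrightarrow>
      (map v [0..<j] @ [v j] @ replicate (D - j - 1) (cst A 1)) @ (map v [0..<j] @ [v D] @ replicate (D - j - 1) (cst A 0)) \<in> I (to_nat Sc)"
      unfolding raw sc by blast
    define R where "R nm xs \<longleftrightarrow> concat (map (tup D) xs) \<in> I (to_nat nm)" for nm :: rname and xs
    have "R Sc [x, Suc x]" if x: "Suc x < n ^ D" for x
    proof -
      have t: "valid n D (tup D x)" "N (tup D x) = x" "valid n D (tup D (Suc x))" "N (tup D (Suc x)) = Suc x"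
        using tup[of x D] tup[of "Suc x" D] x by auto
      obtain j a b where j: "j < D" "a < n" "b < n" "rel A 1 [a, b]" "tup D x = take j (tup D x) @ [a] @ replicate (D - j - 1) (cst A 1)"
        "tup D (Suc x) = take j (tup D x) @ [b] @ replicate (D - j - 1) (cst A 0)"
        using N_succ_split[OF t(1,3)] t(2,4) by auto
      define v where "v = (\<lambda>i. if i < D then tup D x ! i else b)"
      have vn: "\<forall>i<5 * D. v i < n" using t(1) j by (auto simp: v_def valid_def)
      have vj: "map v [0..<j] = take j (tup D x)" using t(1) j(1) by (auto simp: v_def valid_def list_eq_iff_nth_eq)
      have "tup D x ! j = a" using j(1) t(1) by (subst j(5)) (simp add: nth_append valid_def)
      then have va: "v j = a" "v D = b" using j(1) by (auto simp: v_def)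
      have "tup D x @ tup D (Suc x) \<in> I (to_nat Sc)" using I(2)[OF vn j(1)] va vj j(4-6) by metis
      then show ?thesis by (simp add: R_def)
    qed
    moreover have "\<exists>l\<in>set C. nholds D R x l" if x: "\<forall>g<5. x g < n ^ D" and C: "C \<in> set cl" for x C
    proof -
      obtain v where v: "\<forall>i<5 * D. v i < n" "\<forall>g<5. groups D v g = x g" using groups_surj[OF D x] by blast
      obtain l where l: "l \<in> set C" "lval A (map I [0..<M]) v (to_lit \<sigma> D l)" using I(1)[OF v(1)] C by blast
      have ok: "nlit_ok \<sigma> D M l" using cl C l(1) by blast
      have "nholds D R (groups D v) l"
      proof (cases l)
        case (Rl s nm sl)
        then show ?thesis using nholds_rel[OF D v(1), of M s nm sl I R] ok l(2) by (simp add: R_def)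
      next
        case (Bit s b g)
        then show ?thesis using nholds_bit[OF v(1)] ok l(2) by blast
      qed
      then show ?thesis using nholds_cong[OF ok, of "groups D v" x] v(2) l(1) by blast
    qed
    ultimately show "\<exists>R. numeric_model D cl R" unfolding numeric_model_def by blast
  next
    assume "\<exists>R. numeric_model D cl R"
    then obtain R where R: "\<And>x. Suc x < n ^ D \<Longrightarrow> R Sc [x, Suc x]"
      "\<And>x C. \<forall>g<5. x g < n ^ D \<Longrightarrow> C \<in> set cl \<Longrightarrow> \<exists>l\<in>set C. nholds D R x l" unfolding numeric_model_def by blast
    define I where "I j = {t. \<exists>xs. length xs = nargs (from_nat j) \<and> (\<forall>x\<in>set xs. x < n ^ D) \<and> t = concat (map (tup D) xs) \<and> R (from_nat j) xs}" for j
    have vl: "\<forall>t\<in>set (map (tup D) xs). valid n D t" if "\<forall>x\<in>set xs. x < n ^ D" for xs using tup that by auto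
    have Ir: "I j \<in> rels_over A (rel_ar D j)" for j
    proof -
      have "length t = rel_ar D j \<and> (\<forall>x\<in>set t. x < n)" if tI: "t \<in> I j" for t
      proof -
        obtain xs where xs: "length xs = nargs (from_nat j)" "\<forall>x\<in>set xs. x < n ^ D" "t = concat (map (tup D) xs)"
          using tI by (auto simp: I_def)
        have "length t = D * length (map (tup D) xs)" unfolding xs(3)
          by (rule sum_const_list) (use vl[OF xs(2)] in \<open>auto simp: valid_def\<close>)
        then show ?thesis using xs vl[OF xs(2)] by (auto simp: rel_ar_def valid_def)
      qed
      then show ?thesis by (auto simp: rels_over_def)
    qed
    have inI: "concat (map (tup D) xs) \<in> I (to_nat nm) \<longleftrightarrow> R nm xs"
      if xs: "length xs = nargs nm" "\<forall>x\<in>set xs. x < n ^ D" for nm xs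
    proof
      assume "concat (map (tup D) xs) \<in> I (to_nat nm)"
      then obtain ys where ys: "length ys = nargs nm" "\<forall>x\<in>set ys. x < n ^ D"
        "concat (map (tup D) xs) = concat (map (tup D) ys)" "R nm ys" by (auto simp: I_def)
      \<comment> \<open>All pieces have length \<open>D\<close>, so the concatenation determines
        them.\<close>
      have "map (tup D) xs = map (tup D) ys"
      proof (rule concat_injective[OF ys(3)])
        show "length (map (tup D) xs) = length (map (tup D) ys)" using xs ys by simp
        show "\<forall>(x, y)\<in>set (zip (map (tup D) xs) (map (tup D) ys)). length x = length y"
        proof clarify
          fix x y assume z: "(x, y) \<in> set (zip (map (tup D) xs) (map (tup D) ys))"
          show "length x = length y"
            using bspec[OF vl[OF xs(2)] set_zip_leftD[OF z]] bspec[OF vl[OF ys(2)] set_zip_rightD[OF z]] by (simp add: valid_def)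
        qed
      qed
      then have "map N (map (tup D) xs) = map N (map (tup D) ys)" by simp
      moreover have "map N (map (tup D) zs) = zs" if "\<forall>x\<in>set zs. x < n ^ D" for zs
        using tup that by (auto intro: map_idI)
      ultimately have "xs = ys" using xs(2) ys(2) by metis
      then show "R nm xs" using ys by simp
    qed (use that in \<open>auto simp: I_def\<close>)
    show "\<exists>I. (\<forall>j<M. I j \<in> rels_over A (rel_ar D j)) \<and>
      (\<forall>v. (\<forall>i<5 * D. v i < n) \<longrightarrow> (\<forall>C\<in>set ?L. \<exists>l\<in>set C. lval A (map I [0..<M]) v l))"
      unfolding raw sc
    proof (intro exI[of _ I] conjI allI impI ballI)
      show "I j \<in> rels_over A (rel_ar D j)" for j by (rule Ir)
      fix v :: "nat \<Rightarrow> nat" assume v: "\<forall>i<5 * D. v i < n"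
      {
        fix C assume C: "C \<in> set cl"
        have "\<forall>g<5. groups D v g < n ^ D" using valid_group[OF v] N_less by (auto simp: groups_def)
        then obtain l where l: "l \<in> set C" "nholds D R (groups D v) l" using R(2) C by blast
        have ok: "nlit_ok \<sigma> D M l" using cl C l(1) by blast
        have "lval A (map I [0..<M]) v (to_lit \<sigma> D l)"
        proof (cases l)
          case (Rl s nm sl)
          then show ?thesis using nholds_rel[OF D v, of M s nm sl I R] inI ok l(2) by blast
        next
          case (Bit s b g)
          then show ?thesis using nholds_bit[OF v] ok l(2) by blast
        qed
        then show "\<exists>l\<in>set C. lval A (map I [0..<M]) v (to_lit \<sigma> D l)" using l(1) by blast
      }
      fix j assume j: "j < D" and r: "rel A 1 [v j, v D]"
      let ?s = "map v [0..<j] @ [v j] @ replicate (D - j - 1) (cst A 1)" and ?t = "map v [0..<j] @ [v D] @ replicate (D - j - 1) (cst A 0)"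
      have vs: "valid n D ?s" "valid n D ?t" using v j cst01 D5 by (auto simp: valid_def)
      have "v j < n" "v D < n" using v j D5 by auto
      then have "N ?t = Suc (N ?s)" using N_succ succ_rank r by blast
      then have "R Sc [N ?s, N ?t]" using R(1)[of "N ?s"] N_less[OF vs(2)] by simp
      then have "concat (map (tup D) [N ?s, N ?t]) \<in> I (to_nat Sc)"
        using inI[of "[N ?s, N ?t]" Sc] N_less[OF vs(1)] N_less[OF vs(2)] by simp
      then show "?s @ ?t \<in> I (to_nat Sc)" using tup_N[OF vs(1)] tup_N[OF vs(2)] by simp
    qed
  qed
  then show ?thesis unfolding horn_formula_def models_scan[OF raw_ok[OF voc D M cl]] by simp
qed

theorem models_horn_formula_one:
  assumes D: "0 < D" and M: "to_nat Sc < M" and n1: "n = 1"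
    and cl: "\<forall>C\<in>set cl. \<forall>l\<in>set C. nlit_ok \<sigma> D M l" and pats: "\<forall>\<beta>\<in>set pats. length \<beta> = length (rel_arity \<sigma>)"
  shows "models A (horn_formula \<sigma> D M cl pats) \<longleftrightarrow> map (\<lambda>r. rel A r (replicate (rel_arity \<sigma> ! r) 0)) [0..<length (rel_arity \<sigma>)] \<in> set pats"
proof -
  let ?L = "raw_clauses \<sigma> D cl pats"
  let ?p = "map (\<lambda>r. rel A r (replicate (rel_arity \<sigma> ! r) 0)) [0..<length (rel_arity \<sigma>)]"
  have c0: "cst A 0 = 0" "cst A 1 = 0" using cst01 n1 by auto
  have gF: "lval A Is v (guard_lit True)" "\<not> lval A Is v (guard_lit False)" for Is v
    using c0 by (simp_all add: guard_lit_def lval_def)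
  have p: "(\<exists>l\<in>set (pattern_clause \<sigma> \<beta>). lval A Is v l) \<longleftrightarrow> \<beta> \<noteq> ?p" if "length \<beta> = length (rel_arity \<sigma>)" for \<beta> Is v
  proof -
    have e: "lval A Is v (\<not> \<beta> ! r, Rel r (replicate k (C 0))) \<longleftrightarrow> \<beta> ! r \<noteq> rel A r (replicate k 0)" for r k
      by (simp add: lval_def c0(1))
    have "(\<exists>l\<in>set (pattern_clause \<sigma> \<beta>). lval A Is v l) \<longleftrightarrow>
        (\<exists>r<length (rel_arity \<sigma>). \<beta> ! r \<noteq> rel A r (replicate (rel_arity \<sigma> ! r) 0))"
      unfolding pattern_clause_def set_map bex_simps set_upt e by (simp add: Bex_def)
    also have "\<dots> \<longleftrightarrow> \<not> (length \<beta> = length ?p \<and> (\<forall>i<length \<beta>. \<beta> ! i = ?p ! i))" using that by simp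
    also have "\<dots> \<longleftrightarrow> \<beta> \<noteq> ?p" using list_eq_iff_nth_eq[of \<beta> ?p] by argo
    finally show ?thesis .
  qed
  have raw: "(\<forall>C\<in>set ?L. \<exists>l\<in>set C. lval A Is v l) \<longleftrightarrow> ?p \<notin> set pats" for Is v
  proof -
    have "(\<forall>C\<in>set ?L. \<exists>l\<in>set C. lval A Is v l) \<longleftrightarrow> (\<forall>\<beta>\<in>set pats. \<exists>l\<in>set (pattern_clause \<sigma> \<beta>). lval A Is v l)"
      unfolding raw_clauses_def set_append ball_Un set_map ball_simps bex_simps list.set set_upt using gF by auto
    also have "\<dots> \<longleftrightarrow> (\<forall>\<beta>\<in>set pats. \<beta> \<noteq> ?p)" using p pats by blast
    finally show ?thesis by blast
  qed
  have "\<exists>I. \<forall>j<M. I j \<in> rels_over A (rel_ar D j)" using empty_rels_over by (intro exI[of _ "\<lambda>_. {}"]) auto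
  moreover have "\<exists>v. \<forall>i<5 * D. v i < n" using n_pos by (intro exI[of _ "\<lambda>_. 0"]) auto
  ultimately show ?thesis unfolding horn_formula_def models_scan[OF raw_ok[OF voc D M cl]] raw by blast
qed

end

lemma horn_formula_Pi12:
  "ordered_vocab \<sigma> \<Longrightarrow> 0 < D \<Longrightarrow> to_nat Sc < M \<Longrightarrow> \<forall>C\<in>set cl. \<forall>l\<in>set C. nlit_ok \<sigma> D M l \<Longrightarrow>
   horn_formula \<sigma> D M cl pats \<in> Pi12_EKROM \<sigma>"
  unfolding horn_formula_def by (intro scan_Pi12 raw_ok)

section \<open>Clauses that describe the input, the clock and the run of a machine\<close>

section \<open>Horn description of a computation\<close>

definition imp :: "(rname \<times> slot list) list \<Rightarrow> nlit list \<Rightarrow> nlit list" where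
  "imp ps qs = map (\<lambda>(nm, sl). Rl False nm sl) ps @ qs"

abbreviation G0 :: slot where "G0 \<equiv> Grp 0"
abbreviation G1 :: slot where "G1 \<equiv> Grp 1"
abbreviation G2 :: slot where "G2 \<equiv> Grp 2"
abbreviation G3 :: slot where "G3 \<equiv> Grp 3"
abbreviation G4 :: slot where "G4 \<equiv> Grp 4"

type_synonym trans = "nat \<times> nat \<times> nat \<times> nat \<times> int"

text \<open>Contains every state that a run can enter, just as \<open>symbols\<close> contains every
  symbol that it can scan. The clauses excluding all wrong values thus form a finite list.\<close>

definition states :: "ntm \<Rightarrow> trans list \<Rightarrow> nat list" where
  "states T dl = 0 # acc_state T # map (\<lambda>(q, s, q', b, m). q') dl"

definition symbols :: "trans list \<Rightarrow> nat list" where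
  "symbols dl = 0 # 1 # 2 # map (\<lambda>(q, s, q', b, m). b) dl"

(* The clauses force the relations to contain the intended facts but not to be exact, which suffices since the final
   clauses forbid the run to be in a state other than the accepting one at time T. Origin lies far enough from both
   ends of the tape that the head cannot leave it within the time bound. *)
definition arith_clauses :: "nat \<Rightarrow> nat \<Rightarrow> nlit list list" where
  "arith_clauses a d = [
     imp [(Sc, [G0, G1])] [Rl True Lt [G0, G1]],
     imp [(Lt, [G0, G1]), (Sc, [G1, G2])] [Rl True Lt [G0, G2]],
     imp [] [Rl True Ad [G0, Zero, G0]],
     imp [(Ad, [G0, G1, G2]), (Sc, [G1, G3]), (Sc, [G2, G4])] [Rl True Ad [G0, G3, G4]],
     imp [] [Rl True Mu [G0, Zero, Zero]],
     imp [(Mu, [G0, G1, G2]), (Ad, [G2, G0, G3]), (Sc, [G1, G4])] [Rl True Mu [G0, G4, G3]],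
     imp [(RS, [G0]), (Ad, [Origin, G1, G0]), (Sc, [G1, G2])] [Rl True Ln [G2]],
     imp [(Sc, [Zero, G0])] [Rl True (Vl 0) [G0]],
     imp [] [Rl True (Kn 0) [Zero]],
     imp [(Vl d, [G0]), (Kn a, [G1]), (Mu, [G0, G1, G2])] [Rl True Dl [G2]]] @
   map (\<lambda>j. imp [(Vl j, [G0]), (Ln, [G1]), (Mu, [G0, G1, G2])] [Rl True (Vl (Suc j)) [G2]]) [0..<d] @
   map (\<lambda>i. imp [(Kn i, [G0]), (Sc, [G0, G1])] [Rl True (Kn (Suc i)) [G1]]) [0..<a]"

text \<open>Lays the encoding out on the tape from \<open>Origin\<close> on. Within a block the
  entry and the cell advance together, and the last entry, \<open>PadMax\<close>, hands over to
  entry 0 of the next block; a block of arity 0 has the single entry 0.\<close>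

definition input_clauses :: "vocab \<Rightarrow> nlit list list" where
  "input_clauses \<sigma> = (let bs = blocks \<sigma>; nb = length bs in [
     imp [] [Rl True (Pos 0) [Zero, Origin]],
     imp [(Sc, [G0, Origin])] [Rl True Lft [G0]],
     imp [(Lft, [G1]), (Sc, [G0, G1])] [Rl True Lft [G0]],
     imp [(Rgt, [G0]), (Sc, [G0, G1])] [Rl True Rgt [G1]],
     imp [(Rgt, [G0])] [Rl True (Tp 0) [Zero, G0]],
     imp [(Lft, [G0])] [Rl True (Tp 0) [Zero, G0]],
     imp [(Pos (nb - 1), [PadMax (block_arity \<sigma> (bs ! (nb - 1))), G0]), (Sc, [G0, G1])] [Rl True Rgt [G1]],
     imp [(Pos (nb - 1), [PadMax (block_arity \<sigma> (bs ! (nb - 1))), G0]), (Sc, [G0, G1])] [Rl True RS [G1]]] @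
   map (\<lambda>b. let k = block_arity \<sigma> (bs ! b) in
     imp [(Pos b, [Pad k 0, G2]), (Sc, [Pad k 0, Pad k 1]), (Sc, [G2, G3])] [Rl True (Pos b) [Pad k 1, G3]]) [0..<nb] @
   map (\<lambda>b. imp [(Pos b, [PadMax (block_arity \<sigma> (bs ! b)), G0]), (Sc, [G0, G1])] [Rl True (Pos (Suc b)) [Zero, G1]]) [0..<nb - 1] @
   map (\<lambda>b. imp [(Pos b, [Pad (block_arity \<sigma> (bs ! b)) 0, G2])] [Bit False (bs ! b) 0, Rl True (Tp 2) [Zero, G2]]) [0..<nb] @
   map (\<lambda>b. imp [(Pos b, [Pad (block_arity \<sigma> (bs ! b)) 0, G2])] [Bit True (bs ! b) 0, Rl True (Tp 1) [Zero, G2]]) [0..<nb])"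

definition move_clause :: "nat \<Rightarrow> int \<Rightarrow> nlit list" where
  "move_clause i m = (if m = 1 then imp [(Tr i, [G0]), (Sc, [G0, G2]), (Hd, [G0, G1]), (Sc, [G1, G3])] [Rl True Hd [G2, G3]]
     else if m = -1 then imp [(Tr i, [G0]), (Sc, [G0, G2]), (Hd, [G0, G1]), (Sc, [G3, G1])] [Rl True Hd [G2, G3]]
     else imp [(Tr i, [G0]), (Sc, [G0, G2]), (Hd, [G0, G1])] [Rl True Hd [G2, G1]])"

text \<open>The condition of a transition is enforced negatively: it is forbidden while a wrong
  state or a wrong scanned symbol is recorded. As all true facts are recorded, a misfit is always
  detected, and the exact run violates nothing.\<close>

definition trans_clauses :: "ntm \<Rightarrow> trans list \<Rightarrow> nat \<Rightarrow> nlit list list" where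
  "trans_clauses T dl i = (case dl ! i of (q, s, q', b, m) \<Rightarrow>
     map (\<lambda>r. imp [(Tr i, [G0]), (St r, [G0])] []) (filter (\<lambda>r. r \<noteq> q) (states T dl)) @
     map (\<lambda>c. imp [(Tr i, [G0]), (Hd, [G0, G1]), (Tp c, [G0, G1])] []) (filter (\<lambda>c. c \<noteq> s) (symbols dl)) @
     [imp [(Tr i, [G0]), (Sc, [G0, G2])] [Rl True (St q') [G2]],
      imp [(Tr i, [G0]), (Sc, [G0, G2]), (Hd, [G0, G1])] [Rl True (Tp b) [G2, G1]],
      move_clause i m])"

text \<open>Index \<open>L\<close>, one past the last transition, means halting and is allowed in
  the accepting state only, so that a shorter run can idle until time \<open>T\<close>.
  \<open>Lt\<close> on either side of the head replaces an inequality of cells.\<close>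

definition run_clauses :: "ntm \<Rightarrow> trans list \<Rightarrow> nlit list list" where
  "run_clauses T dl = (let L = length dl in [
     imp [] [Rl True (St 0) [Zero]],
     imp [] [Rl True Hd [Zero, Origin]],
     map (\<lambda>i. Rl True (Tr i) [G0]) [0..<Suc L]] @
   concat (map (trans_clauses T dl) [0..<L]) @
   map (\<lambda>r. imp [(Tr L, [G0]), (St r, [G0])] []) (filter (\<lambda>r. r \<noteq> acc_state T) (states T dl)) @
   map (\<lambda>c. imp [(Hd, [G0, G1]), (Sc, [G0, G2]), (Tp c, [G0, G3]), (Lt, [G3, G1])] [Rl True (Tp c) [G2, G3]]) (symbols dl) @
   map (\<lambda>c. imp [(Hd, [G0, G1]), (Sc, [G0, G2]), (Tp c, [G0, G3]), (Lt, [G1, G3])] [Rl True (Tp c) [G2, G3]]) (symbols dl) @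
   map (\<lambda>r. imp [(Dl, [G0]), (St r, [G0])] []) (filter (\<lambda>r. r \<noteq> acc_state T) (states T dl)))"

definition machine_clauses :: "vocab \<Rightarrow> ntm \<Rightarrow> trans list \<Rightarrow> nat \<Rightarrow> nat \<Rightarrow> nlit list list" where
  "machine_clauses \<sigma> T dl a d = arith_clauses a d @ input_clauses \<sigma> @ run_clauses T dl"

fun lit_name :: "nlit \<Rightarrow> nat" where
  "lit_name (Rl s nm sl) = to_nat nm"
| "lit_name (Bit s b g) = 0"

fun shape_ok :: "vocab \<Rightarrow> nat \<Rightarrow> nlit \<Rightarrow> bool" where
  "shape_ok \<sigma> D (Rl s nm sl) = (length sl = nargs nm \<and> list_all (slot_ok D) sl)"
| "shape_ok \<sigma> D (Bit s b g) = (b \<in> set (blocks \<sigma>) \<and> block_arity \<sigma> b \<le> D \<and> g < 5)"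

lemma nlit_ok_shape: "shape_ok \<sigma> D l \<Longrightarrow> lit_name l < M \<Longrightarrow> nlit_ok \<sigma> D M l"
  by (cases l) (auto simp: list_all_iff)

lemma list_all_concat: "list_all P (concat xss) \<longleftrightarrow> list_all (list_all P) xss"
  by (induction xss) auto

lemma list_all_upt: "(\<And>i. i < n \<Longrightarrow> P (f i)) \<Longrightarrow> list_all P (map f [0..<n])"
  by (simp add: list_all_iff)

lemma shape_imp: "list_all (shape_ok \<sigma> D) (imp ps qs) \<longleftrightarrow>
    list_all (\<lambda>(nm, sl). length sl = nargs nm \<and> list_all (slot_ok D) sl) ps \<and> list_all (shape_ok \<sigma> D) qs"
  by (induction ps) (auto simp: imp_def)

lemma machine_clauses_shape:
  assumes D: "\<forall>b\<in>set (blocks \<sigma>). block_arity \<sigma> b \<le> D"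
  shows "list_all (list_all (shape_ok \<sigma> D)) (machine_clauses \<sigma> T dl a d)"
proof -
  have ar: "block_arity \<sigma> (blocks \<sigma> ! b) \<le> D \<and> blocks \<sigma> ! b \<in> set (blocks \<sigma>)" if "b < length (blocks \<sigma>)" for b
    using D that by auto
  have nb: "0 < length (blocks \<sigma>)" by (simp add: blocks_def)
  have arl: "block_arity \<sigma> (blocks \<sigma> ! (length (blocks \<sigma>) - Suc 0)) \<le> D"
    using ar[of "length (blocks \<sigma>) - Suc 0"] nb by simp
  have 1: "list_all (list_all (shape_ok \<sigma> D)) (arith_clauses a d)"
    unfolding arith_clauses_def list_all_append
    by (intro conjI list_all_upt; simp add: shape_imp)
  have 2: "list_all (list_all (shape_ok \<sigma> D)) (input_clauses \<sigma>)"
    unfolding input_clauses_def list_all_append Let_def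
    by (intro conjI list_all_upt; simp add: shape_imp ar arl)
  have 3: "list_all (list_all (shape_ok \<sigma> D)) (run_clauses T dl)"
    unfolding run_clauses_def list_all_append list_all_concat Let_def
    by (intro conjI list_all_upt; simp add: shape_imp list_all_iff[of _ "map _ _"] trans_clauses_def move_clause_def split: prod.split)
  show ?thesis using 1 2 3 by (simp add: machine_clauses_def)
qed

lemma machine_clauses_ok:
  assumes "\<forall>b\<in>set (blocks \<sigma>). block_arity \<sigma> b \<le> D"
    and "cl \<in> set (machine_clauses \<sigma> T dl a d)" "l \<in> set cl" "lit_name l < M"
  shows "nlit_ok \<sigma> D M l"
  using machine_clauses_shape[OF assms(1), of T dl a d] assms(2-4) nlit_ok_shape by (auto simp: list_all_iff)

section \<open>The numbers that occur in a run\<close>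

locale fagin = ordered +
  fixes Tm :: ntm and dl :: "trans list" and a d D :: nat
  assumes n2: "2 \<le> n" and dl: "set dl = {t \<in> delta Tm. snd (snd (snd (snd t))) \<in> {-1, 0, 1}}"
    and D0: "0 < D" and Dar: "\<forall>b\<in>set (blocks \<sigma>). block_arity \<sigma> b \<le> D"
    and big: "length (enc \<sigma> nat_copy) + 1 + a * (length (enc \<sigma> nat_copy) + 1) ^ d + (length (enc \<sigma> nat_copy) + 1) ^ d + a + 2 \<le> n ^ (D - 1)"
begin

definition w :: "bool list" where "w = enc \<sigma> nat_copy"
definition len :: nat where "len = length w"
definition T :: nat where "T = a * (len + 1) ^ d"
definition top :: nat where "top = n ^ D"
definition s0 :: nat where "s0 = (n - 1) * n ^ (D - 1)"
definition off :: "nat \<Rightarrow> nat" where "off b = offset \<sigma> n b"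
definition nb :: nat where "nb = length (blocks \<sigma>)"
definition ka :: "nat \<Rightarrow> nat" where "ka b = block_arity \<sigma> (blocks \<sigma> ! b)"
definition tape0 :: "int \<Rightarrow> nat" where "tape0 = fst (snd (init_conf w))"

abbreviation "CL \<equiv> machine_clauses \<sigma> Tm dl a d"

lemma top_eq: "top = s0 + n ^ (D - 1)"
proof -
  have "n ^ D = n * n ^ (D - 1)" using D0 by (cases D) auto
  then show ?thesis using n2 by (cases n) (auto simp: top_def s0_def)
qed

lemma big': "len + 1 + T + (len + 1) ^ d + a + 2 \<le> n ^ (D - 1)"
  using big by (simp add: len_def w_def T_def)

lemma s0_ge: "n ^ (D - 1) \<le> s0"
  using n2 by (simp add: s0_def)

text \<open>\<open>Origin\<close> is \<open>s0\<close>, with greatest leading digit and zeros behind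
  it. It lies at least \<open>n ^ (D - 1)\<close> above 0, because \<open>n \<ge> 2\<close>, and
  exactly that far below \<open>top\<close>; by \<open>big'\<close> this exceeds both the input
  length and the running time.\<close>

lemma bounds: "0 < top" "T < top" "len + 1 < top" "(len + 1) ^ d < top" "a < top" "s0 + len + 1 < top" "T < s0" "s0 + T < top" "s0 < top"
  using big' s0_ge top_eq by linarith+

lemma nb_pos: "0 < nb"
  by (simp add: nb_def blocks_def)

lemma off_Suc: "b < nb \<Longrightarrow> off (Suc b) = off b + n ^ ka b"
  by (simp add: off_def offset_def nb_def ka_def take_Suc_conv_app_nth)

lemma off_0: "off 0 = 0"
  by (simp add: off_def offset_def)

lemma off_nb: "off nb = len"
  by (simp add: off_def offset_def nb_def len_def w_def enc_blocks length_concat comp_def)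

lemma ka_le: "b < nb \<Longrightarrow> ka b \<le> D"
  using Dar by (simp add: nb_def ka_def)

lemma off_mono: "b < nb \<Longrightarrow> y < n ^ ka b \<Longrightarrow> off b + y < len"
proof -
  assume b: "b < nb" "y < n ^ ka b"
  have m: "off b' \<le> off nb" if "b' \<le> nb" for b'
    using that by (induction rule: inc_induct) (simp, metis off_Suc add_leD1)
  show ?thesis using m[of "Suc b"] off_Suc[OF b(1)] b off_nb by simp
qed

lemma off_cases: "p < len \<Longrightarrow> \<exists>b<nb. \<exists>y<n ^ ka b. p = off b + y"
proof -
  assume p: "p < len"
  have "p < off b \<Longrightarrow> b \<le> nb \<Longrightarrow> \<exists>b'<nb. \<exists>y<n ^ ka b'. p = off b' + y" for b
  proof (induction b)
    case 0 then show ?case by (simp add: off_0)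
  next
    case (Suc b)
    show ?case
    proof (cases "p < off b")
      case True then show ?thesis using Suc by simp
    next
      case False
      then have "p - off b < n ^ ka b" "p = off b + (p - off b)" using Suc.prems off_Suc[of b] by auto
      then show ?thesis using Suc.prems(2) by (metis Suc_le_lessD)
    qed
  qed
  from this[of nb] show ?thesis using p off_nb by simp
qed

lemma bit_enc: "b < nb \<Longrightarrow> y < n ^ ka b \<Longrightarrow> w ! (off b + y) = bit (blocks \<sigma> ! b) y"
proof -
  assume b: "b < nb" "y < n ^ ka b"
  let ?t = "map rank (tup (ka b) y)"
  have t: "valid n (ka b) (tup (ka b) y)" "N (tup (ka b) y) = y" using tup b(2) by auto
  have "enc \<sigma> nat_copy ! (offset \<sigma> (univ_size nat_copy) b + num (univ_size nat_copy) ?t) = block_val nat_copy (blocks \<sigma> ! b) ?t"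
    by (rule enc_nth) (use b t rank_less in \<open>auto simp: nb_def ka_def valid_def\<close>)
  moreover have "num n ?t = y" using t(2) by (simp add: N_def)
  ultimately show ?thesis by (simp add: w_def off_def bit_def ka_def)
qed

lemma tape0_in: "p < len \<Longrightarrow> tape0 (int p) = (if w ! p then 2 else 1)"
  and tape0_out: "i < 0 \<or> int len \<le> i \<Longrightarrow> tape0 i = 0"
  by (auto simp: tape0_def init_conf_def len_def)

lemma init_tape0: "init_conf w = (0, tape0, 0)"
  by (simp add: tape0_def init_conf_def)

lemma imp_holds: "(\<exists>l\<in>set (imp ps qs). nholds D R x l) \<longleftrightarrow>
    ((\<forall>(nm, sl)\<in>set ps. R nm (map (sval D x) sl)) \<longrightarrow> (\<exists>l\<in>set qs. nholds D R x l))"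
  by (induction ps) (auto simp: imp_def nholds_def)

lemma nholds_simps:
  "nholds D R x (Rl s nm sl) = (s = R nm (map (sval D x) sl))"
  "nholds D R x (Bit s b g) = (s = bit b (x g div n ^ (D - block_arity \<sigma> b)))"
  by (simp_all add: nholds_def)

lemma sval_simps:
  "sval D x (Grp g) = x g" "sval D x Zero = 0" "sval D x Origin = s0"
  "sval D x (Pad k g) = x g div n ^ (D - k)" "sval D x (PadMax k) = n ^ k - 1"
  by (simp_all add: sval_def s0_def)

text \<open>Every number of \<open>k\<close> digits arises from a group, by appending zeros;
  \<open>Pad\<close> recovers it as the leading digits.\<close>

lemma pad_div: "k \<le> D \<Longrightarrow> y < n ^ k \<Longrightarrow> y * n ^ (D - k) < top \<and> y * n ^ (D - k) div n ^ (D - k) = y"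
proof -
  assume k: "k \<le> D" "y < n ^ k"
  have "y * n ^ (D - k) < n ^ k * n ^ (D - k)" using k n_pos by simp
  also have "\<dots> = top" using k(1) by (simp add: top_def flip: power_add)
  finally show ?thesis using n_pos by simp
qed

end

section \<open>A numeric model yields an accepting run\<close>

context fagin
begin

lemma blocks_nb: "length (blocks \<sigma>) = nb"
  by (simp add: nb_def)

lemmas in_CL = machine_clauses_def arith_clauses_def input_clauses_def run_clauses_def Let_def
lemmas evals = nholds_simps sval_simps

context
  fixes R assumes mod: "numeric_model D CL R"
begin

lemma Sc: "Suc x < top \<Longrightarrow> R Sc [x, Suc x]"
  using mod by (simp add: numeric_model_def top_def)

text \<open>The form in which clauses are applied from here on: \<open>xs\<close> lists the values
  of the five groups, with 0 for groups that a clause does not mention.\<close>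

lemma fire:
  assumes "imp ps qs \<in> set CL" "length xs = 5" "\<forall>x\<in>set xs. x < top"
    and "list_all (\<lambda>(nm, sl). R nm (map (sval D ((!) xs)) sl)) ps"
  shows "\<exists>l\<in>set qs. nholds D R ((!) xs) l"
proof -
  have "\<forall>g<5. xs ! g < n ^ D" using assms(2,3) by (auto simp: top_def)
  then have "\<exists>l\<in>set (imp ps qs). nholds D R ((!) xs) l" using mod assms(1) unfolding numeric_model_def by blast
  then show ?thesis using assms(4) unfolding imp_holds list_all_iff by blast
qed

lemma Lt: "x < y \<Longrightarrow> y < top \<Longrightarrow> R Lt [x, y]"
proof (induction y)
  case (Suc y)
  have s: "R Sc [y, Suc y]" using Sc Suc.prems by simp
  show ?case
  proof (cases "x = y")
    case True
    then show ?thesis using fire[of "[(Sc, [G0, G1])]" "[Rl True Lt [G0, G1]]" "[y, Suc y, 0, 0, 0]"] s Suc.prems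
      by (simp add: in_CL evals)
  next
    case False
    then have "R Lt [x, y]" using Suc by simp
    then show ?thesis using fire[of "[(Lt, [G0, G1]), (Sc, [G1, G2])]" "[Rl True Lt [G0, G2]]" "[x, y, Suc y, 0, 0]"] s Suc.prems
      by (auto simp: in_CL evals numeral_2_eq_2)
  qed
qed simp

lemma Ad: "x + y < top \<Longrightarrow> R Ad [x, y, x + y]"
proof (induction y)
  case 0
  then show ?case using fire[of "[]" "[Rl True Ad [G0, Zero, G0]]" "[x, 0, 0, 0, 0]"] by (simp add: in_CL evals)
next
  case (Suc y)
  have "R Sc [y, Suc y]" "R Sc [x + y, Suc (x + y)]" "R Ad [x, y, x + y]" using Sc Suc by auto
  then show ?case
    using fire[of "[(Ad, [G0, G1, G2]), (Sc, [G1, G3]), (Sc, [G2, G4])]" "[Rl True Ad [G0, G3, G4]]" "[x, y, x + y, Suc y, Suc (x + y)]"] Suc.prems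
    by (auto simp: in_CL evals eval_nat_numeral)
qed

lemma Mu: "y < top \<Longrightarrow> x * y < top \<Longrightarrow> x < top \<Longrightarrow> R Mu [x, y, x * y]"
proof (induction y)
  case 0
  then show ?case using fire[of "[]" "[Rl True Mu [G0, Zero, Zero]]" "[x, 0, 0, 0, 0]"] by (simp add: in_CL evals)
next
  case (Suc y)
  have s: "x * Suc y = x * y + x" by simp
  then have l: "x * y < top" "x * y + x < top" using Suc.prems by auto
  have "R Sc [y, Suc y]" "R Mu [x, y, x * y]" "R Ad [x * y, x, x * y + x]" using Sc Suc Ad l by auto
  then have "R Mu [x, Suc y, x * y + x]"
    using fire[of "[(Mu, [G0, G1, G2]), (Ad, [G2, G0, G3]), (Sc, [G1, G4])]" "[Rl True Mu [G0, G4, G3]]" "[x, y, x * y, x * y + x, Suc y]"] Suc.prems l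
    by (auto simp: in_CL evals eval_nat_numeral)
  then show ?case unfolding s .
qed

lemma Pos_step:
  assumes "b < nb" "Suc y < n ^ ka b" "R (Pos b) [y, s0 + off b + y]"
  shows "R (Pos b) [Suc y, s0 + off b + Suc y]"
proof -
  let ?m = "n ^ (D - ka b)"
  have l: "s0 + off b + Suc y < top" using off_mono[OF assms(1,2)] bounds by simp
  have y: "y * ?m < top" "y * ?m div ?m = y" "Suc y * ?m < top" "Suc y * ?m div ?m = Suc y"
    using pad_div[OF ka_le[OF assms(1)], of y] pad_div[OF ka_le[OF assms(1)], of "Suc y"] assms(2) by auto
  have s: "R Sc [y, Suc y]" "R Sc [s0 + off b + y, Suc (s0 + off b + y)]" using Sc l by auto
  have "imp [(Pos b, [Pad (ka b) 0, G2]), (Sc, [Pad (ka b) 0, Pad (ka b) 1]), (Sc, [G2, G3])] [Rl True (Pos b) [Pad (ka b) 1, G3]] \<in> set CL"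
    using assms(1) by (simp add: in_CL blocks_nb ka_def)
  from fire[OF this, of "[y * ?m, Suc y * ?m, s0 + off b + y, Suc (s0 + off b + y), 0]"]
  show ?thesis using y l s assms(3) bounds(1) n_pos by (auto simp: evals eval_nat_numeral simp del: mult_Suc)
qed

text \<open>The outer induction follows the blocks, the inner one the entries of a block.\<close>

lemma Pos: "b < nb \<Longrightarrow> y < n ^ ka b \<Longrightarrow> R (Pos b) [y, s0 + off b + y]"
proof (induction b arbitrary: y)
  case 0
  have base: "R (Pos 0) [0, s0]"
    using fire[of "[]" "[Rl True (Pos 0) [Zero, Origin]]" "[0, 0, 0, 0, 0]"] bounds by (simp add: in_CL evals)
  show ?case using 0(2)
  proof (induction y)
    case (Suc y)
    then show ?case using Pos_step[of 0 y] nb_pos by (simp add: off_0)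
  qed (use base in \<open>simp add: off_0\<close>)
next
  case (Suc b)
  then have b: "b < nb" by simp
  have q: "0 < n ^ ka b" using n_pos by simp
  define p where "p = s0 + off b + (n ^ ka b - 1)"
  have "R (Pos b) [n ^ ka b - 1, p]" using Suc.IH[OF b] q by (simp add: p_def)
  moreover have e: "s0 + off (Suc b) = Suc p" using off_Suc[OF b] q by (simp add: p_def)
  moreover have l: "Suc p < top" unfolding e[symmetric] using off_mono[OF Suc.prems(1), of 0] n_pos bounds by simp
  moreover have "imp [(Pos b, [PadMax (ka b), G0]), (Sc, [G0, G1])] [Rl True (Pos (Suc b)) [Zero, G1]] \<in> set CL"
    using Suc.prems(1) by (simp add: in_CL blocks_nb ka_def)
  ultimately have base: "R (Pos (Suc b)) [0, s0 + off (Suc b)]"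
    unfolding e using fire[of "[(Pos b, [PadMax (ka b), G0]), (Sc, [G0, G1])]" "[Rl True (Pos (Suc b)) [Zero, G1]]" "[p, Suc p, 0, 0, 0]"] Sc[of p] bounds(1)
    by (simp add: evals)
  show ?case using Suc.prems(2)
  proof (induction y)
    case (Suc y)
    then show ?case using Pos_step[of "Suc b" y] \<open>Suc b < nb\<close> by simp
  qed (use base in simp)
qed

lemma input_end: "R RS [s0 + len]" "R Rgt [s0 + len]"
proof -
  define b where "b = nb - 1"
  have b: "b < nb" "Suc b = nb" using nb_pos by (auto simp: b_def)
  have q: "0 < n ^ ka b" using n_pos by simp
  define p where "p = s0 + off b + (n ^ ka b - 1)"
  have 1: "R (Pos b) [n ^ ka b - 1, p]" using Pos[OF b(1)] q by (simp add: p_def)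
  have "off b + n ^ ka b = len" using off_Suc[OF b(1)] b(2) off_nb by simp
  then have e: "s0 + len = Suc p" unfolding p_def using q by linarith
  have l: "Suc p < top" unfolding e[symmetric] using bounds by simp
  have "imp [(Pos b, [PadMax (ka b), G0]), (Sc, [G0, G1])] [Rl True Rgt [G1]] \<in> set CL"
    "imp [(Pos b, [PadMax (ka b), G0]), (Sc, [G0, G1])] [Rl True RS [G1]] \<in> set CL"
    by (simp_all add: in_CL blocks_nb ka_def b_def)
  from this[THEN fire, of "[p, Suc p, 0, 0, 0]"] show "R RS [s0 + len]" "R Rgt [s0 + len]"
    unfolding e using 1 l Sc[of p] bounds(1) by (simp_all add: evals)
qed

lemma Rgt: "s0 + len \<le> p \<Longrightarrow> p < top \<Longrightarrow> R Rgt [p]"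
proof (induction p rule: dec_induct)
  case base then show ?case using input_end by simp
next
  case (step p)
  then show ?case using fire[of "[(Rgt, [G0]), (Sc, [G0, G1])]" "[Rl True Rgt [G1]]" "[p, Suc p, 0, 0, 0]"] Sc[of p]
    by (simp add: in_CL evals)
qed

lemma Lft: "p < s0 \<Longrightarrow> R Lft [p]"
proof (induction "s0 - p" arbitrary: p)
  case (Suc k)
  have l: "Suc p < top" using Suc.prems bounds by simp
  show ?case
  proof (cases "Suc p = s0")
    case True
    then show ?thesis using fire[of "[(Sc, [G0, Origin])]" "[Rl True Lft [G0]]" "[p, 0, 0, 0, 0]"] Sc[OF l] l
      by (simp add: in_CL evals)
  next
    case False
    then have "R Lft [Suc p]" using Suc by simp
    then show ?thesis using fire[of "[(Lft, [G1]), (Sc, [G0, G1])]" "[Rl True Lft [G0]]" "[p, Suc p, 0, 0, 0]"] Sc[OF l] l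
      by (simp add: in_CL evals)
  qed
qed simp

lemma Tp0: "p < top \<Longrightarrow> R (Tp (tape0 (int p - int s0))) [0, p]"
proof -
  assume p: "p < top"
  consider "p < s0" | "s0 + len \<le> p" | "s0 \<le> p" "p - s0 < len" by linarith
  then show ?thesis
  proof cases
    case 1
    then have "R (Tp 0) [0, p]" using fire[of "[(Lft, [G0])]" "[Rl True (Tp 0) [Zero, G0]]" "[p, 0, 0, 0, 0]"] Lft p
      by (simp add: in_CL evals)
    then show ?thesis using 1 tape0_out by simp
  next
    case 2
    then have "R (Tp 0) [0, p]" using fire[of "[(Rgt, [G0])]" "[Rl True (Tp 0) [Zero, G0]]" "[p, 0, 0, 0, 0]"] Rgt p
      by (simp add: in_CL evals)
    then show ?thesis using 2 tape0_out by simp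
  next
    case 3
    obtain b y where bl: "b < nb" "y < n ^ ka b" "p - s0 = off b + y" using off_cases[OF 3(2)] by blast
    let ?m = "n ^ (D - ka b)"
    have pe: "p = s0 + off b + y" using 3(1) bl(3) by simp
    have P: "R (Pos b) [y, p]" unfolding pe by (rule Pos[OF bl(1,2)])
    have y: "y * ?m < top" "y * ?m div ?m = y" using pad_div[OF ka_le[OF bl(1)] bl(2)] by auto
    have "imp [(Pos b, [Pad (ka b) 0, G2])] [Bit False (blocks \<sigma> ! b) 0, Rl True (Tp 2) [Zero, G2]] \<in> set CL"
      "imp [(Pos b, [Pad (ka b) 0, G2])] [Bit True (blocks \<sigma> ! b) 0, Rl True (Tp 1) [Zero, G2]] \<in> set CL"
      using bl(1) by (simp_all add: in_CL blocks_nb ka_def)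
    from this[THEN fire, of "[y * ?m, 0, p, 0, 0]"]
    have "bit (blocks \<sigma> ! b) y \<longrightarrow> R (Tp 2) [0, p]" "\<not> bit (blocks \<sigma> ! b) y \<longrightarrow> R (Tp 1) [0, p]"
      using y P p bounds(1) n_pos by (auto simp: evals eval_nat_numeral simp flip: ka_def)
    moreover have "int p - int s0 = int (p - s0)" using 3(1) by simp
    then have "tape0 (int p - int s0) = (if w ! (p - s0) then 2 else 1)" using tape0_in[OF 3(2)] by (simp only:)
    ultimately show ?thesis using bit_enc[OF bl(1,2)] bl(3) by simp
  qed
qed

text \<open>The length is obtained by subtraction: it is the number that leads from
  \<open>Origin\<close> to the end of the input. The successor accounts for the 1 in the time
  bound.\<close>

lemma Ln: "R Ln [len + 1]"
  using fire[of "[(RS, [G0]), (Ad, [Origin, G1, G0]), (Sc, [G1, G2])]" "[Rl True Ln [G2]]" "[s0 + len, len, Suc len, 0, 0]"]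
    input_end(1) Ad[of s0 len] Sc[of len] bounds
  by (simp add: in_CL evals eval_nat_numeral)

lemma Vl: "j \<le> d \<Longrightarrow> R (Vl j) [(len + 1) ^ j]"
proof (induction j)
  case 0
  show ?case using fire[of "[(Sc, [Zero, G0])]" "[Rl True (Vl 0) [G0]]" "[1, 0, 0, 0, 0]"] Sc[of 0] bounds
    by (simp add: in_CL evals)
next
  case (Suc j)
  have "(len + 1) ^ Suc j \<le> (len + 1) ^ d" by (rule power_increasing) (use Suc.prems in auto)
  then have l: "(len + 1) ^ j * (len + 1) < top" using bounds(4) unfolding power_Suc2 by (rule order.strict_trans1)
  moreover have "(len + 1) ^ j * 1 \<le> (len + 1) ^ j * (len + 1)" by (rule mult_le_mono2) simp
  ultimately have l2: "(len + 1) ^ j < top" by linarith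
  have "imp [(Vl j, [G0]), (Ln, [G1]), (Mu, [G0, G1, G2])] [Rl True (Vl (Suc j)) [G2]] \<in> set CL"
    using Suc.prems by (simp add: in_CL)
  from fire[OF this, of "[(len + 1) ^ j, len + 1, (len + 1) ^ j * (len + 1), 0, 0]"]
  have "R (Vl (Suc j)) [(len + 1) ^ j * (len + 1)]"
    using Suc Ln Mu[OF bounds(3) l l2] l l2 bounds by (simp add: evals eval_nat_numeral)
  then show ?case by (simp add: mult.commute)
qed

lemma Kn: "i \<le> a \<Longrightarrow> R (Kn i) [i]"
proof (induction i)
  case 0
  show ?case using fire[of "[]" "[Rl True (Kn 0) [Zero]]" "[0, 0, 0, 0, 0]"] bounds by (simp add: in_CL evals)
next
  case (Suc i)
  then show ?case using fire[of "[(Kn i, [G0]), (Sc, [G0, G1])]" "[Rl True (Kn (Suc i)) [G1]]" "[i, Suc i, 0, 0, 0]"] Sc[of i] bounds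
    by (simp add: in_CL evals)
qed

lemma Dl: "R Dl [T]"
proof -
  have e: "(len + 1) ^ d * a = T" by (simp add: T_def)
  show ?thesis
    using fire[of "[(Vl d, [G0]), (Kn a, [G1]), (Mu, [G0, G1, G2])]" "[Rl True Dl [G2]]" "[(len + 1) ^ d, a, T, 0, 0]"]
      Vl[of d] Kn[of a] Mu[of a "(len + 1) ^ d"] e bounds
    by (simp add: in_CL evals eval_nat_numeral)
qed

text \<open>\<open>c\<close> is a genuine configuration after \<open>t\<close> steps, and
  \<open>R\<close> contains its description on the cells represented. Since the head is within
  distance \<open>t\<close> of the origin, it is on such a cell for
  \<open>t \<le> T\<close>.\<close>

definition sim :: "nat \<Rightarrow> conf \<Rightarrow> bool" where
  "sim t c \<longleftrightarrow> (case c of (q, tp, h) \<Rightarrow> (ntm_step Tm ^^ t) (init_conf w) c \<and> q \<in> set (states Tm dl) \<and> R (St q) [t] \<and>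
     \<bar>h\<bar> \<le> int t \<and> R Hd [t, nat (int s0 + h)] \<and>
     (\<forall>p<top. tp (int p - int s0) \<in> set (symbols dl) \<and> R (Tp (tp (int p - int s0))) [t, p]))"

lemma sim_0: "sim 0 (init_conf w)"
proof -
  have "tape0 i \<in> set (symbols dl)" for i by (auto simp: tape0_def init_conf_def symbols_def)
  moreover have "R (St 0) [0]" using fire[of "[]" "[Rl True (St 0) [Zero]]" "[0, 0, 0, 0, 0]"] bounds by (simp add: in_CL evals)
  moreover have "R Hd [0, s0]" using fire[of "[]" "[Rl True Hd [Zero, Origin]]" "[0, 0, 0, 0, 0]"] bounds by (simp add: in_CL evals)
  ultimately show ?thesis using Tp0 by (simp add: sim_def init_tape0 states_def)
qed

text \<open>\<open>R\<close> names a transition for time \<open>t\<close>. A misfit with the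
  configuration is forbidden, so the named transition really applies, or it is the halting index and
  the state is accepting.\<close>

lemma sim_step:
  assumes s: "sim t c" and t: "t < T"
  shows "fst c = acc_state Tm \<or> (\<exists>c'. sim (Suc t) c')"
proof -
  obtain q tp h where c: "c = (q, tp, h)" by (cases c)
  have S: "(ntm_step Tm ^^ t) (init_conf w) (q, tp, h)" "q \<in> set (states Tm dl)" "R (St q) [t]" "\<bar>h\<bar> \<le> int t"
    "R Hd [t, nat (int s0 + h)]" "\<And>p. p < top \<Longrightarrow> tp (int p - int s0) \<in> set (symbols dl) \<and> R (Tp (tp (int p - int s0))) [t, p]"
    using s by (auto simp: sim_def c)
  define p where "p = nat (int s0 + h)"
  have p: "int p = int s0 + h" using S(4) t bounds(7) by (simp add: p_def)
  have pt: "p < top" "Suc p < top" "0 < p" using p S(4) t bounds by auto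
  have tt: "t < top" "Suc t < top" using t bounds by auto
  have sct: "R Sc [t, Suc t]" using Sc tt by simp
  have tph: "tp h \<in> set (symbols dl)" "R (Tp (tp h)) [t, p]" using S(6)[OF pt(1)] p by auto
  have "\<exists>l\<in>set (map (\<lambda>i. Rl True (Tr i) [G0]) [0..<Suc (length dl)]). nholds D R ((!) [t, 0, 0, 0, 0]) l"
    using fire[of "[]" "map (\<lambda>i. Rl True (Tr i) [G0]) [0..<Suc (length dl)]" "[t, 0, 0, 0, 0]"] tt bounds(1)
    by (simp add: imp_def in_CL del: upt_Suc)
  then obtain i where i: "i \<le> length dl" "R (Tr i) [t]" by (auto simp: evals less_Suc_eq_le simp del: upt_Suc)
  show ?thesis
  proof (cases "i = length dl")
    case True
    have "q = acc_state Tm"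
    proof (rule ccontr)
      assume "q \<noteq> acc_state Tm"
      then have "imp [(Tr i, [G0]), (St q, [G0])] [] \<in> set CL" using S(2) True by (auto simp: in_CL)
      from fire[OF this, of "[t, 0, 0, 0, 0]"] show False using i S(3) tt bounds(1) by (simp add: evals)
    qed
    then show ?thesis by (simp add: c)
  next
    case False
    then have il: "i < length dl" using i by simp
    obtain q1 s1 q' b m where di: "dl ! i = (q1, s1, q', b, m)" by (metis prod.exhaust)
    have din: "(q1, s1, q', b, m) \<in> set dl" using di il by (metis nth_mem)
    have "set (trans_clauses Tm dl i) \<subseteq> set CL"
      unfolding machine_clauses_def run_clauses_def Let_def using il by auto
    note inC = this[unfolded trans_clauses_def di prod.case]
    have q1: "q1 = q"
    proof (rule ccontr)
      assume "q1 \<noteq> q"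
      then have "imp [(Tr i, [G0]), (St q, [G0])] [] \<in> set CL" using inC S(2) by auto
      from fire[OF this, of "[t, 0, 0, 0, 0]"] show False using i S(3) tt bounds(1) by (simp add: evals)
    qed
    have s1: "s1 = tp h"
    proof (rule ccontr)
      assume "s1 \<noteq> tp h"
      then have "imp [(Tr i, [G0]), (Hd, [G0, G1]), (Tp (tp h), [G0, G1])] [] \<in> set CL" using inC tph(1) by auto
      from fire[OF this, of "[t, p, 0, 0, 0]"] show False using i S(5) tph(2) tt pt bounds(1) by (simp add: evals p_def)
    qed
    let ?tp = "tp(h := b)" and ?h = "h + m"
    have delta: "(q, tp h, q', b, m) \<in> delta Tm" "m \<in> {-1, 0, 1}" using din dl q1 s1 by auto
    then have "ntm_step Tm (q, tp, h) (q', ?tp, ?h)" by (auto simp: ntm_step_def)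
    then have 1: "(ntm_step Tm ^^ Suc t) (init_conf w) (q', ?tp, ?h)" using S(1) by auto
    have 2: "q' \<in> set (states Tm dl)" "b \<in> set (symbols dl)" using din by (force simp: states_def symbols_def)+
    have 3: "R (St q') [Suc t]"
    proof -
      have "imp [(Tr i, [G0]), (Sc, [G0, G2])] [Rl True (St q') [G2]] \<in> set CL" using inC by auto
      from fire[OF this, of "[t, 0, Suc t, 0, 0]"] show ?thesis using i sct tt bounds(1) by (simp add: evals eval_nat_numeral)
    qed
    have 4: "R (Tp b) [Suc t, p]"
    proof -
      have "imp [(Tr i, [G0]), (Sc, [G0, G2]), (Hd, [G0, G1])] [Rl True (Tp b) [G2, G1]] \<in> set CL" using inC by auto
      from fire[OF this, of "[t, p, Suc t, 0, 0]"] show ?thesis using i sct S(5) tt pt bounds(1) by (simp add: evals eval_nat_numeral p_def)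
    qed
    have 5: "R Hd [Suc t, nat (int s0 + ?h)]"
    proof -
      have mv: "move_clause i m \<in> set CL" using inC by auto
      consider "m = 1" | "m = -1" | "m = 0" using delta(2) by auto
      then show ?thesis
      proof cases
        case 1
        have "nat (int s0 + ?h) = Suc p" using p 1 by simp
        then show ?thesis using fire[OF mv[unfolded move_clause_def if_P[OF 1]], of "[t, p, Suc t, Suc p, 0]"] i sct S(5) tt pt bounds(1) Sc[of p]
          by (simp add: evals eval_nat_numeral p_def)
      next
        case 2
        have e: "nat (int s0 + ?h) = p - 1" "Suc (p - 1) = p" using p 2 pt(3) by auto
        have "imp [(Tr i, [G0]), (Sc, [G0, G2]), (Hd, [G0, G1]), (Sc, [G3, G1])] [Rl True Hd [G2, G3]] \<in> set CL"
          using mv 2 by (simp add: move_clause_def)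
        from fire[OF this, of "[t, p, Suc t, p - 1, 0]"] show ?thesis unfolding e(1)
          using i sct S(5)[folded p_def] tt pt bounds(1) Sc[of "p - 1"] e(2) by (simp add: evals eval_nat_numeral)
      next
        case 3
        have e: "nat (int s0 + ?h) = p" using p 3 by simp
        have "imp [(Tr i, [G0]), (Sc, [G0, G2]), (Hd, [G0, G1])] [Rl True Hd [G2, G1]] \<in> set CL"
          using mv 3 by (simp add: move_clause_def)
        from fire[OF this, of "[t, p, Suc t, 0, 0]"] show ?thesis unfolding e
          using i sct S(5)[folded p_def] tt pt bounds(1) by (simp add: evals eval_nat_numeral)
      qed
    qed
    have 6: "?tp (int x - int s0) \<in> set (symbols dl) \<and> R (Tp (?tp (int x - int s0))) [Suc t, x]" if x: "x < top" for x
    proof (cases "x = p")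
      case True then show ?thesis using 2 4 p by simp
    next
      case False
      then have e: "?tp (int x - int s0) = tp (int x - int s0)" using p by auto
      let ?c = "tp (int x - int s0)"
      have X: "?c \<in> set (symbols dl)" "R (Tp ?c) [t, x]" using S(6)[OF x] by auto
      have "imp [(Hd, [G0, G1]), (Sc, [G0, G2]), (Tp ?c, [G0, G3]), (Lt, [G3, G1])] [Rl True (Tp ?c) [G2, G3]] \<in> set CL"
        "imp [(Hd, [G0, G1]), (Sc, [G0, G2]), (Tp ?c, [G0, G3]), (Lt, [G1, G3])] [Rl True (Tp ?c) [G2, G3]] \<in> set CL"
        using X(1) by (auto simp: in_CL)
      from this[THEN fire, of "[t, p, Suc t, x, 0]"]
      have "R Lt [x, p] \<longrightarrow> R (Tp ?c) [Suc t, x]" "R Lt [p, x] \<longrightarrow> R (Tp ?c) [Suc t, x]"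
        using X(2) sct S(5)[folded p_def] tt pt x bounds(1) by (simp_all add: evals eval_nat_numeral)
      then show ?thesis unfolding e using X(1) Lt[of x p] Lt[of p x] False pt(1) x by (metis linorder_neqE_nat)
    qed
    have 7: "\<bar>?h\<bar> \<le> int (Suc t)" using S(4) delta(2) by auto
    have "sim (Suc t) (q', ?tp, ?h)" unfolding sim_def prod.case using 1 2(1) 3 5 6 7 by blast
    then show ?thesis by blast
  qed
qed

text \<open>Without acceptance the simulation continues to time \<open>T\<close>, where the clauses
  for \<open>Dl\<close> forbid every state but the accepting one.\<close>

lemma model_accepts: "accepts_within Tm w T"
proof (rule ccontr)
  assume no: "\<not> accepts_within Tm w T"
  have na: "fst c \<noteq> acc_state Tm" if "sim t c" "t \<le> T" for t c
    using no that by (cases c) (auto simp: accepts_within_def sim_def)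
  have "t \<le> T \<Longrightarrow> \<exists>c. sim t c" for t
  proof (induction t)
    case 0 then show ?case using sim_0 by blast
  next
    case (Suc t)
    then obtain c where "sim t c" by auto
    then show ?case using sim_step[of t c] na[of t c] Suc.prems by auto
  qed
  then obtain c where c: "sim T c" by blast
  obtain q tp h where ce: "c = (q, tp, h)" by (cases c)
  have q: "q \<noteq> acc_state Tm" "q \<in> set (states Tm dl)" "R (St q) [T]" using na[OF c] c by (auto simp: ce sim_def)
  then have "imp [(Dl, [G0]), (St q, [G0])] [] \<in> set CL" by (auto simp: in_CL)
  from fire[OF this, of "[T, 0, 0, 0, 0]"] show False using Dl q(3) bounds by (simp add: evals)
qed

end

end

section \<open>An accepting run yields a numeric model\<close>

context fagin
begin

lemma pad_less: "x < n ^ D \<Longrightarrow> k \<le> D \<Longrightarrow> x div n ^ (D - k) < n ^ k"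
  by (simp add: less_mult_imp_div_less flip: power_add)

context
  fixes qs :: "nat \<Rightarrow> nat" and tp :: "nat \<Rightarrow> int \<Rightarrow> nat" and hp :: "nat \<Rightarrow> int" and ti :: "nat \<Rightarrow> nat"
  assumes init: "qs 0 = 0" "tp 0 = tape0" "hp 0 = 0"
    and ti_le: "\<And>t. ti t \<le> length dl"
    and step: "\<And>t. ti t < length dl \<Longrightarrow> dl ! ti t = (qs t, tp t (hp t), qs (Suc t), tp (Suc t) (hp t), hp (Suc t) - hp t)"
    and halt: "\<And>t. ti t = length dl \<Longrightarrow> qs t = acc_state Tm"
    and frame: "\<And>t i. i \<noteq> hp t \<Longrightarrow> tp (Suc t) i = tp t i"
    and fin: "qs T = acc_state Tm"
begin

text \<open>The exact relations of a run, with \<open>ti\<close> naming the transitions. Cell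
  \<open>p\<close> of the description is cell \<open>p - s0\<close> of the machine.\<close>

definition run_model :: "rname \<Rightarrow> nat list \<Rightarrow> bool" where
  "run_model nm xs = (case nm of
      Sc \<Rightarrow> xs ! 1 = Suc (xs ! 0)
    | Lt \<Rightarrow> xs ! 0 < xs ! 1
    | Pos b \<Rightarrow> xs ! 0 < n ^ ka b \<and> xs ! 1 = s0 + off b + xs ! 0
    | Lft \<Rightarrow> xs ! 0 < s0
    | Rgt \<Rightarrow> s0 + len \<le> xs ! 0
    | RS \<Rightarrow> xs ! 0 = s0 + len
    | Tp c \<Rightarrow> tp (xs ! 0) (int (xs ! 1) - int s0) = c
    | Hd \<Rightarrow> int (xs ! 1) = int s0 + hp (xs ! 0)
    | St q \<Rightarrow> qs (xs ! 0) = q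
    | Tr i \<Rightarrow> ti (xs ! 0) = i
    | Ad \<Rightarrow> xs ! 2 = xs ! 0 + xs ! 1
    | Mu \<Rightarrow> xs ! 2 = xs ! 0 * xs ! 1
    | Ln \<Rightarrow> xs ! 0 = len + 1
    | Vl j \<Rightarrow> xs ! 0 = (len + 1) ^ j
    | Kn i \<Rightarrow> xs ! 0 = i
    | Dl \<Rightarrow> xs ! 0 = T)"

lemmas run_evals = imp_holds evals run_model_def

context
  fixes x :: "nat \<Rightarrow> nat"
  assumes x: "\<forall>g<5. x g < n ^ D"
begin

lemma arith_sat: "cl \<in> set (arith_clauses a d) \<Longrightarrow> \<exists>l\<in>set cl. nholds D run_model x l"
  unfolding arith_clauses_def set_append Un_iff set_map list.set insert_iff empty_iff simp_thms
  by (elim disjE imageE; hypsubst; simp add: run_evals T_def algebra_simps)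

lemma pad_x: "g < 5 \<Longrightarrow> b < nb \<Longrightarrow> x g div n ^ (D - ka b) < n ^ ka b"
  using pad_less x ka_le by blast

lemma tape_bit: "b < nb \<Longrightarrow> y < n ^ ka b \<Longrightarrow> tape0 (int (s0 + off b + y) - int s0) = (if bit (blocks \<sigma> ! b) y then 2 else 1)"
proof -
  assume b: "b < nb" "y < n ^ ka b"
  have "int (s0 + off b + y) - int s0 = int (off b + y)" by simp
  then show ?thesis using tape0_in[OF off_mono[OF b]] bit_enc[OF b] by (simp only:)
qed

lemma input_sat: "cl \<in> set (input_clauses \<sigma>) \<Longrightarrow> \<exists>l\<in>set cl. nholds D run_model x l"
proof -
  have pos: "0 < n ^ k" for k using n_pos by simp
  have z: "0 < n ^ k" "n ^ k - Suc 0 < n ^ k" for k using n_pos by simp_all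
  have e: "Suc (s0 + off b + (n ^ ka b - Suc 0)) = s0 + off (Suc b)" if "b < nb" for b
    using off_Suc[OF that] pos[of "ka b"] by simp
  have e': "Suc (s0 + off (nb - Suc 0) + (n ^ ka (nb - Suc 0) - Suc 0)) = s0 + len"
    using e[of "nb - Suc 0"] off_nb nb_pos by simp
  assume "cl \<in> set (input_clauses \<sigma>)"
  then show ?thesis
    unfolding input_clauses_def Let_def blocks_nb ka_def[symmetric]
    apply (simp only: set_append Un_iff set_map list.set insert_iff empty_iff simp_thms)
    apply (elim disjE imageE; hypsubst)
               subgoal using n_pos off_0 by (simp add: run_evals)
              subgoal by (simp add: run_evals)
             subgoal by (simp add: run_evals)
            subgoal by (simp add: run_evals)
           subgoal using tape0_out by (simp add: run_evals init)
          subgoal using tape0_out by (simp add: run_evals init)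
         subgoal using e' by (simp add: run_evals del: add_diff_assoc add_diff_assoc2)
        subgoal using e' by (simp add: run_evals del: add_diff_assoc add_diff_assoc2)
       subgoal for b using pad_x[of 1 b] by (auto simp: run_evals)
      subgoal for b using e[of b] z by (simp add: run_evals del: add_diff_assoc add_diff_assoc2)
     subgoal for b using tape_bit[of b] pad_x[of 0 b] by (simp add: run_evals init flip: ka_def)
    subgoal for b using tape_bit[of b] pad_x[of 0 b] by (simp add: run_evals init flip: ka_def)
    done
qed

lemma trans_sat: "i < length dl \<Longrightarrow> cl \<in> set (trans_clauses Tm dl i) \<Longrightarrow> \<exists>l\<in>set cl. nholds D run_model x l"
proof (cases "ti (x 0) = i")
  case False
  moreover assume "cl \<in> set (trans_clauses Tm dl i)"
  ultimately show ?thesis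
    by (auto simp: trans_clauses_def move_clause_def run_evals split: prod.splits)
next
  case True
  assume i: "i < length dl" and c: "cl \<in> set (trans_clauses Tm dl i)"
  let ?t = "x 0"
  have d: "dl ! i = (qs ?t, tp ?t (hp ?t), qs (Suc ?t), tp (Suc ?t) (hp ?t), hp (Suc ?t) - hp ?t)"
    using step[of ?t] True i by simp
  have "hp (Suc ?t) - hp ?t \<in> {-1, 0, 1}" using dl nth_mem[OF i] d by auto
  moreover have t: "int p - int s0 = hp ?t" if "int p = int s0 + hp ?t" for p using that by simp
  ultimately show ?thesis using c unfolding trans_clauses_def d prod.case
    by (auto simp: move_clause_def run_evals)
qed

lemma run_sat: "cl \<in> set (run_clauses Tm dl) \<Longrightarrow> \<exists>l\<in>set cl. nholds D run_model x l"
proof -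
  have f: "tp (Suc t) (int p - int s0) = tp t (int p - int s0)" if "int p' = int s0 + hp t" "p \<noteq> p'" for t p p'
    by (rule frame) (use that in auto)
  assume "cl \<in> set (run_clauses Tm dl)"
  then show ?thesis
    unfolding run_clauses_def Let_def
    apply (simp only: set_append Un_iff set_map set_concat UN_iff list.set insert_iff empty_iff simp_thms)
    apply (elim disjE imageE bexE; hypsubst?)
           apply (simp add: run_evals init)
          apply (simp add: run_evals init)
         apply (use ti_le[of "x 0"] in \<open>simp add: run_evals less_Suc_eq_le Bex_def del: upt_Suc\<close>)
        apply (rule trans_sat, simp, simp)
       apply (use halt in \<open>auto simp: run_evals\<close>)[1]
      apply (use f in \<open>auto simp: run_evals\<close>)[1]
     apply (use f in \<open>auto simp: run_evals\<close>)[1]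
    apply (use fin in \<open>auto simp: run_evals\<close>)
    done
qed

end

lemma run_numeric_model: "numeric_model D CL run_model"
  unfolding numeric_model_def machine_clauses_def set_append Un_iff
  using arith_sat input_sat run_sat by (auto simp: run_model_def)

end

text \<open>The accepting configuration is repeated for ever, hence \<open>min t k\<close>; from
  time \<open>k\<close> on the named transition is the halting index
  \<open>length dl\<close>.\<close>

lemma accepts_model: "accepts_within Tm w T \<Longrightarrow> \<exists>R. numeric_model D CL R"
proof -
  assume "accepts_within Tm w T"
  then obtain k c where k: "k \<le> T" "(ntm_step Tm ^^ k) (init_conf w) c" "fst c = acc_state Tm"
    by (auto simp: accepts_within_def)
  obtain cf where cf: "cf 0 = init_conf w" "cf k = c" "\<And>i. i < k \<Longrightarrow> ntm_step Tm (cf i) (cf (Suc i))"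
    using k(2) unfolding relpowp_fun_conv by blast
  define qs where "qs t = fst (cf (min t k))" for t
  define tp where "tp t = fst (snd (cf (min t k)))" for t
  define hp where "hp t = snd (snd (cf (min t k)))" for t
  have s: "ntm_step Tm (qs t, tp t, hp t) (qs (Suc t), tp (Suc t), hp (Suc t))" if "t < k" for t
    using cf(3)[OF that] that by (simp add: qs_def tp_def hp_def min_absorb1)
  have "(qs t, tp t (hp t), qs (Suc t), tp (Suc t) (hp t), hp (Suc t) - hp t) \<in> set dl" if "t < k" for t
    using s[OF that] unfolding dl by (auto simp: ntm_step_def)
  then have "\<forall>t. \<exists>i. t < k \<longrightarrow> i < length dl \<and> dl ! i = (qs t, tp t (hp t), qs (Suc t), tp (Suc t) (hp t), hp (Suc t) - hp t)"
    by (metis in_set_conv_nth)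
  then obtain ix where ix: "\<And>t. t < k \<Longrightarrow> ix t < length dl"
    "\<And>t. t < k \<Longrightarrow> dl ! ix t = (qs t, tp t (hp t), qs (Suc t), tp (Suc t) (hp t), hp (Suc t) - hp t)" by metis
  have q: "qs t = acc_state Tm" if "k \<le> t" for t using that cf(2) k(3) by (simp add: qs_def min_absorb2)
  have f: "tp (Suc t) i = tp t i" if "i \<noteq> hp t" for t i
  proof (cases "t < k")
    case True then show ?thesis using s[OF True] that by (auto simp: ntm_step_def)
  next
    case False then show ?thesis by (simp add: tp_def min_absorb2)
  qed
  have ix': "ix t \<noteq> length dl" if "t < k" for t using ix(1)[OF that] by simp
  have "numeric_model D CL (run_model qs tp hp (\<lambda>t. if t < k then ix t else length dl))"
    by (rule run_numeric_model) (use cf(1) init_tape0 ix ix' q k(1) f in \<open>auto simp: qs_def[of 0] tp_def[of 0] hp_def[of 0] less_imp_le split: if_splits\<close>)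
  then show ?thesis by blast
qed

lemma numeric_model_iff: "(\<exists>R. numeric_model D CL R) \<longleftrightarrow> accepts_within Tm w T"
  using model_accepts accepts_model by blast

end

section \<open>Choice of the number of digits, one-element structures, and the final
  assembly\<close>

context ordered
begin

lemma enc_length:
  assumes "\<forall>b\<in>set (blocks \<sigma>). block_arity \<sigma> b \<le> K"
  shows "length (enc \<sigma> nat_copy) \<le> length (blocks \<sigma>) * n ^ K"
proof -
  have "length (enc \<sigma> nat_copy) = sum_list (map (\<lambda>b. n ^ block_arity \<sigma> b) (blocks \<sigma>))"
    by (simp add: enc_blocks length_concat comp_def)
  also have "\<dots> \<le> sum_list (map (\<lambda>b. n ^ K) (blocks \<sigma>))"
    by (rule sum_list_mono) (use assms n_pos in \<open>simp add: power_increasing\<close>)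
  finally show ?thesis by (simp add: sum_list_triv)
qed

text \<open>For \<open>n \<ge> 2\<close> the inequality \<open>m < n ^ m\<close> turns constants
  into powers of \<open>n\<close>. Each of the five summands is then at most \<open>n ^ F\<close>,
  and the factor \<open>n ^ 3\<close>, at least 8, absorbs their number.\<close>

lemma time_bound:
  assumes n2: "2 \<le> n" and K: "\<forall>b\<in>set (blocks \<sigma>). block_arity \<sigma> b \<le> K"
    and E: "E = length (blocks \<sigma>) + K" and F: "F = E + a + E * d + 1"
  shows "length (enc \<sigma> nat_copy) + 1 + a * (length (enc \<sigma> nat_copy) + 1) ^ d + (length (enc \<sigma> nat_copy) + 1) ^ d + a + 2
    \<le> n ^ (F + 3)"
proof -
  let ?l = "length (enc \<sigma> nat_copy)"
  have exp: "m < n ^ m" for m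
    using less_exp[of m] power_mono[OF n2, of m] by linarith
  have mono: "n ^ i \<le> n ^ F" if "i \<le> F" for i using that n_pos by (simp add: power_increasing)
  have "?l + 1 \<le> length (blocks \<sigma>) * n ^ K + n ^ K" using enc_length[OF K] n_pos by (intro add_mono) (simp_all add: Suc_le_eq)
  also have "\<dots> = Suc (length (blocks \<sigma>)) * n ^ K" by simp
  also have "\<dots> \<le> n ^ length (blocks \<sigma>) * n ^ K" by (rule mult_le_mono1) (use exp Suc_leI in blast)
  finally have l: "?l + 1 \<le> n ^ E" by (simp add: E power_add)
  then have "(?l + 1) ^ d \<le> (n ^ E) ^ d" by (intro power_mono) simp_all
  then have p: "(?l + 1) ^ d \<le> n ^ (E * d)" by (simp add: power_mult)
  then have "a * (?l + 1) ^ d \<le> n ^ a * n ^ (E * d)" using exp[of a] by (intro mult_le_mono) simp_all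
  then have "a * (?l + 1) ^ d \<le> n ^ (a + E * d)" by (simp add: power_add)
  also have "\<dots> \<le> n ^ F" by (rule mono) (simp add: F)
  finally have 1: "a * (?l + 1) ^ d \<le> n ^ F" .
  have 2: "?l + 1 \<le> n ^ F" using l mono[of E] F by simp
  have 3: "(?l + 1) ^ d \<le> n ^ F" using p mono[of "E * d"] F by simp
  have 4: "a \<le> n ^ F" using exp[of a] mono[of a] F by simp
  have 5: "2 \<le> n ^ F" using order_trans[OF n2, of "n ^ F"] mono[of 1] F by simp
  have "8 * n ^ F \<le> n ^ 3 * n ^ F" using power_mono[OF n2, of 3] by (intro mult_le_mono1) simp
  then have "8 * n ^ F \<le> n ^ (F + 3)" by (simp add: power_add mult.commute)
  then show ?thesis using 1 2 3 4 5 by linarith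
qed

text \<open>Meant for structures whose only element is 0: there every relation is empty or full, and
  the pattern records which.\<close>

definition pattern :: "bool list" where
  "pattern = map (\<lambda>r. rel A r (replicate (rel_arity \<sigma> ! r) 0)) [0..<length (rel_arity \<sigma>)]"

end

lemma pattern_iso:
  assumes "ordered \<sigma> A" "ordered \<sigma> B" "univ_size A = 1" "univ_size B = 1" "ordered.pattern \<sigma> A = ordered.pattern \<sigma> B"
  shows "struc_iso \<sigma> A B"
proof -
  have r: "rel A r (replicate (rel_arity \<sigma> ! r) 0) = rel B r (replicate (rel_arity \<sigma> ! r) 0)"
    if "r < length (rel_arity \<sigma>)" for r
    using assms(5) that by (simp add: ordered.pattern_def[OF assms(1)] ordered.pattern_def[OF assms(2)])
  have t: "t = replicate (length t) 0" if "\<forall>x\<in>set t. x < (1 :: nat)" for t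
    using that by (induction t) auto
  have "rel B r t = rel A r t" if "r < length (rel_arity \<sigma>)" "length t = rel_arity \<sigma> ! r" "\<forall>x\<in>set t. x < 1" for r t
    using r[OF that(1)] t[OF that(3)] that(2) by metis
  moreover have "cst A c = 0" "cst B c = 0" if "c < nconsts \<sigma>" for c
    using ordered.cst_less[OF assms(1) that] ordered.cst_less[OF assms(2) that] assms(3,4) by auto
  ultimately show ?thesis using assms(3,4) unfolding struc_iso_def
    by (auto intro!: exI[of _ id])
qed

text \<open>Through the guards one sentence serves all sizes: one-element structures by a list of
  their finitely many patterns, larger ones by the computation on \<open>nat_copy\<close>.\<close>

lemma coNP_Pi12:
  assumes voc: "ordered_vocab \<sigma>" and S: "S \<subseteq> ordered_strucs \<sigma>"
    and iso: "iso_closed_in \<sigma> (ordered_strucs \<sigma>) S" and co: "coNP_on \<sigma> (ordered_strucs \<sigma>) S"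
  shows "\<exists>\<phi>\<in>Pi12_EKROM \<sigma>. \<forall>A\<in>ordered_strucs \<sigma>. A \<in> S \<longleftrightarrow> models A \<phi>"
proof -
  have or: "ordered \<sigma> A" if "A \<in> ordered_strucs \<sigma>" for A
    using that voc by (simp add: ordered_def ordered_strucs_def)
  obtain L where L: "- L \<in> NP" "\<And>A. A \<in> ordered_strucs \<sigma> \<Longrightarrow> A \<in> S \<longleftrightarrow> enc \<sigma> A \<in> L"
    using co by (auto simp: coNP_on_def coNP_def)
  then obtain Tm a d where Tm: "finite (delta Tm)" "\<And>w. w \<notin> L \<longleftrightarrow> accepts_within Tm w (a * (length w + 1) ^ d)"
    by (auto simp: NP_def)
  \<comment> \<open>\<open>delta\<close> may contain tuples with other moves, but
    \<open>ntm_step\<close> never takes them.\<close>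
  have "finite {t \<in> delta Tm. snd (snd (snd (snd t))) \<in> {-1, 0, 1}}" using Tm(1) by (rule finite_subset[rotated]) auto
  then obtain dl where dl: "set dl = {t \<in> delta Tm. snd (snd (snd (snd t))) \<in> {-1, 0, 1}}" using finite_list by blast
  define K where "K = sum_list (map (block_arity \<sigma>) (blocks \<sigma>))"
  have K: "\<forall>b\<in>set (blocks \<sigma>). block_arity \<sigma> b \<le> K" by (auto simp: K_def intro: member_le_sum_list)
  define E where "E = length (blocks \<sigma>) + K"
  define F where "F = E + a + E * d + 1"
  \<comment> \<open>One digit more than the exponent \<open>F + 3\<close> of
    \<open>time_bound\<close>: the leading digit serves to place \<open>Origin\<close> far from both
    ends.\<close>
  define D where "D = F + 4"
  have D: "0 < D" "\<forall>b\<in>set (blocks \<sigma>). block_arity \<sigma> b \<le> D" using K by (auto simp: D_def F_def E_def trans_le_add1)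
  define cl where "cl = machine_clauses \<sigma> Tm dl a d"
  define nms where "nms = insert (to_nat Sc) (lit_name ` (\<Union>c\<in>set cl. set c))"
  define M where "M = Suc (Max nms)"
  have "finite nms" by (simp add: nms_def)
  then have "k < M" if "k \<in> nms" for k using that by (simp add: M_def less_Suc_eq_le)
  then have M: "to_nat Sc < M" "\<And>c l. c \<in> set cl \<Longrightarrow> l \<in> set c \<Longrightarrow> lit_name l < M" by (auto simp: nms_def)
  have ok: "\<forall>c\<in>set cl. \<forall>l\<in>set c. nlit_ok \<sigma> D M l"
    by (intro ballI machine_clauses_ok[OF D(2), of _ Tm dl a d]) (simp_all add: cl_def[symmetric] M(2))
  let ?P = "{ordered.pattern \<sigma> A |A. A \<in> S \<and> univ_size A = 1}"
  have pl: "length (ordered.pattern \<sigma> A) = length (rel_arity \<sigma>)" if "A \<in> S" for A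
    using ordered.pattern_def[OF or, of A] S that by auto
  have "finite {xs :: bool list. set xs \<subseteq> UNIV \<and> length xs = length (rel_arity \<sigma>)}"
    by (rule finite_lists_length_eq) simp
  then have "finite ?P" by (rule finite_subset[rotated]) (use pl in auto)
  from finite_list[OF this] obtain pats where pats: "set pats = ?P" by (rule exE)
  have patl: "\<forall>\<beta>\<in>set pats. length \<beta> = length (rel_arity \<sigma>)" using pl pats by auto
  have "A \<in> S \<longleftrightarrow> models A (horn_formula \<sigma> D M cl pats)" if A: "A \<in> ordered_strucs \<sigma>" for A
  proof -
    interpret ordered \<sigma> A by (rule or[OF A])
    show ?thesis
    proof (cases "n = 1")
      case True
      have "A \<in> S \<longleftrightarrow> pattern \<in> set pats"
      proof
        assume "A \<in> S" then show "pattern \<in> set pats" using True pats by blast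
      next
        assume "pattern \<in> set pats"
        then obtain B where B: "pattern = ordered.pattern \<sigma> B" "B \<in> S" "univ_size B = 1" using pats by blast
        then have "B \<in> ordered_strucs \<sigma>" using S by blast
        moreover from this have "struc_iso \<sigma> B A" using pattern_iso[OF or or, of B A] A B True by simp
        ultimately show "A \<in> S" using iso A B(2) unfolding iso_closed_in_def by blast
      qed
      then show ?thesis using models_horn_formula_one[OF D(1) M(1) True ok patl] by (simp add: pattern_def)
    next
      case False
      then have n2: "2 \<le> n" using n_pos by simp
      interpret fagin \<sigma> A Tm dl a d D
        by unfold_locales (use n2 dl D time_bound[OF n2 K E_def F_def] in \<open>simp_all add: D_def add.commute\<close>)
      have nc: "nat_copy \<in> ordered_strucs \<sigma>" using nat_copy_ordered by (simp add: ordered_strucs_def)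
      \<comment> \<open>The sentence follows the order of \<open>A\<close>, the machine the names of
        its elements; on \<open>nat_copy\<close> the two agree.\<close>
      then have "A \<in> S \<longleftrightarrow> nat_copy \<in> S" using iso nat_copy_iso A unfolding iso_closed_in_def by blast
      also have "\<dots> \<longleftrightarrow> \<not> accepts_within Tm w T" using L(2)[OF nc] Tm(2)[of w] by (auto simp: w_def T_def len_def)
      also have "\<dots> \<longleftrightarrow> models A (horn_formula \<sigma> D M cl pats)"
        using models_horn_formula[OF D(1) M(1) n2 ok] numeric_model_iff by (simp add: cl_def)
      finally show ?thesis .
    qed
  qed
  then show ?thesis using horn_formula_Pi12[OF voc D(1) M(1) ok] by blast
qed

text \<open>Membership in co-NP is proved for the larger logic and definability in the smaller one;
  the inclusion carries each half over to the other logic.\<close>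

theorem theorem4p7:
  fixes \<sigma> :: vocab
  assumes "ordered_vocab \<sigma>"
  shows "captures_coNP_ordered \<sigma> (SO_EKROM \<sigma>) \<and> captures_coNP_ordered \<sigma> (Pi12_EKROM \<sigma>)"
proof -
  have "Pi12_EKROM \<sigma> \<subseteq> SO_EKROM \<sigma>" by (auto simp: Pi12_EKROM_def)
  then show ?thesis using SO_EKROM_coNP coNP_Pi12[OF assms] unfolding captures_coNP_ordered_def by blast
qed

end
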